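(* Let $n\ge2$. The composed maps $(\phi^{\mathrm{NN}}_B)^{-1}\circ\overline\rho\circ\overline\xi\circ\iota_B\circ\phi^{\mathrm{NC}}_B:\mathrm{NC}_B(n)\to\mathrm{NN}_B(n)$, $(\phi^{\mathrm{NN}}_C)^{-1}\circ\overline\rho\circ\overline\xi\circ\phi^{\mathrm{NC}}_B:\mathrm{NC}_B(n)\to\mathrm{NN}_C(n)$, and $(\phi^{\mathrm{NN}}_D)^{-1}\circ\overline\rho\circ\overline\xi\circ\iota_D\circ\phi^{\mathrm{NC}}_D:\mathrm{NC}_D(n)\to\mathrm{NN}_D(n)$ are type-preserving bijections (i.e. bijections $\Phi$ with $\operatorname{type}(\Phi(\pi))=\operatorname{type}(\pi)$) between noncrossing and nonnesting partitions of type $B_n$, $C_n$ and $D_n$ respectively.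
   Context: Basic notions. $[m]=\{1,\dots,m\}$, $[\pm m]=\{\pm1,\dots,\pm m\}$, $\Pi(m)$ = set partitions of $[m]$. An edge of a partition of a set of integers is a pair $(i,j)$, $i<j$, in the same block with no element of that block strictly between. $\mathrm{NC}(m)$ (resp. $\mathrm{NN}(m)$): partitions of $[m]$ with no edges $(a,b),(c,d)$ with $a<c<b<d$ (resp. $a<c<d<b$); $\mathrm{NC}(0)=\{\emptyset\}$. A block $B$ of $\sigma$ is nonnested if no edge $(i,j)$ has $i<\min B\le\max B<j$, nonaligned if no edge $(i,j)$ has $\max B<i$. $\mathrm{NC}^{\mathrm{NN}}(m)$, $\mathrm{NC}^{\mathrm{NA}}(m)$, $\mathrm{NN}^{\mathrm{NA}}(m)$ are the sets of pairs $(\sigma,X)$ with $\sigma\in\mathrm{NC}(m)$, $\mathrm{NC}(m)$, $\mathrm{NN}(m)$ respectively and $X$ a set of nonnested, nonaligned, nonaligned blocks of $\sigma$ respectively; the subscript $\{0,\pm1\}$ versions are the sets of triples $(\sigma,X,\epsilon)$ with $(\sigma,X)$ in the corresponding set, $\epsilon\in\{-1,0,1\}$, and $\epsilon=0$ if $X=\emptyset$. $\{A_1,\dots,A_k\}_<$ means $\max A_1<\cdots<\max A_k$. Type $B$. A partition of type $B_m$ is a set partition of $[\pm m]$ with $-B$ a block whenever $B$ is and at most one block (zero block) with $B=-B$; $\Pi_B(m)$ is their set; its type is the multiset containing $i$ with multiplicity the number of unordered pairs $\{B,-B\}$ of nonzero blocks of size $i$. A partition of $U$ is noncrossing (resp.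 nonnesting) w.r.t. a total order $a_1\prec\cdots\prec a_N$ of $U$ if there are no $i<j<k<l$ with $a_i,a_k\in B$, $a_j,a_l\in B'$ (resp. $a_i,a_l\in B$, $a_j,a_k\in B'$), $B\ne B'$. $\mathrm{NC}_B(m)$: noncrossing w.r.t. $1\prec\cdots\prec m\prec-1\prec\cdots\prec-m$. $\mathrm{NN}_C(m)$: nonnesting w.r.t. $1\prec\cdots\prec m\prec-m\prec\cdots\prec-1$. $\mathrm{NN}_B(m)$: $\pi_0$ nonnesting w.r.t. $1\prec\cdots\prec m\prec0\prec-m\prec\cdots\prec-1$, where $\pi_0$ adds $0$ to the zero block if any, else adds $\{0\}$. For $\pi\in\Pi_B(n)$, $\pi'$ is obtained by merging the blocks containing $\pm n$ and deleting $\pm n$ (discarding an empty block). $\mathrm{NC}_D(n)$ (resp. $\mathrm{NN}_D(n)$): $\pi\in\Pi_B(n)$ such that any zero block $B$ satisfies $\{n,-n\}\subsetneq B$, and $\pi'\in\mathrm{NC}_B(n-1)$ (resp. $\mathrm{NN}_B(n-1)$). The maps $\phi$. For $\pi$ in $\mathrm{NC}_B(m)$, $\mathrm{NN}_B(m)$ or $\mathrm{NN}_C(m)$, $\phi^{\mathrm{NC}}_B(\pi)$, $\phi^{\mathrm{NN}}_B(\pi)$, $\phi^{\mathrm{NN}}_C(\pi)$ all equal $(\sigma,X)$, where $\sigma$ is obtained from $\pi$ by deleting negative integers and $X$ is the set of blocks of $\sigma$ properly contained in blocks of $\pi$. For $\pi\in\mathrm{NC}_D(n)$ (resp. $\mathrm{NN}_D(n)$),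 $\phi^{\mathrm{NC}}_D(\pi)$ (resp. $\phi^{\mathrm{NN}}_D(\pi)$) $=(\sigma,X,\epsilon)$: if $\{\pm n\}$ are singleton blocks or $\pi$ has a zero block, then $(\sigma,X)=\phi^{\mathrm{NC}}_B(\pi')$ (resp. $\phi^{\mathrm{NN}}_B(\pi')$) and $\epsilon=0$; otherwise the block containing $n$ is $\{a_1,\dots,a_r,-b_1,\dots,-b_s,n\}$ with $a_1<\cdots<a_r<n$, $b_1<\cdots<b_s<n$, $r+s\ge1$; $\epsilon=1$ if $s=0$ or ($r,s>0$ and $a_r<b_s$), else $\epsilon=-1$; $\sigma$ has as blocks the nonempty sets $B^+\setminus\{n\}$, $B\in\pi$ ($B^+$ = positive elements); $X$ = blocks of $\sigma$ properly contained in blocks of $\pi$. The maps $\phi^{\mathrm{NC}}_B:\mathrm{NC}_B(n)\to\mathrm{NC}^{\mathrm{NN}}(n)$, $\phi^{\mathrm{NN}}_B:\mathrm{NN}_B(n)\to\mathrm{NN}^{\mathrm{NA}}(n)$, $\phi^{\mathrm{NN}}_C:\mathrm{NN}_C(n)\to\mathrm{NN}^{\mathrm{NA}}(n)$, $\phi^{\mathrm{NC}}_D:\mathrm{NC}_D(n)\to\mathrm{NC}^{\mathrm{NN}}_{\{0,\pm1\}}(n-1)$, $\phi^{\mathrm{NN}}_D:\mathrm{NN}_D(n)\to\mathrm{NN}^{\mathrm{NA}}_{\{0,\pm1\}}(n-1)$ are bijections (proved in the paper), so the inverses above make sense. Rearrangements $\iota$. For $(\sigma,X)\in\mathrm{NC}^{\mathrm{NN}}(m)$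 with nonnested blocks $\{A_1,\dots,A_\ell\}_<$, let $\sigma_j=\sigma\cap[\min A_j,\max A_j]$ (restriction relabelled to $1,2,\dots$), so $\sigma=\sigma_1\uplus\cdots\uplus\sigma_\ell$, where $\uplus$ is concatenation (blocks of the second factor shifted by the size of the first). Write $X=\{A_{i_1},\dots,A_{i_k}\}$, $i_1<\cdots<i_k$. For a permutation $p=p_1\cdots p_k$ of $[k]$ put $a_j=j$ if $j\notin\{i_1,\dots,i_k\}$ and $a_{i_t}=i_{p_t}$; the rearrangement according to $p$ is $(\sigma',X')$ with $\sigma'=\sigma_{a_1}\uplus\cdots\uplus\sigma_{a_\ell}$ and $X'=\{A'_{i_1},\dots,A'_{i_k}\}$, where $\{A'_1,\dots,A'_\ell\}_<$ are the nonnested blocks of $\sigma'$. $\iota_B(\sigma,X)$ is the rearrangement according to $12\cdots k$ if $k=2t$ and $(t+1)\,1\,2\cdots t\,(t+2)(t+3)\cdots(2t+1)$ if $k=2t+1$. For $(\sigma,X,\epsilon)\in\mathrm{NC}^{\mathrm{NN}}_{\{0,\pm1\}}(m)$ with $|X|=k$, $\iota_D(\sigma,X,\epsilon)=(\sigma',X',\epsilon)$ with $(\sigma',X')$ the rearrangement according to $12\cdots k$ if $k=2t,\epsilon=0$; $t\,(t+1)\,1\,2\cdots(t-1)\,(t+2)\cdots(2t)$ if $k=2t,\epsilon\ne0$; $(t+1)\,1\,2\cdots t\,(t+2)\cdots(2t+1)$ if $k=2t+1$. The map $\xi$ on $\mathrm{NC}(m)$. For $\sigma\in\mathrm{NC}(a)$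 connected ($1,a$ in one block, $a\ge1$) or $\sigma=\emptyset$, and $\tau\in\mathrm{NC}(b)$, $\sigma*\tau\in\mathrm{NC}(a+b+1)$ is $\sigma\uplus\tau$ with $a+b+1$ added to the block of $a$ (or as a singleton if $\sigma=\emptyset$). For $S=\{s_1<\cdots<s_k\}$, $\pi\cap S$ is the restriction to $S$ with $s_i$ relabelled $i$. If $\{m\}$ is not a block of $\pi\in\mathrm{NC}(m)$: with $B$ the block of $m$, $a=\min B$, $b$ the second largest element of $B$, $\mathrm{decomp}_1(\pi)=\mathrm{decomp}_2(\pi)=(\pi\cap[1,a-1],\pi\cap[a,b],\pi\cap[b+1,m-1])$; if $\{m\}$ is a block, $\mathrm{decomp}_1(\pi)=(\pi\cap[m-1],\emptyset,\emptyset)$, $\mathrm{decomp}_2(\pi)=(\emptyset,\emptyset,\pi\cap[m-1])$. For $\{m\}$ not a block: $\pi_1=\pi$, $(\pi_{i+1},\sigma_i,\sigma'_i)=\mathrm{decomp}_1(\pi_i)$ until $\pi_{r+1}=\emptyset$; $\upsilon_1=\pi$, $(\tau'_i,\tau_i,\upsilon_{i+1})=\mathrm{decomp}_2(\upsilon_i)$ until $\upsilon_{s+1}=\emptyset$; $M_{r+1}=\emptyset$, $M_i=\sigma'_i\uplus(\sigma_i*M_{i+1})$ for $i=r,\dots,2$; $\xi(\pi)=(\tau_s*\tau'_s)\uplus\cdots\uplus(\tau_2*\tau'_2)\uplus(\sigma_1*M_2)$. In general, with $k$ the largest element such that $\{k\}$ is not a block, $\xi(\pi)=\xi(\pi\cap[k])$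 plus singletons $\{k+1\},\dots,\{m\}$ ($\xi(\pi)=\pi$ if all blocks are singletons). $\xi(\sigma)$ has as many nonaligned blocks as $\sigma$ has nonnested blocks. $\overline\xi(\sigma,X)$ for $(\sigma,X)\in\mathrm{NC}^{\mathrm{NN}}(m)$: if $\{A_1,\dots,A_k\}_<$ are the nonnested blocks of $\sigma$, $\{A'_1,\dots,A'_k\}_<$ the nonaligned blocks of $\xi(\sigma)$ and $X=\{A_{i_1},\dots,A_{i_r}\}$, then $\overline\xi(\sigma,X)=(\xi(\sigma),\{A'_{i_1},\dots,A'_{i_r}\})\in\mathrm{NC}^{\mathrm{NA}}(m)$; on triples, $\overline\xi(\sigma,X,\epsilon)=(\overline\xi(\sigma,X),\epsilon)$. The map $\overline\rho$. For $\sigma\in\mathrm{NC}(m)$ with blocks $\{A_1,\dots,A_k\}_<$, $\rho(\sigma)$ is the unique element of $\mathrm{NN}(m)$ with blocks $\{A'_1,\dots,A'_k\}_<$ such that $\max A'_i=\max A_i$, $|A'_i|=|A_i|$ (its existence and uniqueness are known). For $(\sigma,X)\in\mathrm{NC}^{\mathrm{NA}}(m)$ with $X=\{A_{i_1},\dots,A_{i_r}\}$, $\overline\rho(\sigma,X)=(\rho(\sigma),\{A'_{i_1},\dots,A'_{i_r}\})$; on triples $\overline\rho(\sigma,X,\epsilon)=(\overline\rho(\sigma,X),\epsilon)$.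
   Formalization: Nonnesting: the outer pair must be consecutive in its block. NC_D also requires that π with ±n deleted, unmerged, is in NC_B(n-1). NN_D, if π has no zero block and ±n are not singletons: nonnesting for an order with n,-n (either order) in the middle. The literal definitions break the claim. *)

theory Defs
  imports Main "HOL-Library.Multiset" "HOL-Library.Disjoint_Sets"
begin

(* All partitions live in int set set; the m-element ground set [m] is {1..int m}.
   Words and sequences of blocks are lists; list positions start at 0, whereas the letters of
   a permutation word are 1, ..., k as usual. *)

section \<open>Partitions of sets of integers\<close>

definition edges :: "int set set \<Rightarrow> (int \<times> int) set" where
  "edges P = {(i, j). \<exists>B\<in>P. i \<in> B \<and> j \<in> B \<and> i < j \<and> (\<forall>k\<in>B. \<not> (i < k \<and> k < j))}"

definition NN :: "nat \<Rightarrow> int set set set" where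
  "NN m = {P. partition_on {1..int m} P \<and>
     \<not> (\<exists>a b c d. (a, b) \<in> edges P \<and> (c, d) \<in> edges P \<and> a < c \<and> c < d \<and> d < b)}"

definition nonnested :: "int set set \<Rightarrow> int set \<Rightarrow> bool" where
  "nonnested P B \<longleftrightarrow> \<not> (\<exists>i j. (i, j) \<in> edges P \<and> i < Min B \<and> Max B < j)"

definition nonaligned :: "int set set \<Rightarrow> int set \<Rightarrow> bool" where
  "nonaligned P B \<longleftrightarrow> \<not> (\<exists>i j. (i, j) \<in> edges P \<and> Max B < i)"

(* the list A_1, ..., A_k of a set of blocks with max A_1 < ... < max A_k *)
definition by_max :: "int set set \<Rightarrow> int set list" where
  "by_max P = sorted_key_list_of_set Max P"

definition nonnested_list :: "int set set \<Rightarrow> int set list" where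
  "nonnested_list P = by_max {B \<in> P. nonnested P B}"

definition nonaligned_list :: "int set set \<Rightarrow> int set list" where
  "nonaligned_list P = by_max {B \<in> P. nonaligned P B}"

(* {A'_i | A_i in X}, for As = A_1 ... A_k and As' = A'_1 ... A'_k *)
definition transfer_blocks :: "int set list \<Rightarrow> int set list \<Rightarrow> int set set \<Rightarrow> int set set" where
  "transfer_blocks As As' X = {As' ! i | i. i < length As \<and> As ! i \<in> X}"

(* restriction to S, relabelled by the order-preserving bijection S \<rightarrow> {1, ..., |S|} *)
definition restr :: "int set set \<Rightarrow> int set \<Rightarrow> int set set" where
  "restr P S = (\<lambda>B. (\<lambda>x. int (card {y \<in> S. y \<le> x})) ` (B \<inter> S)) ` P - {{}}"

(* for a partition of [m], this is m *)
definition psize :: "int set set \<Rightarrow> nat" where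
  "psize P = card (\<Union>P)"

definition pconcat :: "int set set \<Rightarrow> int set set \<Rightarrow> int set set" (infixr \<open>\<uplus>\<close> 65) where
  "P \<uplus> Q = P \<union> (\<lambda>B. (\<lambda>x. x + int (psize P)) ` B) ` Q"

definition pconcat_list :: "int set set list \<Rightarrow> int set set" where
  "pconcat_list Ps = foldr (\<uplus>) Ps {}"

definition block_of :: "int set set \<Rightarrow> int \<Rightarrow> int set" where
  "block_of P x = (THE B. B \<in> P \<and> x \<in> B)"


section \<open>Partitions of classical types\<close>

definition zero_block :: "int set \<Rightarrow> bool" where
  "zero_block B \<longleftrightarrow> uminus ` B = B"

definition Pi_B :: "nat \<Rightarrow> int set set set" where
  "Pi_B m = {P. partition_on ({1..int m} \<union> {- int m..-1}) P \<and>
     (\<forall>B\<in>P. uminus ` B \<in> P) \<and> (\<exists>\<^sub>\<le>\<^sub>1B. B \<in> P \<and> zero_block B)}"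

(* the inner sets {B, -B} are the unordered pairs; both members have the same size *)
definition btype :: "int set set \<Rightarrow> nat multiset" where
  "btype P = image_mset (\<lambda>p. the_elem (card ` p))
     (mset_set {{B, uminus ` B} | B. B \<in> P \<and> \<not> zero_block B})"

lemma count_btype:
  assumes "finite P"
  shows "count (btype P) i = card {{B, uminus ` B} | B. B \<in> P \<and> \<not> zero_block B \<and> card B = i}"
proof -
  define g :: "int set set \<Rightarrow> nat" where "g = (\<lambda>p. the_elem (card ` p))"
  let ?S = "{{B, uminus ` B} | B. B \<in> P \<and> \<not> zero_block B}"
  have g: "g {B, uminus ` B} = card B" for B
    by (simp add: g_def card_image)
  have "finite ?S"
    using assms by simp
  then have "count (btype P) i = card {p \<in> ?S. i = g p}"
    unfolding btype_def g_def[symmetric]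
    by (simp only: count_image_mset' count_mset_set' finite_set_mset_mset_set) (simp add: sum.If_cases)
  also have "{p \<in> ?S. i = g p} =
      {{B, uminus ` B} | B. B \<in> P \<and> \<not> zero_block B \<and> card B = i}"
  proof (intro equalityI subsetI)
    fix p assume "p \<in> {p \<in> ?S. i = g p}"
    then obtain B where "p = {B, uminus ` B}" "B \<in> P" "\<not> zero_block B" "i = g p" by blast
    then show "p \<in> {{B, uminus ` B} | B. B \<in> P \<and> \<not> zero_block B \<and> card B = i}"
      using g[of B] by (intro CollectI exI[of _ B]) simp
  next
    fix p assume "p \<in> {{B, uminus ` B} | B. B \<in> P \<and> \<not> zero_block B \<and> card B = i}"
    then obtain B where B: "p = {B, uminus ` B}" "B \<in> P" "\<not> zero_block B" "card B = i" by blast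
    then have "p \<in> ?S" by blast
    moreover have "i = g p" using B g[of B] by simp
    ultimately show "p \<in> {p \<in> ?S. i = g p}" by simp
  qed
  finally show ?thesis .
qed

(* The list us enumerates the ground set in its total order. *)
definition noncrossing_wrt :: "int list \<Rightarrow> int set set \<Rightarrow> bool" where
  "noncrossing_wrt us P \<longleftrightarrow> \<not> (\<exists>i j k l B B'. i < j \<and> j < k \<and> k < l \<and> l < length us \<and>
     B \<in> P \<and> B' \<in> P \<and> B \<noteq> B' \<and> us ! i \<in> B \<and> us ! k \<in> B \<and> us ! j \<in> B' \<and> us ! l \<in> B')"

(* The outer pair us ! i, us ! l must be consecutive in its block: as for NN, only edges can
   nest. Otherwise {1,3,5},{2,4} would count as nesting, and so would the type C partition
   {1,3,-2},{-1,-3,2}. *)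
definition nonnesting_wrt :: "int list \<Rightarrow> int set set \<Rightarrow> bool" where
  "nonnesting_wrt us P \<longleftrightarrow> \<not> (\<exists>i j k l B B'. i < j \<and> j < k \<and> k < l \<and> l < length us \<and>
     B \<in> P \<and> B' \<in> P \<and> B \<noteq> B' \<and> us ! i \<in> B \<and> us ! l \<in> B \<and>
     (\<forall>t. i < t \<and> t < l \<longrightarrow> us ! t \<notin> B) \<and> us ! j \<in> B' \<and> us ! k \<in> B')"

definition NC_B :: "nat \<Rightarrow> int set set set" where
  "NC_B m = {P \<in> Pi_B m. noncrossing_wrt ([1..int m] @ map uminus [1..int m]) P}"

definition NN_C :: "nat \<Rightarrow> int set set set" where
  "NN_C m = {P \<in> Pi_B m. nonnesting_wrt ([1..int m] @ [- int m..-1]) P}"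

definition add_zero :: "int set set \<Rightarrow> int set set" where
  "add_zero P = (if \<exists>B\<in>P. zero_block B
     then (\<lambda>B. if zero_block B then insert 0 B else B) ` P
     else insert {0} P)"

definition NN_B :: "nat \<Rightarrow> int set set set" where
  "NN_B m = {P \<in> Pi_B m. nonnesting_wrt ([1..int m] @ [0] @ [- int m..-1]) (add_zero P)}"

(* \<pi>': merge the blocks of n and -n and delete n, -n *)
definition merge_del :: "nat \<Rightarrow> int set set \<Rightarrow> int set set" where
  "merge_del n P =
     ({B \<in> P. int n \<notin> B \<and> - int n \<notin> B} \<union>
      {\<Union>{B \<in> P. int n \<in> B \<or> - int n \<in> B} - {int n, - int n}}) - {{}}"

(* delete n, -n without merging *)
definition remove_pm :: "nat \<Rightarrow> int set set \<Rightarrow> int set set" where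
  "remove_pm n P = (\<lambda>B. B - {int n, - int n}) ` P - {{}}"

definition zero_blocks_D :: "nat \<Rightarrow> int set set \<Rightarrow> bool" where
  "zero_blocks_D n P \<longleftrightarrow> (\<forall>B\<in>P. zero_block B \<longrightarrow> {int n, - int n} \<subset> B)"

definition centred :: "nat \<Rightarrow> int set set \<Rightarrow> bool" where
  "centred n P \<longleftrightarrow> ({int n} \<in> P \<and> {- int n} \<in> P) \<or> (\<exists>B\<in>P. zero_block B)"

(* Athanasiadis-Reiner noncrossing partitions of type D_n: the points 1, ..., n-1, -1, ..., -(n-1)
   lie on a circle and n, -n lie at its centre. Besides \<pi>' being noncrossing, the blocks of n
   and -n must not cross each other, which \<pi>' cannot detect: for n = 4, the partition
   {1,-2,3,4},{-1,2,-3,-4} is crossing although \<pi>' has a single block. If P is centred,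
   then merge_del n P = remove_pm n P. *)
definition NC_D :: "nat \<Rightarrow> int set set set" where
  "NC_D n = {P \<in> Pi_B n. zero_blocks_D n P \<and>
     merge_del n P \<in> NC_B (n - 1) \<and> remove_pm n P \<in> NC_B (n - 1)}"

(* Nonnesting partitions of type D_n, i.e. those given by antichains of the root poset of D_n.
   If P is not centred, n and -n are incomparable and sit in the middle of the order, so that
   edges ending at n and at -n do not nest each other; this means that one of the two
   linear orders is nonnesting. Here \<pi>' would not do: merging may hide a nesting
   ({1,-2,-3,4},{-1,2,3,-4}, n = 4) and may create one
   ({1,4},{2,-3,5} and their negatives, n = 5). *)
definition NN_D :: "nat \<Rightarrow> int set set set" where
  "NN_D n = {P \<in> Pi_B n. zero_blocks_D n P \<and>
     (if centred n P then merge_del n P \<in> NN_B (n - 1)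
      else nonnesting_wrt ([1..int n - 1] @ [int n, - int n] @ [- (int n - 1)..-1]) P \<or>
           nonnesting_wrt ([1..int n - 1] @ [- int n, int n] @ [- (int n - 1)..-1]) P)}"


section \<open>The maps \<open>\<phi>\<close>\<close>

(* pairs (\<sigma>, X) and triples (\<sigma>, X, \<epsilon>) *)
type_synonym marked = "int set set \<times> int set set"
type_synonym signed_marked = "int set set \<times> int set set \<times> int"

definition contained_blocks :: "int set set \<Rightarrow> int set set \<Rightarrow> int set set" where
  "contained_blocks S P = {A \<in> S. \<exists>B\<in>P. A \<subset> B}"

definition phi :: "int set set \<Rightarrow> marked" where
  "phi P = (let S = (\<lambda>B. {x \<in> B. 0 < x}) ` P - {{}} in (S, contained_blocks S P))"

definition phi_D :: "nat \<Rightarrow> int set set \<Rightarrow> signed_marked" where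
  "phi_D n P =
     (if centred n P then (let (S, X) = phi (merge_del n P) in (S, X, 0))
      else let B = block_of P (int n);
               as = {a \<in> B. 0 < a \<and> a < int n};
               bs = {b. 0 < b \<and> b < int n \<and> - b \<in> B};
               \<epsilon> = (if bs = {} \<or> (as \<noteq> {} \<and> bs \<noteq> {} \<and> Max as < Max bs) then 1 else - 1);
               S = (\<lambda>B. {x \<in> B. 0 < x} - {int n}) ` P - {{}}
           in (S, contained_blocks S P, \<epsilon>))"


section \<open>Rearrangements\<close>

(* p is the word p_1 ... p_k; is lists the indices i_1 < ... < i_k of the marked blocks *)
definition rearrange :: "nat list \<Rightarrow> marked \<Rightarrow> marked" where
  "rearrange p = (\<lambda>(S, X).
     let As = nonnested_list S;
         is = filter (\<lambda>j. As ! j \<in> X) [0..<length As];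
         a = (\<lambda>j. if j \<in> set is then is ! (p ! (THE t. t < length is \<and> is ! t = j) - 1) else j);
         S' = pconcat_list (map (\<lambda>j. restr S {Min (As ! a j)..Max (As ! a j)}) [0..<length As])
     in (S', transfer_blocks As (nonnested_list S') X))"

definition word_B :: "nat \<Rightarrow> nat list" where
  "word_B k = (let t = k div 2 in
     if even k then [1..<k + 1] else [t + 1] @ [1..<t + 1] @ [t + 2..<2 * t + 2])"

definition word_D :: "nat \<Rightarrow> int \<Rightarrow> nat list" where
  "word_D k \<epsilon> = (let t = k div 2 in
     if odd k then [t + 1] @ [1..<t + 1] @ [t + 2..<2 * t + 2]
     else if \<epsilon> = 0 then [1..<k + 1]
     else [t, t + 1] @ [1..<t] @ [t + 2..<2 * t + 1])"

definition iota_B :: "marked \<Rightarrow> marked" where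
  "iota_B = (\<lambda>(S, X). rearrange (word_B (card X)) (S, X))"

definition iota_D :: "signed_marked \<Rightarrow> signed_marked" where
  "iota_D = (\<lambda>(S, X, \<epsilon>). let (S', X') = rearrange (word_D (card X) \<epsilon>) (S, X) in (S', X', \<epsilon>))"


section \<open>The map \<open>\<xi>\<close>\<close>

definition star :: "int set set \<Rightarrow> int set set \<Rightarrow> int set set" (infixl \<open>\<star>\<close> 70) where
  "S \<star> T = (let a = int (psize S); b = int (psize T) in
     if S = {} then insert {a + b + 1} (S \<uplus> T)
     else (\<lambda>B. if a \<in> B then insert (a + b + 1) B else B) ` (S \<uplus> T))"

definition decomp_core :: "int set set \<Rightarrow> int set set \<times> int set set \<times> int set set" where
  "decomp_core P = (let m = int (psize P); B = block_of P m; a = Min B; b = Max (B - {m}) in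
     (restr P {1..a - 1}, restr P {a..b}, restr P {b + 1..m - 1}))"

definition decomp1 :: "int set set \<Rightarrow> int set set \<times> int set set \<times> int set set" where
  "decomp1 P = (let m = int (psize P) in
     if {m} \<in> P then (restr P {1..m - 1}, {}, {}) else decomp_core P)"

definition decomp2 :: "int set set \<Rightarrow> int set set \<times> int set set \<times> int set set" where
  "decomp2 P = (let m = int (psize P) in
     if {m} \<in> P then ({}, {}, restr P {1..m - 1}) else decomp_core P)"

(* the sequences \<pi>_i and \<upsilon>_i, i = 1, 2, ... *)
definition pi_seq :: "int set set \<Rightarrow> nat \<Rightarrow> int set set" where
  "pi_seq P i = ((\<lambda>Q. fst (decomp1 Q)) ^^ (i - 1)) P"

definition upsilon_seq :: "int set set \<Rightarrow> nat \<Rightarrow> int set set" where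
  "upsilon_seq P i = ((\<lambda>Q. snd (snd (decomp2 Q))) ^^ (i - 1)) P"

(* \<xi> if the largest element is not a singleton block *)
definition xi_core :: "int set set \<Rightarrow> int set set" where
  "xi_core P = (let
     \<sigma> = (\<lambda>i. fst (snd (decomp1 (pi_seq P i))));
     \<sigma>' = (\<lambda>i. snd (snd (decomp1 (pi_seq P i))));
     r = (LEAST r. pi_seq P (r + 1) = {});
     \<tau>' = (\<lambda>i. fst (decomp2 (upsilon_seq P i)));
     \<tau> = (\<lambda>i. fst (snd (decomp2 (upsilon_seq P i))));
     s = (LEAST s. upsilon_seq P (s + 1) = {});
     M2 = foldr (\<lambda>i M. \<sigma>' i \<uplus> (\<sigma> i \<star> M)) [2..<r + 1] {}
   in pconcat_list (map (\<lambda>i. \<tau> i \<star> \<tau>' i) (rev [2..<s + 1])) \<uplus> (\<sigma> 1 \<star> M2))"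

definition xi :: "int set set \<Rightarrow> int set set" where
  "xi P = (let m = int (psize P); K = {k \<in> {1..m}. {k} \<notin> P} in
     if K = {} then P
     else xi_core (restr P {1..Max K}) \<union> {{j} | j. Max K < j \<and> j \<le> m})"

definition xi_bar :: "marked \<Rightarrow> marked" where
  "xi_bar = (\<lambda>(S, X). (xi S, transfer_blocks (nonnested_list S) (nonaligned_list (xi S)) X))"


section \<open>The map \<open>\<rho>\<close>\<close>

definition rho :: "int set set \<Rightarrow> int set set" where
  "rho S = (THE T. T \<in> NN (psize S) \<and>
     map Max (by_max T) = map Max (by_max S) \<and> map card (by_max T) = map card (by_max S))"

definition rho_bar :: "marked \<Rightarrow> marked" where
  "rho_bar = (\<lambda>(S, X). (rho S, transfer_blocks (by_max S) (by_max (rho S)) X))"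

definition on_triples :: "(marked \<Rightarrow> marked) \<Rightarrow> signed_marked \<Rightarrow> signed_marked" where
  "on_triples f = (\<lambda>(S, X, \<epsilon>). let (S', X') = f (S, X) in (S', X', \<epsilon>))"


definition type_preserving_bij ::
  "(int set set \<Rightarrow> int set set) \<Rightarrow> int set set set \<Rightarrow> int set set set \<Rightarrow> bool" where
  "type_preserving_bij f A B \<longleftrightarrow> bij_betw f A B \<and> (\<forall>P\<in>A. btype (f P) = btype P)"

end

theory Submission
  imports Defs
begin

text \<open>A partition of type B is determined by the pair \<open>(S, X)\<close> given by \<open>\<phi>\<close> and the involution \<open>p\<close> of \<open>X\<close> for
  which the blocks meeting both signs are \<open>A \<union> - p A\<close>. Being noncrossing or nonnesting forces \<open>X\<close> to consist of nonnested
  or nonaligned blocks, and forces \<open>p\<close> to be the order-reversing involution of \<open>X\<close> (ordered by maxima), except that for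
  nonnesting partitions of type B a fixed block must be the first one; so \<open>\<phi>\<close> is bijective. In type D the block of \<open>n\<close>
  is obtained from an additional pair \<open>lo, p lo\<close> of matched blocks, which is the innermost one for noncrossing and the
  first one for nonnesting partitions.

  Both \<open>\<xi>\<close> and \<open>\<rho>\<close> preserve the multiset of all block sizes and the sequence of sizes of the marked blocks, while \<open>\<iota>\<close>
  permutes that sequence by exactly the word that carries the noncrossing matching to the nonnesting one. Since the type
  only depends on these data and on the matching, it is preserved. For \<open>\<rho>\<close>, a noncrossing or nonnesting partition is
  recovered from the sizes of its blocks placed at their maxima: peel off elements by letting the last non-maximal element
  \<open>b\<close> join the nearest (noncrossing) or the farthest (nonnesting) larger maximum of a block of size at least 2.\<close>

section \<open>Partitions of sets of integers\<close>

text \<open>Types are never followed through the maps themselves. Each class of partitions has its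
  type expressed through \<open>stat\<close>, the multiset of all block sizes and the list of sizes
  of marked blocks by increasing maximum, plus the sign in type D; the maps between the marked sets
  then only need their effect on \<open>stat\<close>, and \<open>transport_bij\<close> assembles the
  rest. Marks and sizes are linked by \<open>dat\<close>, which places each block size at the block
  maximum: the nonaligned blocks are those ending in the final stretch of positions with nonzero
  \<open>dat\<close>. The map \<open>rho\<close> fixes \<open>dat\<close>; for \<open>xi\<close>,
  given by iterated decompositions, the obstacle is to follow that final stretch, so it is rewritten
  as a recursion over \<open>L \<uplus> {{1}}\<close> and \<open>L \<uplus> (C \<star> I)\<close>.
  For this recursion injectivity is unique decomposition, and surjectivity follows from finiteness.
  On signed sets, an order given by a list becomes an integer key under which the negative half is a
  shifted or reflected copy of the positive one. In the nonnesting case only the central edges,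
  those passing through or ending in the centre, depend on the matching, so each class amounts to
  one condition on central edges.\<close>

abbreviation parts :: "nat \<Rightarrow> int set set \<Rightarrow> bool" where
 "parts m \<equiv> partition_on {1..int m}"

lemma part_eq: "partition_on U P \<Longrightarrow> A \<in> P \<Longrightarrow> B \<in> P \<Longrightarrow> x \<in> A \<Longrightarrow> x \<in> B \<Longrightarrow> A = B"
 unfolding partition_on_def disjoint_def by blast

lemma part_ex: "partition_on U P \<Longrightarrow> x \<in> U \<Longrightarrow> \<exists>B\<in>P. x \<in> B"
 unfolding partition_on_def by blast

lemma part_sub: "partition_on U P \<Longrightarrow> B \<in> P \<Longrightarrow> B \<subseteq> U"
 unfolding partition_on_def by blast

lemma part_ne: "partition_on U P \<Longrightarrow> B \<in> P \<Longrightarrow> B \<noteq> {}"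
 unfolding partition_on_def by blast

lemma part_intro:
 assumes "\<Union>P = U" "{} \<notin> P" "\<And>A B x. A \<in> P \<Longrightarrow> B \<in> P \<Longrightarrow> x \<in> A \<Longrightarrow> x \<in> B \<Longrightarrow> A = B"
 shows "partition_on U P"
 using assms unfolding partition_on_def disjoint_def by blast

lemma part_finite: "partition_on U P \<Longrightarrow> finite U \<Longrightarrow> finite P"
 unfolding partition_on_def using finite_UnionD by blast

lemma part_finite_block: "partition_on U P \<Longrightarrow> finite U \<Longrightarrow> B \<in> P \<Longrightarrow> finite B"
 by (meson finite_subset part_sub)

lemma part_Max:
 fixes U :: "int set"
 assumes "partition_on U P" "finite U" "B \<in> P"
 shows "Max B \<in> B" "Min B \<in> B" "x \<in> B \<Longrightarrow> x \<le> Max B" "x \<in> B \<Longrightarrow> Min B \<le> x"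
 using assms part_finite_block[OF assms] part_ne[OF assms(1,3)] by auto

lemma part_Max_inj:
 fixes U :: "int set"
 assumes "partition_on U P" "finite U"
 shows "inj_on Max P"
proof (rule inj_onI)
 fix A B assume *: "A \<in> P" "B \<in> P" "Max A = Max B"
 show "A = B" using part_eq[OF assms(1) *(1,2) part_Max(1)[OF assms *(1)]] part_Max(1)[OF assms *(2)] *(3) by simp
qed

lemma part_block_of:
 assumes "partition_on U P" "B \<in> P" "x \<in> B"
 shows "block_of P x = B"
 unfolding block_of_def
proof (rule the_equality)
 show "C = B" if "C \<in> P \<and> x \<in> C" for C
  using part_eq[OF assms(1) conjunct1[OF that] assms(2) conjunct2[OF that] assms(3)] .
qed (use assms in simp)

text \<open>The facts obtained from the locale \<open>folding_insort_key\<close> speak of the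
  constant of the locale \<open>linorder\<close>; this identifies it with the constant of the type
  class.\<close>

lemma linorder_sorted_key_list_of_set:
 "linorder.sorted_key_list_of_set (\<le>) (f::'b \<Rightarrow> int) = sorted_key_list_of_set f"
 unfolding linorder.sorted_key_list_of_set_def[OF linorder_class.linorder_axioms] sorted_key_list_of_set_def
  linorder.insort_key_def[OF linorder_class.linorder_axioms] insort_key_def
 by (rule refl)

text \<open>Injectivity of \<open>Max\<close> makes the sorting strict, so the list is determined by
  its set. Most later computations of \<open>by_max\<close> guess the list and appeal to
  \<open>by_max_unique\<close>.\<close>

lemma by_max:
 assumes "finite P" "inj_on Max P"
 shows set_by_max: "set (by_max P) = P"
  and sorted_by_max: "sorted_wrt (<) (map Max (by_max P))"
  and distinct_by_max: "distinct (by_max P)"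
  and length_by_max: "length (by_max P) = card P"
  and by_max_unique: "set xs = P \<Longrightarrow> sorted_wrt (<) (map Max xs) \<Longrightarrow> by_max P = xs"
proof -
 interpret folding_insort_key "(\<le>)" "(<) :: int \<Rightarrow> int \<Rightarrow> bool" P Max
  by unfold_locales (rule assms)
 show "set (by_max P) = P" "sorted_wrt (<) (map Max (by_max P))" "length (by_max P) = card P"
  unfolding by_max_def
  using set_sorted_key_list_of_set[OF subset_refl assms(1)]
   strict_sorted_key_list_of_set[OF subset_refl] length_sorted_key_list_of_set[OF subset_refl]
  unfolding linorder_sorted_key_list_of_set by simp_all
 hence "distinct (map Max (by_max P))" by (simp add: strict_sorted_iff)
 thus "distinct (by_max P)" unfolding distinct_map by blast
 show "by_max P = xs" if "set xs = P" "sorted_wrt (<) (map Max xs)"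
 proof -
  have "distinct (map Max xs)" using that(2) by (simp add: strict_sorted_iff)
  hence "distinct xs" unfolding distinct_map by blast
  hence "length xs = card P" using distinct_card[of xs] that(1) by simp
  thus ?thesis
   unfolding by_max_def using sorted_key_list_of_set_unique[of P xs, unfolded linorder_sorted_key_list_of_set] that assms(1)
    \<open>length xs = card P\<close> by simp
 qed
qed

lemma by_max_empty [simp]: "by_max {} = []"
 using by_max_unique[of "{}" "[]"] by simp

text \<open>Crossing is stated for arbitrary points of two blocks rather than for edges. For
  partitions both versions agree, and the pointwise one passes directly to subsets and to deletion
  of points.\<close>

definition ncr :: "int set set \<Rightarrow> bool" where
 "ncr P \<longleftrightarrow> (\<forall>A\<in>P. \<forall>B\<in>P. \<forall>a\<in>A. \<forall>b\<in>B. \<forall>c\<in>A. \<forall>d\<in>B. a < b \<longrightarrow> b < c \<longrightarrow> c < d \<longrightarrow> A = B)"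

definition nns :: "int set set \<Rightarrow> bool" where
 "nns P \<longleftrightarrow> \<not> (\<exists>a b c d. (a, b) \<in> edges P \<and> (c, d) \<in> edges P \<and> a < c \<and> c < d \<and> d < b)"

definition NC :: "nat \<Rightarrow> int set set set" where
 "NC m = {P. parts m P \<and> ncr P}"

lemma NN_nns: "NN m = {P. parts m P \<and> nns P}"
 unfolding NN_def nns_def by simp

lemma ncrD: "ncr P \<Longrightarrow> A \<in> P \<Longrightarrow> B \<in> P \<Longrightarrow> a \<in> A \<Longrightarrow> b \<in> B \<Longrightarrow> c \<in> A \<Longrightarrow> d \<in> B \<Longrightarrow>
 a < b \<Longrightarrow> b < c \<Longrightarrow> c < d \<Longrightarrow> A = B"
 unfolding ncr_def by blast

lemma edges_edge_above:
 assumes "finite B" "B \<in> P" "x \<in> B" "y \<in> B" "x < (y::int)"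
 shows "\<exists>z. (x, z) \<in> edges P \<and> z \<le> y \<and> z \<in> B"
proof -
 define z where "z = Min {z\<in>B. x < z}"
 have "z \<in> {z\<in>B. x < z}" unfolding z_def by (rule Min_in) (use assms in auto)
 moreover have "z \<le> k" if "k \<in> B" "x < k" for k unfolding z_def by (rule Min_le) (use assms that in auto)
 ultimately show ?thesis unfolding edges_def using assms
  by (intro exI[of _ z] conjI CollectI case_prodI bexI[of _ B]) fastforce+
qed

lemma edges_edge_below:
 assumes "finite B" "B \<in> P" "x \<in> B" "y \<in> B" "x < (y::int)"
 shows "\<exists>z. (z, y) \<in> edges P \<and> x \<le> z \<and> z \<in> B"
proof -
 define z where "z = Max {z\<in>B. z < y}"
 have "z \<in> {z\<in>B. z < y}" unfolding z_def by (rule Max_in) (use assms in auto)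
 moreover have "k \<le> z" if "k \<in> B" "k < y" for k unfolding z_def by (rule Max_ge) (use assms that in auto)
 ultimately show ?thesis unfolding edges_def using assms
  by (intro exI[of _ z] conjI CollectI case_prodI bexI[of _ B]) fastforce+
qed

text \<open>Every element other than the largest of its block has a successor there. Hence
  nonalignment, which is phrased through left ends of edges, depends only on which positions are
  block maxima.\<close>

lemma edges_nonmax:
 assumes "partition_on U P" "finite U"
 shows "(\<exists>y. (x, y) \<in> edges P) \<longleftrightarrow> x \<in> U \<and> x \<notin> Max ` P"
proof
 assume "\<exists>y. (x, y) \<in> edges P"
 then obtain y B where B: "B \<in> P" "x \<in> B" "y \<in> B" "x < y" unfolding edges_def by blast
 have "x \<noteq> Max C" if "C \<in> P" for C
 proof
  assume "x = Max C"
  hence "x \<in> C" using part_Max(1)[OF assms that] by simp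
  hence "B = C" using part_eq[OF assms(1) B(1) that B(2)] by simp
  thus False using \<open>x = Max C\<close> B part_Max(3)[OF assms B(1,3)] by simp
 qed
 thus "x \<in> U \<and> x \<notin> Max ` P" using B(1,2) part_sub[OF assms(1) B(1)] by blast
next assume x: "x \<in> U \<and> x \<notin> Max ` P"
 then obtain B where B: "B \<in> P" "x \<in> B" using part_ex assms(1) by metis
 hence "x < Max B" using x part_Max(3)[OF assms B] by (metis imageI order_le_less)
 thus "\<exists>y. (x, y) \<in> edges P"
  using edges_edge_above[OF part_finite_block[OF assms B(1)] B part_Max(1)[OF assms B(1)]] by metis
qed

section \<open>Block sizes recorded at block maxima\<close>

text \<open>For a partition the sum has at most one term. Writing it as a sum gives the value 0 at
  positions that are no maxima and makes \<open>dat\<close> additive over disjoint unions.\<close>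

definition dat :: "int set set \<Rightarrow> int \<Rightarrow> nat" where
 "dat P x = (\<Sum>B | B \<in> P \<and> Max B = x. card B)"

lemma dat_Max:
 assumes "partition_on U P" "finite U" "B \<in> P"
 shows "dat P (Max B) = card B"
proof -
 have "{B' \<in> P. Max B' = Max B} = {B}" using part_Max_inj[OF assms(1,2)] assms(3) unfolding inj_on_def by blast
 thus ?thesis unfolding dat_def by simp
qed

lemma dat_0: "x \<notin> Max ` P \<Longrightarrow> dat P x = 0"
 unfolding dat_def by (rule sum.neutral) auto

lemma dat_0_iff:
 assumes "partition_on U P" "finite U"
 shows "dat P x = 0 \<longleftrightarrow> x \<notin> Max ` P"
proof (cases "x \<in> Max ` P")
 case True
 then obtain B where "B \<in> P" "x = Max B" by blast
 thus ?thesis using dat_Max[OF assms] part_ne[OF assms(1)] part_finite_block[OF assms] True by (metis card_eq_0_iff)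
qed (simp add: dat_0)

text \<open>By \<open>edges_nonmax\<close>, an edge starting to the right of \<open>B\<close> is a
  position there that is no maximum. So nonalignment is visible in \<open>dat\<close>, which is why
  \<open>rho\<close> can keep the marks.\<close>

lemma nonaligned_iff:
 assumes "partition_on U P" "finite U" 
 shows "nonaligned P B \<longleftrightarrow> (\<forall>x\<in>U. Max B < x \<longrightarrow> dat P x \<noteq> 0)"
 unfolding nonaligned_def dat_0_iff[OF assms] using edges_nonmax[OF assms] by blast

lemma by_max_map_Max:
 assumes "partition_on U P" "finite U"
 shows "map card (by_max P) = map (dat P) (map Max (by_max P))"
 using by_max(1)[OF part_finite[OF assms] part_Max_inj[OF assms]] dat_Max[OF assms] by simp

lemma map_Max_by_max:
 assumes "finite P" "inj_on Max P"
 shows "map Max (by_max P) = sorted_list_of_set (Max ` P)"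
 using by_max(1,2)[OF assms]
 by (metis finite_list list.set_map sorted_list_of_set.idem_if_sorted_distinct strict_sorted_iff)

text \<open>Turns the condition on two lists in the definition of \<open>rho\<close> into pointwise
  equality of \<open>dat\<close>, the form in which existence and uniqueness are proved.\<close>

lemma by_max_eq_iff_dat:
 assumes P: "partition_on U P" "finite U" and Q: "partition_on U Q"
 shows "map Max (by_max Q) = map Max (by_max P) \<and> map card (by_max Q) = map card (by_max P)
   \<longleftrightarrow> (\<forall>x\<in>U. dat Q x = dat P x)" (is "?L \<longleftrightarrow> ?R")
proof
 note fP = part_finite[OF P] part_Max_inj[OF P] and fQ = part_finite[OF Q P(2)] part_Max_inj[OF Q P(2)]
 show ?R if ?L
 proof
  fix x assume "x \<in> U"
  have e: "map (dat Q) (map Max (by_max P)) = map (dat P) (map Max (by_max P))"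
   using conjunct1[OF that] conjunct2[OF that] by_max_map_Max[OF P] by_max_map_Max[OF Q P(2)] by simp
  have s: "Max ` Q = Max ` P" using arg_cong[OF conjunct1[OF that], of set] by_max(1)[OF fP] by_max(1)[OF fQ] by simp
  show "dat Q x = dat P x"
  proof (cases "x \<in> Max ` P")
   case True
   hence "x \<in> set (map Max (by_max P))" using by_max(1)[OF fP] by auto
   thus ?thesis using e unfolding map_eq_conv by blast
  next case False thus ?thesis using s by (simp add: dat_0)
  qed
 qed
 show ?L if R: ?R
 proof -
  have sub: "Max ` Q \<subseteq> U" "Max ` P \<subseteq> U" using part_Max(1)[OF P] part_sub[OF P(1)] part_Max(1)[OF Q P(2)] part_sub[OF Q] by blast+
  have "x \<in> Max ` Q \<longleftrightarrow> x \<in> Max ` P" for x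
  proof (cases "x \<in> U")
   case True thus ?thesis using R dat_0_iff[OF P, of x] dat_0_iff[OF Q P(2), of x] by simp
  next case False thus ?thesis using sub by blast
  qed
  hence "Max ` Q = Max ` P" by blast
  hence m: "map Max (by_max Q) = map Max (by_max P)" using map_Max_by_max[OF fP] map_Max_by_max[OF fQ] by simp
  moreover have "set (map Max (by_max P)) \<subseteq> U" using by_max(1)[OF fP] sub by auto
  ultimately have "map card (by_max Q) = map card (by_max P)"
   unfolding by_max_map_Max[OF P] by_max_map_Max[OF Q P(2)] m using R by auto
  thus ?thesis using m by blast
 qed
qed

text \<open>A ballot condition on suffixes: all positions from \<open>x\<close> on must fit into the
  blocks ending at or after \<open>x\<close>. By \<open>dat_valid\<close> and \<open>dat_ex\<close>
  these are exactly the size functions of partitions, even of noncrossing or of nonnesting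
  ones.\<close>

definition valid :: "int set \<Rightarrow> (int \<Rightarrow> nat) \<Rightarrow> bool" where
 "valid U d \<longleftrightarrow> sum d U = card U \<and> (\<forall>x\<in>U. card {y\<in>U. x \<le> y} \<le> sum d {y\<in>U. x \<le> y})"

lemma sum_dat:
 assumes "partition_on U P" "finite U"
 shows "sum (dat P) {y\<in>U. Q y} = sum card {B\<in>P. Q (Max B)}"
proof -
 have *: "Max ` {B\<in>P. Q (Max B)} \<subseteq> {y\<in>U. Q y}"
  using part_Max(1)[OF assms] part_sub[OF assms(1)] by blast
 have "sum (dat P) {y\<in>U. Q y} = (\<Sum>y\<in>{y\<in>U. Q y}. sum card {B\<in>{B\<in>P. Q (Max B)}. Max B = y})"
  unfolding dat_def by (rule sum.cong) (auto intro!: sum.cong)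
 also have "\<dots> = sum card {B\<in>P. Q (Max B)}"
  by (rule sum.group) (use part_finite[OF assms] assms(2) * in auto)
 finally show ?thesis .
qed

lemma card_part:
 assumes "partition_on U P" "finite U"
 shows "card U = sum card P"
proof -
 have "U = \<Union>P" using assms(1) by (rule partition_onD1)
 moreover have "card (\<Union>P) = sum card P"
  by (rule card_Union_disjoint) (use assms partition_onD2 part_finite_block in blast)+
 ultimately show ?thesis by simp
qed

lemma dat_valid:
 assumes "partition_on U P" "finite U"
 shows "valid U (dat P)"
 unfolding valid_def
proof (intro conjI ballI)
 show "sum (dat P) U = card U" using sum_dat[OF assms, of "\<lambda>_. True"] card_part[OF assms] by simp
 fix x assume "x \<in> U"
 have f: "finite {B\<in>P. x \<le> Max B}" using part_finite[OF assms] by simp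
 have "{y\<in>U. x \<le> y} \<subseteq> \<Union>{B\<in>P. x \<le> Max B}"
 proof
  fix y assume y: "y \<in> {y\<in>U. x \<le> y}"
  then obtain B where B: "B \<in> P" "y \<in> B" using part_ex[OF assms(1), of y] by auto
  thus "y \<in> \<Union>{B\<in>P. x \<le> Max B}" using part_Max(3)[OF assms B] y by force
 qed
 hence "card {y\<in>U. x \<le> y} \<le> card (\<Union>{B\<in>P. x \<le> Max B})"
  using f part_finite_block[OF assms] by (intro card_mono) auto
 also have "\<dots> \<le> sum card {B\<in>P. x \<le> Max B}"
  by (rule card_Union_le_sum_card)
 finally show "card {y\<in>U. x \<le> y} \<le> sum (dat P) {y\<in>U. x \<le> y}"
  using sum_dat[OF assms, of "\<lambda>y. x \<le> y"] by simp
qed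

text \<open>If all values to the right of \<open>b\<close> were at most 1, the value 0 at
  \<open>b\<close> would make the sum over the suffix from \<open>b\<close> smaller than its
  length.\<close>

lemma valid_ex_big:
 assumes "valid U d" "finite U" "b \<in> U" "d b = 0"
 shows "\<exists>y\<in>U. b < y \<and> 2 \<le> d y"
proof (rule ccontr)
 assume c: "\<not> ?thesis"
 let ?V = "{y\<in>U. b \<le> y}"
 have "sum d ?V < sum (\<lambda>_. 1) ?V"
 proof (rule sum_strict_mono_ex1)
  show "\<forall>x\<in>?V. d x \<le> 1"
  proof
   fix x assume x: "x \<in> ?V"
   show "d x \<le> 1"
   proof (cases "x = b")
    case False
    hence "b < x" using x by simp
    hence "\<not> 2 \<le> d x" using x c by blast
    thus ?thesis by simp
   qed (simp add: assms(4))
  qed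
  show "\<exists>a\<in>?V. d a < 1" using assms by (intro bexI[of _ b]) auto
 qed (use assms in simp)
 moreover have "card ?V \<le> sum d ?V" using assms unfolding valid_def by blast
 ultimately show False by simp
qed

lemma sum_move:
 fixes d :: "int \<Rightarrow> nat"
 assumes "finite V" "b \<in> V" "y \<in> V" "b \<noteq> y" "d b = 0" "1 \<le> d y"
 shows "sum (d(b := d y - 1)) (V - {y}) + 1 = sum d V"
proof -
 let ?R = "V - {y} - {b}"
 have "sum d V = d y + (d b + sum d ?R)"
  using assms sum.remove[of V y d] sum.remove[of "V - {y}" b d] by simp
 moreover have "sum (d(b := d y - 1)) (V - {y}) = (d y - 1) + sum (d(b := d y - 1)) ?R"
  using assms sum.remove[of "V - {y}" b "d(b := d y - 1)"] by simp
 moreover have "sum (d(b := d y - 1)) ?R = sum d ?R" by (rule sum.cong) auto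
 ultimately show ?thesis using assms by simp
qed

text \<open>Models the removal of the maximum \<open>y\<close> of a block whose next element is
  \<open>b\<close>: the block then ends at \<open>b\<close> with size \<open>d y - 1\<close>. A
  suffix starting at or before \<open>b\<close> loses 1 in length and in sum; a later suffix has no
  zero values because \<open>b\<close> is the last zero.\<close>

lemma valid_remove:
 assumes "valid U d" "finite U" "b \<in> U" "d b = 0" "\<forall>z\<in>U. b < z \<longrightarrow> d z \<noteq> 0" "y \<in> U" "b < y" "2 \<le> d y"
 shows "valid (U - {y}) (d(b := d y - 1))"
 unfolding valid_def
proof (intro conjI ballI)
 show "sum (d(b := d y - 1)) (U - {y}) = card (U - {y})"
  using sum_move[of U b y d] assms card_Suc_Diff1[of U y] unfolding valid_def by auto
 fix x assume x: "x \<in> U - {y}"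
 let ?V = "{z\<in>U. x \<le> z}"
 have e: "{z \<in> U - {y}. x \<le> z} = ?V - {y}" by auto
 show "card {z \<in> U - {y}. x \<le> z} \<le> sum (d(b := d y - 1)) {z \<in> U - {y}. x \<le> z}"
 proof (cases "x \<le> b")
  case True
  have "card ?V \<le> sum d ?V" using assms x unfolding valid_def by blast
  moreover have "sum (d(b := d y - 1)) (?V - {y}) + 1 = sum d ?V"
   by (rule sum_move) (use assms True in auto)
  moreover have "Suc (card (?V - {y})) = card ?V"
   by (rule card_Suc_Diff1) (use assms True in auto)
  ultimately show ?thesis unfolding e by simp
 next case False
  have "sum (\<lambda>_. 1) (?V - {y}) \<le> sum (d(b := d y - 1)) (?V - {y})"
  proof (rule sum_mono)
   fix z assume "z \<in> ?V - {y}"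
   thus "1 \<le> (d(b := d y - 1)) z" using False assms(5) by (auto simp: Suc_le_eq)
  qed
  thus ?thesis unfolding e by simp
 qed
qed

lemma sum_eq_card:
 fixes d :: "int \<Rightarrow> nat"
 assumes "finite U" "sum d U = card U" "\<forall>x\<in>U. d x \<noteq> 0" "x \<in> U"
 shows "d x = 1"
proof (rule ccontr)
 assume "d x \<noteq> 1"
 have "sum (\<lambda>_. 1) U < sum d U"
 proof (rule sum_strict_mono_ex1)
  show "\<forall>x\<in>U. 1 \<le> d x" using assms(3) by (simp add: Suc_le_eq)
  show "\<exists>a\<in>U. 1 < d a" using assms(3,4) \<open>d x \<noteq> 1\<close> by (intro bexI[of _ x]) (auto simp: less_Suc_eq_0_disj neq0_conv intro: Suc_lessI)
 qed (rule assms)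
 thus False using assms by simp
qed

section \<open>Adding and deleting a single point\<close>

definition ins :: "int \<Rightarrow> int \<Rightarrow> int set set \<Rightarrow> int set set" where
 "ins y b P = (\<lambda>B. if b \<in> B then insert y B else B) ` P"

definition del :: "int \<Rightarrow> int set set \<Rightarrow> int set set" where
 "del y P = (\<lambda>B. B - {y}) ` P - {{}}"

lemma ins_eq:
 assumes "partition_on U P" "B \<in> P" "b \<in> B"
 shows "ins y b P = insert (insert y B) (P - {B})"
proof -
 have "b \<notin> C" if "C \<in> P - {B}" for C
 proof
  assume "b \<in> C"
  hence "C = B" using part_eq[OF assms(1) _ assms(2) _ assms(3), of C] that by blast
  thus False using that by blast
 qed
 hence "(\<lambda>B. if b \<in> B then insert y B else B) ` (P - {B}) = (\<lambda>B. B) ` (P - {B})"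
  by (intro image_cong) auto
 hence "(\<lambda>B. if b \<in> B then insert y B else B) ` (P - {B}) = P - {B}" by simp
 moreover have "ins y b P = insert (insert y B) ((\<lambda>B. if b \<in> B then insert y B else B) ` (P - {B}))"
  unfolding ins_def using assms(2,3) by (auto simp: image_iff)
 ultimately show ?thesis by simp
qed

lemma part_diff:
 assumes "partition_on U P" "B \<in> P"
 shows "partition_on (U - B) (P - {B})"
proof (rule part_intro)
 show "\<Union> (P - {B}) = U - B"
 proof (intro equalityI subsetI)
  fix x assume "x \<in> \<Union> (P - {B})"
  then obtain C where C: "C \<in> P" "C \<noteq> B" "x \<in> C" by blast
  thus "x \<in> U - B" using part_eq[OF assms(1) C(1) assms(2) C(3)] part_sub[OF assms(1) C(1)] by blast
 next fix x assume "x \<in> U - B"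
  thus "x \<in> \<Union> (P - {B})" using part_ex[OF assms(1), of x] by blast
 qed
 show "{} \<notin> P - {B}" using part_ne[OF assms(1)] by blast
 fix A C x assume *: "A \<in> P - {B}" "C \<in> P - {B}" "x \<in> A" "x \<in> C"
 thus "A = C" using part_eq[OF assms(1), of A C x] by simp
qed

lemma part_insert:
 assumes "partition_on U P" "B \<noteq> {}" "B \<inter> U = {}"
 shows "partition_on (U \<union> B) (insert B P)"
proof (rule part_intro)
 show "\<Union> (insert B P) = U \<union> B" using partition_onD1[OF assms(1)] by blast
 show "{} \<notin> insert B P" using assms part_ne[OF assms(1)] by blast
 fix A C x assume *: "A \<in> insert B P" "C \<in> insert B P" "x \<in> A" "x \<in> C"
 then consider "A = B" "C = B" | "A = B" "C \<in> P" | "A \<in> P" "C = B" | "A \<in> P" "C \<in> P" by blast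
 thus "A = C"
 proof cases
  case 2 thus ?thesis using * assms(3) part_sub[OF assms(1) 2(2)] by blast
 next case 3 thus ?thesis using * assms(3) part_sub[OF assms(1) 3(1)] by blast
 next case 4 thus ?thesis using part_eq[OF assms(1) 4 *(3,4)] by simp
 qed simp
qed

lemma del_eq:
 assumes "partition_on U P" "B \<in> P" "y \<in> B" "B \<noteq> {y}"
 shows "del y P = insert (B - {y}) (P - {B})"
proof -
 have "y \<notin> C" if "C \<in> P - {B}" for C
 proof
  assume "y \<in> C"
  hence "C = B" using part_eq[OF assms(1) _ assms(2) _ assms(3), of C] that by blast
  thus False using that by blast
 qed
 hence "(\<lambda>B. B - {y}) ` (P - {B}) = (\<lambda>B. B) ` (P - {B})"
  by (intro image_cong) auto
 hence "(\<lambda>B. B - {y}) ` (P - {B}) = P - {B}" by simp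
 moreover have "(\<lambda>B. B - {y}) ` P = insert (B - {y}) ((\<lambda>B. B - {y}) ` (P - {B}))"
  using assms(2) by blast
 moreover have "{} \<notin> P" using part_ne[OF assms(1)] by blast
 moreover have "B - {y} \<noteq> {}" using assms(3,4) by blast
 ultimately show ?thesis unfolding del_def by auto
qed

lemma del_partition:
 assumes "partition_on U P" "B \<in> P" "y \<in> B" "B \<noteq> {y}"
 shows "partition_on (U - {y}) (del y P)"
proof -
 have "partition_on ((U - B) \<union> (B - {y})) (insert (B - {y}) (P - {B}))"
  by (rule part_insert[OF part_diff[OF assms(1,2)]]) (use assms in auto)
 moreover have "(U - B) \<union> (B - {y}) = U - {y}" using assms part_sub[OF assms(1,2)] by blast
 ultimately show ?thesis using del_eq[OF assms] by simp
qed

lemma ins_partition: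
 assumes "partition_on (U - {y}) P" "y \<in> U" "B \<in> P" "b \<in> B"
 shows "partition_on U (ins y b P)"
proof -
 have "partition_on ((U - {y} - B) \<union> insert y B) (insert (insert y B) (P - {B}))"
  by (rule part_insert[OF part_diff[OF assms(1,3)]]) (use assms in auto)
 moreover have "(U - {y} - B) \<union> insert y B = U" using assms part_sub[OF assms(1,3)] by blast
 ultimately show ?thesis using ins_eq[OF assms(1,3,4)] by simp
qed

lemma ins_del:
 assumes "partition_on U P" "B \<in> P" "y \<in> B" "b \<in> B" "b \<noteq> y"
 shows "ins y b (del y P) = P"
proof -
 have B: "B \<noteq> {y}" using assms by blast
 note d = del_eq[OF assms(1-3) B]
 have "B - {y} \<notin> P - {B}"
 proof
  assume "B - {y} \<in> P - {B}"
  hence "B - {y} = B" using part_eq[OF assms(1) _ assms(2) _ assms(4), of "B - {y}"] assms(4,5) by blast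
  thus False using assms(3) by blast
 qed
 hence "insert (B - {y}) (P - {B}) - {B - {y}} = P - {B}" by blast
 moreover have "insert y (B - {y}) = B" using assms by blast
 moreover have "ins y b (del y P) = insert (insert y (B - {y})) (del y P - {B - {y}})"
  by (rule ins_eq[OF del_partition[OF assms(1-3) B]]) (use assms d in auto)
 ultimately show ?thesis unfolding d using assms(2) by auto
qed

lemma dat_insert: "finite P \<Longrightarrow> C \<notin> P \<Longrightarrow> dat (insert C P) x = dat P x + (if Max C = x then card C else 0)"
proof -
 assume f: "finite P" "C \<notin> P"
 have "{B \<in> insert C P. Max B = x} = (if Max C = x then insert C {B \<in> P. Max B = x} else {B \<in> P. Max B = x})" by auto
 thus ?thesis unfolding dat_def using f by simp
qed

lemma dat_ins:
 assumes "partition_on (U - {y}) P" "finite U" "y \<in> U" "B \<in> P" "b = Max B" "b < y"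
 shows "dat (ins y b P) = (dat P)(b := 0, y := dat P b + 1)"
proof
 fix x
 have fU: "finite (U - {y})" using assms by simp
 note b = part_Max(1)[OF assms(1) fU assms(4)]
 note fP = part_finite[OF assms(1) fU] and fB = part_finite_block[OF assms(1) fU assms(4)]
 have yB: "y \<notin> B" using part_sub[OF assms(1,4)] by blast
 have "insert y B \<notin> P" using part_sub[OF assms(1)] by blast
 hence 1: "dat (ins y b P) x = dat (P - {B}) x + (if Max (insert y B) = x then card (insert y B) else 0)"
  using dat_insert[of "P - {B}" "insert y B" x] ins_eq[OF assms(1,4), of b y] b fP assms(5) by simp
 have 2: "dat P x = dat (P - {B}) x + (if Max B = x then card B else 0)"
  using dat_insert[of "P - {B}" "B" x] fP assms(4) by (simp add: insert_absorb)
 have 3: "Max (insert y B) = y" using assms fB part_ne[OF assms(1,4)] by simp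
 have 4: "card (insert y B) = card B + 1" using fB yB by simp
 have 5: "dat (P - {B}) b = 0"
 proof (rule dat_0)
  show "b \<notin> Max ` (P - {B})" using part_Max_inj[OF assms(1) fU] assms(4,5) unfolding inj_on_def by blast
 qed
 have 6: "dat (P - {B}) y = 0"
 proof (rule dat_0)
  show "y \<notin> Max ` (P - {B})" using part_Max(1)[OF assms(1) fU] part_sub[OF assms(1)] by blast
 qed
 have 7: "dat P b = card B" using dat_Max[OF assms(1) fU assms(4)] assms(5) by simp
 show "dat (ins y b P) x = ((dat P)(b := 0, y := dat P b + 1)) x"
  using 1 2 3 4 5 6 7 assms(5,6) by auto
qed

text \<open>Base case of the peeling: every element of a block is the maximum of some block,
  necessarily of its own.\<close>

lemma dat_nonzero_singletons:
 assumes "partition_on U P" "finite U" "\<forall>x\<in>U. dat P x \<noteq> 0"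
 shows "P = (\<lambda>x. {x}) ` U"
proof -
 have s: "B = {x}" if B: "B \<in> P" "x \<in> B" for B x
 proof -
  have "z = Max B" if "z \<in> B" for z
  proof -
   have "z \<in> U" using that part_sub[OF assms(1) B(1)] by blast
   hence "z \<in> Max ` P" using assms(3) dat_0_iff[OF assms(1,2), of z] by blast
   then obtain C where C: "C \<in> P" "z = Max C" by blast
   hence "z \<in> C" using part_Max(1)[OF assms(1,2) C(1)] by simp
   hence "C = B" using part_eq[OF assms(1) C(1) B(1) _ that] by simp
   thus ?thesis using C(2) by simp
  qed
  thus ?thesis using B(2) by blast
 qed
 show ?thesis
 proof (intro equalityI subsetI)
  fix B assume B: "B \<in> P"
  then obtain x where x: "x \<in> B" using part_ne[OF assms(1)] by blast
  thus "B \<in> (\<lambda>x. {x}) ` U" using s[OF B x] part_sub[OF assms(1) B] by blast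
 next fix B assume "B \<in> (\<lambda>x. {x}) ` U"
  then obtain x where x: "B = {x}" "x \<in> U" by blast
  then obtain C where "C \<in> P" "x \<in> C" using part_ex[OF assms(1)] by blast
  thus "B \<in> P" using s[of C x] x by simp
 qed
qed

section \<open>Recovering a partition from its block sizes\<close>

text \<open>\<open>R\<close> stands for noncrossing or nonnesting, \<open>b\<close> for the last
  element that is no maximum, and \<open>sel\<close> chooses among the maxima after \<open>b\<close>
  of blocks of size at least 2. The assumption \<open>same\<close> says that the chosen
  \<open>y\<close> must share the block of \<open>b\<close>, which yields uniqueness;
  \<open>R_ins\<close> says that joining \<open>y\<close> to a block ending at \<open>b\<close>
  preserves \<open>R\<close>, which yields existence.\<close>

locale peelable =
 fixes R :: "int set set \<Rightarrow> bool" and sel :: "int set \<Rightarrow> int"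
 assumes sel: "finite S \<Longrightarrow> S \<noteq> {} \<Longrightarrow> sel S \<in> S"
  and same: "finite U \<Longrightarrow> partition_on U P \<Longrightarrow> R P \<Longrightarrow> b \<in> U \<Longrightarrow> dat P b = 0 \<Longrightarrow>
   (\<forall>z\<in>U. b < z \<longrightarrow> dat P z \<noteq> 0) \<Longrightarrow> y = sel {z\<in>U. b < z \<and> 2 \<le> dat P z} \<Longrightarrow> y \<in> U \<Longrightarrow> b < y \<Longrightarrow> 2 \<le> dat P y \<Longrightarrow>
   \<exists>B\<in>P. b \<in> B \<and> y \<in> B"
  and R_del: "finite U \<Longrightarrow> partition_on U P \<Longrightarrow> R P \<Longrightarrow> B \<in> P \<Longrightarrow> y = Max B \<Longrightarrow> R (del y P)"
  and R_ins: "finite U \<Longrightarrow> partition_on (U - {y}) P \<Longrightarrow> R P \<Longrightarrow> B \<in> P \<Longrightarrow> b = Max B \<Longrightarrow> b \<in> U \<Longrightarrow> y \<in> U \<Longrightarrow> b < y \<Longrightarrow>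
   (\<forall>z\<in>U. b < z \<longrightarrow> d z \<noteq> 0) \<Longrightarrow> (\<forall>z\<in>U - {y}. z \<noteq> b \<longrightarrow> dat P z = d z) \<Longrightarrow>
   y = sel {z\<in>U. b < z \<and> 2 \<le> d z} \<Longrightarrow> R (ins y b P)"
  and R_singletons: "R ((\<lambda>x. {x}) ` U)"

begin

text \<open>Since all positions after \<open>b\<close> are maxima, \<open>b\<close> is the second
  largest element of the block of \<open>y\<close>. Deleting \<open>y\<close> therefore moves the
  size of that block, reduced by 1, to \<open>b\<close>.\<close>

lemma dat_del:
 assumes U: "finite U" and P: "partition_on U P" and RP: "R P" and b: "b \<in> U" "dat P b = 0"
  and bz: "\<forall>z\<in>U. b < z \<longrightarrow> dat P z \<noteq> 0" and y: "y = sel {z\<in>U. b < z \<and> 2 \<le> dat P z}" "y \<in> U" "b < y" "2 \<le> dat P y"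
 shows "R (del y P)" "partition_on (U - {y}) (del y P)" "ins y b (del y P) = P"
  "dat (del y P) = (dat P)(b := dat P y - 1, y := 0)"
proof -
 obtain B where B: "B \<in> P" "b \<in> B" "y \<in> B" using same[OF U P RP b bz y] by blast
 obtain C where C: "C \<in> P" "y = Max C" using y(4) dat_0_iff[OF P U, of y] by auto
 have "C = B" using part_eq[OF P C(1) B(1) _ B(3)] part_Max(1)[OF P U C(1)] C(2) by simp
 hence yM: "y = Max B" using C by simp
 have ne: "B \<noteq> {y}" "b \<noteq> y" using B y by auto
 show "R (del y P)" by (rule R_del[OF U P RP B(1) yM])
 show 1: "partition_on (U - {y}) (del y P)" by (rule del_partition[OF P B(1,3) ne(1)])
 show 2: "ins y b (del y P) = P" by (rule ins_del[OF P B(1,3,2) ne(2)])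
 have bM: "b = Max (B - {y})"
 proof (rule sym, rule Max_eqI)
  show "finite (B - {y})" using part_finite_block[OF P U B(1)] by simp
  show "b \<in> B - {y}" using B ne by simp
  fix z assume z: "z \<in> B - {y}"
  show "z \<le> b"
  proof (rule ccontr)
   assume "\<not> z \<le> b"
   hence "dat P z \<noteq> 0" using bz z part_sub[OF P B(1)] by auto
   then obtain D where D: "D \<in> P" "z = Max D" using dat_0_iff[OF P U, of z] by auto
   have "D = B" using part_eq[OF P D(1) B(1), of z] part_Max(1)[OF P U D(1)] D(2) z by simp
   thus False using D(2) yM z by simp
  qed
 qed
 have 3: "B - {y} \<in> del y P" unfolding del_eq[OF P B(1,3) ne(1)] by simp
 have e: "dat P = (dat (del y P))(b := 0, y := dat (del y P) b + 1)"
  using dat_ins[OF 1 U y(2) 3 bM y(3)] 2 by simp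
 have "y \<notin> Max ` del y P" using part_Max(1)[OF 1] part_sub[OF 1] U by blast
 hence f: "dat (del y P) y = 0" by (rule dat_0)
 show "dat (del y P) = (dat P)(b := dat P y - 1, y := 0)"
  by (subst (1 2) e) (rule ext, use f ne in auto)
qed

text \<open>Both partitions have the same last nonmaximal \<open>b\<close> and hence the same
  \<open>y\<close>. The smaller partitions agree by induction, and \<open>ins y b\<close> restores
  the originals.\<close>

lemma dat_inj:
 assumes "finite U" "partition_on U P" "partition_on U Q" "R P" "R Q" "\<forall>x\<in>U. dat P x = dat Q x"
 shows "P = Q"
 using assms
proof (induction "card U" arbitrary: U P Q)
 case 0
 hence "U = {}" by simp
 thus ?case using 0(3,4) by (simp add: partition_on_empty)
next case (Suc n)
 show ?case
 proof (cases "\<exists>x\<in>U. dat P x = 0")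
  case False
  thus ?thesis using dat_nonzero_singletons[OF Suc(4,3)] dat_nonzero_singletons[OF Suc(5,3)] Suc(8) by simp
 next case True
  define b where "b = Max {x\<in>U. dat P x = 0}"
  have "b \<in> {x\<in>U. dat P x = 0}" unfolding b_def by (rule Max_in) (use True Suc(3) in auto)
  hence b: "b \<in> U" "dat P b = 0" by auto
  have bz: "\<forall>z\<in>U. b < z \<longrightarrow> dat P z \<noteq> 0"
  proof (intro ballI impI notI)
   fix z assume "z \<in> U" "b < z" "dat P z = 0"
   hence "z \<le> b" unfolding b_def by (intro Max_ge) (use Suc(3) in auto)
   thus False using \<open>b < z\<close> by simp
  qed
  define y where "y = sel {z\<in>U. b < z \<and> 2 \<le> dat P z}"
  have "y \<in> {z\<in>U. b < z \<and> 2 \<le> dat P z}" unfolding y_def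
   by (rule sel) (use valid_ex_big[OF dat_valid[OF Suc(4,3)] Suc(3) b] Suc(3) in auto)
  hence y: "y \<in> U" "b < y" "2 \<le> dat P y" by auto
  have yQ: "y = sel {z\<in>U. b < z \<and> 2 \<le> dat Q z}" unfolding y_def
   by (rule arg_cong[where f = sel]) (use Suc(8) in auto)
  have bQ: "dat Q b = 0" "\<forall>z\<in>U. b < z \<longrightarrow> dat Q z \<noteq> 0" "2 \<le> dat Q y" using b bz y Suc(8) by auto
  note p = dat_del[OF Suc(3) Suc(4) Suc(6) b bz y_def y]
  note q = dat_del[OF Suc(3) Suc(5) Suc(7) b(1) bQ(1) bQ(2) yQ y(1,2) bQ(3)]
  have "del y P = del y Q"
  proof (rule Suc(1))
   show "n = card (U - {y})" using Suc(2,3) y(1) by simp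
   show "\<forall>x\<in>U - {y}. dat (del y P) x = dat (del y Q) x" unfolding p(4) q(4) using Suc(8) y by auto
  qed (use p q Suc(3) in auto)
  thus ?thesis using p(3) q(3) by metis
 qed
qed

text \<open>Solve the problem on \<open>U - {y}\<close> with \<open>d y - 1\<close> at
  \<open>b\<close>, then give \<open>y\<close> back to the block ending at \<open>b\<close>. As
  \<open>2 \<le> d y\<close>, the value at \<open>b\<close> is positive, so a block does end
  there.\<close>

lemma dat_ex:
 assumes "finite U" "valid U d"
 shows "\<exists>P. partition_on U P \<and> R P \<and> (\<forall>x\<in>U. dat P x = d x)"
 using assms
proof (induction "card U" arbitrary: U d)
 case 0
 hence "U = {}" by simp
 thus ?case using R_singletons[of "{}"] by (intro exI[of _ "{}"]) (auto simp: partition_on_empty)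
next case (Suc n)
 show ?case
 proof (cases "\<exists>x\<in>U. d x = 0")
  case False
  hence d1: "d x = 1" if "x \<in> U" for x using sum_eq_card[OF Suc(3), of d x] Suc(4) that False unfolding valid_def by simp
  have p: "partition_on U ((\<lambda>x. {x}) ` U)" by (rule partition_on_singletons)
  moreover have "dat ((\<lambda>x. {x}) ` U) x = d x" if "x \<in> U" for x
   using dat_Max[OF p Suc(3), of "{x}"] d1[OF that] that by simp
  ultimately show ?thesis using R_singletons by blast
 next case True
  define b where "b = Max {x\<in>U. d x = 0}"
  have "b \<in> {x\<in>U. d x = 0}" unfolding b_def by (rule Max_in) (use True Suc(3) in auto)
  hence b: "b \<in> U" "d b = 0" by auto
  have bz: "\<forall>z\<in>U. b < z \<longrightarrow> d z \<noteq> 0"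
  proof (intro ballI impI notI)
   fix z assume "z \<in> U" "b < z" "d z = 0"
   hence "z \<le> b" unfolding b_def by (intro Max_ge) (use Suc(3) in auto)
   thus False using \<open>b < z\<close> by simp
  qed
  define y where "y = sel {z\<in>U. b < z \<and> 2 \<le> d z}"
  have "y \<in> {z\<in>U. b < z \<and> 2 \<le> d z}" unfolding y_def
   by (rule sel) (use valid_ex_big[OF Suc(4,3) b] Suc(3) in auto)
  hence y: "y \<in> U" "b < y" "2 \<le> d y" by auto
  have fU: "finite (U - {y})" using Suc(3) by simp
  have "\<exists>P. partition_on (U - {y}) P \<and> R P \<and> (\<forall>x\<in>U - {y}. dat P x = (d(b := d y - 1)) x)"
  proof (rule Suc(1))
   show "n = card (U - {y})" using Suc(2,3) y(1) by simp
   show "valid (U - {y}) (d(b := d y - 1))" by (rule valid_remove[OF Suc(4,3) b bz y])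
  qed (use Suc(3) in auto)
  then obtain P where P: "partition_on (U - {y}) P" "R P" "\<forall>x\<in>U - {y}. dat P x = (d(b := d y - 1)) x" by blast
  have db: "dat P b = d y - 1" using P(3) b y by auto
  then obtain B where B: "B \<in> P" "b = Max B" using dat_0_iff[OF P(1) fU, of b] y(3) by auto
  have "partition_on U (ins y b P)"
   by (rule ins_partition[OF P(1) y(1) B(1)]) (use part_Max(1)[OF P(1) fU B(1)] B(2) in simp)
  moreover have "R (ins y b P)"
   by (rule R_ins[OF Suc(3) P(1,2) B b(1) y(1,2) bz _ y_def]) (use P(3) in auto)
  moreover have "dat (ins y b P) x = d x" if "x \<in> U" for x
   unfolding dat_ins[OF P(1) Suc(3) y(1) B y(2)] using P(3) that b y db by auto
  ultimately show ?thesis by blast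
 qed
qed

end

lemma ncr_del: "ncr P \<Longrightarrow> ncr (del y P)"
 unfolding ncr_def
proof (intro ballI impI)
 fix A B a b c d
 assume n: "\<forall>A\<in>P. \<forall>B\<in>P. \<forall>a\<in>A. \<forall>b\<in>B. \<forall>c\<in>A. \<forall>d\<in>B. a < b \<longrightarrow> b < c \<longrightarrow> c < d \<longrightarrow> A = B"
  and *: "A \<in> del y P" "B \<in> del y P" "a \<in> A" "b \<in> B" "c \<in> A" "d \<in> B" "a < b" "b < c" "c < d"
 obtain A' B' where "A' \<in> P" "A = A' - {y}" "B' \<in> P" "B = B' - {y}" using *(1,2) unfolding del_def by blast
 thus "A = B" using n * by (metis DiffD1)
qed

lemma part_nonmax_less:
 assumes "partition_on U P" "finite (U :: int set)" "B \<in> P" "x \<in> B" "x < Max B"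
 shows "dat P x = 0"
proof (rule dat_0, rule notI)
 assume "x \<in> Max ` P"
 then obtain C where C: "C \<in> P" "x = Max C" by blast
 hence "C = B" using part_eq[OF assms(1) C(1) assms(3) _ assms(4)] part_Max(1)[OF assms(1,2) C(1)] by simp
 thus False using C(2) assms(5) by simp
qed

lemma part_two_card:
 assumes "partition_on U P" "finite (U :: int set)" "B \<in> P" "x \<in> B" "x < Max B"
 shows "2 \<le> dat P (Max B)"
proof -
 have "card {x, Max B} \<le> card B"
  by (rule card_mono[OF part_finite_block[OF assms(1-3)]]) (use assms part_Max(1)[OF assms(1-3)] in simp)
 moreover have "card {x, Max B} = 2" using assms(5) by (simp add: card_insert_if)
 ultimately show ?thesis using dat_Max[OF assms(1-3)] by simp
qed

lemma part_dat_nz: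
 assumes "partition_on U P" "finite (U :: int set)" "B \<in> P" "x \<in> B" "dat P x \<noteq> 0"
 shows "x = Max B"
 using part_nonmax_less[OF assms(1-4)] part_Max(3)[OF assms(1-4)] assms(5) by force

lemma part_two_ex:
 assumes "partition_on U P" "finite (U :: int set)" "B \<in> P" "2 \<le> card B"
 shows "\<exists>x\<in>B. x < Max B"
proof (rule ccontr)
 assume c: "\<not> ?thesis"
 have "B \<subseteq> {Max B}" using c part_Max(3)[OF assms(1-3)] by force
 hence "card B \<le> card {Max B}" by (intro card_mono) auto
 thus False using assms(4) by simp
qed

interpretation ncr: peelable ncr Min
proof (unfold_locales, goal_cases)
 case (1 S) thus ?case by (rule Min_in)
\<comment> \<open>The maximum of the block \<open>B\<close> of \<open>b\<close> is a candidate, so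
  \<open>y \<le> Max B\<close>. If \<open>y\<close> ended a different block, that block would have a
  smaller element \<open>c\<close>, nonmaximal and hence left of \<open>b\<close>, and
  \<open>c < b < y < Max B\<close> would be a crossing.\<close>
next case (2 U P b y)
 obtain B where B: "B \<in> P" "b \<in> B" using part_ex[OF 2(2,4)] by blast
 have bB: "b < Max B" using part_Max(3)[OF 2(2,1) B] 2(5) dat_Max[OF 2(2,1) B(1)] part_ne[OF 2(2) B(1)] part_finite_block[OF 2(2,1) B(1)]
  by (metis card_gt_0_iff less_irrefl order_le_less)
 have MU: "Max B \<in> U" using part_Max(1)[OF 2(2,1) B(1)] part_sub[OF 2(2) B(1)] by blast
 have yM: "y \<le> Max B" unfolding 2(7) by (rule Min_le) (use 2(1) bB MU part_two_card[OF 2(2,1) B bB] in auto)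
 show ?case
 proof (cases "y = Max B")
  case True thus ?thesis using B part_Max(1)[OF 2(2,1) B(1)] by blast
 next case False
  obtain C where C: "C \<in> P" "y = Max C" using dat_0_iff[OF 2(2,1), of y] 2(10) by auto
  have yC: "y \<in> C" using part_Max(1)[OF 2(2,1) C(1)] C(2) by simp
  have "2 \<le> card C" using 2(10) dat_Max[OF 2(2,1) C(1)] C(2) by simp
  then obtain c where c: "c \<in> C" "c < y" using part_two_ex[OF 2(2,1) C(1)] C(2) by blast
  have "dat P c = 0" using part_nonmax_less[OF 2(2,1) C(1) c(1)] c(2) C(2) by simp
  hence cb: "c \<le> b" using 2(6) c part_sub[OF 2(2) C(1)] by force
  show ?thesis
  proof (cases "c = b")
   case True thus ?thesis using c C yC by blast
  next case False2: False
   have "C = B" using ncrD[OF 2(3) C(1) B(1) c(1) B(2) yC part_Max(1)[OF 2(2,1) B(1)]] cb False2 2(9) yM False by simp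
   thus ?thesis using B yC by blast
  qed
 qed
next case (3 U P B y) thus ?case by (intro ncr_del)
next case (4 U y P B b d)
 have fU: "finite (U - {y})" using 4(1) by simp
 note P = 4(2) fU
 have bB: "b \<in> B" using part_Max(1)[OF P 4(4)] 4(5) by simp
 have big: "dat P z = d z \<and> d z \<noteq> 0" if "z \<in> U" "z \<noteq> y" "b < z" for z using that 4(9,10) by auto
 \<comment> \<open>Crossings in which \<open>y\<close> is the last point. A block with a point
   strictly between \<open>b\<close> and \<open>y\<close> and another before it would end there and
   be a candidate smaller than \<open>y\<close>; otherwise \<open>b\<close> can replace
   \<open>y\<close>.\<close>
 have key: "A = B" if A: "A \<in> P" "x1 \<in> A" "x3 \<in> A" "x1 < x3" and x2: "x2 \<in> B" "x1 < x2" "x2 < x3" "x3 < y" for A x1 x2 x3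
 proof -
  have x2b: "x2 \<le> b" using part_Max(3)[OF P 4(4) x2(1)] 4(5) by simp
  have x3U: "x3 \<in> U" "x3 \<noteq> y" using part_sub[OF 4(2) A(1)] A(3) by auto
  consider "x3 < b" | "x3 = b" | "b < x3" by linarith
  thus "A = B"
  proof cases
   case 1 thus ?thesis using ncrD[OF 4(3) A(1) 4(4) A(2) x2(1) A(3) bB] x2 by simp
  next case 2 thus ?thesis using part_eq[OF 4(2) A(1) 4(4) A(3)] bB by simp
  next case 3
   have "x3 = Max A" using part_dat_nz[OF P A(1,3)] big[OF x3U 3] by simp
   hence "2 \<le> d x3" using part_two_card[OF P A(1,2)] A(4) big[OF x3U 3] by simp
   hence "y \<le> x3" unfolding 4(11) by (intro Min_le) (use 4(1) x3U 3 in auto)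
   thus ?thesis using x2 by simp
  qed
 qed
 \<comment> \<open>Crossings in which \<open>y\<close> is the third point. Here \<open>x4\<close> is
   a maximum, so \<open>x2\<close> is not, which puts it at or before \<open>b\<close>; then
   \<open>b\<close> can replace \<open>y\<close>.\<close>
 have key2: "C = B" if C: "C \<in> P" "x2 \<in> C" "x4 \<in> C" and x: "x1 \<in> B" "x1 < x2" "x2 < y" "y < x4" for C x1 x2 x4
 proof -
  have x4U: "x4 \<in> U" "x4 \<noteq> y" "b < x4" using part_sub[OF 4(2) C(1)] C(3) x 4(8) by auto
  have x4: "x4 = Max C" using part_dat_nz[OF P C(1,3)] big[OF x4U] by simp
  hence "dat P x2 = 0" using part_nonmax_less[OF P C(1,2)] x by simp
  moreover have "x2 \<in> U" "x2 \<noteq> y" using part_sub[OF 4(2) C(1)] C(2) by auto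
  ultimately have "x2 \<le> b" using big[of x2] by force
  then consider "x2 = b" | "x2 < b" by linarith
  thus "C = B"
  proof cases
   case 1 thus ?thesis using part_eq[OF 4(2) C(1) 4(4) C(2)] bB by simp
  next case 2 thus ?thesis using ncrD[OF 4(3) 4(4) C(1) x(1) C(2) bB C(3)] x x4U by simp
  qed
 qed
 note ie = ins_eq[OF 4(2) 4(4) bB, of y]
 have Bb: "z \<le> b" if "z \<in> B" for z using part_Max(3)[OF P 4(4) that] 4(5) by simp
 show ?case unfolding ie ncr_def
 proof (intro ballI impI)
  fix A C x1 x2 x3 x4
  assume *: "A \<in> insert (insert y B) (P - {B})" "C \<in> insert (insert y B) (P - {B})" "x1 \<in> A" "x2 \<in> C" "x3 \<in> A" "x4 \<in> C" "x1 < x2" "x2 < x3" "x3 < x4"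
  show "A = C"
  proof (rule ccontr)
   assume ne: "A \<noteq> C"
   then consider "A \<in> P" "A \<noteq> B" "C \<in> P" "C \<noteq> B" | "A = insert y B" "C \<in> P" "C \<noteq> B" | "A \<in> P" "A \<noteq> B" "C = insert y B"
    using * by blast
   thus False
   proof cases
    case 1 thus False using ncrD[OF 4(3) 1(1,3) *(3-9)] ne by simp
   next case 2
    have x1: "x1 \<in> B" using * 2 Bb[of x3] 4(8) by auto
    show False
    proof (cases "x3 = y")
     case True thus False using key2[OF 2(2) *(4,6) x1 *(7)] * 2 by simp
    next case False
     thus False using ncrD[OF 4(3) 4(4) 2(2) x1 *(4) _ *(6,7,8,9)] * 2 by auto
    qed
   next case 3
    have x2: "x2 \<in> B" using * 3 Bb[of x4] 4(8) by auto
    show False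
    proof (cases "x4 = y")
     case True thus False using key[OF 3(1) *(3,5) _ x2] * 3 by simp
    next case False
     thus False using ncrD[OF 4(3) 3(1) 4(4) *(3) x2 *(5) _ *(7,8,9)] * 3 by auto
    qed
   qed
  qed
 qed
next case (5 U) thus ?case unfolding ncr_def by auto
qed

lemma edgesE:
 assumes "(i, j) \<in> edges P"
 obtains B where "B \<in> P" "i \<in> B" "j \<in> B" "i < j" "\<And>k. k \<in> B \<Longrightarrow> i < k \<Longrightarrow> j \<le> k"
 using assms unfolding edges_def by force

lemma edgesI: "B \<in> P \<Longrightarrow> i \<in> B \<Longrightarrow> j \<in> B \<Longrightarrow> i < j \<Longrightarrow> (\<And>k. k \<in> B \<Longrightarrow> i < k \<Longrightarrow> k < j \<Longrightarrow> False) \<Longrightarrow> (i, j) \<in> edges P"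
 unfolding edges_def by blast

interpretation nns: peelable nns Max
proof (unfold_locales, goal_cases)
 case (1 S) thus ?case by (rule Max_in)
\<comment> \<open>The pair \<open>(b, Max B)\<close> is an edge, because everything after
  \<open>b\<close> is a maximum. If \<open>y\<close> ended another block, the last edge
  \<open>(c, y)\<close> of that block would start before \<open>b\<close> and end after
  \<open>Max B\<close>.\<close>
next case (2 U P b y)
 obtain B where B: "B \<in> P" "b \<in> B" using part_ex[OF 2(2,4)] by blast
 have bB: "b < Max B" using part_Max(3)[OF 2(2,1) B] 2(5) dat_Max[OF 2(2,1) B(1)] part_ne[OF 2(2) B(1)] part_finite_block[OF 2(2,1) B(1)]
  by (metis card_gt_0_iff less_irrefl order_le_less)
 have MU: "Max B \<in> U" using part_Max(1)[OF 2(2,1) B(1)] part_sub[OF 2(2) B(1)] by blast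
 have yM: "Max B \<le> y" unfolding 2(7) by (rule Max_ge) (use 2(1) bB MU part_two_card[OF 2(2,1) B bB] in auto)
 have eB: "(b, Max B) \<in> edges P"
 proof (rule edgesI[OF B part_Max(1)[OF 2(2,1) B(1)] bB])
  fix k assume k: "k \<in> B" "b < k" "k < Max B"
  hence "dat P k = 0" using part_nonmax_less[OF 2(2,1) B(1)] by simp
  thus False using 2(6) k part_sub[OF 2(2) B(1)] by auto
 qed
 show ?case
 proof (cases "y = Max B")
  case True thus ?thesis using B part_Max(1)[OF 2(2,1) B(1)] by blast
 next case False
  obtain C where C: "C \<in> P" "y = Max C" using dat_0_iff[OF 2(2,1), of y] 2(10) by auto
  have yC: "y \<in> C" using part_Max(1)[OF 2(2,1) C(1)] C(2) by simp
  have "2 \<le> card C" using 2(10) dat_Max[OF 2(2,1) C(1)] C(2) by simp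
  then obtain c' where c': "c' \<in> C" "c' < y" using part_two_ex[OF 2(2,1) C(1)] C(2) by blast
  obtain c where c: "(c, y) \<in> edges P" "c \<in> C" using edges_edge_below[OF part_finite_block[OF 2(2,1) C(1)] C(1) c'(1) yC c'(2)] by blast
  have cy: "c < y" using c(1) unfolding edges_def by blast
  have "dat P c = 0" using part_nonmax_less[OF 2(2,1) C(1) c(2)] cy C(2) by simp
  hence cb: "c \<le> b" using 2(6) c(2) part_sub[OF 2(2) C(1)] by force
  show ?thesis
  proof (cases "c = b")
   case True thus ?thesis using c C yC by blast
  next case False2: False
   thus ?thesis using 2(3) c(1) eB cb bB yM False unfolding nns_def by (metis order_le_less)
  qed
 qed
\<comment> \<open>Deleting the maximum of a block removes its last edge and creates no new
  one.\<close>
next case (3 U P B y)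
 have "edges (del y P) \<subseteq> edges P"
 proof clarify
  fix i j assume e: "(i, j) \<in> edges (del y P)"
  obtain D where D: "D \<in> del y P" "i \<in> D" "j \<in> D" "i < j" "\<And>k. k \<in> D \<Longrightarrow> i < k \<Longrightarrow> j \<le> k"
   by (rule edgesE[OF e]) (rule that)
  then obtain D' where D': "D' \<in> P" "D = D' - {y}" unfolding del_def by blast
  show "(i, j) \<in> edges P"
  proof (rule edgesI[OF D'(1)])
   fix k assume k: "k \<in> D'" "i < k" "k < j"
   show False
   proof (cases "k = y")
    case True
    hence "D' = B" using part_eq[OF 3(2) D'(1) 3(4) k(1)] part_Max(1)[OF 3(2,1,4)] 3(5) by simp
    hence "j \<le> y" using part_Max(3)[OF 3(2,1,4)] D(3) D'(2) 3(5) by simp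
    thus False using True k by simp
   next case False thus False using D(5)[of k] D'(2) k by simp
   qed
  qed (use D D' in auto)
 qed
 thus ?case using 3(3) unfolding nns_def by blast
next case (4 U y P B b d)
 have fU: "finite (U - {y})" using 4(1) by simp
 note P = 4(2) fU
 have bB: "b \<in> B" using part_Max(1)[OF P 4(4)] 4(5) by simp
 have big: "dat P z = d z \<and> d z \<noteq> 0" if "z \<in> U" "z \<noteq> y" "b < z" for z using that 4(9,10) by auto
 note ie = ins_eq[OF 4(2) 4(4) bB, of y]
 have Bb: "z \<le> b" if "z \<in> B" for z using part_Max(3)[OF P 4(4) that] 4(5) by simp
 have sub: "edges (ins y b P) \<subseteq> insert (b, y) (edges P)"
 proof
  fix e assume "e \<in> edges (ins y b P)"
  then obtain i j where e: "e = (i, j)" "(i, j) \<in> edges (ins y b P)" by (cases e) auto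
  obtain D where D: "D \<in> ins y b P" "i \<in> D" "j \<in> D" "i < j" "\<And>k. k \<in> D \<Longrightarrow> i < k \<Longrightarrow> j \<le> k" by (rule edgesE[OF e(2)]) (rule that)
  show "e \<in> insert (b, y) (edges P)"
  proof (cases "D = insert y B")
   case False
   hence "D \<in> P" using D(1) unfolding ie by blast
   hence "(i, j) \<in> edges P" by (rule edgesI) (use D in force)+
   thus ?thesis using e by simp
  next case True
   have i: "i \<in> B" using D True Bb[of j] 4(8) by auto
   show ?thesis
   proof (cases "j = y")
    case True2: True
    have "\<not> i < b" using D(5)[of b] True bB True2 4(8) by auto
    thus ?thesis using Bb[OF i] e True2 by simp
   next case False
    have "(i, j) \<in> edges P" by (rule edgesI[OF 4(4) i]) (use D True False in force)+
    thus ?thesis using e by simp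
   qed
  qed
 qed
 \<comment> \<open>No edge starts after \<open>b\<close>, so nothing can be nested below the new
   edge \<open>(b, y)\<close>.\<close>
 have nm: "c \<le> b" if "(c, e) \<in> edges P" for c e
 proof -
  have "c \<in> U - {y} \<and> c \<notin> Max ` P" using edges_nonmax[OF P, of c] that by blast
  hence "dat P c = 0" "c \<in> U" "c \<noteq> y" using dat_0 by auto
  thus ?thesis using big[of c] by force
 qed
 \<comment> \<open>An edge ending beyond \<open>y\<close> would end in a candidate larger than
   \<open>y\<close>, so nothing can lie above the new edge either.\<close>
 have out: "e \<le> y" if h: "(c, e) \<in> edges P" "y < e" for c e
 proof -
  obtain D where D: "D \<in> P" "c \<in> D" "e \<in> D" "c < e" by (rule edgesE[OF h(1)]) (rule that)
  have e: "e \<in> U" "e \<noteq> y" "b < e" using part_sub[OF 4(2) D(1)] D(3) h(2) 4(8) by auto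
  have "e = Max D" using part_dat_nz[OF P D(1,3)] big[OF e] by simp
  hence "2 \<le> d e" using part_two_card[OF P D(1,2)] D(4) big[OF e] by simp
  thus "e \<le> y" unfolding 4(11) by (intro Max_ge) (use 4(1) e in auto)
 qed
 show ?case unfolding nns_def
 proof (rule notI, elim exE conjE)
  fix a b' c e assume *: "(a, b') \<in> edges (ins y b P)" "(c, e) \<in> edges (ins y b P)" "a < c" "c < e" "e < b'"
  then consider "(a, b') \<in> edges P" "(c, e) \<in> edges P" | "(a, b') = (b, y)" "(c, e) \<in> edges P"
   | "(a, b') \<in> edges P" "(c, e) = (b, y)" | "(a, b') = (b, y)" "(c, e) = (b, y)" using sub by blast
  thus False
  proof cases
   case 1 thus False using 4(3) * unfolding nns_def by blast
  next case 2 thus False using nm[OF 2(2)] * by simp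
  next case 3 thus False using out[OF 3(1)] * by simp
  qed (use * in simp)
 qed
next case (5 U) thus ?case unfolding nns_def edges_def by auto
qed

section \<open>Marked partitions and the transfer of marks\<close>

text \<open>All the information on which the type depends, apart from the sign in type D.\<close>

definition stat :: "marked \<Rightarrow> nat multiset \<times> nat list" where
 "stat = (\<lambda>(S, X). (image_mset card (mset_set S), map card (by_max X)))"

lemma transfer_nth:
 assumes "length As' = length As" "distinct As" "distinct As'" "i < length As"
 shows "As' ! i \<in> transfer_blocks As As' X \<longleftrightarrow> As ! i \<in> X"
 unfolding transfer_blocks_def using assms by (auto simp: nth_eq_iff_index_eq)

lemma transfer_subset: "length As' = length As \<Longrightarrow> transfer_blocks As As' X \<subseteq> set As'"
 unfolding transfer_blocks_def by auto

lemma transfer_transfer: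
 assumes "length As' = length As" "distinct As" "distinct As'" "X \<subseteq> set As"
 shows "transfer_blocks As' As (transfer_blocks As As' X) = X"
proof (intro equalityI subsetI)
 fix A assume "A \<in> transfer_blocks As' As (transfer_blocks As As' X)"
 then obtain i where "A = As ! i" "i < length As'" "As' ! i \<in> transfer_blocks As As' X"
  unfolding transfer_blocks_def[of As'] by blast
 thus "A \<in> X" using transfer_nth[OF assms(1-3)] assms(1) by simp
next fix A assume A: "A \<in> X"
 then obtain i where i: "i < length As" "A = As ! i" using assms(4) by (metis in_set_conv_nth subsetD)
 hence "As' ! i \<in> transfer_blocks As As' X" using transfer_nth[OF assms(1-3) i(1)] A by simp
 thus "A \<in> transfer_blocks As' As (transfer_blocks As As' X)"
  unfolding transfer_blocks_def[of As'] using i assms(1) by auto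
qed

lemma by_max_filter:
 assumes "sorted_wrt (<) (map Max As)" "X \<subseteq> set As"
 shows "by_max X = map ((!) As) (filter (\<lambda>i. As ! i \<in> X) [0..<length As])"
proof (rule by_max_unique)
 have "distinct (map Max As)" using assms(1) by (simp add: strict_sorted_iff)
 hence i: "inj_on Max (set As)" unfolding distinct_map by blast
 show "finite X" using assms(2) finite_subset by blast
 show "inj_on Max X" using i assms(2) inj_on_subset by blast
 have e: "map ((!) As) (filter (\<lambda>i. As ! i \<in> X) [0..<length As]) = filter (\<lambda>A. A \<in> X) As"
  using filter_map[of "\<lambda>A. A \<in> X" "(!) As" "[0..<length As]"] by (simp add: map_nth comp_def)
 show "set (map ((!) As) (filter (\<lambda>i. As ! i \<in> X) [0..<length As])) = X" unfolding e using assms(2) by auto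
 show "sorted_wrt (<) (map Max (map ((!) As) (filter (\<lambda>i. As ! i \<in> X) [0..<length As])))"
  unfolding e using assms(1) by (simp add: sorted_wrt_map sorted_wrt_filter)
qed

lemma by_max_transfer:
 assumes "length As' = length As" "distinct As" "sorted_wrt (<) (map Max As')"
 shows "by_max (transfer_blocks As As' X) = map ((!) As') (filter (\<lambda>i. As ! i \<in> X) [0..<length As])"
proof -
 have "distinct (map Max As')" using assms(3) by (simp add: strict_sorted_iff)
 hence d: "distinct As'" unfolding distinct_map by blast
 have "filter (\<lambda>i. As' ! i \<in> transfer_blocks As As' X) [0..<length As'] = filter (\<lambda>i. As ! i \<in> X) [0..<length As]"
  unfolding assms(1) by (rule filter_cong[OF refl]) (use transfer_nth[OF assms(1,2) d] in auto)
 thus ?thesis using by_max_filter[OF assms(3) transfer_subset[OF assms(1)], of X] by simp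
qed

lemma map_card_by_max_transfer:
 assumes "map card As' = map card As" "sorted_wrt (<) (map Max As)" "sorted_wrt (<) (map Max As')" "X \<subseteq> set As"
 shows "map card (by_max (transfer_blocks As As' X)) = map card (by_max X)"
proof -
 have "distinct (map Max As)" using assms(2) by (simp add: strict_sorted_iff)
 hence d: "distinct As" unfolding distinct_map by blast
 have l: "length As' = length As" using assms(1) by (metis length_map)
 have "card (As' ! i) = card (As ! i)" if "i < length As" for i
  using arg_cong[OF assms(1), of "\<lambda>l. l ! i"] that l by simp
 thus ?thesis unfolding by_max_transfer[OF l d assms(3)] by_max_filter[OF assms(2,4)] by simp
qed

text \<open>Serves both \<open>xi_bar\<close> and \<open>rho_bar\<close>. For \<open>rho_bar\<close>
  the lists contain all blocks and not only the nonaligned ones; hence the separate sets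
  \<open>pa\<close> and \<open>pb\<close> of blocks that may be marked, required to agree position
  by position.\<close>

lemma marked_bij:
 assumes f: "bij_betw f A B"
  and l: "\<And>S. S \<in> A \<Longrightarrow> length (lb (f S)) = length (la S)" "\<And>S. S \<in> A \<Longrightarrow> distinct (la S)" "\<And>S. S \<in> A \<Longrightarrow> distinct (lb (f S))"
  and sub: "\<And>S. S \<in> A \<Longrightarrow> pa S \<subseteq> set (la S)" "\<And>S. S \<in> A \<Longrightarrow> pb (f S) \<subseteq> set (lb (f S))"
  and p: "\<And>S i. S \<in> A \<Longrightarrow> i < length (la S) \<Longrightarrow> la S ! i \<in> pa S \<longleftrightarrow> lb (f S) ! i \<in> pb (f S)"
 shows "bij_betw (\<lambda>(S, X). (f S, transfer_blocks (la S) (lb (f S)) X))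
  {(S, X). S \<in> A \<and> X \<subseteq> pa S} {(T, Y). T \<in> B \<and> Y \<subseteq> pb T}"
proof (rule bij_betw_byWitness[where f' = "\<lambda>(T, Y). (inv_into A f T, transfer_blocks (lb T) (la (inv_into A f T)) Y)"])
 let ?g = "inv_into A f"
 have g: "?g T \<in> A" "f (?g T) = T" if "T \<in> B" for T
  using that f bij_betw_inv_into_right[OF f] bij_betwE[OF bij_betw_inv_into[OF f]] by auto
 have gf: "?g (f S) = S" if "S \<in> A" for S using bij_betw_inv_into_left[OF f that] .
 show "\<forall>a\<in>{(S, X). S \<in> A \<and> X \<subseteq> pa S}.
    (case (case a of (S, X) \<Rightarrow> (f S, transfer_blocks (la S) (lb (f S)) X)) of (T, Y) \<Rightarrow> (?g T, transfer_blocks (lb T) (la (?g T)) Y)) = a"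
 proof (intro ballI, elim CollectE case_prodE conjE, simp only: split_conv)
  fix S X assume "S \<in> A" "X \<subseteq> pa S"
  thus "(?g (f S), transfer_blocks (lb (f S)) (la (?g (f S))) (transfer_blocks (la S) (lb (f S)) X)) = (S, X)"
   using gf transfer_transfer[OF l] sub(1)[of S] by (simp add: subset_trans)
 qed
 show "\<forall>a'\<in>{(T, Y). T \<in> B \<and> Y \<subseteq> pb T}.
    (case (case a' of (T, Y) \<Rightarrow> (?g T, transfer_blocks (lb T) (la (?g T)) Y)) of (S, X) \<Rightarrow> (f S, transfer_blocks (la S) (lb (f S)) X)) = a'"
 proof (intro ballI, elim CollectE case_prodE conjE, simp only: split_conv)
  fix T Y assume "T \<in> B" "Y \<subseteq> pb T"
  thus "(f (?g T), transfer_blocks (la (?g T)) (lb (f (?g T))) (transfer_blocks (lb T) (la (?g T)) Y)) = (T, Y)"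
   using g[of T] transfer_transfer[of "la (?g T)" "lb T" Y] l[of "?g T"] sub(2)[of "?g T"] by (simp add: subset_trans)
 qed
 show "(\<lambda>(S, X). (f S, transfer_blocks (la S) (lb (f S)) X)) ` {(S, X). S \<in> A \<and> X \<subseteq> pa S} \<subseteq> {(T, Y). T \<in> B \<and> Y \<subseteq> pb T}"
 proof clarsimp
  fix S X assume S: "S \<in> A" "X \<subseteq> pa S"
  have "transfer_blocks (la S) (lb (f S)) X \<subseteq> pb (f S)"
   unfolding transfer_blocks_def using p[OF S(1)] S(2) by blast
  thus "f S \<in> B \<and> transfer_blocks (la S) (lb (f S)) X \<subseteq> pb (f S)" using bij_betwE[OF f] S by blast
 qed
 show "(\<lambda>(T, Y). (?g T, transfer_blocks (lb T) (la (?g T)) Y)) ` {(T, Y). T \<in> B \<and> Y \<subseteq> pb T} \<subseteq> {(S, X). S \<in> A \<and> X \<subseteq> pa S}"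
 proof clarsimp
  fix T Y assume T: "T \<in> B" "Y \<subseteq> pb T"
  have "transfer_blocks (lb T) (la (?g T)) Y \<subseteq> pa (?g T)"
   unfolding transfer_blocks_def using p[OF g(1)[OF T(1)]] l(1)[OF g(1)[OF T(1)]] g(2)[OF T(1)] T(2) by auto
  thus "?g T \<in> A \<and> transfer_blocks (lb T) (la (?g T)) Y \<subseteq> pa (?g T)" using g T by blast
 qed
qed

section \<open>The map \<open>rho\<close>\<close>

lemma psize_part: "parts m P \<Longrightarrow> psize P = m"
 unfolding psize_def by (simp add: partition_onD1[symmetric])

text \<open>\<open>nns.dat_ex\<close> and \<open>nns.dat_inj\<close> show that the definite
  description in \<open>rho\<close> denotes, and that it denotes the nonnesting partition with the
  same \<open>dat\<close>.\<close>

lemma rho: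
 assumes "S \<in> NC m"
 shows "rho S \<in> NN m" "\<forall>x\<in>{1..int m}. dat (rho S) x = dat S x"
proof -
 have S: "parts m S" using assms unfolding NC_def by simp
 let ?Q = "\<lambda>T. T \<in> NN (psize S) \<and> map Max (by_max T) = map Max (by_max S) \<and> map card (by_max T) = map card (by_max S)"
 have iff: "?Q T \<longleftrightarrow> parts m T \<and> nns T \<and> (\<forall>x\<in>{1..int m}. dat T x = dat S x)" for T
  unfolding psize_part[OF S] NN_nns using by_max_eq_iff_dat[OF S, of T] by auto
 obtain T where T: "parts m T" "nns T" "\<forall>x\<in>{1..int m}. dat T x = dat S x"
  using nns.dat_ex[OF _ dat_valid[OF S]] by auto
 have "?Q (rho S)" unfolding rho_def
 proof (rule theI)
  show "?Q T" unfolding iff using T by blast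
  show "T' = T" if "?Q T'" for T'
   using that T unfolding iff by (intro nns.dat_inj[of "{1..int m}"]) auto
 qed
 hence "parts m (rho S) \<and> nns (rho S) \<and> (\<forall>x\<in>{1..int m}. dat (rho S) x = dat S x)"
  by (rule iff[THEN iffD1])
 thus "rho S \<in> NN m" "\<forall>x\<in>{1..int m}. dat (rho S) x = dat S x" unfolding NN_nns by auto
qed

text \<open>Noncrossing and nonnesting partitions are both parametrised by \<open>dat\<close>, with
  the same range, and \<open>rho\<close> is the identity on this parameter.\<close>

lemma rho_bij: "bij_betw rho (NC m) (NN m)"
proof (rule bij_betw_imageI[OF inj_onI], goal_cases)
 case (1 S T)
 show ?case
 proof -
  note * = 1
  have "\<forall>x\<in>{1..int m}. dat S x = dat T x" using * rho(2)[of S m] rho(2)[of T m] by simp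
  thus ?thesis using * unfolding NC_def by (intro ncr.dat_inj[of "{1..int m}"]) auto
 qed
next case 2
 have "T \<in> rho ` NC m" if T: "T \<in> NN m" for T
 proof -
 have T': "parts m T" "nns T" using T unfolding NN_nns by auto
 obtain S where S: "parts m S" "ncr S" "\<forall>x\<in>{1..int m}. dat S x = dat T x"
  using ncr.dat_ex[OF _ dat_valid[OF T'(1)]] by auto
 hence SN: "S \<in> NC m" unfolding NC_def by simp
 have "rho S = T" using rho[OF SN] T' S(3) unfolding NN_nns by (intro nns.dat_inj[of "{1..int m}"]) auto
 thus "T \<in> rho ` NC m" using SN by blast
 qed
 thus ?case using rho(1) by blast
qed

definition NCNN :: "nat \<Rightarrow> marked set" where
 "NCNN m = {(S, X). S \<in> NC m \<and> X \<subseteq> {B \<in> S. nonnested S B}}"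

definition NCNA :: "nat \<Rightarrow> marked set" where
 "NCNA m = {(S, X). S \<in> NC m \<and> X \<subseteq> {B \<in> S. nonaligned S B}}"

definition NNNA :: "nat \<Rightarrow> marked set" where
 "NNNA m = {(S, X). S \<in> NN m \<and> X \<subseteq> {B \<in> S. nonaligned S B}}"

lemma part_by_max:
 assumes "parts m S" "X \<subseteq> S"
 shows "set (by_max X) = X" "sorted_wrt (<) (map Max (by_max X))" "distinct (by_max X)" "length (by_max X) = card X" "finite X"
proof -
 have f: "finite X" using part_finite[OF assms(1)] assms(2) finite_subset by auto
 have i: "inj_on Max X" using part_Max_inj[OF assms(1)] assms(2) inj_on_subset by auto
 show "set (by_max X) = X" "sorted_wrt (<) (map Max (by_max X))" "distinct (by_max X)" "length (by_max X) = card X" "finite X"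
  using by_max(1-4)[OF f i] f by auto
qed

lemma rho_by_max:
 assumes "S \<in> NC m"
 shows "map Max (by_max (rho S)) = map Max (by_max S)" "map card (by_max (rho S)) = map card (by_max S)"
 using by_max_eq_iff_dat[of "{1..int m}" S "rho S"] rho[OF assms] assms unfolding NC_def NN_nns by auto

lemma rho_bar_bij: "bij_betw rho_bar (NCNA m) (NNNA m)"
 unfolding rho_bar_def NCNA_def NNNA_def
proof (rule marked_bij[OF rho_bij])
 fix S assume S: "S \<in> NC m"
 hence P: "parts m S" "parts m (rho S)" using rho(1)[OF S] unfolding NC_def NN_nns by auto
 show "length (by_max (rho S)) = length (by_max S)" using rho_by_max(1)[OF S] by (metis length_map)
 show "distinct (by_max S)" "distinct (by_max (rho S))" using part_by_max(3)[OF P(1)] part_by_max(3)[OF P(2)] by auto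
 show "{B \<in> S. nonaligned S B} \<subseteq> set (by_max S)" "{B \<in> rho S. nonaligned (rho S) B} \<subseteq> set (by_max (rho S))"
  using part_by_max(1)[OF P(1)] part_by_max(1)[OF P(2)] by auto
 fix i assume i: "i < length (by_max S)"
 hence M: "Max (by_max (rho S) ! i) = Max (by_max S ! i)"
  using arg_cong[OF rho_by_max(1)[OF S], of "\<lambda>l. l ! i"] \<open>length (by_max (rho S)) = length (by_max S)\<close> by simp
 have "by_max S ! i \<in> S" "by_max (rho S) ! i \<in> rho S"
  using i part_by_max(1)[OF P(1)] part_by_max(1)[OF P(2)] \<open>length (by_max (rho S)) = length (by_max S)\<close> nth_mem by (metis order_refl)+
 thus "by_max S ! i \<in> {B \<in> S. nonaligned S B} \<longleftrightarrow> by_max (rho S) ! i \<in> {B \<in> rho S. nonaligned (rho S) B}"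
  using nonaligned_iff[OF P(1)] nonaligned_iff[OF P(2)] M rho(2)[OF S] by simp
qed

lemma image_card_by_max:
 assumes "finite P" "inj_on Max P"
 shows "image_mset card (mset_set P) = mset (map card (by_max P))"
 using by_max(1,3)[OF assms] by (simp flip: mset_set_set)

lemma rho_bar_stat:
 assumes "A \<in> NCNA m"
 shows "stat (rho_bar A) = stat A"
proof -
 obtain S X where A: "A = (S, X)" "S \<in> NC m" "X \<subseteq> S" using assms unfolding NCNA_def by blast
 hence P: "parts m S" "parts m (rho S)" using rho(1)[OF A(2)] unfolding NC_def NN_nns by auto
 have "map card (by_max (transfer_blocks (by_max S) (by_max (rho S)) X)) = map card (by_max X)"
  by (rule map_card_by_max_transfer[OF rho_by_max(2)[OF A(2)]]) (use part_by_max[OF P(1) order_refl] part_by_max[OF P(2) order_refl] A in auto)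
 thus ?thesis unfolding A stat_def rho_bar_def
  using image_card_by_max part_finite[OF P(1)] part_finite[OF P(2)] part_Max_inj[OF P(1)] part_Max_inj[OF P(2)] rho_by_max(2)[OF A(2)]
  by (simp del: mset_map)
qed

section \<open>Concatenation and the operation \<open>\<star>\<close>\<close>

definition sh :: "int \<Rightarrow> int set \<Rightarrow> int set" where
 "sh k B = (\<lambda>x. x + k) ` B"

lemma mem_sh: "x \<in> sh k B \<longleftrightarrow> x - k \<in> B"
 unfolding sh_def by (auto simp: image_iff) (metis diff_add_cancel)

lemma sh_0 [simp]: "sh 0 = id"
 unfolding sh_def by (auto simp: fun_eq_iff)

lemma sh_sh [simp]: "sh j (sh k B) = sh (j + k) B"
 by (auto simp: mem_sh algebra_simps set_eq_iff)

lemma sh_empty_iff [simp]: "sh k B = {} \<longleftrightarrow> B = {}" "sh k {} = {}" "{} = sh k B \<longleftrightarrow> B = {}"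
 unfolding sh_def by auto

lemma sh_sh_image: "sh j ` sh k ` P = sh (j + k) ` P"
 by (simp add: image_image)

lemma inj_sh: "inj (sh k)"
 by (rule injI) (metis sh_sh sh_0 id_apply add.left_inverse)

lemma card_sh [simp]: "card (sh k B) = card B"
 unfolding sh_def by (simp add: card_image)

lemma Max_sh: "finite B \<Longrightarrow> B \<noteq> {} \<Longrightarrow> Max (sh k B) = Max B + k"
 unfolding sh_def using Max_add_commute[of B "\<lambda>x. x" k] by simp

lemma Min_sh: "finite B \<Longrightarrow> B \<noteq> {} \<Longrightarrow> Min (sh k B) = Min B + k"
 unfolding sh_def using Min_add_commute[of B "\<lambda>x. x" k] by simp

lemma pconcat_sh: "P \<uplus> Q = P \<union> sh (int (psize P)) ` Q"
 unfolding pconcat_def sh_def by simp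

lemma psize_empty [simp]: "psize {} = 0"
 unfolding psize_def by simp

lemma pconcat_empty [simp]: "{} \<uplus> P = P" "P \<uplus> {} = P"
 unfolding pconcat_sh by auto

lemma part_sh:
 assumes "partition_on U P"
 shows "partition_on (sh k U) (sh k ` P)"
proof (rule part_intro)
 show "\<Union> (sh k ` P) = sh k U" using partition_onD1[OF assms] by (auto simp: mem_sh)
 show "{} \<notin> sh k ` P" using part_ne[OF assms] by auto
 fix A B x assume "A \<in> sh k ` P" "B \<in> sh k ` P" "x \<in> A" "x \<in> B"
 then obtain A' B' where *: "A' \<in> P" "B' \<in> P" "A = sh k A'" "B = sh k B'" by blast
 thus "A = B" using part_eq[OF assms *(1,2), of "x - k"] \<open>x \<in> A\<close> \<open>x \<in> B\<close> by (simp add: mem_sh)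
qed

lemma part_union:
 assumes "partition_on U P" "partition_on V Q" "U \<inter> V = {}"
 shows "partition_on (U \<union> V) (P \<union> Q)"
proof (rule part_intro)
 show "\<Union> (P \<union> Q) = U \<union> V" using partition_onD1[OF assms(1)] partition_onD1[OF assms(2)] by blast
 show "{} \<notin> P \<union> Q" using part_ne[OF assms(1)] part_ne[OF assms(2)] by blast
 fix A B x assume *: "A \<in> P \<union> Q" "B \<in> P \<union> Q" "x \<in> A" "x \<in> B"
 then consider "A \<in> P" "B \<in> P" | "A \<in> P" "B \<in> Q" | "A \<in> Q" "B \<in> P" | "A \<in> Q" "B \<in> Q" by blast
 thus "A = B"
 proof cases
  case 1 thus ?thesis using part_eq[OF assms(1) 1 *(3,4)] by simp
 next case 2 thus ?thesis using part_sub[OF assms(1) 2(1)] part_sub[OF assms(2) 2(2)] * assms(3) by blast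
 next case 3 thus ?thesis using part_sub[OF assms(1) 3(2)] part_sub[OF assms(2) 3(1)] * assms(3) by blast
 next case 4 thus ?thesis using part_eq[OF assms(2) 4 *(3,4)] by simp
 qed
qed

lemma part_concat:
 assumes "parts a P" "parts b Q"
 shows "partition_on {1..int (a + b)} (P \<uplus> Q)"
proof -
 have "partition_on ({1..int a} \<union> sh (int a) {1..int b}) (P \<union> sh (int a) ` Q)"
  by (rule part_union[OF assms(1) part_sh[OF assms(2)]]) (auto simp: mem_sh)
 moreover have "{1..int a} \<union> sh (int a) {1..int b} = {1..int (a + b)}" by (auto simp: mem_sh)
 ultimately show ?thesis unfolding pconcat_sh psize_part[OF assms(1)] by simp
qed

lemma psize_concat:
 assumes "parts a P" "parts b Q"
 shows "psize (P \<uplus> Q) = a + b"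
 by (rule psize_part[OF part_concat[OF assms]])

lemma pconcat_assoc:
 assumes "parts a P" "parts b Q"
 shows "(P \<uplus> Q) \<uplus> R = P \<uplus> (Q \<uplus> R)"
 unfolding pconcat_sh[of "P \<uplus> Q"] psize_concat[OF assms] 
 unfolding pconcat_sh psize_part[OF assms(1)] psize_part[OF assms(2)] image_Un sh_sh_image
 by (simp add: Un_assoc)

lemma ncr_sh: "ncr P \<Longrightarrow> ncr (sh k ` P)"
 unfolding ncr_def
proof (intro ballI impI)
 fix A B a b c d
 assume n: "\<forall>A\<in>P. \<forall>B\<in>P. \<forall>a\<in>A. \<forall>b\<in>B. \<forall>c\<in>A. \<forall>d\<in>B. a < b \<longrightarrow> b < c \<longrightarrow> c < d \<longrightarrow> A = B"
  and *: "A \<in> sh k ` P" "B \<in> sh k ` P" "a \<in> A" "b \<in> B" "c \<in> A" "d \<in> B" "a < b" "b < c" "c < d"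
 obtain A' B' where "A' \<in> P" "A = sh k A'" "B' \<in> P" "B = sh k B'" using *(1,2) by blast
 moreover hence "A' = B'" using n[rule_format, of A' B' "a - k" "b - k" "c - k" "d - k"] * by (simp add: mem_sh)
 ultimately show "A = B" by simp
qed

lemma ncr_union:
 assumes "ncr P" "ncr Q" "parts a P" "\<And>B x. B \<in> Q \<Longrightarrow> x \<in> B \<Longrightarrow> int a < x"
 shows "ncr (P \<union> Q)"
 unfolding ncr_def
proof (intro ballI impI)
 fix A B x1 x2 x3 x4
 assume *: "A \<in> P \<union> Q" "B \<in> P \<union> Q" "x1 \<in> A" "x2 \<in> B" "x3 \<in> A" "x4 \<in> B" "x1 < x2" "x2 < x3" "x3 < x4"
 have s: "x \<le> int a" if "C \<in> P" "x \<in> C" for C x using part_sub[OF assms(3) that(1)] that(2) by auto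
 consider "A \<in> P" "B \<in> P" | "A \<in> P" "B \<in> Q" | "A \<in> Q" "B \<in> P" | "A \<in> Q" "B \<in> Q" using * by blast
 thus "A = B"
 proof cases
  case 1 thus ?thesis using ncrD[OF assms(1) 1 *(3-9)] by simp
 next case 2 thus ?thesis using s[OF 2(1) *(5)] assms(4)[OF 2(2) *(4)] * by simp
 next case 3 thus ?thesis using s[OF 3(2) *(4)] assms(4)[OF 3(1) *(3)] * by simp
 next case 4 thus ?thesis using ncrD[OF assms(2) 4 *(3-9)] by simp
 qed
qed

lemma NC_part: "P \<in> NC m \<Longrightarrow> parts m P"
 unfolding NC_def by simp

lemma NC_psize: "P \<in> NC m \<Longrightarrow> psize P = m"
 using NC_part psize_part by blast

lemma NC_concat:
 assumes "P \<in> NC a" "Q \<in> NC b"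
 shows "P \<uplus> Q \<in> NC (a + b)"
proof -
 note p = NC_part[OF assms(1)] and q = NC_part[OF assms(2)]
 have "ncr (P \<union> sh (int a) ` Q)"
 proof (rule ncr_union[OF _ _ p])
  show "ncr P" using assms unfolding NC_def by simp
  show "ncr (sh (int a) ` Q)" using assms unfolding NC_def by (simp add: ncr_sh)
  fix B x assume "B \<in> sh (int a) ` Q" "x \<in> B"
  thus "int a < x" using part_sub[OF q] by (fastforce simp: mem_sh)
 qed
 thus ?thesis using part_concat[OF p q] unfolding NC_def pconcat_sh psize_part[OF p] by simp
qed

lemma NC_0: "NC 0 = {{}}"
 unfolding NC_def ncr_def by (auto simp: partition_on_empty)

lemma NC_singleton: "{{1}} \<in> NC 1"
 unfolding NC_def ncr_def by (auto simp: partition_on_space)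

text \<open>The nonempty connected noncrossing partitions: the components of an arbitrary one, and
  the possible nonempty left arguments of \<open>\<star>\<close>.\<close>

definition NCc :: "nat \<Rightarrow> int set set set" where
 "NCc c = {C \<in> NC c. 1 \<le> c \<and> (\<exists>A\<in>C. 1 \<in> A \<and> int c \<in> A)}"

lemma NCcD: "C \<in> NCc c \<Longrightarrow> C \<in> NC c" "C \<in> NCc c \<Longrightarrow> 1 \<le> c"
 unfolding NCc_def by auto

text \<open>For a connected partition this is the block through both ends, which is its only
  nonnested block.\<close>

definition topb :: "int set set \<Rightarrow> int set" where
 "topb C = block_of C (int (psize C))"

lemma topb:
 assumes "C \<in> NCc c"
 shows "topb C \<in> C" "1 \<in> topb C" "int c \<in> topb C" "Max (topb C) = int c" "Min (topb C) = 1"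
proof -
 obtain A where A: "A \<in> C" "1 \<in> A" "int c \<in> A" using assms unfolding NCc_def by blast
 note p = NC_part[OF NCcD(1)[OF assms]]
 have t: "topb C = A" unfolding topb_def psize_part[OF p] using part_block_of[OF p A(1,3)] .
 have s: "A \<subseteq> {1..int c}" using part_sub[OF p A(1)] .
 have "finite A" using s by (rule finite_subset) simp
 thus "topb C \<in> C" "1 \<in> topb C" "int c \<in> topb C" "Max (topb C) = int c" "Min (topb C) = 1"
  unfolding t using A s by (auto intro!: Max_eqI Min_eqI)
qed

lemma star_empty: "{} \<star> T = T \<uplus> {{1}}"
 unfolding star_def Let_def pconcat_sh sh_def by auto

lemma star_ins:
 assumes "C \<in> NCc c" "T \<in> NC t"
 shows "C \<star> T = ins (int (c + t + 1)) (int c) (C \<uplus> T)"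
proof -
 have "C \<noteq> {}" using topb(1)[OF assms(1)] by blast
 thus ?thesis unfolding star_def Let_def ins_def NC_psize[OF assms(2)] NC_psize[OF NCcD(1)[OF assms(1)]] by (simp add: add.commute)
qed

lemma topb_concat:
 assumes "C \<in> NCc c" "T \<in> NC t"
 shows "topb C \<in> C \<uplus> T" "int c \<in> topb C" "int c = Max (topb C)" "partition_on {1..int (c + t)} (C \<uplus> T)"
 using topb[OF assms(1)] NC_part[OF NC_concat[OF NCcD(1)[OF assms(1)] assms(2)]] unfolding pconcat_sh by auto

lemma interval_Suc: "{1..int (k + 1)} - {int (k + 1)} = {1..int k}"
 by auto

lemma star_eq:
 assumes "C \<in> NCc c" "T \<in> NC t"
 shows "C \<star> T = insert (insert (int (c + t + 1)) (topb C)) (C - {topb C}) \<union> sh (int c) ` T"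
proof -
 note p = NC_part[OF NCcD(1)[OF assms(1)]]
 have "topb C \<notin> sh (int c) ` T"
 proof
  assume "topb C \<in> sh (int c) ` T"
  then obtain B where "B \<in> T" "topb C = sh (int c) B" by blast
  hence "1 - int c \<in> B" using topb(2)[OF assms(1)] by (simp add: mem_sh)
  thus False using part_sub[OF NC_part[OF assms(2)] \<open>B \<in> T\<close>] NCcD(2)[OF assms(1)] by auto
 qed
 thus ?thesis
  unfolding star_ins[OF assms] ins_eq[OF topb_concat(4,1,2)[OF assms]]
  unfolding pconcat_sh psize_part[OF p] by blast
qed

lemma star_part:
 assumes "C \<in> NCc c" "T \<in> NC t"
 shows "partition_on {1..int (c + t + 1)} (C \<star> T)"
 unfolding star_ins[OF assms]
 by (rule ins_partition[OF _ _ topb_concat(1,2)[OF assms]]) (use topb_concat(4)[OF assms] interval_Suc[of "c + t"] in auto)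

text \<open>All of \<open>T\<close> lies in the gap between \<open>int c\<close>, so far the maximum
  of the top block, and the new point, so enlarging that block creates no crossing.\<close>

lemma star_NCc:
 assumes "C \<in> NCc c" "T \<in> NC t"
 shows "C \<star> T \<in> NCc (c + t + 1)"
proof -
 let ?N = "int (c + t + 1)" and ?A = "topb C" and ?Q = "C \<uplus> T"
 note p = topb_concat(4)[OF assms] and A = topb_concat(1,2)[OF assms]
 have e: "C \<star> T = insert (insert ?N ?A) (?Q - {?A})" unfolding star_ins[OF assms] by (rule ins_eq[OF p A])
 have n: "ncr ?Q" using NC_concat[OF NCcD(1)[OF assms(1)] assms(2)] unfolding NC_def by simp
 have le: "x \<le> int (c + t)" if "B \<in> ?Q" "x \<in> B" for B x using part_sub[OF p that(1)] that(2) by auto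
 have leA: "x \<le> int c" "1 \<le> x" if "x \<in> ?A" for x
  using part_sub[OF NC_part[OF NCcD(1)[OF assms(1)]] topb(1)[OF assms(1)]] that by auto
 have "ncr (C \<star> T)" unfolding ncr_def e
 proof (intro ballI impI)
  fix B D x1 x2 x3 x4
  assume *: "B \<in> insert (insert ?N ?A) (?Q - {?A})" "D \<in> insert (insert ?N ?A) (?Q - {?A})"
   "x1 \<in> B" "x2 \<in> D" "x3 \<in> B" "x4 \<in> D" "x1 < x2" "x2 < x3" "x3 < x4"
  then consider "B = D" | "B \<in> ?Q" "D \<in> ?Q" | "B = insert ?N ?A" "D \<in> ?Q" | "B \<in> ?Q" "B \<noteq> ?A" "D = insert ?N ?A" by blast
  thus "B = D"
  proof cases
   case 2 thus ?thesis using ncrD[OF n 2 *(3-9)] by simp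
  next case 3
   have x: "x1 \<in> ?A" "x3 \<in> ?A" using 3 *(3,5) le[OF 3(2) *(6)] le[OF 3(2) *(4)] * by auto
   hence "D = ?A" using ncrD[OF n A(1) 3(2) x(1) *(4) x(2) *(6,7,8,9)] by simp
   thus ?thesis using * leA[OF x(2)] leA(1)[of x4] 3 by auto
  next case 4
   have x: "x2 \<in> ?A" using 4 *(4) le[OF 4(1) *(5)] * by auto
   have "x3 \<noteq> int c" using part_eq[OF p 4(1) A(1) *(5)] A(2) 4(2) by auto
   show ?thesis
   proof (cases "x3 < int c")
    case True
    thus ?thesis using ncrD[OF n 4(1) A(1) *(3) x *(5) A(2) *(7,8)] 4 by simp
   next case False
    hence "int c < x3" using \<open>x3 \<noteq> int c\<close> by simp
    hence "B \<notin> C" using part_sub[OF NC_part[OF NCcD(1)[OF assms(1)]], of B] *(5) by force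
    hence "B \<in> sh (int c) ` T" using 4(1) unfolding pconcat_sh NC_psize[OF NCcD(1)[OF assms(1)]] by blast
    then obtain B' where "B' \<in> T" "B = sh (int c) B'" by blast
    hence "int c < x1" using part_sub[OF NC_part[OF assms(2)], of B'] *(3) by (auto simp: mem_sh)
    thus ?thesis using leA[OF x] * by simp
   qed
  qed simp
 qed
 moreover have "insert ?N ?A \<in> C \<star> T" unfolding e by blast
 ultimately show ?thesis unfolding NCc_def NC_def using star_part[OF assms] topb(2)[OF assms(1)]
  by (auto intro!: bexI[of _ "insert ?N ?A"])
qed

lemma singleton_NCc: "{{1}} \<in> NCc 1"
 unfolding NCc_def using NC_singleton by auto

lemma topb_star:
 assumes "C \<in> NCc c" "T \<in> NC t"
 shows "topb (C \<star> T) = insert (int (c + t + 1)) (topb C)"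
 unfolding topb_def[of "C \<star> T"] psize_part[OF star_part[OF assms]]
 by (rule part_block_of[OF star_part[OF assms]]) (use star_eq[OF assms] in auto)

lemma restr_Un: "restr (P \<union> Q) S = restr P S \<union> restr Q S"
 unfolding restr_def by blast

text \<open>On an interval the order-preserving relabelling is a translation, so the restrictions
  can be computed through \<open>sh\<close>.\<close>

lemma restr_interval: "restr P {a..b} = (\<lambda>B. sh (1 - a) (B \<inter> {a..b})) ` P - {{}}"
proof -
 have "(\<lambda>x. int (card {y \<in> {a..b}. y \<le> x})) ` (B \<inter> {a..b}) = sh (1 - a) (B \<inter> {a..b})" for B
  unfolding sh_def
 proof (rule image_cong[OF refl])
  fix x assume x: "x \<in> B \<inter> {a..b}"
  hence "{y \<in> {a..b}. y \<le> x} = {a..x}" by auto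
  thus "int (card {y \<in> {a..b}. y \<le> x}) = x + (1 - a)" using x by simp
 qed
 thus ?thesis unfolding restr_def by simp
qed

lemma restr_all:
 assumes "parts m P"
 shows "restr P {1..int m} = P"
proof -
 have "(\<lambda>B. sh (1 - 1) (B \<inter> {1..int m})) ` P = (\<lambda>B. B) ` P"
  by (rule image_cong[OF refl]) (use part_sub[OF assms] in auto)
 thus ?thesis unfolding restr_interval using part_ne[OF assms] by auto
qed

lemma restr_disjoint: "(\<And>B. B \<in> P \<Longrightarrow> B \<inter> {a..b} = {}) \<Longrightarrow> restr P {a..b} = {}"
 unfolding restr_interval by auto

lemma restr_sh: "restr (sh k ` P) {a + k..b + k} = restr P {a..b}"
proof -
 have e: "sh (1 - (a + k)) (sh k B \<inter> {a + k..b + k}) = sh (1 - a) (B \<inter> {a..b})" for B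
  by (auto simp: mem_sh set_eq_iff algebra_simps)
 have "(\<lambda>B. sh (1 - (a + k)) (B \<inter> {a + k..b + k})) ` sh k ` P = (\<lambda>B. sh (1 - a) (B \<inter> {a..b})) ` P"
  unfolding image_image e ..
 thus ?thesis unfolding restr_interval by simp
qed

lemma NC_restrict:
 assumes "partition_on U Q" "ncr Q" "\<And>D. D \<in> Q \<Longrightarrow> D \<inter> {a..b} \<noteq> {} \<Longrightarrow> D \<subseteq> {a..b}" "{a..b} \<subseteq> U" "a \<le> b + 1"
 shows "sh (1 - a) ` {D \<in> Q. D \<subseteq> {a..b}} \<in> NC (nat (b + 1 - a))"
proof -
 have p: "partition_on {a..b} {D \<in> Q. D \<subseteq> {a..b}}"
 proof (rule part_intro)
  show "\<Union> {D \<in> Q. D \<subseteq> {a..b}} = {a..b}"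
  proof (intro equalityI subsetI)
   fix x assume x: "x \<in> {a..b}"
   then obtain D where "D \<in> Q" "x \<in> D" using part_ex[OF assms(1), of x] assms(4) by blast
   thus "x \<in> \<Union> {D \<in> Q. D \<subseteq> {a..b}}" using assms(3)[of D] x by blast
  qed blast
  show "{} \<notin> {D \<in> Q. D \<subseteq> {a..b}}" using part_ne[OF assms(1)] by blast
  fix A B x assume "A \<in> {D \<in> Q. D \<subseteq> {a..b}}" "B \<in> {D \<in> Q. D \<subseteq> {a..b}}" "x \<in> A" "x \<in> B"
  thus "A = B" using part_eq[OF assms(1), of A B x] by blast
 qed
 have n: "ncr {D \<in> Q. D \<subseteq> {a..b}}" using assms(2) unfolding ncr_def by blast
 have "sh (1 - a) {a..b} = {1..int (nat (b + 1 - a))}" using assms(5) by (auto simp: mem_sh)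
 thus ?thesis using part_sh[OF p, of "1 - a"] ncr_sh[OF n, of "1 - a"] unfolding NC_def by simp
qed

lemma pconcat_star:
 assumes "L \<in> NC l" "C \<in> NCc c" "I \<in> NC i"
 shows "L \<uplus> (C \<star> I) = ins (int (l + c + i + 1)) (int (l + c)) (L \<uplus> (C \<uplus> I))"
proof -
 have 1: "sh (int l) ` ins (int (c + i + 1)) (int c) Q = ins (int (l + c + i + 1)) (int (l + c)) (sh (int l) ` Q)" for Q
  unfolding ins_def image_image
  by (rule image_cong[OF refl]) (auto simp: mem_sh set_eq_iff)
 have 2: "ins y (int (l + c)) L = (\<lambda>B. B) ` L" for y unfolding ins_def
 proof (rule image_cong[OF refl])
  fix B assume "B \<in> L"
  hence "int (l + c) \<notin> B" using part_sub[OF NC_part[OF assms(1)], of B] NCcD(2)[OF assms(2)] by auto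
  thus "(if int (l + c) \<in> B then insert y B else B) = B" by simp
 qed
 have 3: "ins y b (P \<union> Q) = ins y b P \<union> ins y b Q" for y b P Q unfolding ins_def by blast
 show ?thesis
  unfolding star_ins[OF assms(2,3)] pconcat_sh[of L] NC_psize[OF assms(1)] 1 3 2 by simp
qed

text \<open>Let \<open>B\<close> be the block of the last point, \<open>a\<close> its minimum and
  \<open>b\<close> its second largest element. A block other than \<open>B\<close> cannot cross it,
  so it stays inside \<open>[1, a - 1]\<close>, \<open>[a, b]\<close> or
  \<open>[b + 1, m - 1]\<close>. Deleting the last point from \<open>B\<close> leaves three
  independent pieces, the middle one connected through \<open>a\<close> and
  \<open>b\<close>.\<close>

lemma NC_cases:
 assumes P: "P \<in> NC m" "0 < m"
 obtains (single) L where "L \<in> NC (m - 1)" "P = L \<uplus> {{1}}"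
 | (nest) L C I l c i where "L \<in> NC l" "C \<in> NCc c" "I \<in> NC i" "l + c + i + 1 = m" "P = L \<uplus> (C \<star> I)"
proof -
 note p = NC_part[OF P(1)]
 have ncP: "ncr P" using P(1) unfolding NC_def by simp
 let ?m = "int m"
 obtain B where B: "B \<in> P" "?m \<in> B" using part_ex[OF p, of ?m] P(2) by auto
 have sub: "D \<subseteq> {1..?m}" if "D \<in> P" for D using part_sub[OF p that] .
 show thesis
 proof (cases "B = {?m}")
  case True
  have "partition_on ({1..?m} - B) (P - {B})" by (rule part_diff[OF p B(1)])
  moreover have "{1..?m} - B = {1..int (m - 1)}" using True P(2) by auto
  ultimately have L: "P - {B} \<in> NC (m - 1)" using ncP unfolding NC_def ncr_def by auto
  have "P = (P - {B}) \<uplus> {{1}}" unfolding pconcat_sh NC_psize[OF L] using True B P(2) by (auto simp: sh_def)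
  thus thesis using single[OF L] by blast
 next case False
  note f = part_finite_block[OF p _ B(1), simplified]
  define a where "a = Min B"
  define b where "b = Max (B - {?m})"
  have a: "a \<in> B" "\<And>x. x \<in> B \<Longrightarrow> a \<le> x" unfolding a_def using f B by (auto intro: Min_in)
  have "B - {?m} \<noteq> {}" using False B by blast
  hence "b \<in> B - {?m}" unfolding b_def using f by (intro Max_in) auto
  hence b: "b \<in> B" "b \<noteq> ?m" by auto
  have bx: "x \<le> b" if "x \<in> B" "x \<noteq> ?m" for x unfolding b_def using f that by (intro Max_ge) auto
  have ab: "1 \<le> a" "a \<le> b" "b < ?m" using sub[OF B(1)] a b by force+
  let ?Q = "del ?m P"
  have q: "partition_on ({1..?m} - {?m}) ?Q" by (rule del_partition[OF p B False])
  have ncQ: "ncr ?Q" using ncP by (rule ncr_del)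
  have Qe: "?Q = insert (B - {?m}) (P - {B})" by (rule del_eq[OF p B False])
  \<comment> \<open>Distinguishes where one element of \<open>D\<close> lies; \<open>c1\<close> and
    \<open>c2\<close> show that the remaining elements cannot leave that region without crossing
    \<open>B\<close>.\<close>
  have tri: "D \<subseteq> {1..a - 1} \<or> D \<subseteq> {a..b} \<or> D \<subseteq> {b + 1..?m - 1}" if D: "D \<in> ?Q" for D
  proof (cases "D = B - {?m}")
   case True
   hence "D \<subseteq> {a..b}" using a bx by auto
   thus ?thesis by blast
  next case False
   hence D: "D \<in> P" "D \<noteq> B" using D Qe by auto
   have dis: "x \<notin> B" if "x \<in> D" for x using part_eq[OF p D(1) B(1) that] D(2) by blast
   have r: "1 \<le> x" "x < ?m" "x \<noteq> a" "x \<noteq> b" if "x \<in> D" for x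
    using sub[OF D(1)] that dis[OF that] B(2) a(1) b(1) by (auto simp: order_less_le)
   have c1: "y < a" if "x \<in> D" "x < a" "y \<in> D" for x y
   proof (rule ccontr)
    assume "\<not> y < a"
    hence "a < y" using r(3)[OF that(3)] by simp
    thus False using ncrD[OF ncP D(1) B(1) that(1) a(1) that(3) B(2)] that(2) r(2)[OF that(3)] D(2) by simp
   qed
   have c2: "y < b" if "x \<in> D" "a < x" "x < b" "y \<in> D" for x y
   proof (rule ccontr)
    assume "\<not> y < b"
    hence "b < y" using r(4)[OF that(4)] by simp
    thus False using ncrD[OF ncP B(1) D(1) a(1) that(1) b(1) that(4)] that(2,3) D(2) by simp
   qed
   obtain x where x: "x \<in> D" using part_ne[OF p D(1)] by blast
   consider "x < a" | "a < x" "x < b" | "b < x" using r[OF x] by linarith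
   thus ?thesis
   proof cases
    case 1
    have "D \<subseteq> {1..a - 1}" using c1[OF x 1] r(1) by force
    thus ?thesis by blast
   next case 2
    have "D \<subseteq> {a..b}" using c2[OF x 2] c1[of _ x] 2 x by force
    thus ?thesis by blast
   next case 3
    have "b < y" if y: "y \<in> D" for y
    proof (rule ccontr)
     assume "\<not> b < y"
     hence "y < b" using r(4)[OF y] by simp
     thus False using c1[OF y _ x] c2[OF y _ _ x] r(3)[OF y] 3 ab by linarith
    qed
    hence "D \<subseteq> {b + 1..?m - 1}" using r(2) by force
    thus ?thesis by blast
   qed
  qed
  have U: "{1..?m} - {?m} = {1..?m - 1}" by auto
  note q' = q[unfolded U]
  have 1: "D \<subseteq> {1..a - 1}" if "D \<in> ?Q" "D \<inter> {1..a - 1} \<noteq> {}" for D using tri[OF that(1)] that(2) ab by force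
  have 2: "D \<subseteq> {a..b}" if "D \<in> ?Q" "D \<inter> {a..b} \<noteq> {}" for D using tri[OF that(1)] that(2) ab by force
  have 3: "D \<subseteq> {b + 1..?m - 1}" if "D \<in> ?Q" "D \<inter> {b + 1..?m - 1} \<noteq> {}" for D using tri[OF that(1)] that(2) ab by force
  define l c i where "l = nat (a - 1)" and "c = nat (b + 1 - a)" and "i = nat (?m - 1 - b)"
  define L C I where "L = {D \<in> ?Q. D \<subseteq> {1..a - 1}}" and "C = sh (1 - a) ` {D \<in> ?Q. D \<subseteq> {a..b}}"
   and "I = sh (- b) ` {D \<in> ?Q. D \<subseteq> {b + 1..?m - 1}}"
  have lci: "int l = a - 1" "int c = b + 1 - a" "int i = ?m - 1 - b" "1 \<le> c" unfolding l_def c_def i_def using ab by auto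
  have L: "L \<in> NC l" using NC_restrict[OF q' ncQ 1] ab unfolding L_def l_def by simp
  have C: "C \<in> NC c" using NC_restrict[OF q' ncQ 2] ab unfolding C_def c_def by simp
  have I: "I \<in> NC i" using NC_restrict[OF q' ncQ 3] ab unfolding I_def i_def by (simp add: algebra_simps)
  have "B - {?m} \<subseteq> {a..b}"
  proof
   fix x assume "x \<in> B - {?m}"
   thus "x \<in> {a..b}" using a(2)[of x] bx[of x] by simp
  qed
  hence "sh (1 - a) (B - {?m}) \<in> C" unfolding C_def Qe by (intro imageI) simp
  moreover have "1 \<in> sh (1 - a) (B - {?m})" "int c \<in> sh (1 - a) (B - {?m})" unfolding mem_sh lci using a(1) b ab by auto
  ultimately have C': "C \<in> NCc c" unfolding NCc_def using C lci(4) by blast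
  have "L \<uplus> (C \<uplus> I) = ?Q"
  proof -
   have "L \<uplus> (C \<uplus> I) = {D \<in> ?Q. D \<subseteq> {1..a - 1}} \<union> {D \<in> ?Q. D \<subseteq> {a..b}} \<union> {D \<in> ?Q. D \<subseteq> {b + 1..?m - 1}}"
    unfolding pconcat_sh NC_psize[OF L] NC_psize[OF C] lci image_Un
    unfolding C_def I_def sh_sh_image L_def by (simp add: Un_assoc)
   thus ?thesis using tri by blast
  qed
  moreover have "int (l + c + i + 1) = ?m" "int (l + c) = b" using lci by auto
  ultimately have "L \<uplus> (C \<star> I) = ins ?m b ?Q" unfolding pconcat_star[OF L C' I] by simp
  also have "\<dots> = P" by (rule ins_del[OF p B b(1) b(2)])
  finally have "P = L \<uplus> (C \<star> I)" ..
  moreover have "l + c + i + 1 = m" using lci ab by linarith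
  ultimately show thesis using nest[OF L C' I] by blast
 qed
qed

lemma NCc_finite:
 assumes "C \<in> NCc c"
 shows "finite (topb C)" "topb C \<subseteq> {1..int c}"
proof -
 show "topb C \<subseteq> {1..int c}" using part_sub[OF NC_part[OF NCcD(1)[OF assms]] topb(1)[OF assms]] .
 thus "finite (topb C)" by (rule finite_subset) simp
qed

text \<open>The decomposition inverts the construction: the block of the last point starts at
  \<open>l + 1\<close> and its second largest element is \<open>l + c\<close>. Unique decomposition,
  and through it the injectivity of \<open>xi\<close>, rests on this computation.\<close>

lemma decomp_core_star:
 assumes "L \<in> NC l" "C \<in> NCc c" "I \<in> NC i"
 shows "decomp_core (L \<uplus> (C \<star> I)) = (L, C, I)" "{int (psize (L \<uplus> (C \<star> I)))} \<notin> L \<uplus> (C \<star> I)"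
proof -
 let ?P = "L \<uplus> (C \<star> I)" and ?N = "int (c + i + 1)" and ?m = "int (l + (c + i + 1))"
 note pL = NC_part[OF assms(1)] and pC = NC_part[OF NCcD(1)[OF assms(2)]] and pI = NC_part[OF assms(3)]
 note pCI = star_part[OF assms(2,3)]
 have p: "partition_on {1..?m} ?P" by (rule part_concat[OF pL pCI])
 note c = NCcD(2)[OF assms(2)] and t = topb[OF assms(2)] and f = NCc_finite[OF assms(2)]
 define C' where "C' = insert (insert ?N (topb C)) (C - {topb C})"
 have e: "?P = L \<union> sh (int l) ` C' \<union> sh (int l + int c) ` I"
  unfolding pconcat_sh NC_psize[OF assms(1)] star_eq[OF assms(2,3)] C'_def image_Un sh_sh_image by (simp add: Un_assoc)
 let ?B = "sh (int l) (insert ?N (topb C))"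
 have B: "?B \<in> ?P" "?m \<in> ?B" unfolding e C'_def by (auto simp: mem_sh)
 note ps = psize_part[OF p]
 have bl: "block_of ?P ?m = ?B" by (rule part_block_of[OF p B])
 have a: "Min ?B = int l + 1"
 proof (rule Min_eqI)
  show "finite ?B" using f unfolding sh_def by simp
  show "int l + 1 \<in> ?B" using t by (simp add: mem_sh)
  show "int l + 1 \<le> y" if "y \<in> ?B" for y using that f(2) c by (auto simp: mem_sh)
 qed
 have b: "Max (?B - {?m}) = int l + int c"
 proof (rule Max_eqI)
  show "finite (?B - {?m})" using f unfolding sh_def by simp
  show "int l + int c \<in> ?B - {?m}" using t by (simp add: mem_sh)
  show "y \<le> int l + int c" if "y \<in> ?B - {?m}" for y using that f(2) c by (force simp: mem_sh)
 qed
 have sC': "D \<subseteq> {1..int c} \<union> {?N}" if "D \<in> C'" for D using that part_sub[OF pC] f(2) unfolding C'_def by blast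
 have sL: "D \<subseteq> {1..int l}" if "D \<in> L" for D using part_sub[OF pL that] .
 have sI: "D \<subseteq> {1..int i}" if "D \<in> I" for D using part_sub[OF pI that] .
 have "restr ?P {1..int l + 1 - 1} = L"
 proof -
  have 1: "restr L {1..int l + 1 - 1} = L" using restr_all[OF pL] by simp
  have 2: "restr (sh (int l) ` C') {1..int l + 1 - 1} = {}"
   by (rule restr_disjoint) (use sC' in \<open>force simp: mem_sh\<close>)
  have 3: "restr (sh (int l + int c) ` I) {1..int l + 1 - 1} = {}"
   by (rule restr_disjoint) (use sI in \<open>force simp: mem_sh\<close>)
  show ?thesis unfolding e restr_Un 1 2 3 by simp
 qed
 moreover have "restr ?P {int l + 1..int l + int c} = C"
 proof -
  have 1: "restr L {int l + 1..int l + int c} = {}" by (rule restr_disjoint) (use sL in force)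
  have "restr (sh (int l) ` C') {int l + 1..int l + int c} = restr C' {1..int c}"
   using restr_sh[of "int l" C' 1 "int c"] by (simp add: add.commute)
  also have "\<dots> = C"
  proof -
   have "insert ?N (topb C) \<inter> {1..int c} = topb C" "topb C \<inter> {1..int c} = topb C" using f(2) by auto
   hence "restr C' {1..int c} = restr (insert (topb C) (C - {topb C})) {1..int c}"
    unfolding C'_def restr_interval image_insert by simp
   also have "insert (topb C) (C - {topb C}) = C" using t(1) by blast
   finally show ?thesis using restr_all[OF pC] by simp
  qed
  finally have 2: "restr (sh (int l) ` C') {int l + 1..int l + int c} = C" .
  have 3: "restr (sh (int l + int c) ` I) {int l + 1..int l + int c} = {}"
   by (rule restr_disjoint) (use sI in \<open>force simp: mem_sh\<close>)
  show ?thesis unfolding e restr_Un 1 2 3 by simp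
 qed
 moreover have "restr ?P {int l + int c + 1..?m - 1} = I"
 proof -
  have 1: "restr L {int l + int c + 1..?m - 1} = {}" by (rule restr_disjoint) (use sL in force)
  have 2: "restr (sh (int l) ` C') {int l + int c + 1..?m - 1} = {}"
   by (rule restr_disjoint) (use sC' in \<open>force simp: mem_sh\<close>)
  have i: "{int l + int c + 1..?m - 1} = {1 + (int l + int c)..int i + (int l + int c)}" by auto
  have 3: "restr (sh (int l + int c) ` I) {int l + int c + 1..?m - 1} = I"
   unfolding i restr_sh by (rule restr_all[OF pI])
  show ?thesis unfolding e restr_Un 1 2 3 by simp
 qed
 ultimately show "decomp_core ?P = (L, C, I)"
  unfolding decomp_core_def Let_def ps bl a b by simp
 show "{int (psize ?P)} \<notin> ?P"
 proof
  assume "{int (psize ?P)} \<in> ?P"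
  hence "{?m} = ?B" using part_eq[OF p _ B(1) _ B(2), of "{?m}"] unfolding ps by simp
  moreover have "int l + 1 \<in> ?B" using t by (simp add: mem_sh)
  ultimately have "int l + 1 \<in> {?m}" by simp
  thus False using c by simp
 qed
qed

lemma decomp_star:
 assumes "L \<in> NC l" "C \<in> NCc c" "I \<in> NC i"
 shows "decomp1 (L \<uplus> (C \<star> I)) = (L, C, I)" "decomp2 (L \<uplus> (C \<star> I)) = (L, C, I)"
 using decomp_core_star[OF assms] unfolding decomp1_def decomp2_def Let_def by simp_all

lemma decomp_single:
 assumes "L \<in> NC l"
 shows "decomp1 (L \<uplus> {{1}}) = (L, {}, {})" "decomp2 (L \<uplus> {{1}}) = ({}, {}, L)"
  "{int (psize (L \<uplus> {{1}}))} \<in> L \<uplus> {{1}}" "restr (L \<uplus> {{1}}) {1..int l} = L"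
proof -
 note p = NC_part[OF assms]
 have ps: "psize (L \<uplus> {{1}}) = l + 1" using psize_concat[OF p NC_part[OF NC_singleton]] .
 have e: "L \<uplus> {{1}} = L \<union> {{int l + 1}}" unfolding pconcat_sh NC_psize[OF assms] by (simp add: sh_def add.commute)
 show 1: "{int (psize (L \<uplus> {{1}}))} \<in> L \<uplus> {{1}}" unfolding ps unfolding e by simp
 have "restr {{int l + 1}} {1..int l} = {}" by (rule restr_disjoint) auto
 thus 2: "restr (L \<uplus> {{1}}) {1..int l} = L" unfolding e restr_Un restr_all[OF p] by simp
 show "decomp1 (L \<uplus> {{1}}) = (L, {}, {})" "decomp2 (L \<uplus> {{1}}) = ({}, {}, L)"
  using 1 2 unfolding decomp1_def decomp2_def Let_def ps by simp_all
qed

text \<open>If a block \<open>D\<close> has points on both sides of \<open>B\<close>, consider the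
  edge leaving its last point before \<open>Min B\<close>. It cannot end between
  \<open>Min B\<close> and \<open>Max B\<close> without a crossing, so it ends beyond
  \<open>Max B\<close> and nests \<open>B\<close>.\<close>

lemma nonnested_NC:
 assumes "P \<in> NC m" "B \<in> P"
 shows "nonnested P B \<longleftrightarrow> (\<forall>D\<in>P. \<forall>x\<in>D. \<forall>y\<in>D. \<not> (x < Min B \<and> Max B < y))"
proof -
 note p = NC_part[OF assms(1)]
 have n: "ncr P" using assms(1) unfolding NC_def by simp
 have M: "Min B \<in> B" "Max B \<in> B" "Min B \<le> Max B" using part_Max[OF p _ assms(2)] by auto
 show ?thesis
 proof
  assume nn: "nonnested P B"
  show "\<forall>D\<in>P. \<forall>x\<in>D. \<forall>y\<in>D. \<not> (x < Min B \<and> Max B < y)"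
  proof (intro ballI notI)
   fix D x y assume D: "D \<in> P" "x \<in> D" "y \<in> D" "x < Min B \<and> Max B < y"
   have f: "finite D" using part_finite_block[OF p _ D(1)] by simp
   define u where "u = Max {z\<in>D. z < Min B}"
   have "u \<in> {z\<in>D. z < Min B}" unfolding u_def by (rule Max_in) (use f D in auto)
   hence u: "u \<in> D" "u < Min B" by auto
   have u2: "z \<le> u" if "z \<in> D" "z < Min B" for z unfolding u_def by (rule Max_ge) (use f that in auto)
   obtain v where v: "(u, v) \<in> edges P" "v \<in> D" using edges_edge_above[OF f D(1) u(1) D(3)] u D M by force
   have uv: "u < v" using v(1) unfolding edges_def by blast
   have "\<not> v < Min B" using u2[OF v(2)] uv by auto
   moreover have "v \<noteq> Min B" "v \<noteq> Max B" if "D \<noteq> B" using part_eq[OF p D(1) assms(2) v(2)] M that by auto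
   moreover have "D \<noteq> B" using part_Max(4)[OF p _ assms(2), of x] D by auto
   ultimately have "Min B < v" "v \<noteq> Max B" by auto
   moreover have "\<not> v < Max B" using ncrD[OF n D(1) assms(2) u(1) M(1) v(2) M(2) u(2)] \<open>Min B < v\<close> \<open>D \<noteq> B\<close> by blast
   ultimately have "Max B < v" by simp
   thus False using nn v(1) u(2) unfolding nonnested_def by blast
  qed
 next assume "\<forall>D\<in>P. \<forall>x\<in>D. \<forall>y\<in>D. \<not> (x < Min B \<and> Max B < y)"
  thus "nonnested P B" unfolding nonnested_def edges_def by blast
 qed
qed

text \<open>In a connected factor every block but the top one lies strictly between the two ends of
  the top block, while nothing reaches from one factor into the other.\<close>

lemma nonnested_concat:
 assumes "L \<in> NC l" "C \<in> NCc c"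
 shows "{B \<in> L \<uplus> C. nonnested (L \<uplus> C) B} = insert (sh (int l) (topb C)) {B \<in> L. nonnested L B}"
proof -
 note pL = NC_part[OF assms(1)] and pC = NC_part[OF NCcD(1)[OF assms(2)]]
 note t = topb[OF assms(2)] and f = NCc_finite[OF assms(2)] and c = NCcD(2)[OF assms(2)]
 have N: "L \<uplus> C \<in> NC (l + c)" by (rule NC_concat[OF assms(1) NCcD(1)[OF assms(2)]])
 note nn = nonnested_NC[OF N] and nL = nonnested_NC[OF assms(1)]
 have e: "L \<uplus> C = L \<union> sh (int l) ` C" unfolding pconcat_sh NC_psize[OF assms(1)] ..
 have sL: "1 \<le> x \<and> x \<le> int l" if "D \<in> L" "x \<in> D" for D x using part_sub[OF pL that(1)] that(2) by auto
 have sC: "int l < x \<and> x \<le> int l + int c" if "D \<in> sh (int l) ` C" "x \<in> D" for D x using part_sub[OF pC] that by (fastforce simp: mem_sh)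
 have M: "Min B \<in> B" "Max B \<in> B" if "B \<in> L \<uplus> C" for B using part_Max[OF NC_part[OF N] _ that] by auto
 have top: "sh (int l) (topb C) \<in> L \<uplus> C" unfolding e using t by blast
 show ?thesis
 proof (intro equalityI subsetI)
  fix B assume "B \<in> {B \<in> L \<uplus> C. nonnested (L \<uplus> C) B}"
  hence B: "B \<in> L \<uplus> C" "nonnested (L \<uplus> C) B" by auto
  show "B \<in> insert (sh (int l) (topb C)) {B \<in> L. nonnested L B}"
  proof (cases "B \<in> L")
   case True
   have "nonnested L B" unfolding nL[OF True] using nn[OF B(1)] B(2) e by blast
   thus ?thesis using True by blast
  next case False
   then obtain D where D: "D \<in> C" "B = sh (int l) D" using B(1) e by blast
   have "D = topb C"
   proof (rule ccontr)
    assume ne: "D \<noteq> topb C"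
    have fD: "finite D" "D \<noteq> {}" using part_finite_block[OF pC _ D(1)] part_ne[OF pC D(1)] by auto
    have dis: "x \<notin> D" if "x \<in> topb C" for x using part_eq[OF pC D(1) t(1) _ that] ne by blast
    have "Min D \<in> D" "Max D \<in> D" using part_Max(1,2)[OF pC _ D(1)] by auto
    hence "Min D \<noteq> 1" "Max D \<noteq> int c" using dis[OF t(2)] dis[OF t(3)] by metis+
    moreover have "1 \<le> Min D" "Max D \<le> int c" using part_sub[OF pC D(1)] part_Max(1,2)[OF pC _ D(1)] by auto
    ultimately have "int l + 1 < Min B" "Max B < int l + int c" unfolding D(2) Min_sh[OF fD] Max_sh[OF fD] by auto
    moreover have "int l + 1 \<in> sh (int l) (topb C)" "int l + int c \<in> sh (int l) (topb C)" using t by (auto simp: mem_sh)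
    ultimately show False using nn[OF B(1)] B(2) top by blast
   qed
   thus ?thesis using D by blast
  qed
 next fix B assume "B \<in> insert (sh (int l) (topb C)) {B \<in> L. nonnested L B}"
  then consider "B = sh (int l) (topb C)" | "B \<in> L" "nonnested L B" by blast
  thus "B \<in> {B \<in> L \<uplus> C. nonnested (L \<uplus> C) B}"
  proof cases
   case 1
   hence BP: "B \<in> L \<uplus> C" using top by simp
   have "topb C \<noteq> {}" using t by blast
   hence "Min B = int l + 1" "Max B = int l + int c" unfolding 1 using Min_sh[OF f(1)] Max_sh[OF f(1)] t by auto
   hence M1: "Min B = int l + 1" "Max B = int l + int c" by auto
   have "nonnested (L \<uplus> C) B" unfolding nn[OF BP] M1
   proof (intro ballI notI)
    fix D x y assume D: "D \<in> L \<uplus> C" "x \<in> D" "y \<in> D" "x < int l + 1 \<and> int l + int c < y"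
    show False
    proof (cases "D \<in> L")
     case True thus False using sL[OF True D(3)] D(4) by linarith
    next case False
     hence "D \<in> sh (int l) ` C" using D(1) e by blast
     thus False using sC[OF _ D(3)] D(4) by force
    qed
   qed
   thus ?thesis using BP by simp
  next case 2
   hence BP: "B \<in> L \<uplus> C" using e by simp
   have "nonnested (L \<uplus> C) B" unfolding nn[OF BP]
   proof (intro ballI notI)
    fix D x y assume D: "D \<in> L \<uplus> C" "x \<in> D" "y \<in> D" "x < Min B \<and> Max B < y"
    show False
    proof (cases "D \<in> L")
     case True thus False using nL[OF 2(1)] 2(2) D by blast
    next case False
     hence "D \<in> sh (int l) ` C" using D(1) e by blast
     thus False using sC[OF _ D(2)] D(4) sL[OF 2(1) M(1)[OF BP]] by force
    qed
   qed
   thus ?thesis using BP by simp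
  qed
 qed
qed

lemma nonnested_list_concat:
 assumes "L \<in> NC l" "C \<in> NCc c"
 shows "nonnested_list (L \<uplus> C) = nonnested_list L @ [sh (int l) (topb C)]"
 unfolding nonnested_list_def nonnested_concat[OF assms]
proof (rule by_max_unique)
 let ?X = "{B \<in> L. nonnested L B}" and ?T = "sh (int l) (topb C)"
 note pL = NC_part[OF assms(1)]
 note b = part_by_max[OF pL, of ?X, simplified]
 have N: "L \<uplus> C \<in> NC (l + c)" by (rule NC_concat[OF assms(1) NCcD(1)[OF assms(2)]])
 have s: "insert ?T ?X \<subseteq> L \<uplus> C" using topb(1)[OF assms(2)] unfolding pconcat_sh NC_psize[OF assms(1)] by blast
 show "finite (insert ?T ?X)" by (rule part_by_max(5)[OF NC_part[OF N] s])
 show "inj_on Max (insert ?T ?X)" by (rule inj_on_subset[OF part_Max_inj[OF NC_part[OF N]] s]) simp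
 show "set (by_max ?X @ [?T]) = insert ?T ?X" using b by simp
 have "topb C \<noteq> {}" using topb[OF assms(2)] by blast
 hence M: "Max ?T = int l + int c" using Max_sh[OF NCc_finite(1)[OF assms(2)]] topb[OF assms(2)] by simp
 have "Max B < Max ?T" if "B \<in> ?X" for B
  using part_Max(1)[OF pL, of B] part_sub[OF pL, of B] that NCcD(2)[OF assms(2)] unfolding M by force
 thus "sorted_wrt (<) (map Max (by_max ?X @ [?T]))" using b by (simp add: sorted_wrt_append)
qed

lemma nonnested_list_empty [simp]: "nonnested_list {} = []"
 unfolding nonnested_list_def by simp

section \<open>Components of a noncrossing partition\<close>

text \<open>The factors of the decomposition into connected partitions. The list determines the
  partition by \<open>NC_comps\<close>, and a rearrangement permutes it.\<close>

definition comps :: "int set set \<Rightarrow> int set set list" where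
 "comps S = map (\<lambda>A. restr S {Min A..Max A}) (nonnested_list S)"

lemma restr_concat_left:
 assumes "parts l L" "parts c C" "b \<le> int l"
 shows "restr (L \<uplus> C) {a..b} = restr L {a..b}"
proof -
 have "restr (sh (int l) ` C) {a..b} = {}"
  by (rule restr_disjoint) (use part_sub[OF assms(2)] assms(3) in \<open>fastforce simp: mem_sh\<close>)
 thus ?thesis unfolding pconcat_sh psize_part[OF assms(1)] restr_Un by simp
qed

lemma comps_concat:
 assumes "L \<in> NC l" "C \<in> NCc c"
 shows "comps (L \<uplus> C) = comps L @ [C]"
proof -
 note pL = NC_part[OF assms(1)] and pC = NC_part[OF NCcD(1)[OF assms(2)]]
 let ?T = "sh (int l) (topb C)"
 have ne: "topb C \<noteq> {}" using topb[OF assms(2)] by blast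
 have 1: "Min ?T = int l + 1" "Max ?T = int c + int l"
  using Min_sh[OF NCc_finite(1)[OF assms(2)] ne] Max_sh[OF NCc_finite(1)[OF assms(2)] ne] topb[OF assms(2)] by auto
 have "restr L {int l + 1..int c + int l} = {}" by (rule restr_disjoint) (use part_sub[OF pL] in force)
 moreover have "restr (sh (int l) ` C) {int l + 1..int c + int l} = C"
  using restr_sh[of "int l" C 1 "int c"] restr_all[OF pC] by (simp add: add.commute)
 ultimately have 2: "restr (L \<uplus> C) {Min ?T..Max ?T} = C" unfolding 1 pconcat_sh NC_psize[OF assms(1)] restr_Un by simp
 have 3: "restr (L \<uplus> C) {Min A..Max A} = restr L {Min A..Max A}" if "A \<in> set (nonnested_list L)" for A
 proof -
  have "A \<in> L" using that part_by_max(1)[OF pL, of "{B\<in>L. nonnested L B}"] unfolding nonnested_list_def by auto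
  hence "Max A \<le> int l" using part_Max(1)[OF pL, of A] part_sub[OF pL, of A] by force
  thus ?thesis by (rule restr_concat_left[OF pL pC])
 qed
 show ?thesis unfolding comps_def nonnested_list_concat[OF assms] using 2 3 by simp
qed

lemma comps_empty [simp]: "comps {} = []"
 unfolding comps_def by simp

lemma length_comps: "length (comps S) = length (nonnested_list S)"
 unfolding comps_def by simp

lemma pconcat_list_NC:
 assumes "\<forall>C\<in>set cs. \<exists>c. C \<in> NC c"
 shows "pconcat_list cs \<in> NC (sum_list (map psize cs))"
 using assms
proof (induction cs)
 case Nil thus ?case by (simp add: pconcat_list_def NC_0)
next case (Cons C cs)
 then obtain c where C: "C \<in> NC c" by auto
 have "pconcat_list (C # cs) = C \<uplus> pconcat_list cs" by (simp add: pconcat_list_def)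
 thus ?case using NC_concat[OF C, of "pconcat_list cs"] Cons NC_psize[OF C] by simp
qed

lemma pconcat_list_snoc:
 assumes "\<forall>C\<in>set cs. \<exists>c. C \<in> NC c"
 shows "pconcat_list (cs @ [D]) = pconcat_list cs \<uplus> D"
 using assms
proof (induction cs)
 case Nil thus ?case by (simp add: pconcat_list_def)
next case (Cons C cs)
 then obtain c where C: "C \<in> NC c" by auto
 have 1: "pconcat_list (C # xs) = C \<uplus> pconcat_list xs" for xs by (simp add: pconcat_list_def)
 have "\<forall>C\<in>set cs. \<exists>c. C \<in> NC c" using Cons by simp
 note n = pconcat_list_NC[OF this]
 show ?case using Cons unfolding append_Cons 1 pconcat_assoc[OF NC_part[OF C] NC_part[OF n]] by simp
qed

lemma comps_pconcat_list:
 assumes "\<forall>C\<in>set cs. \<exists>c. C \<in> NCc c"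
 shows "comps (pconcat_list cs) = cs"
 using assms
proof (induction cs rule: rev_induct)
 case Nil thus ?case by (simp add: pconcat_list_def)
next case (snoc C cs)
 then obtain c where C: "C \<in> NCc c" by auto
 have *: "\<forall>C\<in>set cs. \<exists>c. C \<in> NC c" using snoc NCcD(1) by fastforce
 show ?case unfolding pconcat_list_snoc[OF *] comps_concat[OF pconcat_list_NC[OF *] C] using snoc by simp
qed

lemma NC_last_component:
 assumes "P \<in> NC m" "0 < m"
 obtains L C l c where "L \<in> NC l" "C \<in> NCc c" "l + c = m" "P = L \<uplus> C"
 using assms
proof (cases rule: NC_cases)
 case (single L)
 thus thesis using that[of L "m - 1" "{{1}}" 1] singleton_NCc assms(2) by simp
next case (nest L C I l c i)
 thus thesis using that[of L l "C \<star> I" "c + i + 1"] star_NCc[of C c I i] by simp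
qed

lemma NC_comps:
 assumes "P \<in> NC m"
 shows "(\<forall>C\<in>set (comps P). \<exists>c. C \<in> NCc c) \<and> pconcat_list (comps P) = P"
 using assms
proof (induction m arbitrary: P rule: less_induct)
 case (less m)
 show ?case
 proof (cases "m = 0")
  case True thus ?thesis using less(2) NC_0 by (simp add: pconcat_list_def)
 next case False
  hence "0 < m" by simp
  obtain L C l c where P: "L \<in> NC l" "C \<in> NCc c" "l + c = m" "P = L \<uplus> C"
   by (rule NC_last_component[OF less(2) \<open>0 < m\<close>])
  have "l < m" using P(3) NCcD(2)[OF P(2)] by simp
  hence IH: "(\<forall>C\<in>set (comps L). \<exists>c. C \<in> NCc c) \<and> pconcat_list (comps L) = L" using less(1) P(1) by blast
  hence *: "\<forall>C\<in>set (comps L). \<exists>c. C \<in> NC c" using NCcD(1) by blast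
  show ?thesis unfolding P(4) comps_concat[OF P(1,2)] pconcat_list_snoc[OF *] using IH P(2) by auto
 qed
qed

section \<open>The word of block sizes\<close>

text \<open>Under this encoding \<open>\<uplus>\<close> becomes concatenation of words.\<close>

definition wd :: "int set set \<Rightarrow> nat list" where
 "wd P = map (dat P) [1..int (psize P)]"

lemma dat_Un:
 assumes "finite P" "finite Q" "P \<inter> Q = {}"
 shows "dat (P \<union> Q) x = dat P x + dat Q x"
proof -
 have "{B \<in> P \<union> Q. Max B = x} = {B \<in> P. Max B = x} \<union> {B \<in> Q. Max B = x}" by blast
 moreover have "sum card ({B \<in> P. Max B = x} \<union> {B \<in> Q. Max B = x}) = sum card {B \<in> P. Max B = x} + sum card {B \<in> Q. Max B = x}"
  by (rule sum.union_disjoint) (use assms in auto)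
 ultimately show ?thesis unfolding dat_def by simp
qed

lemma dat_sh:
 assumes "partition_on U P" "finite U"
 shows "dat (sh k ` P) x = dat P (x - k)"
proof -
 have "Max (sh k B) = Max B + k" if "B \<in> P" for B using Max_sh part_finite_block[OF assms that] part_ne[OF assms(1) that] by blast
 hence "{B \<in> sh k ` P. Max B = x} = sh k ` {B \<in> P. Max B = x - k}" by force
 moreover have "inj_on (sh k) {B \<in> P. Max B = x - k}" using inj_sh inj_on_subset by blast
 ultimately show ?thesis unfolding dat_def by (simp add: sum.reindex)
qed

lemma part_disjoint:
 assumes "partition_on U P" "partition_on V Q" "U \<inter> V = {}"
 shows "P \<inter> Q = {}"
 using part_ne[OF assms(1)] part_sub[OF assms(1)] part_sub[OF assms(2)] assms(3) by blast

lemma concat_disjoint: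
 assumes "parts a P" "parts b Q"
 shows "P \<inter> sh (int a) ` Q = {}"
 by (rule part_disjoint[OF assms(1) part_sh[OF assms(2)]]) (auto simp: mem_sh)

lemma dat_concat:
 assumes "parts a P" "parts b Q"
 shows "dat (P \<uplus> Q) x = dat P x + dat Q (x - int a)"
 unfolding pconcat_sh psize_part[OF assms(1)]
 using dat_Un[OF _ _ concat_disjoint[OF assms]] part_finite[OF assms(1)] part_finite[OF assms(2)] dat_sh[OF assms(2)] by simp

lemma dat_outside:
 assumes "partition_on U P" "finite U" "x \<notin> U"
 shows "dat P x = 0"
 by (rule dat_0) (use part_Max(1)[OF assms(1,2)] part_sub[OF assms(1)] assms(3) in blast)

lemma upto_shift: "[a + k..b + k] = map (\<lambda>x. x + k) [a..b]"
 by (rule nth_equalityI) auto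

lemma wd_concat:
 assumes "parts a P" "parts b Q"
 shows "wd (P \<uplus> Q) = wd P @ wd Q"
proof -
 have "[1..int (a + b)] = [1..int a] @ [int a + 1..int (a + b)]"
 proof (cases "a = 0")
  case False thus ?thesis by (intro upto_split2) auto
 qed simp
 also have "[int a + 1..int (a + b)] = map (\<lambda>x. x + int a) [1..int b]"
  using upto_shift[of 1 "int a" "int b"] by (simp add: add.commute)
 finally have e: "[1..int (a + b)] = [1..int a] @ map (\<lambda>x. x + int a) [1..int b]" .
 have "dat (P \<uplus> Q) x = dat P x" if "x \<in> set [1..int a]" for x
  unfolding dat_concat[OF assms] using dat_outside[OF assms(2)] that by simp
 moreover have "dat (P \<uplus> Q) (x + int a) = dat Q x" if "x \<in> set [1..int b]" for x
  unfolding dat_concat[OF assms] using dat_outside[OF assms(1)] that by simp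
 ultimately show ?thesis unfolding wd_def psize_concat[OF assms] psize_part[OF assms(1)] psize_part[OF assms(2)] e
  by (simp add: comp_def)
qed

lemma dat_star:
 assumes "C \<in> NCc c" "T \<in> NC t"
 shows "dat (C \<star> T) = (dat (C \<uplus> T))(int c := 0, int (c + t + 1) := dat C (int c) + 1)"
proof -
 have p: "partition_on ({1..int (c + t + 1)} - {int (c + t + 1)}) (C \<uplus> T)"
  using topb_concat(4)[OF assms] interval_Suc[of "c + t"] by simp
 have "dat (C \<uplus> T) (int c) = dat C (int c)"
  using dat_concat[OF NC_part[OF NCcD(1)[OF assms(1)]] NC_part[OF assms(2)]] dat_outside[OF NC_part[OF assms(2)]] by simp
 thus ?thesis unfolding star_ins[OF assms]
  using dat_ins[OF p _ _ topb_concat(1,3)[OF assms]] by simp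
qed

text \<open>Attaching the last point to the top block of \<open>C\<close> turns the letter at
  \<open>c\<close> into 0 and puts the enlarged size at the end. The word of \<open>T\<close> stays
  intact in between, directly after that 0.\<close>

lemma wd_star:
 assumes "C \<in> NCc c" "T \<in> NC t"
 shows "wd (C \<star> T) = map (dat C) [1..int c - 1] @ [0] @ wd T @ [card (topb C) + 1]"
proof -
 note p = NC_part[OF NCcD(1)[OF assms(1)]] and q = NC_part[OF assms(2)] and c = NCcD(2)[OF assms(1)]
 have dc: "dat C (int c) = card (topb C)" using dat_Max[OF p _ topb(1)[OF assms(1)]] topb(4)[OF assms(1)] by simp
 have "[1..int (c + t + 1)] = [1..int c - 1] @ [int c..int (c + t + 1)]" by (rule upto_split1) (use c in auto)
 also have "[int c..int (c + t + 1)] = int c # [int c + 1..int (c + t + 1)]" by (rule upto_rec1) auto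
 also have "[int c + 1..int (c + t + 1)] = [int c + 1..int (c + t)] @ [int (c + t + 1)]"
  using upto_rec2[of "int c + 1" "int (c + t + 1)"] by simp
 also have "[int c + 1..int (c + t)] = map (\<lambda>x. x + int c) [1..int t]"
  using upto_shift[of 1 "int c" "int t"] by (simp add: add.commute)
 finally have e: "[1..int (c + t + 1)] = [1..int c - 1] @ int c # map (\<lambda>x. x + int c) [1..int t] @ [int (c + t + 1)]" by simp
 have 1: "dat (C \<star> T) x = dat C x" if "x \<in> set [1..int c - 1]" for x
  unfolding dat_star[OF assms] using that dat_concat[OF p q] dat_outside[OF q] by simp
 have 2: "dat (C \<star> T) (x + int c) = dat T x" if "x \<in> set [1..int t]" for x
  unfolding dat_star[OF assms] using that dat_concat[OF p q] dat_outside[OF p] by simp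
 show ?thesis unfolding wd_def psize_part[OF star_part[OF assms]] NC_psize[OF assms(2)] e
  using 1 2 dat_star[OF assms] dc by (simp add: comp_def)
qed

lemma wd_singleton [simp]: "wd {{1}} = [1]"
proof -
 have "{B. B = {1::int} \<and> Max B = 1} = {{1}}" by auto
 thus ?thesis unfolding wd_def psize_def dat_def by (simp add: upto.simps)
qed

text \<open>The longest suffix without a zero. Applied to \<open>wd P\<close>, it lists the sizes of
  the nonaligned blocks.\<close>

fun trl :: "nat list \<Rightarrow> nat list" where
 "trl [] = []"
| "trl (x # xs) = (if 0 \<in> set (x # xs) then trl xs else x # xs)"

lemma trl_append0: "trl (u @ 0 # v) = trl v"
 by (induction u) auto

lemma trl_snoc: "c \<noteq> 0 \<Longrightarrow> trl (v @ [c]) = trl v @ [c]"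
 by (induction v) auto

lemma trl_nonzero: "0 \<notin> set v \<Longrightarrow> trl v = v"
 by (cases v) auto

lemma map_filter_trl: "map d (filter (\<lambda>x. \<forall>y\<in>{x..b}. d y \<noteq> 0) [a..b]) = trl (map d [a..b])"
proof (induction "nat (b + 1 - a)" arbitrary: a)
 case 0 thus ?case by simp
next case (Suc k)
 hence "a \<le> b" by simp
 hence e: "[a..b] = a # [a + 1..b]" by (rule upto_rec1)
 have IH: "map d (filter (\<lambda>x. \<forall>y\<in>{x..b}. d y \<noteq> 0) [a + 1..b]) = trl (map d [a + 1..b])"
  by (rule Suc(1)) (use Suc(2) in simp)
 show ?case
 proof (cases "\<forall>y\<in>{a..b}. d y \<noteq> 0")
  case True
  hence "filter (\<lambda>x. \<forall>y\<in>{x..b}. d y \<noteq> 0) [a..b] = [a..b]" by (intro filter_True) auto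
  moreover have "0 \<notin> set (map d [a..b])" using True by auto
  ultimately show ?thesis by (simp add: trl_nonzero)
 next case False
  hence "0 \<in> set (map d [a..b])" by force
  hence "trl (map d [a..b]) = trl (map d [a + 1..b])" unfolding e by simp
  moreover have "filter (\<lambda>x. \<forall>y\<in>{x..b}. d y \<noteq> 0) [a..b] = filter (\<lambda>x. \<forall>y\<in>{x..b}. d y \<noteq> 0) [a + 1..b]"
   unfolding e by (simp only: filter.simps False if_False)
  ultimately show ?thesis using IH by simp
 qed
qed

lemma nonaligned_list:
 assumes "parts m P"
 shows "map card (nonaligned_list P) = trl (wd P)"
proof -
 let ?X = "{B \<in> P. nonaligned P B}"
 note b = part_by_max[OF assms, of ?X, simplified]
 have nz: "dat P (Max B) \<noteq> 0" if "B \<in> P" for B using that dat_0_iff[OF assms, of "Max B"] by simp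
 have in1: "Max B \<in> {1..int m}" if "B \<in> P" for B using part_Max(1)[OF assms _ that] part_sub[OF assms that] by auto
 have s: "Max ` ?X = {x \<in> {1..int m}. \<forall>y\<in>{x..int m}. dat P y \<noteq> 0}" (is "_ = ?Y")
 proof (intro equalityI subsetI)
  fix x assume "x \<in> Max ` ?X"
  then obtain B where B: "B \<in> P" "nonaligned P B" "x = Max B" by blast
  thus "x \<in> ?Y" using nz[OF B(1)] in1[OF B(1)] nonaligned_iff[OF assms, of B]
   by (auto simp: order_le_less)
 next fix x assume x: "x \<in> ?Y"
  hence "dat P x \<noteq> 0" by auto
  then obtain B where B: "B \<in> P" "x = Max B" using dat_0_iff[OF assms, of x] by auto
  hence "nonaligned P B" using nonaligned_iff[OF assms, of B] x by auto
  thus "x \<in> Max ` ?X" using B by blast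
 qed
 have "map Max (by_max ?X) = sorted_list_of_set (Max ` ?X)"
  by (rule map_Max_by_max) (use part_finite[OF assms] inj_on_subset[OF part_Max_inj[OF assms], of ?X] in auto)
 also have "\<dots> = filter (\<lambda>x. \<forall>y\<in>{x..int m}. dat P y \<noteq> 0) [1..int m]"
  unfolding s by (rule sorted_list_of_set.idem_if_sorted_distinct[THEN subst[where P = "\<lambda>l. sorted_list_of_set _ = l"]])
   (auto intro!: sorted_wrt_filter arg_cong[where f = sorted_list_of_set])
 finally have "map (dat P) (map Max (by_max ?X)) = trl (wd P)"
  using map_filter_trl[of "dat P" "int m" 1] unfolding wd_def psize_part[OF assms] by simp
 moreover have "map card (by_max ?X) = map (dat P) (map Max (by_max ?X))"
  using b(1) dat_Max[OF assms] by auto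
 ultimately show ?thesis unfolding nonaligned_list_def by simp
qed

lemma card_mset_wd:
 assumes "parts m P"
 shows "image_mset card (mset_set P) = filter_mset (\<lambda>x. x \<noteq> 0) (mset (wd P))"
proof -
 have in1: "Max B \<in> {1..int m}" if "B \<in> P" for B using part_Max(1)[OF assms _ that] part_sub[OF assms that] by auto
 have s: "Max ` P = {x \<in> {1..int m}. dat P x \<noteq> 0}"
  using dat_0_iff[OF assms] in1 by auto
 have "image_mset card (mset_set P) = image_mset (dat P) (image_mset Max (mset_set P))"
  unfolding multiset.map_comp by (rule image_mset_cong) (use dat_Max[OF assms] part_finite[OF assms] in auto)
 also have "image_mset Max (mset_set P) = mset_set (Max ` P)" by (rule image_mset_mset_set) (use part_Max_inj[OF assms] in simp)
 also have "\<dots> = mset_set {x \<in> {1..int m}. dat P x \<noteq> 0}" unfolding s ..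
 also have "image_mset (dat P) (mset_set {x \<in> {1..int m}. dat P x \<noteq> 0}) = filter_mset (\<lambda>x. x \<noteq> 0) (image_mset (dat P) (mset_set {1..int m}))"
  by (simp add: filter_mset_image_mset comp_def filter_mset_mset_set)
 finally have "image_mset card (mset_set P) = filter_mset (\<lambda>x. x \<noteq> 0) (image_mset (dat P) (mset_set {1..int m}))" .
 moreover have "mset [1..int m] = mset_set {1..int m}" using mset_set_set[of "[1..int m]"] by simp
 ultimately show ?thesis unfolding wd_def psize_part[OF assms] mset_map by simp
qed

section \<open>The map \<open>\<xi>\<close>\<close>

text \<open>There is no induction hypothesis for \<open>C\<close>, which the recursions for
  \<open>xi\<close> leave unchanged.\<close>

lemma NC_induct [consumes 1, case_names empty single nest]:
 assumes "P \<in> NC m" "Q {}"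
  and single: "\<And>L l. L \<in> NC l \<Longrightarrow> Q L \<Longrightarrow> Q (L \<uplus> {{1}})"
  and nest: "\<And>L C I l c i. L \<in> NC l \<Longrightarrow> C \<in> NCc c \<Longrightarrow> I \<in> NC i \<Longrightarrow> Q L \<Longrightarrow> Q I \<Longrightarrow> Q (L \<uplus> (C \<star> I))"
 shows "Q P"
 using assms(1)
proof (induction m arbitrary: P rule: less_induct)
 case (less m)
 show ?case
 proof (cases "m = 0")
  case True thus ?thesis using less(2) NC_0 assms(2) by simp
 next case False
  hence "0 < m" by simp
  from less(2) this show ?thesis
  proof (cases rule: NC_cases)
   case (single L)
   thus ?thesis using assms(3)[of L "m - 1"] less(1)[of "m - 1" L] \<open>0 < m\<close> by simp
  next case (nest L C I l c i)
   thus ?thesis using assms(4)[of L l C c I i] less(1)[of l L] less(1)[of i I] by simp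
  qed
 qed
qed

text \<open>A fold over the orbit \<open>P\<close>, \<open>f P\<close>, \<open>f (f P)\<close>, ...
  up to its first empty member. The sequences of \<open>xi_core\<close> with their least stopping
  index have this shape, and \<open>iter_step\<close> turns them into recursive equations once
  termination is known.\<close>

definition iter :: "('a set \<Rightarrow> 'a set) \<Rightarrow> ('a set \<Rightarrow> 'b \<Rightarrow> 'b) \<Rightarrow> 'b \<Rightarrow> 'a set \<Rightarrow> 'b" where
 "iter f h e P = foldr (\<lambda>i. h ((f ^^ i) P)) [0..<(LEAST r. (f ^^ r) P = {})] e"

lemma iter_empty [simp]: "iter f h e {} = e"
 unfolding iter_def by (simp add: Least_eq_0)

lemma Least_funpow:
 assumes "P \<noteq> {}" "(f ^^ k) P = {}"
 shows "(LEAST r. (f ^^ r) P = {}) = Suc (LEAST r. (f ^^ r) (f P) = {})"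
 using Least_Suc[of "\<lambda>r. (f ^^ r) P = {}" k] assms by (simp add: funpow_swap1)

lemma iter_step:
 assumes "P \<noteq> {}" "(f ^^ k) P = {}"
 shows "iter f h e P = h P (iter f h e (f P))"
proof -
 let ?r = "LEAST r. (f ^^ r) (f P) = {}"
 have "[0..<Suc ?r] = 0 # map Suc [0..<?r]" by (simp add: upt_conv_Cons map_Suc_upt)
 thus ?thesis unfolding iter_def Least_funpow[OF assms]
  by (simp add: foldr_map comp_def funpow_swap1)
qed

abbreviation f1 :: "int set set \<Rightarrow> int set set" where "f1 Q \<equiv> fst (decomp1 Q)"

abbreviation f2 :: "int set set \<Rightarrow> int set set" where "f2 Q \<equiv> snd (snd (decomp2 Q))"

lemma single_nonempty: "L \<in> NC l \<Longrightarrow> L \<uplus> {{1}} \<noteq> {}"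
 using decomp_single(3) by blast

lemma nest_nonempty: "C \<in> NCc c \<Longrightarrow> I \<in> NC i \<Longrightarrow> L \<uplus> (C \<star> I) \<noteq> {}"
 unfolding star_eq pconcat_sh by blast

lemma f1_terminates: "P \<in> NC m \<Longrightarrow> \<exists>k. (f1 ^^ k) P = {}"
proof (induction rule: NC_induct)
 case empty thus ?case by (intro exI[of _ 0]) simp
next case (single L l)
 then obtain k where "(f1 ^^ k) L = {}" by blast
 thus ?case using decomp_single(1)[OF single(1)] by (intro exI[of _ "Suc k"]) (simp add: funpow_Suc_right del: funpow.simps)
next case (nest L C I l c i)
 then obtain k where "(f1 ^^ k) L = {}" by blast
 thus ?case using decomp_star(1)[OF nest(1-3)] by (intro exI[of _ "Suc k"]) (simp add: funpow_Suc_right del: funpow.simps)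
qed

lemma f2_terminates: "P \<in> NC m \<Longrightarrow> \<exists>k. (f2 ^^ k) P = {}"
proof (induction rule: NC_induct)
 case empty thus ?case by (intro exI[of _ 0]) simp
next case (single L l)
 then obtain k where "(f2 ^^ k) L = {}" by blast
 thus ?case using decomp_single(2)[OF single(1)] by (intro exI[of _ "Suc k"]) (simp add: funpow_Suc_right del: funpow.simps)
next case (nest L C I l c i)
 then obtain k where "(f2 ^^ k) I = {}" by blast
 thus ?case using decomp_star(2)[OF nest(1-3)] by (intro exI[of _ "Suc k"]) (simp add: funpow_Suc_right del: funpow.simps)
qed

text \<open>The value \<open>M2\<close> of \<open>xi_core\<close> as a function of the second member
  of \<open>pi_seq\<close>.\<close>

definition xiM :: "int set set \<Rightarrow> int set set" where
 "xiM = iter f1 (\<lambda>Q M. snd (snd (decomp1 Q)) \<uplus> (fst (snd (decomp1 Q)) \<star> M)) {}"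

text \<open>The factors in front of the last summand of \<open>xi_core\<close>, as a function of the
  second member of \<open>upsilon_seq\<close>. Appending on the right produces the decreasing order
  of indices used there.\<close>

definition xiNl :: "int set set \<Rightarrow> int set set list" where
 "xiNl = iter f2 (\<lambda>Q l. l @ [fst (snd (decomp2 Q)) \<star> fst (decomp2 Q)]) []"

definition xiN :: "int set set \<Rightarrow> int set set" where
 "xiN P = pconcat_list (xiNl P)"

text \<open>For a final singleton the inner factors are empty and \<open>{} \<star> M\<close>
  appends \<open>{{1}}\<close>. Otherwise \<open>L\<close> and \<open>I\<close> change places around
  \<open>C\<close>, and only \<open>L\<close> is transformed further.\<close>

lemma xiM_simps:
 shows "xiM {} = {}"
  and "L \<in> NC l \<Longrightarrow> xiM (L \<uplus> {{1}}) = xiM L \<uplus> {{1}}"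
  and "L \<in> NC l \<Longrightarrow> C \<in> NCc c \<Longrightarrow> I \<in> NC i \<Longrightarrow> xiM (L \<uplus> (C \<star> I)) = I \<uplus> (C \<star> xiM L)"
proof -
 show "xiM {} = {}" unfolding xiM_def by simp
 show "xiM (L \<uplus> {{1}}) = xiM L \<uplus> {{1}}" if L: "L \<in> NC l"
 proof -
  obtain k where k: "(f1 ^^ k) (L \<uplus> {{1}}) = {}" using f1_terminates[OF NC_concat[OF L NC_singleton]] by blast
  show ?thesis unfolding xiM_def iter_step[OF single_nonempty[OF L] k] decomp_single(1)[OF L] by (simp add: star_empty)
 qed
 show "xiM (L \<uplus> (C \<star> I)) = I \<uplus> (C \<star> xiM L)" if L: "L \<in> NC l" "C \<in> NCc c" "I \<in> NC i"
 proof -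
  obtain k where k: "(f1 ^^ k) (L \<uplus> (C \<star> I)) = {}"
   using f1_terminates[OF NC_concat[OF L(1) NCcD(1)[OF star_NCc[OF L(2,3)]]]] by blast
  show ?thesis unfolding xiM_def iter_step[OF nest_nonempty[OF L(2,3)] k] decomp_star(1)[OF L] by simp
 qed
qed

lemma xiNl_simps:
 shows "xiNl {} = []"
  and "L \<in> NC l \<Longrightarrow> xiNl (L \<uplus> {{1}}) = xiNl L @ [{{1}}]"
  and "L \<in> NC l \<Longrightarrow> C \<in> NCc c \<Longrightarrow> I \<in> NC i \<Longrightarrow> xiNl (L \<uplus> (C \<star> I)) = xiNl I @ [C \<star> L]"
proof -
 show "xiNl {} = []" unfolding xiNl_def by simp
 show "xiNl (L \<uplus> {{1}}) = xiNl L @ [{{1}}]" if L: "L \<in> NC l"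
 proof -
  obtain k where k: "(f2 ^^ k) (L \<uplus> {{1}}) = {}" using f2_terminates[OF NC_concat[OF L NC_singleton]] by blast
  show ?thesis unfolding xiNl_def iter_step[OF single_nonempty[OF L] k] decomp_single(2)[OF L] by (simp add: star_empty)
 qed
 show "xiNl (L \<uplus> (C \<star> I)) = xiNl I @ [C \<star> L]" if L: "L \<in> NC l" "C \<in> NCc c" "I \<in> NC i"
 proof -
  obtain k where k: "(f2 ^^ k) (L \<uplus> (C \<star> I)) = {}"
   using f2_terminates[OF NC_concat[OF L(1) NCcD(1)[OF star_NCc[OF L(2,3)]]]] by blast
  show ?thesis unfolding xiNl_def iter_step[OF nest_nonempty[OF L(2,3)] k] decomp_star(2)[OF L] by simp
 qed
qed

lemma xiNl_NC: "P \<in> NC m \<Longrightarrow> \<forall>C\<in>set (xiNl P). \<exists>c. C \<in> NC c"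
proof (induction rule: NC_induct)
 case empty thus ?case using xiNl_simps(1) by simp
next case (single L l) thus ?case using xiNl_simps(2)[OF single(1)] NC_singleton by auto
next case (nest L C I l c i) thus ?case using xiNl_simps(3)[OF nest(1-3)] NCcD(1)[OF star_NCc[OF nest(2,1)]] by auto
qed

text \<open>Again \<open>L\<close> and \<open>I\<close> change places around \<open>C\<close>, but
  now only \<open>I\<close> is transformed further.\<close>

lemma xiN_simps:
 shows "xiN {} = {}"
  and "L \<in> NC l \<Longrightarrow> xiN (L \<uplus> {{1}}) = xiN L \<uplus> {{1}}"
  and "L \<in> NC l \<Longrightarrow> C \<in> NCc c \<Longrightarrow> I \<in> NC i \<Longrightarrow> xiN (L \<uplus> (C \<star> I)) = xiN I \<uplus> (C \<star> L)"
proof -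
 show "xiN {} = {}" unfolding xiN_def xiNl_simps(1) by (simp add: pconcat_list_def)
 show "xiN (L \<uplus> {{1}}) = xiN L \<uplus> {{1}}" if L: "L \<in> NC l"
  unfolding xiN_def xiNl_simps(2)[OF L] by (rule pconcat_list_snoc[OF xiNl_NC[OF L]])
 show "xiN (L \<uplus> (C \<star> I)) = xiN I \<uplus> (C \<star> L)" if L: "L \<in> NC l" "C \<in> NCc c" "I \<in> NC i"
  unfolding xiN_def xiNl_simps(3)[OF L] by (rule pconcat_list_snoc[OF xiNl_NC[OF L(3)]])
qed

lemma foldr_snoc: "foldr (\<lambda>i l. l @ [x i]) js [] = map x (rev js)"
 by (induction js) auto

lemma upt_shift2: "[2..<Suc r + 1] = map (\<lambda>j. j + 2) [0..<r]"
 using map_add_upt[of 2 r] by (simp add: add.commute)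

text \<open>Both sequences start with the same decomposition \<open>(L, C, I)\<close>. After that,
  \<open>pi_seq\<close> continues inside \<open>L\<close> and \<open>upsilon_seq\<close> inside
  \<open>I\<close>, independently of each other.\<close>

lemma xi_core_nest:
 assumes L: "L \<in> NC l" "C \<in> NCc c" "I \<in> NC i"
 shows "xi_core (L \<uplus> (C \<star> I)) = xiN I \<uplus> (C \<star> xiM L)"
proof -
 let ?P = "L \<uplus> (C \<star> I)"
 note P = NC_concat[OF L(1) NCcD(1)[OF star_NCc[OF L(2,3)]]]
 note ne = nest_nonempty[OF L(2,3), of L]
 obtain k1 k2 where k: "(f1 ^^ k1) ?P = {}" "(f2 ^^ k2) ?P = {}" using f1_terminates[OF P] f2_terminates[OF P] by blast
 note d = decomp_star[OF L]
 define r where "r = (LEAST r. (f1 ^^ r) L = {})"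
 define s where "s = (LEAST s. (f2 ^^ s) I = {})"
 have 1: "(LEAST r. pi_seq ?P (r + 1) = {}) = Suc r"
  unfolding pi_seq_def r_def using Least_funpow[OF ne k(1)] d by simp
 have 2: "(LEAST s. upsilon_seq ?P (s + 1) = {}) = Suc s"
  unfolding upsilon_seq_def s_def using Least_funpow[OF ne k(2)] d by simp
 \<comment> \<open>The sequences are indexed from 1 and their first step is already used up, hence
   the shift by 2.\<close>
 have 3: "pi_seq ?P (j + 2) = (f1 ^^ j) L" "pi_seq ?P 1 = ?P" for j
  unfolding pi_seq_def using d by (simp_all add: funpow_Suc_right del: funpow.simps(2))
 have 4: "upsilon_seq ?P (j + 2) = (f2 ^^ j) I" for j
  unfolding upsilon_seq_def using d by (simp_all add: funpow_Suc_right del: funpow.simps(2))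
 have M: "foldr (\<lambda>i M. snd (snd (decomp1 (pi_seq ?P i))) \<uplus> (fst (snd (decomp1 (pi_seq ?P i))) \<star> M)) [2..<Suc r + 1] {} = xiM L"
  unfolding upt_shift2 foldr_map comp_def 3 xiM_def iter_def r_def ..
 have "map (\<lambda>i. fst (snd (decomp2 (upsilon_seq ?P i))) \<star> fst (decomp2 (upsilon_seq ?P i))) (rev [2..<Suc s + 1])
   = map (\<lambda>i. fst (snd (decomp2 ((f2 ^^ i) I))) \<star> fst (decomp2 ((f2 ^^ i) I))) (rev [0..<s])"
  unfolding upt_shift2 rev_map map_map comp_def 4 ..
 also have "\<dots> = xiNl I" unfolding xiNl_def iter_def s_def foldr_snoc ..
 finally have N: "map (\<lambda>i. fst (snd (decomp2 (upsilon_seq ?P i))) \<star> fst (decomp2 (upsilon_seq ?P i))) (rev [2..<Suc s + 1]) = xiNl I" .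
 show ?thesis unfolding xi_core_def Let_def 1 2 M N 3 xiN_def d by simp
qed

lemma xi_nest:
 assumes L: "L \<in> NC l" "C \<in> NCc c" "I \<in> NC i"
 shows "xi (L \<uplus> (C \<star> I)) = xiN I \<uplus> (C \<star> xiM L)"
proof -
 let ?P = "L \<uplus> (C \<star> I)"
 note P = NC_concat[OF L(1) NCcD(1)[OF star_NCc[OF L(2,3)]]]
 define m where "m = psize ?P"
 have m: "?P \<in> NC m" unfolding m_def using P NC_psize[OF P] by simp
 define K where "K = {k \<in> {1..int m}. {k} \<notin> ?P}"
 have "m > 0" using m NC_0 nest_nonempty[OF L(2,3), of L] by (cases m) auto
 hence "int m \<in> K" unfolding K_def using decomp_core_star(2)[OF L] unfolding m_def by simp
 moreover have "finite K" by (rule finite_subset[of _ "{1..int m}"]) (auto simp: K_def)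
 hence "Max K = int m"
  by (rule Max_eqI) (use \<open>int m \<in> K\<close> in \<open>auto simp: K_def\<close>)
 ultimately have "xi ?P = xi_core (restr ?P {1..int m}) \<union> {{j} |j. int m < j \<and> j \<le> int m}"
  unfolding xi_def Let_def m_def[symmetric] K_def[symmetric] by auto
 also have "\<dots> = xi_core ?P" unfolding restr_all[OF NC_part[OF m]] by auto
 finally show ?thesis unfolding xi_core_nest[OF L] .
qed

text \<open>Trailing singletons are split off before anything else happens, so one more of them does
  not change the part handled by \<open>xi_core\<close>. If all blocks are singletons,
  \<open>xi\<close> is the identity on both sides.\<close>

lemma xi_single:
 assumes L: "L \<in> NC l" "xi L \<in> NC l"
 shows "xi (L \<uplus> {{1}}) = xi L \<uplus> {{1}}"
proof -
 let ?P = "L \<uplus> {{1}}"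
 have ps: "psize ?P = l + 1" using NC_psize[OF NC_concat[OF L(1) NC_singleton]] .
 have u: "X \<uplus> {{1}} = X \<union> {{int l + 1}}" if "X \<in> NC l" for X
  unfolding pconcat_sh NC_psize[OF that] by (simp add: sh_def add.commute)
 define K where "K = {k \<in> {1..int l}. {k} \<notin> L}"
 have K: "{k \<in> {1..int (l + 1)}. {k} \<notin> ?P} = K" unfolding K_def u[OF L(1)] by auto
 show ?thesis
 proof (cases "K = {}")
  case True
  thus ?thesis using K unfolding xi_def Let_def ps NC_psize[OF L(1)] K_def by simp
 next case False
  have "finite K" by (rule finite_subset[of _ "{1..int l}"]) (auto simp: K_def)
  hence "Max K \<in> K" using False by (rule Max_in)
  hence M: "Max K \<le> int l" unfolding K_def by simp
  have 1: "restr ?P {1..Max K} = restr L {1..Max K}"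
   by (rule restr_concat_left[OF NC_part[OF L(1)] NC_part[OF NC_singleton] M])
  have "xi ?P = xi_core (restr L {1..Max K}) \<union> {{j} |j. Max K < j \<and> j \<le> int (l + 1)}"
   unfolding xi_def Let_def ps K 1 using False by simp
  moreover have "xi L = xi_core (restr L {1..Max K}) \<union> {{j} |j. Max K < j \<and> j \<le> int l}"
   using False unfolding xi_def Let_def NC_psize[OF L(1)] K_def[symmetric] by simp
  moreover have "{{j} |j. Max K < j \<and> j \<le> int (l + 1)} = {{j} |j. Max K < j \<and> j \<le> int l} \<union> {{int l + 1}}"
   using M by force
  ultimately show ?thesis unfolding u[OF L(2)] by (simp only: Un_assoc)
 qed
qed

lemma xi_empty: "xi {} = {}"
 unfolding xi_def by simp

text \<open>By \<open>card_mset_wd\<close> this is the multiset of block sizes, here in a form that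
  is additive over \<open>\<uplus>\<close>.\<close>

definition W :: "int set set \<Rightarrow> nat multiset" where
 "W P = filter_mset (\<lambda>x. x \<noteq> 0) (mset (wd P))"

lemma W_concat: "P \<in> NC a \<Longrightarrow> Q \<in> NC b \<Longrightarrow> W (P \<uplus> Q) = W P + W Q"
 unfolding W_def using wd_concat[OF NC_part NC_part, of P a Q b] by simp

text \<open>Says that \<open>\<star>\<close> adds the same sizes whatever its right argument is,
  written without multiset subtraction.\<close>

lemma W_star:
 assumes "C \<in> NCc c" "T \<in> NC t" "T' \<in> NC t'" 
 shows "W (C \<star> T) + W T' = W (C \<star> T') + W T"
 unfolding W_def wd_star[OF assms(1,2)] wd_star[OF assms(1,3)] by (simp add: ac_simps)

text \<open>The 0 that \<open>wd_star\<close> puts in front of the word of \<open>T\<close> cuts off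
  everything to its left.\<close>

lemma trl_concat_star:
 assumes "P \<in> NC a" "C \<in> NCc c" "T \<in> NC t"
 shows "trl (wd (P \<uplus> (C \<star> T))) = trl (wd T) @ [card (topb C) + 1]"
proof -
 have "wd (P \<uplus> (C \<star> T)) = (wd P @ map (dat C) [1..int c - 1]) @ 0 # (wd T @ [card (topb C) + 1])"
  using wd_concat[OF NC_part[OF assms(1)] star_part[OF assms(2,3)]] wd_star[OF assms(2,3)] by simp
 thus ?thesis by (simp only: trl_append0) (simp add: trl_snoc)
qed

lemma trl_concat_single:
 assumes "P \<in> NC a"
 shows "trl (wd (P \<uplus> {{1}})) = trl (wd P) @ [1]"
 using wd_concat[OF NC_part[OF assms] NC_part[OF NC_singleton]] by (simp add: trl_snoc)

lemma card_nonnested_nest: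
 assumes "L \<in> NC l" "C \<in> NCc c" "I \<in> NC i"
 shows "map card (nonnested_list (L \<uplus> (C \<star> I))) = map card (nonnested_list L) @ [card (topb C) + 1]"
proof -
 have "int (c + i + 1) \<notin> topb C" using NCc_finite(2)[OF assms(2)] by auto
 thus ?thesis unfolding nonnested_list_concat[OF assms(1) star_NCc[OF assms(2,3)]] topb_star[OF assms(2,3)]
  using NCc_finite(1)[OF assms(2)] by simp
qed

lemma card_nonnested_single:
 assumes "L \<in> NC l"
 shows "map card (nonnested_list (L \<uplus> {{1}})) = map card (nonnested_list L) @ [1]"
proof -
 have "topb {{1}} = {1}" using topb(1)[OF singleton_NCc] by simp
 thus ?thesis unfolding nonnested_list_concat[OF assms singleton_NCc] by simp
qed

text \<open>Each constructor appends one size to the nonnested list of \<open>L\<close>, and it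
  appends the same size to the final zero-free stretch of \<open>xiM L\<close>. This parallel is the
  reason why nonnested blocks turn into nonaligned ones with their sizes in the same order.\<close>

lemma xiM_props:
 assumes "P \<in> NC m"
 shows "xiM P \<in> NC (psize P) \<and> W (xiM P) = W P \<and> trl (wd (xiM P)) = map card (nonnested_list P)"
 using assms
proof (induction rule: NC_induct)
 case empty thus ?case using xiM_simps(1) NC_0 by (simp add: wd_def)
next case (single L l)
 hence M: "xiM L \<in> NC l" using NC_psize[OF single(1)] by simp
 show ?case unfolding xiM_simps(2)[OF single(1)] NC_psize[OF NC_concat[OF single(1) NC_singleton]]
  using NC_concat[OF M NC_singleton] W_concat[OF M NC_singleton] W_concat[OF single(1) NC_singleton]
   trl_concat_single[OF M] card_nonnested_single[OF single(1)] single(2) by simp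
next case (nest L C I l c i)
 hence M: "xiM L \<in> NC l" using NC_psize[OF nest(1)] by simp
 note s = star_NCc[OF nest(2) nest(3)] star_NCc[OF nest(2) M]
 note n = NC_concat[OF nest(1) NCcD(1)[OF s(1)]] NC_concat[OF nest(3) NCcD(1)[OF s(2)]]
 have "W (I \<uplus> (C \<star> xiM L)) = W (L \<uplus> (C \<star> I))"
  using W_concat[OF nest(1) NCcD(1)[OF s(1)]] W_concat[OF nest(3) NCcD(1)[OF s(2)]]
   W_star[OF nest(2,3) M] nest(4) by (simp add: ac_simps)
 thus ?case unfolding xiM_simps(3)[OF nest(1-3)] NC_psize[OF n(1)]
  using n(2) trl_concat_star[OF nest(3,2) M] card_nonnested_nest[OF nest(1-3)] nest(4) by (simp add: ac_simps)
qed

lemma xiN_props: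
 assumes "P \<in> NC m"
 shows "xiN P \<in> NC (psize P) \<and> W (xiN P) = W P"
 using assms
proof (induction rule: NC_induct)
 case empty thus ?case using xiN_simps(1) NC_0 by simp
next case (single L l)
 hence M: "xiN L \<in> NC l" using NC_psize[OF single(1)] by simp
 show ?case unfolding xiN_simps(2)[OF single(1)] NC_psize[OF NC_concat[OF single(1) NC_singleton]]
  using NC_concat[OF M NC_singleton] W_concat[OF M NC_singleton] W_concat[OF single(1) NC_singleton]
   single(2) by simp
next case (nest L C I l c i)
 hence N: "xiN I \<in> NC i" using NC_psize[OF nest(3)] by simp
 note s = star_NCc[OF nest(2) nest(3)] star_NCc[OF nest(2) nest(1)]
 note n = NC_concat[OF nest(1) NCcD(1)[OF s(1)]] NC_concat[OF N NCcD(1)[OF s(2)]]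
 have "W (xiN I \<uplus> (C \<star> L)) = W (L \<uplus> (C \<star> I))"
  using W_concat[OF nest(1) NCcD(1)[OF s(1)]] W_concat[OF N NCcD(1)[OF s(2)]]
   W_star[OF nest(2,3) nest(1)] nest(5) by (simp add: ac_simps)
 thus ?case unfolding xiN_simps(3)[OF nest(1-3)] NC_psize[OF n(1)]
  using n(2) by (simp add: ac_simps)
qed

text \<open>Of \<open>xiN I\<close> only the number of points and the multiset of sizes matter: the
  zero produced by \<open>\<star>\<close> hides it from the final stretch, which comes from
  \<open>xiM L\<close>.\<close>

lemma xi_props:
 assumes "P \<in> NC m"
 shows "xi P \<in> NC (psize P) \<and> W (xi P) = W P \<and> trl (wd (xi P)) = map card (nonnested_list P)"
 using assms
proof (induction rule: NC_induct)
 case empty thus ?case using xi_empty NC_0 by (simp add: wd_def)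
next case (single L l)
 hence M: "xi L \<in> NC l" using NC_psize[OF single(1)] by simp
 show ?case unfolding xi_single[OF single(1) M] NC_psize[OF NC_concat[OF single(1) NC_singleton]]
  using NC_concat[OF M NC_singleton] W_concat[OF M NC_singleton] W_concat[OF single(1) NC_singleton]
   trl_concat_single[OF M] card_nonnested_single[OF single(1)] single(2) by simp
next case (nest L C I l c i)
 have M: "xiM L \<in> NC l" "W (xiM L) = W L" using xiM_props[OF nest(1)] NC_psize[OF nest(1)] by auto
 have N: "xiN I \<in> NC i" "W (xiN I) = W I" using xiN_props[OF nest(3)] NC_psize[OF nest(3)] by auto
 note s = star_NCc[OF nest(2) nest(3)] star_NCc[OF nest(2) M(1)]
 note n = NC_concat[OF nest(1) NCcD(1)[OF s(1)]] NC_concat[OF N(1) NCcD(1)[OF s(2)]]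
 have "W (xiN I \<uplus> (C \<star> xiM L)) = W (L \<uplus> (C \<star> I))"
  using W_concat[OF nest(1) NCcD(1)[OF s(1)]] W_concat[OF N(1) NCcD(1)[OF s(2)]]
   W_star[OF nest(2,3) M(1)] M(2) N(2) by (simp add: ac_simps)
 thus ?case unfolding xi_nest[OF nest(1-3)] NC_psize[OF n(1)]
  using n(2) trl_concat_star[OF N(1) nest(2) M(1)] card_nonnested_nest[OF nest(1-3)] xiM_props[OF nest(1)] by (simp add: ac_simps)
qed

lemma nest_inj:
 assumes "L \<in> NC l" "C \<in> NCc c" "I \<in> NC i" "L' \<in> NC l'" "C' \<in> NCc c'" "I' \<in> NC i'" "L \<uplus> (C \<star> I) = L' \<uplus> (C' \<star> I')"
 shows "L = L'" "C = C'" "I = I'"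
proof -
 have "(L, C, I) = (L', C', I')"
  using decomp_star(1)[OF assms(1-3)] unfolding assms(7) decomp_star(1)[OF assms(4-6)] by (rule sym)
 thus "L = L'" "C = C'" "I = I'" by simp_all
qed

lemma single_inj:
 assumes "L \<in> NC l" "L' \<in> NC l'" "L \<uplus> {{1}} = L' \<uplus> {{1}}"
 shows "L = L'"
 using decomp_single(1)[OF assms(1)] unfolding assms(3) decomp_single(1)[OF assms(2)] by simp

lemma single_neq_nest:
 assumes "P \<in> NC p" "L \<in> NC l" "C \<in> NCc c" "I \<in> NC i"
 shows "P \<uplus> {{1}} \<noteq> L \<uplus> (C \<star> I)"
proof
 assume e: "P \<uplus> {{1}} = L \<uplus> (C \<star> I)"
 show False using decomp_single(3)[OF assms(1)] decomp_core_star(2)[OF assms(2-4)] unfolding e by simp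
qed

text \<open>The common injectivity argument for \<open>xiM\<close>, \<open>xiN\<close> and
  \<open>xi\<close>. The image shows whether the last block is a singleton, and if it is not, unique
  decomposition recovers \<open>G L I\<close>, \<open>C\<close> and \<open>H L I\<close>. It remains
  to recover \<open>L\<close> and \<open>I\<close> from \<open>G L I\<close> and
  \<open>H L I\<close>; in \<open>inj\<close> the injectivity of \<open>F\<close> at
  \<open>L\<close> and at \<open>I\<close> is available for this.\<close>

lemma xi_like_inj:
 assumes F: "\<And>P m. P \<in> NC m \<Longrightarrow> F P \<in> NC (psize P)"
  and F1: "\<And>L l. L \<in> NC l \<Longrightarrow> F (L \<uplus> {{1}}) = F L \<uplus> {{1}}"
  and F2: "\<And>L C I l c i. L \<in> NC l \<Longrightarrow> C \<in> NCc c \<Longrightarrow> I \<in> NC i \<Longrightarrow> F (L \<uplus> (C \<star> I)) = G L I \<uplus> (C \<star> H L I)"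
  and GH: "\<And>L I l i. L \<in> NC l \<Longrightarrow> I \<in> NC i \<Longrightarrow> (\<exists>a. G L I \<in> NC a) \<and> (\<exists>b. H L I \<in> NC b)"
  and inj: "\<And>L I l i L' I' l' i'. L \<in> NC l \<Longrightarrow> I \<in> NC i \<Longrightarrow> L' \<in> NC l' \<Longrightarrow> I' \<in> NC i' \<Longrightarrow>
   (\<And>Q k. Q \<in> NC k \<Longrightarrow> F L = F Q \<Longrightarrow> L = Q) \<Longrightarrow> (\<And>Q k. Q \<in> NC k \<Longrightarrow> F I = F Q \<Longrightarrow> I = Q) \<Longrightarrow>
   G L I = G L' I' \<Longrightarrow> H L I = H L' I' \<Longrightarrow> L = L' \<and> I = I'"
 shows "P \<in> NC m \<Longrightarrow> \<forall>Q k. Q \<in> NC k \<longrightarrow> F P = F Q \<longrightarrow> P = Q"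
proof (induction rule: NC_induct)
 case empty
 show ?case
 proof (intro allI impI)
  fix Q k assume Q: "Q \<in> NC k" "F {} = F Q"
  have "F {} \<in> NC 0" using F[of "{}" 0] NC_0 by simp
  hence "psize Q = 0" using F[OF Q(1)] Q(2) NC_psize by (metis)
  thus "{} = Q" using Q(1) NC_psize[OF Q(1)] NC_0 by simp
 qed
next case (single L l)
 show ?case
 proof (intro allI impI)
  fix Q k assume Q: "Q \<in> NC k" "F (L \<uplus> {{1}}) = F Q"
  have FL: "F L \<in> NC l" using F[OF single(1)] NC_psize[OF single(1)] by simp
  have "psize Q = l + 1" using F[OF Q(1)] Q(2) F1[OF single(1)] NC_psize NC_concat[OF FL NC_singleton] by metis
  hence "0 < k" using NC_psize[OF Q(1)] by simp
  from Q(1) this show "L \<uplus> {{1}} = Q"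
  proof (cases rule: NC_cases)
   case s: (single L')
   have FL': "F L' \<in> NC (k - 1)" using F[OF s(1)] NC_psize[OF s(1)] by simp
   have "F L = F L'" using single_inj[OF FL FL'] Q(2) F1[OF single(1)] F1[OF s(1)] s(2) by simp
   thus ?thesis using single(2) s by metis
  next case n: (nest L' C' I' l' c' i')
   obtain a b where "G L' I' \<in> NC a" "H L' I' \<in> NC b" using GH[OF n(1,3)] by blast
   thus ?thesis using single_neq_nest[OF FL _ n(2), of "G L' I'" a "H L' I'" b] Q(2) F1[OF single(1)] F2[OF n(1-3)] n(5) by simp
  qed
 qed
next case (nest L C I l c i)
 obtain a b where g: "G L I \<in> NC a" "H L I \<in> NC b" using GH[OF nest(1,3)] by blast
 show ?case
 proof (intro allI impI)
  fix Q k assume Q: "Q \<in> NC k" "F (L \<uplus> (C \<star> I)) = F Q"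
  have "psize Q = l + (c + i + 1)"
   using F[OF Q(1)] Q(2) F[OF NC_concat[OF nest(1) NCcD(1)[OF star_NCc[OF nest(2,3)]]]] NC_psize NC_concat[OF nest(1) NCcD(1)[OF star_NCc[OF nest(2,3)]]] by metis
  hence "0 < k" using NC_psize[OF Q(1)] by simp
  from Q(1) this show "L \<uplus> (C \<star> I) = Q"
  proof (cases rule: NC_cases)
   case s: (single L')
   have FL': "F L' \<in> NC (k - 1)" using F[OF s(1)] NC_psize[OF s(1)] by simp
   show ?thesis using single_neq_nest[OF FL' g(1) nest(2) g(2)] Q(2) F1[OF s(1)] F2[OF nest(1-3)] s(2) by simp
  next case n: (nest L' C' I' l' c' i')
   obtain a' b' where g': "G L' I' \<in> NC a'" "H L' I' \<in> NC b'" using GH[OF n(1,3)] by blast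
   have e: "G L I \<uplus> (C \<star> H L I) = G L' I' \<uplus> (C' \<star> H L' I')"
    using Q(2) F2[OF nest(1-3)] F2[OF n(1-3)] n(5) by simp
   note ni = nest_inj[OF g(1) nest(2) g(2) g'(1) n(2) g'(2) e]
   have "L = L' \<and> I = I'" by (rule inj[OF nest(1,3) n(1,3) _ _ ni(1,3)]) (use nest(4,5) in blast)+
   thus ?thesis using ni(2) n(5) by simp
  qed
 qed
qed

lemma xiM_inj: "P \<in> NC m \<Longrightarrow> Q \<in> NC k \<Longrightarrow> xiM P = xiM Q \<Longrightarrow> P = Q"
proof (rule xi_like_inj[where F = xiM and G = "\<lambda>L I. I" and H = "\<lambda>L I. xiM L", rule_format, of P m Q k])
 show "xiM P \<in> NC (psize P)" if "P \<in> NC m" for P m using xiM_props[OF that] by blast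
 show "xiM (L \<uplus> {{1}}) = xiM L \<uplus> {{1}}" if "L \<in> NC l" for L l by (rule xiM_simps(2)[OF that])
 show "xiM (L \<uplus> (C \<star> I)) = I \<uplus> (C \<star> xiM L)" if "L \<in> NC l" "C \<in> NCc c" "I \<in> NC i" for L C I l c i
  by (rule xiM_simps(3)[OF that])
 show "(\<exists>a. I \<in> NC a) \<and> (\<exists>b. xiM L \<in> NC b)" if "L \<in> NC l" "I \<in> NC i" for L I l i
  using xiM_props[OF that(1)] that by blast
qed blast+

lemma xiN_inj: "P \<in> NC m \<Longrightarrow> Q \<in> NC k \<Longrightarrow> xiN P = xiN Q \<Longrightarrow> P = Q"
proof (rule xi_like_inj[where F = xiN and G = "\<lambda>L I. xiN I" and H = "\<lambda>L I. L", rule_format, of P m Q k])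
 show "xiN P \<in> NC (psize P)" if "P \<in> NC m" for P m using xiN_props[OF that] by blast
 show "xiN (L \<uplus> {{1}}) = xiN L \<uplus> {{1}}" if "L \<in> NC l" for L l by (rule xiN_simps(2)[OF that])
 show "xiN (L \<uplus> (C \<star> I)) = xiN I \<uplus> (C \<star> L)" if "L \<in> NC l" "C \<in> NCc c" "I \<in> NC i" for L C I l c i
  by (rule xiN_simps(3)[OF that])
 show "(\<exists>a. xiN I \<in> NC a) \<and> (\<exists>b. L \<in> NC b)" if "L \<in> NC l" "I \<in> NC i" for L I l i
  using xiN_props[OF that(2)] that by blast
qed blast+

lemma xi_inj: "P \<in> NC m \<Longrightarrow> Q \<in> NC k \<Longrightarrow> xi P = xi Q \<Longrightarrow> P = Q"
proof (rule xi_like_inj[where F = xi and G = "\<lambda>L I. xiN I" and H = "\<lambda>L I. xiM L", rule_format, of P m Q k])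
 show "xi P \<in> NC (psize P)" if "P \<in> NC m" for P m using xi_props[OF that] by blast
 show "xi (L \<uplus> {{1}}) = xi L \<uplus> {{1}}" if "L \<in> NC l" for L l
  using xi_single[OF that] xi_props[OF that] NC_psize[OF that] by simp
 show "xi (L \<uplus> (C \<star> I)) = xiN I \<uplus> (C \<star> xiM L)" if "L \<in> NC l" "C \<in> NCc c" "I \<in> NC i" for L C I l c i
  by (rule xi_nest[OF that])
 show "(\<exists>a. xiN I \<in> NC a) \<and> (\<exists>b. xiM L \<in> NC b)" if "L \<in> NC l" "I \<in> NC i" for L I l i
  using xiM_props[OF that(1)] xiN_props[OF that(2)] by blast
 show "L = L' \<and> I = I'" if "L \<in> NC l" "I \<in> NC i" "L' \<in> NC l'" "I' \<in> NC i'" "xiN I = xiN I'" "xiM L = xiM L'" for L I l i L' I' l' i'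
  by (rule conjI[OF xiM_inj[OF that(1,3,6)] xiN_inj[OF that(2,4,5)]])
qed (assumption+)

lemma finite_NC: "finite (NC m)"
proof (rule finite_subset)
 show "NC m \<subseteq> Pow (Pow {1..int m})" using NC_part part_sub by blast
qed simp

lemma xi_bij: "bij_betw xi (NC m) (NC m)"
 unfolding bij_betw_def
proof
 show i: "inj_on xi (NC m)" by (rule inj_onI) (rule xi_inj)
 show "xi ` NC m = NC m" by (rule endo_inj_surj[OF finite_NC _ i]) (use xi_props NC_psize in fastforce)
qed

lemma xi_lists:
 assumes "S \<in> NC m"
 shows "map card (nonaligned_list (xi S)) = map card (nonnested_list S)"
  "image_mset card (mset_set (xi S)) = image_mset card (mset_set S)" "xi S \<in> NC m"
proof -
 have x: "xi S \<in> NC m" "W (xi S) = W S" "trl (wd (xi S)) = map card (nonnested_list S)"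
  using xi_props[OF assms] NC_psize[OF assms] by auto
 show "map card (nonaligned_list (xi S)) = map card (nonnested_list S)"
  using nonaligned_list[OF NC_part[OF x(1)]] x(3) by simp
 show "image_mset card (mset_set (xi S)) = image_mset card (mset_set S)"
  using card_mset_wd[OF NC_part[OF x(1)]] card_mset_wd[OF NC_part[OF assms]] x(2) unfolding W_def by simp
 show "xi S \<in> NC m" by (rule x(1))
qed

lemma nonnested_list_props:
 assumes "S \<in> NC m"
 shows "set (nonnested_list S) = {B \<in> S. nonnested S B}" "sorted_wrt (<) (map Max (nonnested_list S))" "distinct (nonnested_list S)"
 unfolding nonnested_list_def using part_by_max[OF NC_part[OF assms], of "{B \<in> S. nonnested S B}"] by auto

lemma nonaligned_list_props:
 assumes "parts m S"
 shows "set (nonaligned_list S) = {B \<in> S. nonaligned S B}" "sorted_wrt (<) (map Max (nonaligned_list S))" "distinct (nonaligned_list S)"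
 unfolding nonaligned_list_def using part_by_max[OF assms, of "{B \<in> S. nonaligned S B}"] by auto

lemma xi_bar_bij: "bij_betw xi_bar (NCNN m) (NCNA m)"
 unfolding xi_bar_def NCNA_def NCNN_def
proof (rule marked_bij[OF xi_bij])
 fix S assume S: "S \<in> NC m"
 note l = xi_lists[OF S]
 show le: "length (nonaligned_list (xi S)) = length (nonnested_list S)" using l(1) by (metis length_map)
 note nn = nonnested_list_props[OF S] and na = nonaligned_list_props[OF NC_part[OF l(3)]]
 show "distinct (nonnested_list S)" "distinct (nonaligned_list (xi S))" by (rule nn na)+
 show "{B \<in> S. nonnested S B} \<subseteq> set (nonnested_list S)" "{B \<in> xi S. nonaligned (xi S) B} \<subseteq> set (nonaligned_list (xi S))"
  using nn na by auto
 fix i assume "i < length (nonnested_list S)"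
 thus "nonnested_list S ! i \<in> {B \<in> S. nonnested S B} \<longleftrightarrow> nonaligned_list (xi S) ! i \<in> {B \<in> xi S. nonaligned (xi S) B}"
  unfolding nn(1)[symmetric] na(1)[symmetric] using le by simp
qed

lemma xi_bar_stat:
 assumes "A \<in> NCNN m"
 shows "stat (xi_bar A) = stat A"
proof -
 obtain S X where A: "A = (S, X)" "S \<in> NC m" "X \<subseteq> {B \<in> S. nonnested S B}" using assms unfolding NCNN_def by blast
 note l = xi_lists[OF A(2)]
 note nn = nonnested_list_props[OF A(2)] and na = nonaligned_list_props[OF NC_part[OF l(3)]]
 have "map card (by_max (transfer_blocks (nonnested_list S) (nonaligned_list (xi S)) X)) = map card (by_max X)"
  by (rule map_card_by_max_transfer[OF l(1) nn(2) na(2)]) (use A nn in auto)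
 thus ?thesis unfolding A stat_def xi_bar_def using l by simp
qed

section \<open>Rearrangements\<close>

definition perm_word :: "nat list \<Rightarrow> bool" where
 "perm_word p \<longleftrightarrow> distinct p \<and> set p = {1..length p}"

definition marked_idx :: "int set list \<Rightarrow> int set set \<Rightarrow> nat list" where
 "marked_idx As X = filter (\<lambda>j. As ! j \<in> X) [0..<length As]"

text \<open>The local index map \<open>a\<close> of \<open>rearrange\<close>, isolated in order to
  prove it bijective. Letters of the word start at 1 and list positions at 0.\<close>

definition amap :: "nat list \<Rightarrow> nat list \<Rightarrow> nat \<Rightarrow> nat" where
 "amap p iz j = (if j \<in> set iz then iz ! (p ! (THE t. t < length iz \<and> iz ! t = j) - 1) else j)"

lemma rearrange_eq:
 "rearrange p (S, X) = (let As = nonnested_list S; S' = pconcat_list (map (\<lambda>j. restr S {Min (As ! amap p (marked_idx As X) j)..Max (As ! amap p (marked_idx As X) j)}) [0..<length As])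
  in (S', transfer_blocks As (nonnested_list S') X))"
 unfolding rearrange_def Let_def amap_def marked_idx_def by simp

lemma amap_nth:
 assumes "distinct iz" "t < length iz"
 shows "amap p iz (iz ! t) = iz ! (p ! t - 1)"
proof -
 have "(THE u. u < length iz \<and> iz ! u = iz ! t) = t"
  by (rule the_equality) (use assms nth_eq_iff_index_eq in auto)
 thus ?thesis unfolding amap_def using assms(2) by simp
qed

lemma perm_word_nth:
 assumes "perm_word p" "t < length p"
 shows "1 \<le> p ! t" "p ! t - 1 < length p"
proof -
 have "p ! t \<in> {1..length p}" using assms nth_mem unfolding perm_word_def by blast
 thus "1 \<le> p ! t" "p ! t - 1 < length p" by auto
qed

lemma amap_bij:
 assumes "distinct iz" "set iz \<subseteq> {..<l}" "perm_word p" "length p = length iz"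
 shows "bij_betw (amap p iz) {..<l} {..<l}"
 unfolding bij_betw_def
proof
 have m: "\<exists>t<length iz. x = iz ! t \<and> amap p iz x = iz ! (p ! t - 1) \<and> p ! t - 1 < length iz \<and> 1 \<le> p ! t" if x: "x \<in> set iz" for x
 proof -
  obtain t where t: "t < length iz" "x = iz ! t" using x by (metis in_set_conv_nth)
  thus ?thesis using amap_nth[OF assms(1) t(1), of p] perm_word_nth[OF assms(3), of t] assms(4) by auto
 qed
 have o: "amap p iz x = x" if "x \<notin> set iz" for x unfolding amap_def using that by simp
 have i: "amap p iz x \<in> set iz" if "x \<in> set iz" for x using m[OF that] nth_mem by fastforce
 show inj: "inj_on (amap p iz) {..<l}"
 proof (rule inj_onI)
  fix x y assume e: "amap p iz x = amap p iz y"
  consider "x \<in> set iz" "y \<in> set iz" | "x \<in> set iz" "y \<notin> set iz" | "x \<notin> set iz" "y \<in> set iz" | "x \<notin> set iz" "y \<notin> set iz" by blast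
  thus "x = y"
  proof cases
   case 1
   obtain t where t: "t < length iz" "x = iz ! t" "amap p iz x = iz ! (p ! t - 1)" "p ! t - 1 < length iz" "1 \<le> p ! t" using m[OF 1(1)] by blast
   obtain u where u: "u < length iz" "y = iz ! u" "amap p iz y = iz ! (p ! u - 1)" "p ! u - 1 < length iz" "1 \<le> p ! u" using m[OF 1(2)] by blast
   have "p ! t - 1 = p ! u - 1" using e t(3,4) u(3,4) nth_eq_iff_index_eq[OF assms(1) t(4) u(4)] by simp
   hence "p ! t = p ! u" using t(5) u(5) by linarith
   hence "t = u" using nth_eq_iff_index_eq[of p t u] assms(3,4) t(1) u(1) unfolding perm_word_def by simp
   thus ?thesis using t u by simp
  next case 2 thus ?thesis using i[OF 2(1)] unfolding e o[OF 2(2)] by blast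
  next case 3 thus ?thesis using i[OF 3(2)] unfolding e[symmetric] o[OF 3(1)] by blast
  next case 4 show ?thesis using e unfolding o[OF 4(1)] o[OF 4(2)] .
  qed
 qed
 show "amap p iz ` {..<l} = {..<l}"
 proof (rule endo_inj_surj[OF _ _ inj])
  show "amap p iz ` {..<l} \<subseteq> {..<l}"
  proof
   fix y assume "y \<in> amap p iz ` {..<l}"
   then obtain x where x: "x < l" "y = amap p iz x" by blast
   show "y \<in> {..<l}"
   proof (cases "x \<in> set iz")
    case True thus ?thesis using i[OF True] assms(2) x by blast
   next case False have "y = x" unfolding x(2) by (rule o[OF False])
    thus ?thesis using x(1) by simp
   qed
  qed
 qed simp
qed

lemma card_nonnested_list:
 assumes "S \<in> NC m"
 shows "map card (nonnested_list S) = map (\<lambda>C. card (topb C)) (comps S)"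
proof -
 have "map card (nonnested_list (pconcat_list cs)) = map (\<lambda>C. card (topb C)) cs" if "\<forall>C\<in>set cs. \<exists>c. C \<in> NCc c" for cs
  using that
 proof (induction cs rule: rev_induct)
  case Nil thus ?case by (simp add: pconcat_list_def)
 next case (snoc C cs)
  then obtain c where C: "C \<in> NCc c" by auto
  have *: "\<forall>C\<in>set cs. \<exists>c. C \<in> NC c" using snoc NCcD(1) by fastforce
  show ?case unfolding pconcat_list_snoc[OF *] nonnested_list_concat[OF pconcat_list_NC[OF *] C] using snoc by simp
 qed
 thus ?thesis using NC_comps[OF assms] by metis
qed

lemma W_pconcat_list:
 assumes "\<forall>C\<in>set cs. \<exists>c. C \<in> NC c"
 shows "W (pconcat_list cs) = sum_list (map W cs)"
 using assms
proof (induction cs)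
 case Nil thus ?case by (simp add: pconcat_list_def W_def wd_def)
next case (Cons C cs)
 then obtain c where C: "C \<in> NC c" by auto
 have 1: "pconcat_list (C # cs) = C \<uplus> pconcat_list cs" by (simp add: pconcat_list_def)
 have *: "\<forall>C\<in>set cs. \<exists>c. C \<in> NC c" using Cons by simp
 show ?case unfolding 1 W_concat[OF C pconcat_list_NC[OF *]] using Cons by simp
qed

lemma mset_map_bij:
 assumes "bij_betw a {..<length xs} {..<length xs}"
 shows "mset (map (\<lambda>j. xs ! a j) [0..<length xs]) = mset xs"
proof -
 have "mset (map (\<lambda>j. xs ! a j) [0..<length xs]) = image_mset ((!) xs) (image_mset a (mset_set {..<length xs}))"
  by (simp add: multiset.map_comp comp_def atLeast0LessThan)
 also have "image_mset a (mset_set {..<length xs}) = mset_set {..<length xs}"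
  using assms image_mset_mset_set[of a "{..<length xs}"] unfolding bij_betw_def by simp
 also have "image_mset ((!) xs) \<dots> = mset (map ((!) xs) [0..<length xs])" by (simp add: atLeast0LessThan)
 finally show ?thesis by (simp add: map_nth)
qed

text \<open>The index map permutes all positions, so the components of the result are those of
  \<open>S\<close> in another order. Size and multiset of block sizes are then unchanged, and the
  nonnested blocks of the result are the top blocks in the new order.\<close>

lemma rearrange:
 assumes SX: "(S, X) \<in> NCNN m" and p: "perm_word p" "length p = card X"
 defines "As \<equiv> nonnested_list S" and "a \<equiv> amap p (marked_idx (nonnested_list S) X)"
 obtains S' where "rearrange p (S, X) = (S', transfer_blocks As (nonnested_list S') X)"
  "S' \<in> NC m" "comps S' = map (\<lambda>j. comps S ! a j) [0..<length As]" "W S' = W S"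
  "map card (nonnested_list S') = map (\<lambda>j. card (As ! a j)) [0..<length As]"
  "bij_betw a {..<length As} {..<length As}" "length (marked_idx As X) = card X"
proof -
 have S: "S \<in> NC m" "X \<subseteq> {B \<in> S. nonnested S B}" using SX unfolding NCNN_def by auto
 note nn = nonnested_list_props[OF S(1), folded As_def]
 have XA: "X \<subseteq> set As" using S(2) nn(1) by simp
 have dz: "distinct (marked_idx As X)" unfolding marked_idx_def by simp
 have sz: "set (marked_idx As X) \<subseteq> {..<length As}" unfolding marked_idx_def by auto
 have "by_max X = map ((!) As) (marked_idx As X)" unfolding marked_idx_def by (rule by_max_filter[OF nn(2) XA])
 hence lz: "length (marked_idx As X) = card X" using part_by_max(4)[OF NC_part[OF S(1)], of X] S(2) by (metis (no_types, lifting) length_map mem_Collect_eq subset_iff)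
 have bij: "bij_betw a {..<length As} {..<length As}" unfolding a_def As_def[symmetric] by (rule amap_bij[OF dz sz p(1)]) (simp add: p lz)
 have aj: "a j < length As" if "j < length As" for j using bij_betwE[OF bij] that by blast
 define cs where "cs = map (\<lambda>j. comps S ! a j) [0..<length As]"
 have lc: "length (comps S) = length As" unfolding As_def by (rule length_comps)
 have m1: "map (\<lambda>j. restr S {Min (As ! a j)..Max (As ! a j)}) [0..<length As] = cs"
  unfolding cs_def comps_def As_def[symmetric] by (rule map_cong[OF refl]) (use aj in simp)
 have csm: "mset cs = mset (comps S)" using mset_map_bij[of a "comps S"] bij unfolding cs_def lc by simp
 have cc: "\<forall>C\<in>set cs. \<exists>c. C \<in> NCc c" using NC_comps[OF S(1)] mset_eq_setD[OF csm] by simp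
 hence cN: "\<forall>C\<in>set cs. \<exists>c. C \<in> NC c" using NCcD(1) by blast
 have cN': "\<forall>C\<in>set (comps S). \<exists>c. C \<in> NC c" using cN mset_eq_setD[OF csm] by simp
 define S' where "S' = pconcat_list cs"
 have sm: "sum_list (map f cs) = sum_list (map f (comps S))" for f :: "int set set \<Rightarrow> 'z::comm_monoid_add"
  using csm by (metis mset_map sum_mset_sum_list)
 have S'1: "S' \<in> NC (sum_list (map psize (comps S)))" unfolding S'_def using pconcat_list_NC[OF cN] sm[of psize] by simp
 have "S \<in> NC (sum_list (map psize (comps S)))" using pconcat_list_NC[OF cN'] NC_comps[OF S(1)] by simp
 hence "sum_list (map psize (comps S)) = m" using NC_psize[OF S(1)] NC_psize by metis
 hence S'2: "S' \<in> NC m" using S'1 by simp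
 have cS': "comps S' = cs" unfolding S'_def by (rule comps_pconcat_list[OF cc])
 have W': "W S' = W S"
 proof -
  have "W S = sum_list (map W (comps S))" using W_pconcat_list[OF cN'] NC_comps[OF S(1)] by simp
  thus ?thesis unfolding S'_def W_pconcat_list[OF cN] sm by (rule sym)
 qed
 have "map card (nonnested_list S') = map (\<lambda>C. card (topb C)) cs" unfolding card_nonnested_list[OF S'2] cS' ..
 also have "\<dots> = map (\<lambda>j. card (As ! a j)) [0..<length As]"
 proof -
  have "card (topb (comps S ! j)) = card (As ! j)" if "j < length As" for j
   using arg_cong[OF card_nonnested_list[OF S(1)], of "\<lambda>l. l ! j"] that lc unfolding As_def by simp
  thus ?thesis unfolding cs_def using aj by simp
 qed
 finally have mc: "map card (nonnested_list S') = map (\<lambda>j. card (As ! a j)) [0..<length As]" .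
 have r: "rearrange p (S, X) = (S', transfer_blocks As (nonnested_list S') X)"
  unfolding rearrange_eq Let_def S'_def m1[symmetric] As_def a_def ..
 show thesis using that[OF r S'2 _ W' mc bij lz] cS' unfolding cs_def by blast
qed

text \<open>Marked positions stay marked and exchange components only among themselves, so the list
  of marked sizes is read through the word.\<close>

lemma rearrange_props:
 assumes SX: "(S, X) \<in> NCNN m" and p: "perm_word p" "length p = card X"
 shows "rearrange p (S, X) \<in> NCNN m" "card (snd (rearrange p (S, X))) = card X"
  "stat (rearrange p (S, X)) = (fst (stat (S, X)), map (\<lambda>x. snd (stat (S, X)) ! (x - 1)) p)"
proof -
 have S: "S \<in> NC m" "X \<subseteq> {B \<in> S. nonnested S B}" using SX unfolding NCNN_def by auto
 define As where "As = nonnested_list S"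
 define iz where "iz = marked_idx As X"
 obtain S' where r: "rearrange p (S, X) = (S', transfer_blocks As (nonnested_list S') X)"
  "S' \<in> NC m" "W S' = W S"
  "map card (nonnested_list S') = map (\<lambda>j. card (As ! amap p iz j)) [0..<length As]" "length iz = card X"
  unfolding As_def iz_def using rearrange[OF assms] by metis
 let ?As' = "nonnested_list S'" and ?X' = "transfer_blocks As (nonnested_list S') X"
 note nn = nonnested_list_props[OF S(1), folded As_def] and nn' = nonnested_list_props[OF r(2)]
 have XA: "X \<subseteq> set As" using S(2) nn(1) by simp
 have l: "length ?As' = length As" using arg_cong[OF r(4), of length] by simp
 have X': "?X' \<subseteq> {B \<in> S'. nonnested S' B}" using transfer_subset[OF l, of X] nn'(1) by simp
 thus "rearrange p (S, X) \<in> NCNN m" unfolding r NCNN_def using r(2) by simp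
 have bm: "by_max ?X' = map ((!) ?As') iz" unfolding iz_def marked_idx_def by (rule by_max_transfer[OF l nn(3) nn'(2)])
 have bX: "by_max X = map ((!) As) iz" unfolding iz_def marked_idx_def by (rule by_max_filter[OF nn(2) XA])
 have "?X' \<subseteq> S'" using X' by blast
 hence "card ?X' = length (by_max ?X')" using part_by_max(4)[OF NC_part[OF r(2)], of ?X'] by simp
 thus "card (snd (rearrange p (S, X))) = card X" unfolding r using bm r(5) by simp
 have iz: "iz ! t < length As" if "t < length iz" for t
  using nth_mem[OF that] unfolding iz_def marked_idx_def by auto
 have dz: "distinct iz" unfolding iz_def marked_idx_def by simp
 have "map card (by_max ?X') = map (\<lambda>x. map card (by_max X) ! (x - 1)) p"
 proof (rule nth_equalityI)
  show "length (map card (by_max ?X')) = length (map (\<lambda>x. map card (by_max X) ! (x - 1)) p)" using bm r(5) p by simp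
  fix t assume "t < length (map card (by_max ?X'))"
  hence t: "t < length iz" using bm by simp
  have "map card (by_max ?X') ! t = map card ?As' ! (iz ! t)" unfolding bm using t iz[OF t] l by simp
  also have "\<dots> = card (As ! amap p iz (iz ! t))" unfolding r(4) using iz[OF t] by simp
  also have "\<dots> = card (As ! (iz ! (p ! t - 1)))" unfolding amap_nth[OF dz t] ..
  also have "\<dots> = map (\<lambda>x. map card (by_max X) ! (x - 1)) p ! t"
   unfolding bX using t perm_word_nth[OF p(1), of t] p(2) r(5) by simp
  finally show "map card (by_max ?X') ! t = map (\<lambda>x. map card (by_max X) ! (x - 1)) p ! t" .
 qed
 moreover have "image_mset card (mset_set S') = image_mset card (mset_set S)"
  using card_mset_wd[OF NC_part[OF r(2)]] card_mset_wd[OF NC_part[OF S(1)]] r(3) unfolding W_def by simp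
 ultimately show "stat (rearrange p (S, X)) = (fst (stat (S, X)), map (\<lambda>x. snd (stat (S, X)) ! (x - 1)) p)"
  unfolding r stat_def by simp
qed

text \<open>Marks are transferred position by position, so the image still shows which positions
  were marked. This determines the permutation of the components, which can then be undone.\<close>

lemma rearrange_inj:
 assumes SX: "(S, X) \<in> NCNN m" "length p = card X" and TY: "(T, Y) \<in> NCNN m" "length p = card Y" and p: "perm_word p"
  and e: "rearrange p (S, X) = rearrange p (T, Y)"
 shows "S = T \<and> X = Y"
proof -
 have S: "S \<in> NC m" "X \<subseteq> {B \<in> S. nonnested S B}" using SX unfolding NCNN_def by auto
 have T: "T \<in> NC m" "Y \<subseteq> {B \<in> T. nonnested T B}" using TY unfolding NCNN_def by auto
 define As where "As = nonnested_list S"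
 define Bs where "Bs = nonnested_list T"
 obtain S' where r: "rearrange p (S, X) = (S', transfer_blocks As (nonnested_list S') X)"
  "S' \<in> NC m" "comps S' = map (\<lambda>j. comps S ! amap p (marked_idx As X) j) [0..<length As]"
  "map card (nonnested_list S') = map (\<lambda>j. card (As ! amap p (marked_idx As X) j)) [0..<length As]"
  "bij_betw (amap p (marked_idx As X)) {..<length As} {..<length As}"
  unfolding As_def using rearrange[OF SX(1) p SX(2)] by metis
 obtain T' where q: "rearrange p (T, Y) = (T', transfer_blocks Bs (nonnested_list T') Y)"
  "T' \<in> NC m" "comps T' = map (\<lambda>j. comps T ! amap p (marked_idx Bs Y) j) [0..<length Bs]"
  "map card (nonnested_list T') = map (\<lambda>j. card (Bs ! amap p (marked_idx Bs Y) j)) [0..<length Bs]"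
  "bij_betw (amap p (marked_idx Bs Y)) {..<length Bs} {..<length Bs}"
  unfolding Bs_def using rearrange[OF TY(1) p TY(2)] by metis
 have TS: "T' = S'" "transfer_blocks Bs (nonnested_list S') Y = transfer_blocks As (nonnested_list S') X" using e r(1) q(1) by auto
 note nS = nonnested_list_props[OF S(1), folded As_def] and nT = nonnested_list_props[OF T(1), folded Bs_def] and nn' = nonnested_list_props[OF r(2)]
 have XA: "X \<subseteq> set As" "Y \<subseteq> set Bs" using S(2) nS(1) T(2) nT(1) by auto
 have lA: "length (nonnested_list S') = length As" using arg_cong[OF r(4), of length] by simp
 have lB: "length (nonnested_list S') = length Bs" using arg_cong[OF q(4), of length] TS(1) by simp
 have l: "length Bs = length As" using lA lB by simp
 have iz: "marked_idx Bs Y = marked_idx As X" unfolding marked_idx_def l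
 proof (rule filter_cong[OF refl])
  fix j assume "j \<in> set [0..<length As]"
  hence j: "j < length As" by simp
  show "Bs ! j \<in> Y \<longleftrightarrow> As ! j \<in> X"
   using transfer_nth[OF lA nS(3) nn'(3) j, of X] transfer_nth[OF lB nT(3) nn'(3), of j Y] j l TS(2) by simp
 qed
 let ?a = "amap p (marked_idx As X)"
 have lc: "length (comps S) = length As" "length (comps T) = length As" using length_comps[of S] length_comps[of T] l unfolding As_def Bs_def by auto
 have m: "map (\<lambda>j. comps S ! ?a j) [0..<length As] = map (\<lambda>j. comps T ! ?a j) [0..<length As]"
  using r(3) q(3) TS(1) iz l by simp
 have "comps S = comps T"
 proof (rule nth_equalityI)
  show "length (comps S) = length (comps T)" using lc by simp
  fix i assume "i < length (comps S)"
  hence "i \<in> {..<length As}" using lc by simp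
  then obtain j where "j < length As" "i = ?a j" using bij_betw_imp_surj_on[OF r(5)] by (metis image_iff lessThan_iff)
  thus "comps S ! i = comps T ! i" using arg_cong[OF m, of "\<lambda>l. l ! j"] by simp
 qed
 hence ST: "S = T" using NC_comps[OF S(1)] NC_comps[OF T(1)] by metis
 hence "As = Bs" unfolding As_def Bs_def by simp
 hence "X = Y" using transfer_transfer[OF lA nS(3) nn'(3) XA(1)] transfer_transfer[OF lB nT(3) nn'(3) XA(2)] TS(2) by simp
 thus ?thesis using ST by simp
qed

lemma word_B: "perm_word (word_B k)" "length (word_B k) = k"
proof -
 show "perm_word (word_B k)" unfolding perm_word_def word_B_def Let_def
  by (cases "even k") (auto elim!: oddE)
 show "length (word_B k) = k" unfolding word_B_def Let_def by (cases "even k") (auto elim!: oddE)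
qed

text \<open>For \<open>k = 0\<close> and \<open>e \<noteq> 0\<close> the defining formula gives
  \<open>[0, 1]\<close>, hence the assumption; a triple without marks has
  \<open>e = 0\<close>.\<close>

lemma word_D:
 assumes "k = 0 \<longrightarrow> e = 0"
 shows "perm_word (word_D k e)" "length (word_D k e) = k"
proof -
 show "length (word_D k e) = k" unfolding word_D_def Let_def using assms by (cases "even k") (auto elim!: oddE evenE)
 show "perm_word (word_D k e)" unfolding perm_word_def word_D_def Let_def using assms
  by (cases "even k") (auto elim!: oddE evenE)
qed

lemma NCNN_finite_X: "(S, X) \<in> NCNN m \<Longrightarrow> finite X"
 unfolding NCNN_def using part_finite[OF NC_part] by (auto intro: finite_subset)

lemma finite_NCNN: "finite (NCNN m)"
proof (rule finite_subset)
 show "NCNN m \<subseteq> NC m \<times> Pow (Pow {1..int m})" unfolding NCNN_def using NC_part part_sub by fastforce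
qed (simp add: finite_NC)

text \<open>The word varies with the number of marks, but this number is preserved, so injectivity
  for a fixed word is enough. Surjectivity follows from finiteness.\<close>

lemma iota_B_bij: "bij_betw iota_B (NCNN m) (NCNN m)"
 unfolding bij_betw_def
proof
 have w: "iota_B (S, X) = rearrange (word_B (card X)) (S, X)" for S X unfolding iota_B_def by simp
 show i: "inj_on iota_B (NCNN m)"
 proof (rule inj_onI)
  fix A B assume AB: "A \<in> NCNN m" "B \<in> NCNN m" "iota_B A = iota_B B"
  obtain S X T Y where *: "A = (S, X)" "B = (T, Y)" by (cases A, cases B) auto
  have c: "card X = card Y"
   using rearrange_props(2)[OF AB(1)[unfolded *] word_B] rearrange_props(2)[OF AB(2)[unfolded *] word_B] AB(3) unfolding * w by simp
  show "A = B" using rearrange_inj[OF AB(1)[unfolded *] _ AB(2)[unfolded *] _ word_B(1), of "card X"] AB(3) c word_B(2) unfolding * w by simp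
 qed
 show "iota_B ` NCNN m = NCNN m"
 proof (rule endo_inj_surj[OF finite_NCNN _ i])
  show "iota_B ` NCNN m \<subseteq> NCNN m" using rearrange_props(1)[OF _ word_B] by (force simp: w)
 qed
qed

lemma iota_B_stat:
 assumes "A \<in> NCNN m"
 shows "stat (iota_B A) = (fst (stat A), map (\<lambda>x. snd (stat A) ! (x - 1)) (word_B (length (snd (stat A)))))"
proof -
 obtain S X where A: "A = (S, X)" by (cases A)
 have "length (by_max X) = card X" using assms part_by_max(4)[OF NC_part, of S m X] unfolding A NCNN_def by auto
 thus ?thesis using rearrange_props(3)[OF assms[unfolded A] word_B] unfolding A iota_B_def by (simp add: stat_def)
qed

definition triples :: "marked set \<Rightarrow> signed_marked set" where
 "triples M = {(S, X, e). (S, X) \<in> M \<and> e \<in> {-1, 0, 1} \<and> (X = {} \<longrightarrow> e = 0)}"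

definition stat3 :: "signed_marked \<Rightarrow> nat multiset \<times> nat list \<times> int" where
 "stat3 = (\<lambda>(S, X, e). (fst (stat (S, X)), snd (stat (S, X)), e))"

lemma iota_D_eq: "iota_D (S, X, e) = (let (S', X') = rearrange (word_D (card X) e) (S, X) in (S', X', e))"
 unfolding iota_D_def by simp

lemma iota_D_bij: "bij_betw iota_D (triples (NCNN m)) (triples (NCNN m))"
 unfolding bij_betw_def
proof
 have wd: "card X = 0 \<longrightarrow> e = 0" "(S, X) \<in> NCNN m" if "(S, X, e) \<in> triples (NCNN m)" for S X e
  using that NCNN_finite_X unfolding triples_def by auto
 show i: "inj_on iota_D (triples (NCNN m))"
 proof (rule inj_onI)
  fix A B assume AB: "A \<in> triples (NCNN m)" "B \<in> triples (NCNN m)" "iota_D A = iota_D B"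
  obtain S X e T Y e' where *: "A = (S, X, e)" "B = (T, Y, e')" by (cases A, cases B) auto
  note a = wd[OF AB(1)[unfolded *]] and b = wd[OF AB(2)[unfolded *]]
  have e: "e' = e" "rearrange (word_D (card X) e) (S, X) = rearrange (word_D (card Y) e') (T, Y)"
   using AB(3) unfolding * iota_D_eq Let_def by (auto split: prod.splits)
  have c: "card X = card Y"
   using rearrange_props(2)[OF a(2) word_D[OF a(1)]] rearrange_props(2)[OF b(2) word_D[OF b(1)]] e(2) by simp
  show "A = B" using rearrange_inj[OF a(2) _ b(2) _ word_D(1)[OF a(1)]] e c word_D(2)[OF a(1)] unfolding * by simp
 qed
 show "iota_D ` triples (NCNN m) = triples (NCNN m)"
 proof (rule endo_inj_surj[OF _ _ i])
  show "finite (triples (NCNN m))"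
  proof (rule finite_subset)
   show "triples (NCNN m) \<subseteq> (\<lambda>((S, X), e). (S, X, e)) ` (NCNN m \<times> {-1, 0, 1})" unfolding triples_def by force
  qed (simp add: finite_NCNN)
  show "iota_D ` triples (NCNN m) \<subseteq> triples (NCNN m)"
  proof
   fix B assume "B \<in> iota_D ` triples (NCNN m)"
   then obtain S X e where A: "(S, X, e) \<in> triples (NCNN m)" "B = iota_D (S, X, e)" by (metis imageE prod_cases3)
   note a = wd[OF A(1)]
   obtain S' X' where r: "rearrange (word_D (card X) e) (S, X) = (S', X')" by fastforce
   note rp = rearrange_props(1,2)[OF a(2) word_D[OF a(1)], unfolded r]
   have "X' = {} \<longrightarrow> e = 0" using rp(2) a(1) by auto
   thus "B \<in> triples (NCNN m)" unfolding A(2) iota_D_eq Let_def r using rp(1) A(1) unfolding triples_def by auto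
  qed
 qed
qed

lemma iota_D_stat:
 assumes "(S, X, e) \<in> triples (NCNN m)" "stat3 (S, X, e) = (U, L, e)"
 shows "stat3 (iota_D (S, X, e)) = (U, map (\<lambda>x. L ! (x - 1)) (word_D (length L) e), e)"
proof -
 have a: "(S, X) \<in> NCNN m" "card X = 0 \<longrightarrow> e = 0" using assms(1) NCNN_finite_X unfolding triples_def by auto
 have "X \<subseteq> S" using a(1) unfolding NCNN_def by auto
 hence l: "length L = card X" using a(1) part_by_max(4)[OF NC_part, of S m X] assms(2) unfolding NCNN_def stat3_def stat_def by auto
 obtain S' X' where r: "rearrange (word_D (card X) e) (S, X) = (S', X')" by fastforce
 show ?thesis using rearrange_props(3)[OF a(1) word_D[OF a(2)], unfolded r] assms(2) unfolding iota_D_eq Let_def r l by (simp add: stat3_def)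
qed

text \<open>A nonzero sign is allowed only in the presence of marks, so \<open>f\<close> has to
  preserve whether the marked set is empty.\<close>

lemma on_triples_bij:
 assumes "bij_betw f A B" "\<And>S X. (S, X) \<in> A \<Longrightarrow> snd (f (S, X)) = {} \<longleftrightarrow> X = {}"
 shows "bij_betw (on_triples f) (triples A) (triples B)"
proof -
 have o: "on_triples f (S, X, e) = (fst (f (S, X)), snd (f (S, X)), e)" for S X e unfolding on_triples_def by (simp add: case_prod_beta)
 show ?thesis
 proof (rule bij_betw_imageI)
  show "inj_on (on_triples f) (triples A)"
  proof (rule inj_onI)
   fix x y assume xy: "x \<in> triples A" "y \<in> triples A" "on_triples f x = on_triples f y"
   obtain S X e T Y e' where *: "x = (S, X, e)" "y = (T, Y, e')" by (cases x, cases y) auto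
   have "f (S, X) = f (T, Y)" "e = e'" using xy(3) unfolding * o by (auto intro: prod_eqI)
   moreover have "(S, X) \<in> A" "(T, Y) \<in> A" using xy unfolding * triples_def by auto
   ultimately show "x = y" using bij_betw_imp_inj_on[OF assms(1)] unfolding * inj_on_def by blast
  qed
  show "on_triples f ` triples A = triples B"
  proof (intro equalityI subsetI)
   fix y assume "y \<in> on_triples f ` triples A"
   then obtain S X e where *: "(S, X, e) \<in> triples A" "y = on_triples f (S, X, e)" by (metis imageE prod_cases3)
   hence SX: "(S, X) \<in> A" unfolding triples_def by auto
   hence "f (S, X) \<in> B" using bij_betwE[OF assms(1)] by blast
   thus "y \<in> triples B" using *(1) assms(2)[OF SX] unfolding *(2) o triples_def by auto
  next fix y assume y: "y \<in> triples B"
   obtain T Y e where *: "y = (T, Y, e)" by (cases y)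
   hence "(T, Y) \<in> B" using y unfolding triples_def by auto
   then obtain S X where SX: "(S, X) \<in> A" "f (S, X) = (T, Y)" using bij_betw_imp_surj_on[OF assms(1)] by (metis imageE prod.collapse)
   hence "(S, X, e) \<in> triples A" "on_triples f (S, X, e) = y" using y assms(2)[OF SX(1)] unfolding * o triples_def by auto
   thus "y \<in> on_triples f ` triples A" by blast
  qed
 qed
qed

section \<open>Symmetric partitions as matchings of marked blocks\<close>

abbreviation neg :: "int set \<Rightarrow> int set" where "neg B \<equiv> uminus ` B"

lemma mem_neg: "x \<in> neg B \<longleftrightarrow> - x \<in> B"
 by (auto simp: image_iff) (metis minus_minus)

lemma neg_Un: "neg (A \<union> B) = neg A \<union> neg B"
 by (rule image_Un)

lemma neg_neg [simp]: "neg (neg B) = B"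
 by (auto simp: image_image)

lemma neg_inj: "neg A = neg B \<longleftrightarrow> A = B"
 by (metis neg_neg)

definition pos :: "int set \<Rightarrow> int set" where
 "pos B = {x \<in> B. 0 < x}"

lemma phi_eq: "phi P = (pos ` P - {{}}, contained_blocks (pos ` P - {{}}) P)"
 unfolding phi_def Let_def pos_def ..

definition blk :: "int set set \<Rightarrow> (int set \<Rightarrow> int set) \<Rightarrow> int set \<Rightarrow> int set" where
 "blk X p A = (if A \<in> X then A \<union> neg (p A) else A)"

definition build :: "int set set \<Rightarrow> int set set \<Rightarrow> (int set \<Rightarrow> int set) \<Rightarrow> int set set" where
 "build S X p = blk X p ` S \<union> neg ` (blk X p ` S)"

text \<open>At most one fixed point is allowed because a fixed \<open>A\<close> yields the zero
  block \<open>A \<union> neg A\<close>.\<close>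

definition invol :: "int set set \<Rightarrow> (int set \<Rightarrow> int set) \<Rightarrow> bool" where
 "invol X p \<longleftrightarrow> (\<forall>A\<in>X. p A \<in> X \<and> p (p A) = A) \<and> (\<forall>A\<in>X. \<forall>B\<in>X. p A = A \<longrightarrow> p B = B \<longrightarrow> A = B)"

lemma invol_in: "invol X p \<Longrightarrow> A \<in> X \<Longrightarrow> p A \<in> X"
 and invol_inv: "invol X p \<Longrightarrow> A \<in> X \<Longrightarrow> p (p A) = A"
 and invol_fix: "invol X p \<Longrightarrow> A \<in> X \<Longrightarrow> B \<in> X \<Longrightarrow> p A = A \<Longrightarrow> p B = B \<Longrightarrow> A = B"
 unfolding invol_def by blast+

lemma build_cong: "(\<And>A. A \<in> X \<Longrightarrow> p A = q A) \<Longrightarrow> build S X p = build S X q"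
proof -
 assume *: "\<And>A. A \<in> X \<Longrightarrow> p A = q A"
 have "blk X p = blk X q" unfolding blk_def by (rule ext) (simp add: *)
 thus ?thesis unfolding build_def by simp
qed

lemma neg_blk: "invol X p \<Longrightarrow> A \<in> X \<Longrightarrow> neg (blk X p A) = blk X p (p A)"
 unfolding blk_def using invol_in[of X p A] invol_inv[of X p A] by (simp add: neg_Un Un_commute)

text \<open>Negation sends the mixed block of \<open>A\<close> to that of \<open>p A\<close>, so the
  mixed blocks are closed under negation and need to be listed only once.\<close>

lemma build_alt:
 assumes "X \<subseteq> S" "invol X p"
 shows "build S X p = (S - X) \<union> neg ` (S - X) \<union> (\<lambda>A. A \<union> neg (p A)) ` X"
proof -
 have "S = (S - X) \<union> X" using assms(1) by blast
 hence 1: "blk X p ` S = blk X p ` (S - X) \<union> blk X p ` X" by (metis image_Un)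
 have 2: "blk X p ` (S - X) = (\<lambda>A. A) ` (S - X)" by (rule image_cong[OF refl]) (simp add: blk_def)
 have 3: "blk X p ` X = (\<lambda>A. A \<union> neg (p A)) ` X" by (rule image_cong[OF refl]) (simp add: blk_def)
 have "neg ` (blk X p ` X) \<subseteq> blk X p ` X" using neg_blk[OF assms(2)] invol_in[OF assms(2)] by blast
 thus ?thesis unfolding build_def 1 image_Un 3 2 by auto
qed

context
 fixes m :: nat and S X :: "int set set" and p :: "int set \<Rightarrow> int set"
 assumes S: "parts m S" and X: "X \<subseteq> S" and p: "invol X p"

begin

lemma S_pos: "A \<in> S \<Longrightarrow> x \<in> A \<Longrightarrow> 1 \<le> x \<and> x \<le> int m"
 using part_sub[OF S] by fastforce

lemma pX: "A \<in> X \<Longrightarrow> p A \<in> S"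
 using X invol_in[OF p] by blast

lemma mem_blk_pos: "A \<in> S \<Longrightarrow> 0 < x \<Longrightarrow> x \<in> blk X p A \<longleftrightarrow> x \<in> A"
 unfolding blk_def using S_pos[OF pX, of A "- x"] by (auto simp: mem_neg)

lemma mem_blk_neg: "A \<in> S \<Longrightarrow> x < 0 \<Longrightarrow> x \<in> blk X p A \<longleftrightarrow> A \<in> X \<and> - x \<in> p A"
 unfolding blk_def using S_pos[of A x] by (auto simp: mem_neg)

lemma build_pos:
 assumes "B \<in> build S X p" "x \<in> B" "0 < x"
 shows "\<exists>A\<in>S. x \<in> A \<and> B = blk X p A"
proof -
 consider A where "A \<in> S" "B = blk X p A" | A where "A \<in> S" "B = neg (blk X p A)" using assms(1) unfolding build_def by blast
 thus ?thesis
 proof cases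
  case 1 thus ?thesis using mem_blk_pos[OF 1(1) assms(3)] assms(2) by blast
 next case 2
  hence "A \<in> X" using mem_blk_neg[OF 2(1), of "- x"] assms by (simp add: mem_neg)
  hence "B = blk X p (p A)" "p A \<in> S" using 2 neg_blk[OF p] pX by auto
  thus ?thesis using mem_blk_pos[of "p A" x] assms by blast
 qed
qed

lemma build_neg_closed: "B \<in> build S X p \<Longrightarrow> neg B \<in> build S X p"
 unfolding build_def by auto

lemma build_neg:
 assumes "B \<in> build S X p" "x \<in> B" "x < 0"
 shows "\<exists>A\<in>S. - x \<in> A \<and> B = neg (blk X p A)"
proof -
 have "neg B \<in> build S X p" "- x \<in> neg B" "0 < - x" using build_neg_closed assms by auto
 from build_pos[OF this] show ?thesis by (metis neg_neg)
qed

lemma build_pos_part: "A \<in> S \<Longrightarrow> pos (blk X p A) = A"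
 unfolding pos_def using mem_blk_pos[of A] S_pos[of A] unfolding blk_def by force

lemma build_partition: "partition_on ({1..int m} \<union> {- int m..-1}) (build S X p)"
proof (rule part_intro)
 have b: "x \<in> {1..int m} \<union> {- int m..-1}" if "A \<in> S" "x \<in> blk X p A" for A x
  using that S_pos[OF that(1)] S_pos[OF pX, of A "- x"] unfolding blk_def by (force simp: mem_neg split: if_splits)
 show "\<Union> (build S X p) = {1..int m} \<union> {- int m..-1}"
 proof (intro equalityI subsetI)
  fix x assume "x \<in> \<Union> (build S X p)"
  then obtain A where "A \<in> S" "x \<in> blk X p A \<or> - x \<in> blk X p A" unfolding build_def by (auto simp: mem_neg)
  thus "x \<in> {1..int m} \<union> {- int m..-1}" using b[of A x] b[of A "- x"] by auto
 next fix x assume x: "x \<in> {1..int m} \<union> {- int m..-1}"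
  hence "\<bar>x\<bar> \<in> {1..int m}" by auto
  then obtain A where A: "A \<in> S" "\<bar>x\<bar> \<in> A" using part_ex[OF S] by blast
  hence "\<bar>x\<bar> \<in> blk X p A" unfolding blk_def by simp
  hence "x \<in> blk X p A \<or> x \<in> neg (blk X p A)" by (simp add: mem_neg abs_if split: if_splits)
  moreover have "blk X p A \<in> build S X p" "neg (blk X p A) \<in> build S X p" unfolding build_def using A(1) by auto
  ultimately show "x \<in> \<Union> (build S X p)" by (metis UnionI)
 qed
 have "blk X p A \<noteq> {}" if "A \<in> S" for A using part_ne[OF S that] unfolding blk_def by auto
 thus "{} \<notin> build S X p" unfolding build_def by auto
 fix B C x assume *: "B \<in> build S X p" "C \<in> build S X p" "x \<in> B" "x \<in> C"
 hence "x \<noteq> 0"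
  using b unfolding build_def by (fastforce simp: mem_neg)
 then consider "0 < x" | "x < 0" by linarith
 thus "B = C"
 proof cases
  case 1
  obtain A D where "A \<in> S" "x \<in> A" "B = blk X p A" "D \<in> S" "x \<in> D" "C = blk X p D" using build_pos[OF *(1,3) 1] build_pos[OF *(2,4) 1] by blast
  moreover hence "A = D" by (rule_tac part_eq[OF S])
  ultimately show ?thesis by simp
 next case 2
  obtain A D where "A \<in> S" "- x \<in> A" "B = neg (blk X p A)" "D \<in> S" "- x \<in> D" "C = neg (blk X p D)" using build_neg[OF *(1,3) 2] build_neg[OF *(2,4) 2] by blast
  moreover hence "A = D" by (rule_tac part_eq[OF S])
  ultimately show ?thesis by simp
 qed
qed

lemma build_zero:
 assumes "B \<in> build S X p"
 shows "zero_block B \<longleftrightarrow> (\<exists>A\<in>X. p A = A \<and> B = A \<union> neg A)"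
proof
 assume z: "zero_block B"
 consider A where "A \<in> S" "B = blk X p A" | A where "A \<in> S" "B = neg (blk X p A)" using assms unfolding build_def by blast
 then obtain A where A: "A \<in> S" "B = blk X p A"
  using z unfolding zero_block_def by (metis neg_neg)
 obtain x where x: "x \<in> A" using part_ne[OF S A(1)] by blast
 have AX: "A \<in> X"
 proof (rule ccontr)
  assume "A \<notin> X"
  hence "neg A = A" using z A unfolding zero_block_def blk_def by simp
  hence "- x \<in> A" using x by blast
  thus False using S_pos[OF A(1) x] S_pos[OF A(1)] by fastforce
 qed
 have "blk X p (p A) = blk X p A" using neg_blk[OF p AX] z A(2) unfolding zero_block_def by simp
 hence "p A = A" using build_pos_part[OF A(1)] build_pos_part[OF pX[OF AX]] by simp
 thus "\<exists>A\<in>X. p A = A \<and> B = A \<union> neg A" using AX A(2) unfolding blk_def by auto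
next assume "\<exists>A\<in>X. p A = A \<and> B = A \<union> neg A"
 thus "zero_block B" unfolding zero_block_def by (auto simp: neg_Un)
qed

lemma build_Pi: "build S X p \<in> Pi_B m"
 unfolding Pi_B_def
proof (intro CollectI conjI ballI)
 show "partition_on ({1..int m} \<union> {- int m..-1}) (build S X p)" by (rule build_partition)
 show "neg B \<in> build S X p" if "B \<in> build S X p" for B by (rule build_neg_closed[OF that])
 show "\<exists>\<^sub>\<le>\<^sub>1B. B \<in> build S X p \<and> zero_block B"
  unfolding Uniq_def using build_zero invol_fix[OF p] by (metis)
qed

text \<open>The matching \<open>p\<close> is invisible to \<open>phi\<close>, which records only the
  positive parts and which of them are extended by negative elements.\<close>

lemma build_phi: "phi (build S X p) = (S, X)"
proof -
 have e: "pos ` build S X p - {{}} = S"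
 proof (intro equalityI subsetI)
  fix A assume A: "A \<in> pos ` build S X p - {{}}"
  then obtain B x where B: "B \<in> build S X p" "A = pos B" "x \<in> B" "0 < x" unfolding pos_def by blast
  obtain A' where "A' \<in> S" "B = blk X p A'" using build_pos[OF B(1,3,4)] by blast
  thus "A \<in> S" using build_pos_part B(2) by simp
 next fix A assume A: "A \<in> S"
  hence "A = pos (blk X p A)" using build_pos_part by simp
  thus "A \<in> pos ` build S X p - {{}}" using A part_ne[OF S A] unfolding build_def by blast
 qed
 have "contained_blocks S (build S X p) = X"
 proof (intro equalityI subsetI)
  fix A assume "A \<in> contained_blocks S (build S X p)"
  then obtain B where B: "A \<in> S" "B \<in> build S X p" "A \<subset> B" unfolding contained_blocks_def by blast
  obtain x where x: "x \<in> A" using part_ne[OF S B(1)] by blast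
  hence "x \<in> B" "0 < x" using B S_pos[OF B(1) x] by auto
  then obtain A' where A': "A' \<in> S" "x \<in> A'" "B = blk X p A'" using build_pos[OF B(2)] by blast
  hence "A' = A" using part_eq[OF S A'(1) B(1) A'(2) x] by simp
  thus "A \<in> X" using A'(3) B(3) unfolding blk_def by (auto split: if_splits)
 next fix A assume A: "A \<in> X"
  hence "A \<in> S" using X by blast
  obtain y where y: "y \<in> p A" using part_ne[OF S pX[OF A]] by blast
  have "- y \<notin> A" using S_pos[OF \<open>A \<in> S\<close>, of "- y"] S_pos[OF pX[OF A] y] by auto
  moreover have "- y \<in> blk X p A" using A y unfolding blk_def by (simp add: mem_neg)
  moreover have "A \<subseteq> blk X p A" unfolding blk_def by auto
  ultimately have "A \<subset> blk X p A" by blast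
  thus "A \<in> contained_blocks S (build S X p)" using \<open>A \<in> S\<close> unfolding contained_blocks_def build_def by blast
 qed
 thus ?thesis unfolding phi_eq e by simp
qed

end

lemma Pi_B_part: "P \<in> Pi_B m \<Longrightarrow> partition_on ({1..int m} \<union> {- int m..-1}) P"
 and Pi_B_neg: "P \<in> Pi_B m \<Longrightarrow> B \<in> P \<Longrightarrow> neg B \<in> P"
 and Pi_B_zero: "P \<in> Pi_B m \<Longrightarrow> A \<in> P \<Longrightarrow> B \<in> P \<Longrightarrow> zero_block A \<Longrightarrow> zero_block B \<Longrightarrow> A = B"
 unfolding Pi_B_def Uniq_def by blast+

text \<open>The matching sends \<open>pos B\<close> to \<open>pos (neg B)\<close>: the negative part
  of \<open>B\<close>, with its sign changed, is the positive part of the opposite block. This is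
  visibly an involution, and a fixed point is a zero block.\<close>

lemma Pi_build:
 assumes P: "P \<in> Pi_B m" and ph: "phi P = (S, X)"
 shows "parts m S" "X \<subseteq> S" "\<exists>p. invol X p \<and> P = build S X p"
proof -
 note pt = Pi_B_part[OF P]
 have Se: "S = pos ` P - {{}}" and Xe: "X = contained_blocks S P" using ph unfolding phi_eq by auto
 have nz: "x \<noteq> 0" if "B \<in> P" "x \<in> B" for B x using part_sub[OF pt that(1)] that(2) by auto
 have bl: "B = C" if "B \<in> P" "C \<in> P" "x \<in> pos B" "x \<in> C" for B C x
  using part_eq[OF pt that(1,2) _ that(4)] that(3) unfolding pos_def by simp
 show Sp: "parts m S"
 proof (rule part_intro)
  show "\<Union> S = {1..int m}"
  proof (intro equalityI subsetI)
   fix x assume "x \<in> \<Union> S"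
   then obtain B where "B \<in> P" "x \<in> pos B" unfolding Se by blast
   thus "x \<in> {1..int m}" using part_sub[OF pt, of B] unfolding pos_def by auto
  next fix x assume x: "x \<in> {1..int m}"
   then obtain B where B: "B \<in> P" "x \<in> B" using part_ex[OF pt, of x] by auto
   hence "x \<in> pos B" unfolding pos_def using x by simp
   thus "x \<in> \<Union> S" unfolding Se using B by blast
  qed
  show "{} \<notin> S" unfolding Se by simp
  fix A C x assume *: "A \<in> S" "C \<in> S" "x \<in> A" "x \<in> C"
  then obtain A' C' where "A' \<in> P" "C' \<in> P" "A = pos A'" "C = pos C'" unfolding Se by blast
  thus "A = C" using bl[of A' C' x] * unfolding pos_def by auto
 qed
 show "X \<subseteq> S" unfolding Xe contained_blocks_def by blast
 define p where "p A = {x. 0 < x \<and> (\<exists>B\<in>P. A \<subseteq> B \<and> - x \<in> B)}" for A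
 have pp: "p (pos B) = pos (neg B)" if B: "B \<in> P" "pos B \<noteq> {}" for B
 proof -
  obtain y where y: "y \<in> pos B" using B(2) by blast
  have "C = B" if "C \<in> P" "pos B \<subseteq> C" for C using bl[OF B(1) that(1) y] that(2) y by blast
  moreover have "pos B \<subseteq> B" unfolding pos_def by blast
  ultimately show ?thesis unfolding p_def using B(1) by (auto simp: pos_def mem_neg)
 qed
 have split: "B = pos B \<union> neg (pos (neg B))" if "B \<in> P" for B
 proof (intro equalityI subsetI)
  fix x assume x: "x \<in> B"
  thus "x \<in> pos B \<union> neg (pos (neg B))" using nz[OF that x] by (auto simp: pos_def mem_neg)
 next fix x assume "x \<in> pos B \<union> neg (pos (neg B))"
  thus "x \<in> B" by (auto simp: pos_def mem_neg)
 qed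
 have Xin: "pos B \<in> X \<longleftrightarrow> pos (neg B) \<noteq> {}" if B: "B \<in> P" "pos B \<noteq> {}" for B
 proof
  assume "pos B \<in> X"
  then obtain C where C: "C \<in> P" "pos B \<subset> C" unfolding Xe contained_blocks_def by blast
  obtain y where y: "y \<in> pos B" using B(2) by blast
  have "B = C" using bl[OF B(1) C(1) y] C(2) y by blast
  thus "pos (neg B) \<noteq> {}" using split[OF B(1)] C(2) by auto
 next assume "pos (neg B) \<noteq> {}"
  then obtain z where z: "z \<in> pos (neg B)" by blast
  hence "- z \<in> B" "- z \<notin> pos B" by (auto simp: pos_def mem_neg)
  moreover have "pos B \<subseteq> B" unfolding pos_def by blast
  ultimately have "pos B \<subset> B" by blast
  thus "pos B \<in> X" unfolding Xe contained_blocks_def using B Se by blast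
 qed
 have XB: "\<exists>B\<in>P. A = pos B \<and> pos B \<noteq> {} \<and> pos (neg B) \<noteq> {} \<and> p A = pos (neg B)" if "A \<in> X" for A
 proof -
  have "A \<in> S" using that \<open>X \<subseteq> S\<close> by blast
  then obtain B where B: "B \<in> P" "A = pos B" "pos B \<noteq> {}" unfolding Se by blast
  thus ?thesis using Xin[OF B(1,3)] pp[OF B(1,3)] that by auto
 qed
 have iv: "invol X p"
  unfolding invol_def
 proof (intro conjI ballI impI)
  fix A assume "A \<in> X"
  then obtain B where B: "B \<in> P" "A = pos B" "pos B \<noteq> {}" "pos (neg B) \<noteq> {}" "p A = pos (neg B)" using XB by blast
  have nB: "neg B \<in> P" by (rule Pi_B_neg[OF P B(1)])
  show "p A \<in> X" using Xin[OF nB B(4)] B by simp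
  show "p (p A) = A" unfolding B(5) pp[OF nB B(4)] using B(2) by simp
 next fix A C assume AC: "A \<in> X" "C \<in> X" "p A = A" "p C = C"
  obtain B where B: "B \<in> P" "A = pos B" "p A = pos (neg B)" using XB[OF AC(1)] by blast
  obtain D where D: "D \<in> P" "C = pos D" "p C = pos (neg D)" using XB[OF AC(2)] by blast
  have "B = A \<union> neg A" using split[OF B(1)] B AC by simp
  hence zB: "zero_block B" unfolding zero_block_def by (auto simp: neg_Un)
  have "D = C \<union> neg C" using split[OF D(1)] D AC by simp
  hence "zero_block D" unfolding zero_block_def by (auto simp: neg_Un)
  hence "B = D" using Pi_B_zero[OF P B(1) D(1) zB] by simp
  thus "A = C" using B D by simp
 qed
 have blk: "blk X p (pos B) = B" if B: "B \<in> P" "pos B \<noteq> {}" for B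
  unfolding blk_def Xin[OF B] pp[OF B] using split[OF B(1)] by auto
 have "P = build S X p"
 proof (intro equalityI subsetI)
  fix B assume B: "B \<in> P"
  show "B \<in> build S X p"
  proof (cases "pos B = {}")
   case False
   hence "pos B \<in> S" unfolding Se using B by blast
   thus ?thesis unfolding build_def using blk[OF B False] by (metis UnI1 imageI)
  next case True
   have nB: "neg B \<in> P" by (rule Pi_B_neg[OF P B])
   have ne: "pos (neg B) \<noteq> {}" using split[OF B] True part_ne[OF pt B] by auto
   hence "pos (neg B) \<in> S" unfolding Se using nB by blast
   hence "blk X p (pos (neg B)) \<in> blk X p ` S" by (rule imageI)
   hence "neg B \<in> blk X p ` S" unfolding blk[OF nB ne] .
   hence "neg (neg B) \<in> neg ` (blk X p ` S)" by (rule imageI)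
   thus ?thesis unfolding build_def by simp
  qed
 next fix B assume "B \<in> build S X p"
  then obtain A where A: "A \<in> S" "B = blk X p A \<or> B = neg (blk X p A)" unfolding build_def by blast
  then obtain C where C: "C \<in> P" "A = pos C" "pos C \<noteq> {}" unfolding Se by blast
  hence "blk X p A = C" using blk by simp
  thus "B \<in> P" using A(2) C(1) Pi_B_neg[OF P C(1)] by auto
 qed
 thus "\<exists>p. invol X p \<and> P = build S X p" using iv by blast
qed

lemma part_sub_X:
 assumes "parts m S" "X \<subseteq> S"
 shows "finite X" "inj_on Max X"
 using part_by_max(5)[OF assms] inj_on_subset[OF part_Max_inj[OF assms(1)] assms(2)] by auto

text \<open>Since \<open>phi\<close> forgets exactly the matching, it is bijective on a class as
  soon as membership amounts to a condition on \<open>(S, X)\<close> together with a condition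
  \<open>C X p\<close> satisfied by just one involution of each \<open>X\<close>.\<close>

lemma phi_bij:
 assumes sub: "\<P> \<subseteq> Pi_B m"
  and M: "\<And>S X. (S, X) \<in> M \<Longrightarrow> parts m S \<and> X \<subseteq> S"
  and char: "\<And>S X p. parts m S \<Longrightarrow> X \<subseteq> S \<Longrightarrow> invol X p \<Longrightarrow> build S X p \<in> \<P> \<longleftrightarrow> (S, X) \<in> M \<and> C X p"
  and ex: "\<And>X. finite X \<Longrightarrow> inj_on Max X \<Longrightarrow> \<exists>p. invol X p \<and> C X p"
  and uniq: "\<And>X p q A. finite X \<Longrightarrow> inj_on Max X \<Longrightarrow> invol X p \<Longrightarrow> invol X q \<Longrightarrow> C X p \<Longrightarrow> C X q \<Longrightarrow> A \<in> X \<Longrightarrow> p A = q A"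
 shows "bij_betw phi \<P> M"
proof -
 have b: "\<exists>S X p. phi P = (S, X) \<and> (S, X) \<in> M \<and> invol X p \<and> C X p \<and> P = build S X p" if "P \<in> \<P>" for P
 proof -
  obtain S X where ph: "phi P = (S, X)" by fastforce
  note B = Pi_build[OF subsetD[OF sub that] ph]
  obtain p where p: "invol X p" "P = build S X p" using B(3) by blast
  thus ?thesis using char[OF B(1,2) p(1)] that ph by blast
 qed
 show ?thesis
 proof (rule bij_betw_imageI)
  show "inj_on phi \<P>"
  proof (rule inj_onI)
   fix P Q assume PQ: "P \<in> \<P>" "Q \<in> \<P>" "phi P = phi Q"
   obtain S X p where p: "phi P = (S, X)" "(S, X) \<in> M" "invol X p" "C X p" "P = build S X p" using b[OF PQ(1)] by blast
   obtain T Y q where q: "phi Q = (T, Y)" "invol Y q" "C Y q" "Q = build T Y q" using b[OF PQ(2)] by blast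
   have f: "finite X" "inj_on Max X" using part_sub_X M[OF p(2)] by blast+
   have "T = S" "Y = X" using p(1) q(1) PQ(3) by auto
   thus "P = Q" using build_cong[of X p q S] uniq[OF f p(3) _ p(4), of q] q p(5) by simp
  qed
  show "phi ` \<P> = M"
  proof (intro equalityI subsetI)
   fix Z assume "Z \<in> phi ` \<P>"
   thus "Z \<in> M" using b by force
  next fix Z assume Z: "Z \<in> M"
   obtain S X where SX: "Z = (S, X)" by (cases Z)
   have s: "parts m S" "X \<subseteq> S" using M Z SX by auto
   obtain p where p: "invol X p" "C X p" using ex[OF part_sub_X[OF s]] by blast
   have "build S X p \<in> \<P>" using char[OF s p(1)] Z SX p(2) by simp
   moreover have "phi (build S X p) = Z" using build_phi[OF s p(1)] SX by simp
   ultimately show "Z \<in> phi ` \<P>" by blast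
  qed
 qed
qed

definition anti :: "int set set \<Rightarrow> (int set \<Rightarrow> int set) \<Rightarrow> bool" where
 "anti X p \<longleftrightarrow> (\<forall>A\<in>X. \<forall>B\<in>X. Max A < Max B \<longrightarrow> Max (p B) < Max (p A))"

text \<open>Applying \<open>p\<close> to the increasing list gives a decreasing list of the same
  set, and the sorted list of a set is unique.\<close>

lemma anti_rev:
 assumes "finite X" "inj_on Max X" "anti X p" "p ` X = X"
 shows "map p (by_max X) = rev (by_max X)"
proof -
 note b = by_max[OF assms(1,2)]
 have "sorted_wrt (\<lambda>A B. Max A < Max B) (by_max X)" using b(2) by (simp add: sorted_wrt_map)
 hence "sorted_wrt (\<lambda>A B. Max (p B) < Max (p A)) (by_max X)"
  using sorted_wrt_mono_rel[of "by_max X" "\<lambda>A B. Max A < Max B" "\<lambda>A B. Max (p B) < Max (p A)"] assms(3) b(1)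
  unfolding anti_def by blast
 hence "sorted_wrt (<) (map Max (rev (map p (by_max X))))" by (simp add: rev_map[symmetric] sorted_wrt_rev sorted_wrt_map)
 moreover have "set (rev (map p (by_max X))) = X" using b(1) assms(4) by simp
 ultimately have "by_max X = rev (map p (by_max X))" using b(5) by blast
 thus ?thesis by (metis rev_rev_ident)
qed

lemma invol_image: "invol X p \<Longrightarrow> p ` X = X"
proof (intro equalityI subsetI)
 assume p: "invol X p"
 show "x \<in> X" if "x \<in> p ` X" for x using that invol_in[OF p] by blast
 show "x \<in> p ` X" if "x \<in> X" for x using imageI[OF invol_in[OF p that], of p] unfolding invol_inv[OF p that] .
qed

text \<open>Reversal of a list as a map on its elements. The identity outside the list is used in
  type B, where a first block is kept fixed.\<close>

definition rp :: "'a list \<Rightarrow> 'a \<Rightarrow> 'a" where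
 "rp xs a = (case map_of (zip xs (rev xs)) a of None \<Rightarrow> a | Some b \<Rightarrow> b)"

lemma rp_nth: "distinct xs \<Longrightarrow> i < length xs \<Longrightarrow> rp xs (xs ! i) = xs ! (length xs - 1 - i)"
 unfolding rp_def by (simp add: map_of_zip_nth rev_nth)

lemma rp_other: "a \<notin> set xs \<Longrightarrow> rp xs a = a"
 unfolding rp_def by (metis length_rev map_of_zip_is_None option.simps(4))

lemma rp_invol: "distinct xs \<Longrightarrow> invol (set xs) (rp xs)"
 unfolding invol_def
proof (intro conjI ballI impI)
 assume d: "distinct xs"
 fix A assume "A \<in> set xs"
 then obtain i where i: "i < length xs" "A = xs ! i" by (metis in_set_conv_nth)
 hence r: "rp xs A = xs ! (length xs - 1 - i)" "length xs - 1 - i < length xs" using rp_nth[OF d i(1)] by auto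
 thus "rp xs A \<in> set xs" by simp
 show "rp xs (rp xs A) = A" using rp_nth[OF d r(2)] r i by simp
 fix B assume "B \<in> set xs" and e: "rp xs A = A" "rp xs B = B"
 then obtain j where j: "j < length xs" "B = xs ! j" by (metis in_set_conv_nth)
 have "xs ! (length xs - 1 - i) = xs ! i" using e(1) r(1) i(2) by metis
 hence "length xs - 1 - i = i" unfolding nth_eq_iff_index_eq[OF d r(2) i(1)] .
 moreover have "xs ! (length xs - 1 - j) = xs ! j" using e(2) rp_nth[OF d j(1)] j(2) by metis
 hence "length xs - 1 - j = j" using nth_eq_iff_index_eq[OF d, of "length xs - 1 - j" j] j(1) by force
 ultimately have "i = j" using i j by linarith
 thus "A = B" using i j by simp
qed

lemma sorted_nth_less:
 assumes "sorted_wrt (<) (map f xs)" "i < length xs" "j < length xs"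
 shows "f (xs ! i) < (f (xs ! j) :: 'b :: linorder) \<longleftrightarrow> i < j"
proof -
 have *: "f (xs ! i) < f (xs ! j)" if "i < j" "j < length xs" for i j
  using sorted_wrt_nth_less[OF assms(1), of i j] that by simp
 show ?thesis
 proof (cases i j rule: linorder_cases)
  case less thus ?thesis using *[OF less assms(3)] by simp
 next case greater thus ?thesis using less_not_sym[OF *[OF greater assms(2)]] by simp
 qed simp
qed

lemma rp_anti:
 assumes "sorted_wrt (<) (map Max xs)"
 shows "anti (set xs) (rp xs)"
 unfolding anti_def
proof (intro ballI impI)
 have "distinct (map Max xs)" using assms by (simp add: strict_sorted_iff)
 hence d: "distinct xs" unfolding distinct_map by blast
 fix A B assume "A \<in> set xs" "B \<in> set xs" and l: "Max A < Max B"
 then obtain i j where ij: "i < length xs" "A = xs ! i" "j < length xs" "B = xs ! j" by (metis in_set_conv_nth)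
 hence "i < j" using sorted_nth_less[OF assms ij(1,3)] l by simp
 thus "Max (rp xs B) < Max (rp xs A)" using ij rp_nth[OF d ij(1)] rp_nth[OF d ij(3)]
  sorted_nth_less[OF assms, of "length xs - 1 - j" "length xs - 1 - i"] by simp
qed

lemma key_index:
 assumes "sorted_wrt (\<lambda>x y. f x < (f y :: int)) us" "i < length us" "j < length us"
 shows "f (us ! i) < f (us ! j) \<longleftrightarrow> i < j"
 using sorted_nth_less[of f us i j] assms by (simp add: sorted_wrt_map)

text \<open>A key that increases along the list replaces list positions by inequalities between
  integers.\<close>

lemma noncrossing_key:
 assumes s: "sorted_wrt (\<lambda>x y. f x < (f y :: int)) us" and U: "\<And>B. B \<in> P \<Longrightarrow> B \<subseteq> set us"
 shows "noncrossing_wrt us P \<longleftrightarrow> (\<forall>A\<in>P. \<forall>B\<in>P. \<forall>a\<in>A. \<forall>b\<in>B. \<forall>c\<in>A. \<forall>d\<in>B. f a < f b \<longrightarrow> f b < f c \<longrightarrow> f c < f d \<longrightarrow> A = B)"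
proof
 assume n: "noncrossing_wrt us P"
 show "\<forall>A\<in>P. \<forall>B\<in>P. \<forall>a\<in>A. \<forall>b\<in>B. \<forall>c\<in>A. \<forall>d\<in>B. f a < f b \<longrightarrow> f b < f c \<longrightarrow> f c < f d \<longrightarrow> A = B"
 proof (intro ballI impI, rule ccontr)
  fix A B a b c d assume *: "A \<in> P" "B \<in> P" "a \<in> A" "b \<in> B" "c \<in> A" "d \<in> B" "f a < f b" "f b < f c" "f c < f d" "A \<noteq> B"
  have ix: "\<exists>i<length us. us ! i = x" if "x \<in> C" "C \<in> P" for x C using U[OF that(2)] that(1) by (metis in_set_conv_nth subsetD)
  obtain i where i: "i < length us" "us ! i = a" using ix[OF *(3,1)] by blast
  obtain j where j: "j < length us" "us ! j = b" using ix[OF *(4,2)] by blast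
  obtain k where k: "k < length us" "us ! k = c" using ix[OF *(5,1)] by blast
  obtain l where l: "l < length us" "us ! l = d" using ix[OF *(6,2)] by blast
  have "i < j" "j < k" "k < l" using key_index[OF s i(1) j(1)] key_index[OF s j(1) k(1)] key_index[OF s k(1) l(1)] *(7-9) i j k l by auto
  moreover have "us ! i \<in> A" "us ! k \<in> A" "us ! j \<in> B" "us ! l \<in> B" using *(3-6) i j k l by auto
  ultimately show False using n l(1) *(1,2,10) unfolding noncrossing_wrt_def by blast
 qed
next assume n: "\<forall>A\<in>P. \<forall>B\<in>P. \<forall>a\<in>A. \<forall>b\<in>B. \<forall>c\<in>A. \<forall>d\<in>B. f a < f b \<longrightarrow> f b < f c \<longrightarrow> f c < f d \<longrightarrow> A = B"
 show "noncrossing_wrt us P" unfolding noncrossing_wrt_def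
 proof (rule notI, elim exE conjE)
  fix i j k l B B'
  assume *: "i < j" "j < k" "k < l" "l < length us" "B \<in> P" "B' \<in> P" "B \<noteq> B'" "us ! i \<in> B" "us ! k \<in> B" "us ! j \<in> B'" "us ! l \<in> B'"
  have "f (us ! i) < f (us ! j)" "f (us ! j) < f (us ! k)" "f (us ! k) < f (us ! l)"
   using key_index[OF s, of i j] key_index[OF s, of j k] key_index[OF s, of k l] *(1-4) by auto
  hence "B = B'" using n[rule_format, OF *(5,6,8,10,9,11)] by simp
  thus False using *(7) by simp
 qed
qed

section \<open>Noncrossing partitions of type B\<close>

text \<open>Rank in the order \<open>1, ..., m, -1, ..., -m\<close>: the negative half is a shifted
  copy of the positive one.\<close>

definition kB :: "nat \<Rightarrow> int \<Rightarrow> int" where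
 "kB m x = (if 0 < x then x else int m - x)"

lemma kB_sorted: "sorted_wrt (\<lambda>x y. kB m x < kB m y) ([1..int m] @ map uminus [1..int m])"
proof -
 have 1: "sorted_wrt (\<lambda>x y. kB m x < kB m y) [1..int m]"
  by (rule sorted_wrt_mono_rel[OF _ sorted_wrt_upto]) (auto simp: kB_def)
 have 2: "sorted_wrt (\<lambda>x y. kB m (- x) < kB m (- y)) [1..int m]"
  by (rule sorted_wrt_mono_rel[OF _ sorted_wrt_upto]) (auto simp: kB_def)
 show ?thesis using 1 2 by (auto simp: sorted_wrt_append sorted_wrt_map kB_def)
qed

lemma kB_set: "set ([1..int m] @ map uminus [1..int m]) = {1..int m} \<union> {- int m..-1}"
proof -
 have "neg {1..int m} = {- int m..-1}" by (auto simp: mem_neg)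
 thus ?thesis by simp
qed

lemma NC_B_key:
 assumes "P \<in> Pi_B m"
 shows "P \<in> NC_B m \<longleftrightarrow> (\<forall>A\<in>P. \<forall>B\<in>P. \<forall>a\<in>A. \<forall>b\<in>B. \<forall>c\<in>A. \<forall>d\<in>B. kB m a < kB m b \<longrightarrow> kB m b < kB m c \<longrightarrow> kB m c < kB m d \<longrightarrow> A = B)"
 unfolding NC_B_def using assms noncrossing_key[OF kB_sorted, of P m] part_sub[OF Pi_B_part[OF assms]] unfolding kB_set by blast

text \<open>A different block with points on both sides of a point of \<open>A\<close> would either
  cross \<open>A\<close> or span it.\<close>

lemma nonnested_between:
 assumes S: "S \<in> NC m" and A: "A \<in> S" "nonnested S A" and D: "D \<in> S" "x1 \<in> D" "x3 \<in> D" and x: "x2 \<in> A" "x1 < x2" "x2 < x3"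
 shows "D = A"
proof (rule ccontr)
 assume ne: "D \<noteq> A"
 note p = NC_part[OF S]
 have n: "ncr S" using S unfolding NC_def by simp
 note M = part_Max[OF p _ A(1), simplified]
 have dis: "z \<notin> D" if "z \<in> A" for z using part_eq[OF p D(1) A(1) _ that] ne by blast
 have "\<not> x3 < Max A" using ncrD[OF n D(1) A(1) D(2) x(1) D(3) M(1) x(2,3)] ne by blast
 moreover have "x3 \<noteq> Max A" "x1 \<noteq> Min A" using dis[OF M(1)] dis[OF M(2)] D by metis+
 moreover have "\<not> Min A < x1" using ncrD[OF n A(1) D(1) M(2) D(2) x(1) D(3)] x ne by blast
 ultimately have "x1 < Min A" "Max A < x3" by auto
 thus False using A(2) D unfolding nonnested_NC[OF S A(1)] by blast
qed

text \<open>By \<open>nonnested_between\<close>, distinct nonnested blocks do not interleave, so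
  comparing their maxima compares all of their elements.\<close>

lemma nonnested_order:
 assumes S: "S \<in> NC m" and A: "A \<in> S" "nonnested S A" and B: "B \<in> S" "nonnested S B" and M: "Max A < Max B" and xy: "x \<in> A" "y \<in> B"
 shows "x < y"
proof (rule ccontr)
 assume c: "\<not> x < y"
 note p = NC_part[OF S]
 have ne: "B \<noteq> A" using M by auto
 hence "y \<noteq> x" using part_eq[OF p B(1) A(1) xy(2)] xy(1) by blast
 hence "y < x" using c by simp
 moreover have "x < Max B" using part_Max(3)[OF p _ A(1) xy(1)] M by simp
 ultimately show False using nonnested_between[OF S A B(1) xy(2) part_Max(1)[OF p _ B(1)] xy(1)] ne by simp
qed

text \<open>A mixed block reaches from its positive part past all larger positive numbers. Hence
  nothing can span a marked block, and two mixed blocks avoid crossing exactly if the negative ends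
  come in the opposite order of the positive ones.\<close>

lemma NC_B_char:
 assumes S: "parts m S" and X: "X \<subseteq> S" and p: "invol X p"
 shows "build S X p \<in> NC_B m \<longleftrightarrow> (S, X) \<in> NCNN m \<and> anti X p"
proof -
 let ?P = "build S X p" and ?b = "blk X p"
 note ctx = S X p
 note key = NC_B_key[OF build_Pi[OF ctx]]
 have bP: "?b A \<in> ?P" if "A \<in> S" for A unfolding build_def using that by blast
 have sub: "x \<in> ?b A" if "x \<in> A" for x A using that unfolding blk_def by auto
 have bneg: "- x \<in> ?b A" if "A \<in> X" "x \<in> p A" for x A using that unfolding blk_def by (auto simp: mem_neg)
 have binj: "A = B" if "A \<in> S" "B \<in> S" "?b A = ?b B" for A B
  using arg_cong[OF that(3), of pos] unfolding build_pos_part[OF ctx that(1)] build_pos_part[OF ctx that(2)] .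
 note Sp = S_pos[OF ctx] and pX = pX[OF ctx]
 have k1: "kB m x = x" if "A \<in> S" "x \<in> A" for x A using Sp[OF that] unfolding kB_def by simp
 have k2: "kB m (- x) = int m + x" if "A \<in> S" "x \<in> A" for x A using Sp[OF that] unfolding kB_def by simp
 note Mx = part_Max[OF S, simplified]
 show ?thesis
 proof
  assume "?P \<in> NC_B m"
  hence n: "A = B" if "A \<in> ?P" "B \<in> ?P" "a \<in> A" "b \<in> B" "c \<in> A" "d \<in> B" "kB m a < kB m b" "kB m b < kB m c" "kB m c < kB m d" for A B a b c d
   unfolding key using that by blast
  have "ncr S" unfolding ncr_def
  proof (intro ballI impI)
   fix A B a b c d assume *: "A \<in> S" "B \<in> S" "a \<in> A" "b \<in> B" "c \<in> A" "d \<in> B" "a < b" "b < c" "c < d"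
   have "?b A = ?b B" using n[OF bP[OF *(1)] bP[OF *(2)] sub[OF *(3)] sub[OF *(4)] sub[OF *(5)] sub[OF *(6)]]
    k1[OF *(1,3)] k1[OF *(2,4)] k1[OF *(1,5)] k1[OF *(2,6)] *(7-9) by simp
   thus "A = B" by (rule binj[OF *(1,2)])
  qed
  hence SN: "S \<in> NC m" using S unfolding NC_def by simp
  have nn: "nonnested S A" if A: "A \<in> X" for A
  proof -
   have AS: "A \<in> S" using A X by blast
   show ?thesis unfolding nonnested_NC[OF SN AS]
   proof (intro ballI notI)
    fix D x y assume D: "D \<in> S" "x \<in> D" "y \<in> D" "x < Min A \<and> Max A < y"
    \<comment> \<open>The point \<open>- z\<close> belongs to the block of \<open>A\<close> and
      ranks after all positive points, so \<open>x\<close>, \<open>Min A\<close>, \<open>y\<close>,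
      \<open>- z\<close> would be a crossing.\<close>
    obtain z where z: "z \<in> p A" using part_ne[OF S pX[OF A]] by blast
    have "Min A < y" using Mx(3)[OF AS Mx(2)[OF AS]] D(4) by simp
    hence "?b D = ?b A" using n[OF bP[OF D(1)] bP[OF AS] sub[OF D(2)] sub[OF Mx(2)[OF AS]] sub[OF D(3)] bneg[OF A z]]
     k1[OF D(1,2)] k1[OF AS Mx(2)[OF AS]] k1[OF D(1,3)] k2[OF pX[OF A] z] D(4) Sp[OF D(1,3)] Sp[OF pX[OF A] z] by simp
    hence "D = A" by (rule binj[OF D(1) AS])
    thus False using Mx(4)[OF AS] D by force
   qed
  qed
  have "anti X p" unfolding anti_def
  proof (intro ballI impI, rule ccontr)
   fix A B assume AB: "A \<in> X" "B \<in> X" "Max A < Max B" "\<not> Max (p B) < Max (p A)"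
   have S2: "A \<in> S" "B \<in> S" using AB X by auto
   have "p A \<noteq> p B"
   proof
    assume "p A = p B"
    from arg_cong[OF this, of p] have "A = B" unfolding invol_inv[OF p AB(1)] invol_inv[OF p AB(2)] .
    thus False using AB(3) by simp
   qed
   hence "Max (p A) \<noteq> Max (p B)" using part_Max_inj[OF S] pX[OF AB(1)] pX[OF AB(2)] unfolding inj_on_def by blast
   \<comment> \<open>This order gives the crossing \<open>Max A\<close>, \<open>Max B\<close>,
     \<open>- Max (p A)\<close>, \<open>- Max (p B)\<close>.\<close>
   hence l: "Max (p A) < Max (p B)" using AB(4) by simp
   note q = pX[OF AB(1)] pX[OF AB(2)]
   have "?b A = ?b B" using n[OF bP[OF S2(1)] bP[OF S2(2)] sub[OF Mx(1)[OF S2(1)]] sub[OF Mx(1)[OF S2(2)]] bneg[OF AB(1) Mx(1)[OF q(1)]] bneg[OF AB(2) Mx(1)[OF q(2)]]]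
    k1[OF S2(1) Mx(1)[OF S2(1)]] k1[OF S2(2) Mx(1)[OF S2(2)]] k2[OF q(1) Mx(1)[OF q(1)]] k2[OF q(2) Mx(1)[OF q(2)]] AB(3) l
    Sp[OF S2(2) Mx(1)[OF S2(2)]] Sp[OF q(1) Mx(1)[OF q(1)]] by simp
   hence "A = B" by (rule binj[OF S2])
   thus False using AB(3) by simp
  qed
  thus "(S, X) \<in> NCNN m \<and> anti X p" unfolding NCNN_def using SN nn X by auto
 next assume h: "(S, X) \<in> NCNN m \<and> anti X p"
  hence SN: "S \<in> NC m" and nn: "\<And>A. A \<in> X \<Longrightarrow> nonnested S A" and an: "anti X p" unfolding NCNN_def by auto
  have ncS: "ncr S" using SN unfolding NC_def by simp
  have bet: "D = A" if "A \<in> X" "D \<in> S" "x1 \<in> D" "x3 \<in> D" "x2 \<in> A" "x1 < x2" "x2 < x3" for A D x1 x2 x3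
   using nonnested_between[OF SN _ nn[OF that(1)] that(2-7)] that(1) X by blast
  have ord: "x < y" if "A \<in> X" "B \<in> X" "Max A < Max B" "x \<in> A" "y \<in> B" for A B x y
   using nonnested_order[OF SN _ nn[OF that(1)] _ nn[OF that(2)] that(3-5)] that(1,2) X by blast
  have Pnz: "x \<noteq> 0" if "B \<in> ?P" "x \<in> B" for B x using part_sub[OF build_partition[OF ctx] that(1)] that(2) by auto
  have Pm: "x \<le> int m" "- int m \<le> x" if "B \<in> ?P" "x \<in> B" for B x using part_sub[OF build_partition[OF ctx] that(1)] that(2) by auto
  have mono: "0 < x \<and> (0 < y \<longrightarrow> x < y)" if "kB m x < kB m y" "0 < y" "B \<in> ?P" "x \<in> B" "C \<in> ?P" "y \<in> C" for x y B C
   using that(1,2) Pm[OF that(3,4)] Pm[OF that(5,6)] Pnz[OF that(3,4)] unfolding kB_def by (auto split: if_splits)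
  have monon: "- x < - y" if "kB m x < kB m y" "x < 0" "y < 0" for x y
   using that unfolding kB_def by (auto split: if_splits)
  show "?P \<in> NC_B m" unfolding key
  proof (intro ballI impI)
   fix B1 B2 a b c d
   assume *: "B1 \<in> ?P" "B2 \<in> ?P" "a \<in> B1" "b \<in> B2" "c \<in> B1" "d \<in> B2" "kB m a < kB m b" "kB m b < kB m c" "kB m c < kB m d"
   have cd: "0 < c \<and> c < d" if "0 < d" using mono[OF *(9) that *(1,5,2,6)] that by blast
   have bc: "0 < b \<and> b < c" if "0 < c" using mono[OF *(8) that *(2,4,1,5)] that by blast
   have ab: "0 < a \<and> a < b" if "0 < b" using mono[OF *(7) that *(1,3,2,4)] that by blast
   note nz = Pnz[OF *(1,3)] Pnz[OF *(2,4)] Pnz[OF *(1,5)] Pnz[OF *(2,6)]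
   \<comment> \<open>Positive points have smaller rank than negative ones, so the signs of the four
     points are determined by how many of them are positive.\<close>
   consider "0 < d" | "0 < c" "d < 0" | "0 < b" "c < 0" "d < 0" | "0 < a" "b < 0" "c < 0" "d < 0" | "a < 0" "b < 0" "c < 0" "d < 0"
    using nz ab bc cd by linarith
   thus "B1 = B2"
   proof cases
    case 1
    hence o: "a < b" "b < c" "c < d" "0 < a" "0 < b" "0 < c" using ab bc cd by auto
    obtain A where A: "A \<in> S" "a \<in> A" "B1 = ?b A" using build_pos[OF ctx *(1,3) o(4)] by blast
    obtain D where D: "D \<in> S" "b \<in> D" "B2 = ?b D" using build_pos[OF ctx *(2,4) o(5)] by blast
    have "c \<in> A" "d \<in> D" using mem_blk_pos[OF ctx A(1) o(6)] mem_blk_pos[OF ctx D(1) 1] A(3) D(3) *(5,6) by auto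
    hence "A = D" using ncrD[OF ncS A(1) D(1) A(2) D(2)] o by blast
    thus ?thesis using A D by simp
   next case 2
    hence o: "a < b" "b < c" "0 < a" "0 < b" using ab bc by auto
    obtain A where A: "A \<in> S" "a \<in> A" "B1 = ?b A" using build_pos[OF ctx *(1,3) o(3)] by blast
    obtain D where D: "D \<in> S" "b \<in> D" "B2 = ?b D" using build_pos[OF ctx *(2,4) o(4)] by blast
    have "c \<in> A" using mem_blk_pos[OF ctx A(1) 2(1)] A(3) *(5) by auto
    moreover have "D \<in> X" using mem_blk_neg[OF ctx D(1) 2(2)] D(3) *(6) by simp
    ultimately have "A = D" using bet[OF _ A(1,2) _ D(2) o(1,2)] by blast
    thus ?thesis using A D by simp
   next case 3
    hence o: "a < b" "0 < a" using ab by auto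
    obtain A where A: "A \<in> S" "a \<in> A" "B1 = ?b A" using build_pos[OF ctx *(1,3) o(2)] by blast
    obtain D where D: "D \<in> S" "b \<in> D" "B2 = ?b D" using build_pos[OF ctx *(2,4) 3(1)] by blast
    have c: "A \<in> X" "- c \<in> p A" using mem_blk_neg[OF ctx A(1) 3(2)] A(3) *(5) by auto
    have d: "D \<in> X" "- d \<in> p D" using mem_blk_neg[OF ctx D(1) 3(3)] D(3) *(6) by auto
    have "A = D"
    proof (rule ccontr)
     assume "A \<noteq> D"
     hence "Max A \<noteq> Max D" using part_Max_inj[OF S] A(1) D(1) unfolding inj_on_def by auto
     moreover have "\<not> Max D < Max A" using ord[OF d(1) c(1) _ D(2) A(2)] o by auto
     ultimately have "Max A < Max D" by simp
     hence "Max (p D) < Max (p A)" using an c d unfolding anti_def by blast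
     hence "- d < - c" using ord[OF invol_in[OF p d(1)] invol_in[OF p c(1)] _ d(2) c(2)] by blast
     thus False using monon[OF *(9) 3(2,3)] by simp
    qed
    thus ?thesis using A D by simp
   next case 4
    obtain A where A: "A \<in> S" "a \<in> A" "B1 = ?b A" using build_pos[OF ctx *(1,3) 4(1)] by blast
    have c: "A \<in> X" "- c \<in> p A" using mem_blk_neg[OF ctx A(1) 4(3)] A(3) *(5) by auto
    obtain D where D: "D \<in> S" "- b \<in> D" "B2 = neg (?b D)" using build_neg[OF ctx *(2,4) 4(2)] by blast
    have "- d \<in> D" using mem_blk_pos[OF ctx D(1), of "- d"] 4(4) *(6) D(3) by (simp add: mem_neg)
    hence "D = p A" using bet[OF invol_in[OF p c(1)] D(1,2) _ c(2)] monon[OF *(8) 4(2,3)] monon[OF *(9) 4(3,4)] by blast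
    hence "B2 = neg (neg (?b A))" using D(3) neg_blk[OF p c(1)] by simp
    thus ?thesis using A(3) by simp
   next case 5
    obtain A where A: "A \<in> S" "- a \<in> A" "B1 = neg (?b A)" using build_neg[OF ctx *(1,3) 5(1)] by blast
    obtain D where D: "D \<in> S" "- b \<in> D" "B2 = neg (?b D)" using build_neg[OF ctx *(2,4) 5(2)] by blast
    have "- d \<in> D" using mem_blk_pos[OF ctx D(1), of "- d"] 5(4) *(6) D(3) by (simp add: mem_neg)
    moreover have "- c \<in> A" using mem_blk_pos[OF ctx A(1), of "- c"] 5(3) *(5) A(3) by (simp add: mem_neg)
    ultimately have "A = D" using ncrD[OF ncS A(1) D(1) A(2) D(2)] monon[OF *(7) 5(1,2)] monon[OF *(8) 5(2,3)] monon[OF *(9) 5(3,4)] by blast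
    thus ?thesis using A D by simp
   qed
  qed
 qed
qed

lemma anti_unique:
 assumes "finite X" "inj_on Max X" "invol X p" "invol X q" "anti X p" "anti X q" "A \<in> X"
 shows "p A = q A"
proof -
 have "map p (by_max X) = map q (by_max X)"
  using anti_rev[OF assms(1,2,5) invol_image[OF assms(3)]] anti_rev[OF assms(1,2,6) invol_image[OF assms(4)]] by simp
 thus ?thesis using set_by_max[OF assms(1,2)] assms(7) by (metis map_eq_conv)
qed

lemma anti_ex:
 assumes "finite X" "inj_on Max X"
 shows "invol X (rp (by_max X))" "anti X (rp (by_max X))"
 using rp_invol[OF distinct_by_max[OF assms]] rp_anti[OF sorted_by_max[OF assms]] unfolding set_by_max[OF assms] by auto

lemma NCNN_part: "(S, X) \<in> NCNN m \<Longrightarrow> parts m S \<and> X \<subseteq> S"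
 unfolding NCNN_def using NC_part by auto

lemma phi_NC_B_bij: "bij_betw phi (NC_B m) (NCNN m)"
proof (rule phi_bij[where C = anti])
 show "NC_B m \<subseteq> Pi_B m" unfolding NC_B_def by blast
 show "parts m S \<and> X \<subseteq> S" if "(S, X) \<in> NCNN m" for S X by (rule NCNN_part[OF that])
 show "build S X p \<in> NC_B m \<longleftrightarrow> (S, X) \<in> NCNN m \<and> anti X p" if "parts m S" "X \<subseteq> S" "invol X p" for S X p
  by (rule NC_B_char[OF that])
 show "\<exists>p. invol X p \<and> anti X p" if "finite X" "inj_on Max X" for X
  using anti_ex[OF that] by blast
 show "p A = q A" if "finite X" "inj_on Max X" "invol X p" "invol X q" "anti X p" "anti X q" "A \<in> X" for X p q A
  by (rule anti_unique[OF that])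
qed

text \<open>\<open>H\<close> contains one block from each opposite pair, so the pairs can be counted
  through \<open>H\<close>.\<close>

lemma btype_reps:
 assumes f: "finite H" and P: "P = H \<union> neg ` H \<union> Z" and Z: "\<And>B. B \<in> Z \<Longrightarrow> zero_block B"
  and H: "\<And>B. B \<in> H \<Longrightarrow> \<not> zero_block B" "\<And>B. B \<in> H \<Longrightarrow> neg B \<notin> H"
 shows "btype P = image_mset card (mset_set H)"
proof -
 let ?g = "\<lambda>B. {B, neg B}"
 have e: "{{B, neg B} |B. B \<in> P \<and> \<not> zero_block B} = ?g ` H"
 proof (intro equalityI subsetI)
  fix q assume "q \<in> {{B, neg B} |B. B \<in> P \<and> \<not> zero_block B}"
  then obtain B where B: "q = {B, neg B}" "B \<in> H \<or> B \<in> neg ` H" unfolding P using Z by blast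
  then consider "B \<in> H" | C where "C \<in> H" "B = neg C" by blast
  thus "q \<in> ?g ` H"
  proof cases
   case 1 thus ?thesis using B(1) by blast
  next case 2
   hence "q = ?g C" unfolding B(1) by auto
   thus ?thesis using 2(1) by blast
  qed
 next fix q assume "q \<in> ?g ` H"
  thus "q \<in> {{B, neg B} |B. B \<in> P \<and> \<not> zero_block B}" unfolding P using H(1) by blast
 qed
 have i: "inj_on ?g H"
 proof (rule inj_onI)
  fix B C assume "B \<in> H" "C \<in> H" "?g B = ?g C"
  thus "B = C" using H(2) by (metis doubleton_eq_iff)
 qed
 have c: "the_elem (card ` ?g B) = card B" for B :: "int set" by (simp add: card_image)
 have "btype P = image_mset (\<lambda>q. the_elem (card ` q)) (image_mset ?g (mset_set H))"
  unfolding btype_def e image_mset_mset_set[OF i] ..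
 also have "\<dots> = image_mset card (mset_set H)" unfolding multiset.map_comp comp_def c ..
 finally show ?thesis .
qed

text \<open>As representatives serve the unmarked positive blocks and, for each two-element orbit of
  \<open>p\<close>, the mixed block whose positive part has the smaller maximum. A fixed point gives
  the zero block, which does not count.\<close>

lemma btype_build:
 assumes S: "parts m S" and X: "X \<subseteq> S" and p: "invol X p"
 shows "btype (build S X p) = image_mset card (mset_set (S - X)) +
  image_mset (\<lambda>A. card A + card (p A)) (mset_set {A \<in> X. Max A < Max (p A)})"
proof -
 note ctx = S X p
 let ?b = "blk X p"
 let ?Y = "{A \<in> X. Max A < Max (p A)}"
 let ?F = "{A \<in> X. p A = A}"
 let ?H = "?b ` ((S - X) \<union> ?Y)"
 have fS: "finite S" using part_finite[OF S] by simp
 have YS: "(S - X) \<union> ?Y \<subseteq> S" using X by blast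
 have YX: "?Y \<subseteq> X" "finite ?Y" using part_sub_X(1)[OF S X] by auto
 have inj: "inj_on ?b S" by (rule inj_onI) (metis build_pos_part[OF ctx])
 have Max_neq: "Max (p A) \<noteq> Max A" if "A \<in> X" "p A \<noteq> A" for A
  using part_Max_inj[OF S] that X pX[OF ctx that(1)] unfolding inj_on_def by blast
 have "btype (build S X p) = image_mset card (mset_set ?H)"
 proof (rule btype_reps)
  show "finite ?H" using fS YX by simp
  show "build S X p = ?H \<union> neg ` ?H \<union> ?b ` ?F"
  proof (intro equalityI subsetI)
   fix B assume B: "B \<in> build S X p"
   have "?b A \<in> ?H \<union> neg ` ?H \<union> ?b ` ?F \<and> neg (?b A) \<in> ?H \<union> neg ` ?H \<union> ?b ` ?F" if A: "A \<in> S" for A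
   proof -
    consider "A \<in> S - X" | "A \<in> X" "p A = A" | "A \<in> X" "p A \<noteq> A" using A by blast
    thus ?thesis
    proof cases
     case 1 thus ?thesis by blast
    next case 2
     hence "neg (?b A) = ?b A" using neg_blk[OF p 2(1)] by simp
     thus ?thesis using 2 by auto
    next case 3
     have nb: "neg (?b A) = ?b (p A)" "?b A = neg (?b (p A))" using neg_blk[OF p 3(1)] neg_neg[of "?b A"] by simp_all
     consider "Max A < Max (p A)" | "Max (p A) < Max A" using Max_neq[OF 3] by linarith
     thus ?thesis
     proof cases
      case 1 thus ?thesis using 3(1) by blast
     next case 2
      hence "p A \<in> ?Y" using invol_in[OF p 3(1)] invol_inv[OF p 3(1)] by simp
      thus ?thesis using nb by blast
     qed
    qed
   qed
   thus "B \<in> ?H \<union> neg ` ?H \<union> ?b ` ?F" using B unfolding build_def by blast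
  next fix B assume "B \<in> ?H \<union> neg ` ?H \<union> ?b ` ?F"
   thus "B \<in> build S X p" using YS X unfolding build_def by blast
  qed
  show "zero_block B" if B: "B \<in> ?b ` ?F" for B
  proof -
   obtain A where "A \<in> X" "p A = A" "B = ?b A" using B by blast
   thus ?thesis using neg_blk[OF p, of A] unfolding zero_block_def by simp
  qed
  have nH: "neg (?b A) \<noteq> ?b C" if A: "A \<in> (S - X) \<union> ?Y" and C: "C \<in> (S - X) \<union> ?Y" for A C
  proof
   assume e: "neg (?b A) = ?b C"
   have CS: "C \<in> S" and AS: "A \<in> S" using A C X by auto
   obtain x where x: "x \<in> C" using part_ne[OF S CS] by blast
   hence "x \<in> ?b C" unfolding blk_def by simp
   hence "x \<in> neg (?b A)" unfolding e .
   hence "A \<in> X" using mem_blk_neg[OF ctx AS, of "- x"] S_pos[OF ctx CS x] by (simp add: mem_neg)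
   hence "?b (p A) = ?b C" using e neg_blk[OF p] by simp
   hence "p A = C" using build_pos_part[OF ctx CS] build_pos_part[OF ctx pX[OF ctx \<open>A \<in> X\<close>]] by simp
   hence "C \<in> ?Y" "A \<in> ?Y" using C A \<open>A \<in> X\<close> invol_in[OF p \<open>A \<in> X\<close>] by auto
   moreover have "p C = A" unfolding \<open>p A = C\<close>[symmetric] by (rule invol_inv[OF p \<open>A \<in> X\<close>])
   ultimately show False using \<open>p A = C\<close> by auto
  qed
  show "\<not> zero_block B" if "B \<in> ?H" for B using that nH unfolding zero_block_def by blast
  show "neg B \<notin> ?H" if "B \<in> ?H" for B using that nH by blast
 qed
 also have "mset_set ?H = image_mset ?b (mset_set ((S - X) \<union> ?Y))"
  by (rule image_mset_mset_set[symmetric]) (rule inj_on_subset[OF inj YS])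
 also have "mset_set ((S - X) \<union> ?Y) = mset_set (S - X) + mset_set ?Y"
  by (rule mset_set_Union) (use fS YX in auto)
 also have "image_mset card (image_mset ?b (mset_set (S - X) + mset_set ?Y)) =
  image_mset (\<lambda>A. card (?b A)) (mset_set (S - X)) + image_mset (\<lambda>A. card (?b A)) (mset_set ?Y)"
  by (simp add: multiset.map_comp comp_def)
 also have "image_mset (\<lambda>A. card (?b A)) (mset_set (S - X)) = image_mset card (mset_set (S - X))"
  by (rule image_mset_cong) (use fS in \<open>simp add: blk_def\<close>)
 also have "image_mset (\<lambda>A. card (?b A)) (mset_set ?Y) = image_mset (\<lambda>A. card A + card (p A)) (mset_set ?Y)"
 proof (rule image_mset_cong)
  fix A assume "A \<in># mset_set ?Y"
  hence A: "A \<in> X" "A \<in> S" using YX X by auto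
  have "A \<inter> neg (p A) = {}" using S_pos[OF ctx A(2)] S_pos[OF ctx pX[OF ctx A(1)]] by (force simp: mem_neg)
  hence "card (A \<union> neg (p A)) = card A + card (neg (p A))"
   using part_finite_block[OF S _ A(2)] part_finite_block[OF S _ pX[OF ctx A(1)]] by (intro card_Un_disjoint) auto
  thus "card (?b A) = card A + card (p A)" unfolding blk_def using A by (simp add: card_image)
 qed
 finally show ?thesis .
qed

text \<open>Adds the entries at opposite ends. The middle entry of a list of odd length is left out:
  under an order-reversing matching it belongs to the fixed block.\<close>

definition pairsum :: "nat list \<Rightarrow> nat multiset" where
 "pairsum L = mset (map (\<lambda>i. L ! i + L ! (length L - 1 - i)) [0..<length L div 2])"

lemma pairsum_rev:
 assumes s: "sorted_wrt (<) (map Max xs)" and p: "map p xs = rev xs"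
 shows "image_mset (\<lambda>A. card A + card (p A)) (mset_set {A \<in> set xs. Max A < Max (p A)}) = pairsum (map card xs)"
proof -
 let ?k = "length xs"
 have "distinct (map Max xs)" using s by (simp add: strict_sorted_iff)
 hence d: "distinct xs" unfolding distinct_map by blast
 have pn: "p (xs ! i) = xs ! (?k - 1 - i)" if "i < ?k" for i
  using arg_cong[OF p, of "\<lambda>l. l ! i"] that by (simp add: rev_nth)
 have e: "{A \<in> set xs. Max A < Max (p A)} = (!) xs ` {..<?k div 2}"
 proof (intro equalityI subsetI)
  fix A assume "A \<in> {A \<in> set xs. Max A < Max (p A)}"
  then obtain i where i: "i < ?k" "A = xs ! i" "Max A < Max (p A)" by (auto simp: in_set_conv_nth)
  hence "i < ?k - 1 - i" using pn[OF i(1)] sorted_nth_less[OF s i(1), of "?k - 1 - i"] by simp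
  thus "A \<in> (!) xs ` {..<?k div 2}" using i by auto
 next fix A assume "A \<in> (!) xs ` {..<?k div 2}"
  then obtain i where i: "i < ?k div 2" "A = xs ! i" by blast
  hence "i < ?k" "i < ?k - 1 - i" "?k - 1 - i < ?k" by auto
  thus "A \<in> {A \<in> set xs. Max A < Max (p A)}" using pn sorted_nth_less[OF s, of i "?k - 1 - i"] i by simp
 qed
 have inj: "inj_on ((!) xs) {..<?k div 2}" by (rule inj_on_nth[OF d]) auto
 have "image_mset (\<lambda>A. card A + card (p A)) (mset_set {A \<in> set xs. Max A < Max (p A)}) =
  image_mset (\<lambda>i. card (xs ! i) + card (p (xs ! i))) (mset_set {..<?k div 2})"
  unfolding e image_mset_mset_set[OF inj, symmetric] multiset.map_comp comp_def ..
 also have "\<dots> = image_mset (\<lambda>i. map card xs ! i + map card xs ! (length (map card xs) - 1 - i)) (mset_set {..<?k div 2})"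
 proof (rule image_mset_cong)
  fix i assume "i \<in># mset_set {..<?k div 2}"
  hence "i < ?k" "?k - 1 - i < ?k" by auto
  thus "card (xs ! i) + card (p (xs ! i)) = map card xs ! i + map card xs ! (length (map card xs) - 1 - i)" using pn by simp
 qed
 also have "\<dots> = pairsum (map card xs)" unfolding pairsum_def by (simp add: atLeast0LessThan)
 finally show ?thesis .
qed

definition rest :: "nat multiset \<times> nat list \<Rightarrow> nat multiset" where
 "rest = (\<lambda>(T, L). T - mset L)"

lemma rest_stat:
 assumes S: "parts m S" and X: "X \<subseteq> S"
 shows "rest (stat (S, X)) = image_mset card (mset_set (S - X))"
proof -
 have fS: "finite S" using part_finite[OF S] by simp
 have "(S - X) \<inter> X = {}" by blast
 hence "mset_set S = mset_set (S - X) + mset_set X"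
  using mset_set_Union[of "S - X" X] fS finite_subset[OF X fS] X by (simp add: Un_absorb2)
 moreover have "image_mset card (mset_set X) = mset (map card (by_max X))"
  by (rule image_card_by_max[OF part_sub_X[OF S X]])
 ultimately show ?thesis unfolding rest_def stat_def by simp
qed

lemma btype_build_anti:
 assumes S: "parts m S" and X: "X \<subseteq> S" and p: "invol X p" "anti X p"
 shows "btype (build S X p) = rest (stat (S, X)) + pairsum (snd (stat (S, X)))"
proof -
 note f = part_sub_X[OF S X]
 have "image_mset (\<lambda>A. card A + card (p A)) (mset_set {A \<in> X. Max A < Max (p A)}) = pairsum (map card (by_max X))"
  using pairsum_rev[OF sorted_by_max[OF f] anti_rev[OF f p(2) invol_image[OF p(1)]]] unfolding set_by_max[OF f] .
 thus ?thesis unfolding btype_build[OF S X p(1)] rest_stat[OF S X] by (simp add: stat_def)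
qed

lemma NC_B_type:
 assumes "P \<in> NC_B m"
 shows "btype P = rest (stat (phi P)) + pairsum (snd (stat (phi P)))"
proof -
 obtain S X where ph: "phi P = (S, X)" by fastforce
 have Pi: "P \<in> Pi_B m" using assms unfolding NC_B_def by blast
 note B = Pi_build[OF Pi ph]
 obtain p where p: "invol X p" "P = build S X p" using B(3) by blast
 hence "anti X p" using NC_B_char[OF B(1,2) p(1)] assms by simp
 thus ?thesis using btype_build_anti[OF B(1,2) p(1)] p(2) ph by simp
qed

section \<open>Nonnesting partitions of types C and B\<close>

definition ke :: "(int \<Rightarrow> int) \<Rightarrow> int set \<Rightarrow> int \<Rightarrow> int \<Rightarrow> bool" where
 "ke f B x y \<longleftrightarrow> x \<in> B \<and> y \<in> B \<and> f x < f y \<and> (\<forall>z\<in>B. \<not> (f x < f z \<and> f z < f y))"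

definition kedge :: "(int \<Rightarrow> int) \<Rightarrow> int set set \<Rightarrow> int \<Rightarrow> int \<Rightarrow> bool" where
 "kedge f P x y \<longleftrightarrow> (\<exists>B\<in>P. ke f B x y)"

lemma ke_above:
 assumes "finite B" "x \<in> B" "y \<in> B" "f x < f y"
 shows "\<exists>z. ke f B x z \<and> f z \<le> f y"
proof -
 define v where "v = Min (f ` {z\<in>B. f x < f z})"
 have "v \<in> f ` {z\<in>B. f x < f z}" unfolding v_def by (rule Min_in) (use assms in auto)
 then obtain z where z: "z \<in> B" "f x < f z" "v = f z" by blast
 have m: "f z \<le> f w" if "w \<in> B" "f x < f w" for w unfolding z(3)[symmetric] v_def
  by (rule Min_le) (use assms that in auto)
 have "ke f B x z" unfolding ke_def using assms(2) z m by force
 thus ?thesis using m[OF assms(3,4)] by blast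
qed

text \<open>\<open>nonnesting_wrt\<close> requires only the outer pair to be consecutive in its
  block. The inner pair can be replaced by the edge that leaves its first point, since this edge
  ends no later.\<close>

lemma nonnesting_key:
 assumes s: "sorted_wrt (\<lambda>x y. f x < (f y :: int)) us" and U: "\<And>B. B \<in> P \<Longrightarrow> B \<subseteq> set us"
 shows "nonnesting_wrt us P \<longleftrightarrow> \<not> (\<exists>x y x' y'. kedge f P x y \<and> kedge f P x' y' \<and> f x < f x' \<and> f y' < f y)"
proof (rule iffI, rule notI)
 assume n: "nonnesting_wrt us P" and "\<exists>x y x' y'. kedge f P x y \<and> kedge f P x' y' \<and> f x < f x' \<and> f y' < f y"
 then obtain x y x' y' B B' where *: "B \<in> P" "ke f B x y" "B' \<in> P" "ke f B' x' y'" "f x < f x'" "f y' < f y" unfolding kedge_def by blast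
 have b: "x \<in> B" "y \<in> B" "x' \<in> B'" "y' \<in> B'" "f x' < f y'" using *(2,4) unfolding ke_def by auto
 have ne: "B \<noteq> B'" using *(2,5,6) b unfolding ke_def by force
 have ix: "\<exists>i<length us. us ! i = z" if "z \<in> C" "C \<in> P" for z C using U[OF that(2)] that(1) by (metis in_set_conv_nth subsetD)
 obtain i where i: "i < length us" "us ! i = x" using ix[OF b(1) *(1)] by blast
 obtain j where j: "j < length us" "us ! j = x'" using ix[OF b(3) *(3)] by blast
 obtain k where k: "k < length us" "us ! k = y'" using ix[OF b(4) *(3)] by blast
 obtain l where l: "l < length us" "us ! l = y" using ix[OF b(2) *(1)] by blast
 have "i < j" "j < k" "k < l" using key_index[OF s i(1) j(1)] key_index[OF s j(1) k(1)] key_index[OF s k(1) l(1)] *(5,6) b(5) i j k l by auto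
 moreover have "us ! t \<notin> B" if t: "i < t \<and> t < l" for t
 proof -
  have "t < length us" using t l by simp
  hence "f x < f (us ! t)" "f (us ! t) < f y" using key_index[OF s i(1), of t] key_index[OF s _ l(1), of t] t i l by auto
  thus ?thesis using *(2) unfolding ke_def by blast
 qed
 moreover have "us ! i \<in> B" "us ! l \<in> B" "us ! j \<in> B'" "us ! k \<in> B'" using b i j k l by auto
 ultimately show False using n l(1) *(1,3) ne unfolding nonnesting_wrt_def by blast
next assume n: "\<not> (\<exists>x y x' y'. kedge f P x y \<and> kedge f P x' y' \<and> f x < f x' \<and> f y' < f y)"
 show "nonnesting_wrt us P" unfolding nonnesting_wrt_def
 proof (rule notI, elim exE conjE)
  fix i j k l B B'
  assume *: "i < j" "j < k" "k < l" "l < length us" "B \<in> P" "B' \<in> P" "B \<noteq> B'" "us ! i \<in> B" "us ! l \<in> B"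
   "\<forall>t. i < t \<and> t < l \<longrightarrow> us ! t \<notin> B" "us ! j \<in> B'" "us ! k \<in> B'"
  have f: "f (us ! i) < f (us ! j)" "f (us ! j) < f (us ! k)" "f (us ! k) < f (us ! l)"
   using key_index[OF s, of i j] key_index[OF s, of j k] key_index[OF s, of k l] *(1-4) by auto
  have "ke f B (us ! i) (us ! l)" unfolding ke_def
  proof (intro conjI ballI notI)
   fix z assume z: "z \<in> B" "f (us ! i) < f z \<and> f z < f (us ! l)"
   obtain t where t: "t < length us" "us ! t = z" using U[OF *(5)] z(1) by (metis in_set_conv_nth subsetD)
   hence "i < t" "t < l" using key_index[OF s, of i t] key_index[OF s, of t l] z(2) *(1-4) by auto
   thus False using *(10) t z(1) by blast
  qed (use * f in auto)
  moreover have "finite B'" using U[OF *(6)] by (rule finite_subset) simp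
  then obtain z where "ke f B' (us ! j) z" "f z \<le> f (us ! k)" using ke_above[of B' "us ! j" "us ! k" f] *(11,12) f(2) by blast
  ultimately show False using n *(5,6) f unfolding kedge_def by (metis order_le_less_trans)
 qed
qed

text \<open>The positive half keeps its values and the negative half is its reflection at
  \<open>N\<close>. The bound on \<open>N\<close> separates the halves; \<open>N\<close> is
  \<open>2 * int m + 1\<close>, \<open>2 * int m + 2\<close> or \<open>2 * int m + 3\<close>
  according to whether zero, one or two central points have to be placed between them.\<close>

definition keyok :: "nat \<Rightarrow> int \<Rightarrow> (int \<Rightarrow> int) \<Rightarrow> bool" where
 "keyok m N f \<longleftrightarrow> 2 * int m < N \<and> (\<forall>x\<in>{1..int m}. f x = x \<and> f (- x) = N - x)"

lemma keyok: "keyok m N f \<Longrightarrow> 2 * int m < N" "keyok m N f \<Longrightarrow> x \<in> {1..int m} \<Longrightarrow> f x = x" "keyok m N f \<Longrightarrow> x \<in> {1..int m} \<Longrightarrow> f (- x) = N - x"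
 unfolding keyok_def by blast+

text \<open>Exactly one kind of edge leads from the lower to the upper part: from the last element
  below to the first one above.\<close>

lemma ke_Un:
 assumes "\<And>x y. x \<in> L \<Longrightarrow> y \<in> U \<Longrightarrow> f x < f y"
 shows "ke f (L \<union> U) x y \<longleftrightarrow> ke f L x y \<or> ke f U x y \<or> (x \<in> L \<and> y \<in> U \<and> (\<forall>z\<in>L. \<not> f x < f z) \<and> (\<forall>z\<in>U. \<not> f z < f y))"
 (is "?l \<longleftrightarrow> ?a \<or> ?b \<or> ?c")
proof
 assume l: ?l
 have nUL: "\<not> (x \<in> U \<and> y \<in> L)" using l assms[of y x] unfolding ke_def by auto
 consider "x \<in> L" "y \<in> L" | "x \<in> U" "y \<in> U" | "x \<in> L" "y \<in> U" using l nUL unfolding ke_def by blast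
 thus "?a \<or> ?b \<or> ?c"
 proof cases
  case 1 thus ?thesis using l unfolding ke_def by blast
 next case 2 thus ?thesis using l unfolding ke_def by blast
 next case 3
  have "\<not> f x < f z" if "z \<in> L" for z using l assms[OF that 3(2)] that unfolding ke_def by blast
  moreover have "\<not> f z < f y" if "z \<in> U" for z using l assms[OF 3(1) that] that unfolding ke_def by blast
  ultimately show ?thesis using 3 by blast
 qed
next assume "?a \<or> ?b \<or> ?c"
 then consider ?a | ?b | ?c by blast
 thus ?l
 proof cases
  case 1
  hence "\<not> f z < f y" if "z \<in> U" for z using assms[of y z] that unfolding ke_def by auto
  thus ?thesis using 1 unfolding ke_def by blast
 next case 2
  hence "\<not> f x < f z" if "z \<in> L" for z using assms[of z x] that unfolding ke_def by auto
  thus ?thesis using 2 unfolding ke_def by blast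
 next case 3
  thus ?thesis using assms[of x y] unfolding ke_def by blast
 qed
qed

lemma ke_pos:
 assumes "keyok m N f" "A \<subseteq> {1..int m}"
 shows "ke f A x y \<longleftrightarrow> (x, y) \<in> edges {A}"
proof -
 have "f z = z" if "z \<in> A" for z using keyok(2)[OF assms(1)] assms(2) that by blast
 thus ?thesis unfolding ke_def edges_def by auto
qed

lemma ke_neg:
 assumes "keyok m N f" "A \<subseteq> {1..int m}"
 shows "ke f (neg A) x y \<longleftrightarrow> (- y, - x) \<in> edges {A}"
proof -
 have f: "f (- z) = N - z" if "z \<in> A" for z using keyok(3)[OF assms(1)] assms(2) that by blast
 show ?thesis
 proof
  assume k: "ke f (neg A) x y"
  hence xy: "- x \<in> A" "- y \<in> A" unfolding ke_def by (auto simp: mem_neg)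
  have "f x = N + x" "f y = N + y" using f[OF xy(1)] f[OF xy(2)] by auto
  moreover have "\<not> (f x < f (- z) \<and> f (- z) < f y)" if "z \<in> A" for z using k that unfolding ke_def by blast
  ultimately show "(- y, - x) \<in> edges {A}" using xy k f unfolding edges_def ke_def by fastforce
 next assume e: "(- y, - x) \<in> edges {A}"
  hence xy: "- x \<in> A" "- y \<in> A" "x < y" unfolding edges_def by auto
  have fx: "f x = N + x" "f y = N + y" using f[OF xy(1)] f[OF xy(2)] by auto
  show "ke f (neg A) x y" unfolding ke_def
  proof (intro conjI ballI notI)
   fix z assume z: "z \<in> neg A" "f x < f z \<and> f z < f y"
   hence "- z \<in> A" by (simp add: mem_neg)
   moreover have "f z = N + z" using f[OF calculation] by simp
   ultimately show False using e z(2) fx unfolding edges_def by auto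
  qed (use xy fx in \<open>auto simp: mem_neg\<close>)
 qed
qed

lemma not_less_Max: "finite A \<Longrightarrow> x \<in> A \<and> (\<forall>z\<in>A. \<not> x < z) \<longleftrightarrow> A \<noteq> {} \<and> x = Max (A :: int set)"
 by (metis Max_eqI Max_ge Max_in empty_iff not_less)

lemma top_pos:
 assumes "keyok m N f" "A \<subseteq> {1..int m}"
 shows "(x \<in> A \<and> (\<forall>z\<in>A. \<not> f x < f z)) \<longleftrightarrow> A \<noteq> {} \<and> x = Max A"
proof -
 have f: "f z = z" if "z \<in> A" for z using keyok(2)[OF assms(1)] assms(2) that by blast
 have "finite A" using assms(2) by (rule finite_subset) simp
 have "(x \<in> A \<and> (\<forall>z\<in>A. \<not> f x < f z)) \<longleftrightarrow> x \<in> A \<and> (\<forall>z\<in>A. \<not> x < z)" using f by auto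
 thus ?thesis using not_less_Max[OF \<open>finite A\<close>] by simp
qed

lemma bot_neg:
 assumes "keyok m N f" "A \<subseteq> {1..int m}"
 shows "(y \<in> neg A \<and> (\<forall>z\<in>neg A. \<not> f z < f y)) \<longleftrightarrow> A \<noteq> {} \<and> y = - Max A"
proof -
 have f: "f (- z) = N - z" if "z \<in> A" for z using keyok(3)[OF assms(1)] assms(2) that by blast
 have "finite A" using assms(2) by (rule finite_subset) simp
 have "(y \<in> neg A \<and> (\<forall>z\<in>neg A. \<not> f z < f y)) \<longleftrightarrow> - y \<in> A \<and> (\<forall>z\<in>A. \<not> - y < z)"
 proof -
  have "(\<forall>z\<in>neg A. \<not> f z < f y) \<longleftrightarrow> (\<forall>z\<in>A. \<not> - y < z)" if "- y \<in> A"
  proof -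
   have "f y = N + y" using f[OF that] by simp
   thus ?thesis using f by auto
  qed
  thus ?thesis by (auto simp: mem_neg)
 qed
 thus ?thesis using not_less_Max[OF \<open>finite A\<close>, of "- y"] by auto
qed

text \<open>The first negative element in key order is \<open>- Max B\<close>, so a mixed block has
  the single central edge \<open>(Max A, - Max B)\<close>.\<close>

lemma ke_cross:
 assumes k: "keyok m N f" and A: "A \<subseteq> {1..int m}" and B: "B \<subseteq> {1..int m}"
 shows "ke f (A \<union> neg B) x y \<longleftrightarrow> (x, y) \<in> edges {A} \<or> (- y, - x) \<in> edges {B} \<or> (A \<noteq> {} \<and> B \<noteq> {} \<and> x = Max A \<and> y = - Max B)"
proof -
 have "f x < f y" if "x \<in> A" "y \<in> neg B" for x y
 proof -
  have "- y \<in> {1..int m}" "x \<in> {1..int m}" using that A B by (auto simp: mem_neg)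
  thus ?thesis using keyok(2)[OF k, of x] keyok(3)[OF k, of "- y"] keyok(1)[OF k] by simp
 qed
 thus ?thesis using ke_Un[of A "neg B" f x y] ke_pos[OF k A] ke_neg[OF k B] top_pos[OF k A, of x] bot_neg[OF k B, of y] by auto
qed

text \<open>A central point \<open>c\<close> splits the central edge into one ending and one
  starting at \<open>c\<close>.\<close>

lemma ke_central:
 assumes k: "keyok m N f" and A: "A \<subseteq> {1..int m}" and B: "B \<subseteq> {1..int m}" and c: "int m < f c" "f c < N - int m"
 shows "ke f (insert c (A \<union> neg B)) x y \<longleftrightarrow> (x, y) \<in> edges {A} \<or> (- y, - x) \<in> edges {B} \<or>
  (A \<noteq> {} \<and> x = Max A \<and> y = c) \<or> (B \<noteq> {} \<and> x = c \<and> y = - Max B)"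
proof -
 have 1: "f x < f c" if "x \<in> A" for x
 proof -
  have "x \<in> {1..int m}" using that A by blast
  thus ?thesis using keyok(2)[OF k, of x] c by simp
 qed
 have 2: "f c < f y" if "y \<in> neg B" for y
 proof -
  have "- y \<in> {1..int m}" using that B by (auto simp: mem_neg)
  thus ?thesis using keyok(3)[OF k, of "- y"] c by simp
 qed
 have 3: "ke f ({c} \<union> neg B) x y \<longleftrightarrow> (- y, - x) \<in> edges {B} \<or> (B \<noteq> {} \<and> x = c \<and> y = - Max B)"
  using ke_Un[of "{c}" "neg B" f x y] 2 ke_neg[OF k B] bot_neg[OF k B, of y] by (auto simp: ke_def)
 have 4: "f x < f y" if "x \<in> A" "y \<in> {c} \<union> neg B" for x y
  using 1[OF that(1)] 2[of y] that(2) by auto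
 have 5: "(y \<in> {c} \<union> neg B \<and> (\<forall>z\<in>{c} \<union> neg B. \<not> f z < f y)) \<longleftrightarrow> y = c"
  using 2 by fastforce
 have "insert c (A \<union> neg B) = A \<union> ({c} \<union> neg B)" by blast
 thus ?thesis using ke_Un[of A "{c} \<union> neg B" f x y] 4 3 5 ke_pos[OF k A] top_pos[OF k A, of x] by auto
qed

lemma edges_blocks: "(i, j) \<in> edges P \<longleftrightarrow> (\<exists>B\<in>P. (i, j) \<in> edges {B})"
 unfolding edges_def by auto

lemma edges_range:
 assumes "parts m S" "(i, j) \<in> edges S"
 shows "i \<in> {1..int m}" "j \<in> {1..int m}" "i < j"
proof -
 obtain B where "B \<in> S" "i \<in> B" "j \<in> B" "i < j" using assms(2) unfolding edges_def by blast
 thus "i \<in> {1..int m}" "j \<in> {1..int m}" "i < j" using part_sub[OF assms(1)] by blast+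
qed

text \<open>\<open>C\<close> describes the central edges. These are too far right or too far left to
  lie below an edge within one half, and edges of different halves never nest. The reflection
  \<open>x\<close>, \<open>y\<close> to \<open>- y\<close>, \<open>- x\<close> reduces the negative
  half to the positive one, which leaves three kinds of nesting.\<close>

lemma nonnest_gen:
 assumes k: "keyok m N f" and S: "parts m S"
  and K: "\<And>x y. K x y \<longleftrightarrow> (x, y) \<in> edges S \<or> (- y, - x) \<in> edges S \<or> C x y"
  and C: "\<And>x y. C x y \<Longrightarrow> f x < N - int m \<and> int m < f y \<and> C (- y) (- x) \<and> f (- y) = N - f y"
 shows "\<not> (\<exists>x y x' y'. K x y \<and> K x' y' \<and> f x < f x' \<and> f y' < f y) \<longleftrightarrow>
  nns S \<and> (\<forall>x y i j. C x y \<longrightarrow> (i, j) \<in> edges S \<longrightarrow> \<not> f x < i) \<and>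
  \<not> (\<exists>x y x' y'. C x y \<and> C x' y' \<and> f x < f x' \<and> f y' < f y)"
  (is "?l \<longleftrightarrow> ?a \<and> ?b \<and> ?c")
proof
 note r = edges_range[OF S]
 note k1 = keyok(1)[OF k] and k2 = keyok(2)[OF k]
 have E: "f i = i \<and> f j = j \<and> i < j \<and> 1 \<le> i \<and> j \<le> int m" if "(i, j) \<in> edges S" for i j using r[OF that] k2 by auto
 have M: "f x = N + x \<and> f y = N + y \<and> x < y \<and> - int m \<le> x \<and> y \<le> - 1" if "(- y, - x) \<in> edges S" for x y
  using r[OF that] keyok(3)[OF k, of "- x"] keyok(3)[OF k, of "- y"] by auto
 {
  assume l: ?l
  have ?a unfolding nns_def
  proof (rule notI, elim exE conjE)
   fix a b c d assume *: "(a, b) \<in> edges S" "(c, d) \<in> edges S" "a < c" "c < d" "d < b"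
   have "f a < f c" "f d < f b" using E[OF *(1)] E[OF *(2)] * by auto
   moreover have "K a b" "K c d" using K *(1,2) by auto
   ultimately show False using l by blast
  qed
  moreover have ?b
  proof (intro allI impI notI)
   fix x y i j assume *: "C x y" "(i, j) \<in> edges S" "f x < i"
   have "f j < f y" "f x < f i" using C[OF *(1)] E[OF *(2)] *(3) by auto
   thus False using l K[of x y] K[of i j] * by blast
  qed
  moreover have ?c using l K by blast
  ultimately show "?a \<and> ?b \<and> ?c" by blast
 }
 {
  assume h: "?a \<and> ?b \<and> ?c"
  show ?l
  proof (rule notI, elim exE conjE)
   fix x y x' y' assume *: "K x y" "K x' y'" "f x < f x'" "f y' < f y"
   from *(1) consider "(x, y) \<in> edges S" | "(- y, - x) \<in> edges S" | "C x y" unfolding K by blast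
   thus False
   proof cases
    case 1
    from *(2) consider "(x', y') \<in> edges S" | "(- y', - x') \<in> edges S" | "C x' y'" unfolding K by blast
    thus False
    proof cases
     case c1: 1
     have "x < x'" "x' < y'" "y' < y" using E[OF 1] E[OF c1] *(3,4) by auto
     thus False using h 1 c1 unfolding nns_def by blast
    next case 2 thus False using E[OF 1] M[OF 2] *(3,4) k1 by linarith
    next case 3 thus False using E[OF 1] C[OF 3] *(3,4) by linarith
    qed
   next case 2
    from *(2) consider "(x', y') \<in> edges S" | "(- y', - x') \<in> edges S" | "C x' y'" unfolding K by blast
    thus False
    proof cases
     case 1 thus False using E[OF 1] M[OF 2] *(3,4) k1 by linarith
    next case c2: 2
     have "- y < - y'" "- y' < - x'" "- x' < - x" using M[OF 2] M[OF c2] *(3,4) by auto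
     thus False using h 2 c2 unfolding nns_def by blast
    next case 3 thus False using M[OF 2] C[OF 3] *(3,4) by linarith
    qed
   next case 3
    from *(2) consider "(x', y') \<in> edges S" | "(- y', - x') \<in> edges S" | "C x' y'" unfolding K by blast
    thus False
    proof cases
     case 1
     have "f x < x'" using E[OF 1] *(3) by simp
     thus False using h 3 1 by blast
    next case 2
     have "f (- y) < - y'" using M[OF 2] C[OF 3] *(4) by linarith
     thus False using h C[OF 3] 2 by blast
    next case c3: 3 thus False using h 3 *(3,4) by blast
    qed
   qed
  qed
 }
qed

lemma kedge_build:
 assumes S: "parts m S" and X: "X \<subseteq> S" and p: "invol X p"
  and R: "\<And>x y. (\<exists>A\<in>X. ke f (g A) x y) \<longleftrightarrow> (\<exists>A\<in>X. (x, y) \<in> edges {A} \<or> (- y, - x) \<in> edges {p A}) \<or> C x y"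
  and k: "keyok m N f"
 shows "kedge f ((S - X) \<union> neg ` (S - X) \<union> g ` X) x y \<longleftrightarrow> (x, y) \<in> edges S \<or> (- y, - x) \<in> edges S \<or> C x y"
proof -
 have kp: "ke f A x y \<longleftrightarrow> (x, y) \<in> edges {A}" "ke f (neg A) x y \<longleftrightarrow> (- y, - x) \<in> edges {A}" if "A \<in> S" for A
  using ke_pos[OF k part_sub[OF S that]] ke_neg[OF k part_sub[OF S that]] by auto
 have "kedge f ((S - X) \<union> neg ` (S - X) \<union> g ` X) x y \<longleftrightarrow>
   (\<exists>A\<in>S - X. (x, y) \<in> edges {A}) \<or> (\<exists>A\<in>S - X. (- y, - x) \<in> edges {A}) \<or> (\<exists>A\<in>X. ke f (g A) x y)"
  unfolding kedge_def using kp by auto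
 also have "\<dots> \<longleftrightarrow> (\<exists>A\<in>S - X. (x, y) \<in> edges {A}) \<or> (\<exists>A\<in>S - X. (- y, - x) \<in> edges {A}) \<or>
   (\<exists>A\<in>X. (x, y) \<in> edges {A}) \<or> (\<exists>A\<in>X. (- y, - x) \<in> edges {p A}) \<or> C x y"
  unfolding R by blast
 also have "(\<exists>A\<in>X. (- y, - x) \<in> edges {p A}) \<longleftrightarrow> (\<exists>A\<in>X. (- y, - x) \<in> edges {A})"
  using invol_in[OF p] invol_inv[OF p] by metis
 also have "(\<exists>A\<in>S - X. (x, y) \<in> edges {A}) \<or> (\<exists>A\<in>S - X. (- y, - x) \<in> edges {A}) \<or>
   (\<exists>A\<in>X. (x, y) \<in> edges {A}) \<or> (\<exists>A\<in>X. (- y, - x) \<in> edges {A}) \<or> C x y \<longleftrightarrow>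
   (\<exists>A\<in>S. (x, y) \<in> edges {A}) \<or> (\<exists>A\<in>S. (- y, - x) \<in> edges {A}) \<or> C x y"
  using X by blast
 finally show ?thesis using edges_blocks[of x y S] edges_blocks[of "- y" "- x" S] by simp
qed

lemma NNNA_part: "(S, X) \<in> NNNA m \<Longrightarrow> parts m S \<and> X \<subseteq> S"
 unfolding NNNA_def NN_nns by auto

lemma NNNA_iff:
 assumes "parts m S" "X \<subseteq> S"
 shows "(S, X) \<in> NNNA m \<longleftrightarrow> nns S \<and> (\<forall>A\<in>X. nonaligned S A)"
 unfolding NNNA_def NN_nns using assms by auto

definition kC :: "int \<Rightarrow> int \<Rightarrow> int" where
 "kC N x = (if 0 < x then x else N + x)"

lemma kC_ok: "2 * int m < N \<Longrightarrow> keyok m N (kC N)"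
 unfolding keyok_def kC_def by auto

lemma kC_sorted: "sorted_wrt (\<lambda>x y. kC (2 * int m + 1) x < kC (2 * int m + 1) y) ([1..int m] @ [- int m..-1])"
proof -
 have 1: "sorted_wrt (\<lambda>x y. kC (2 * int m + 1) x < kC (2 * int m + 1) y) [1..int m]"
  by (rule sorted_wrt_mono_rel[OF _ sorted_wrt_upto]) (auto simp: kC_def)
 have 2: "sorted_wrt (\<lambda>x y. kC (2 * int m + 1) x < kC (2 * int m + 1) y) [- int m..-1]"
  by (rule sorted_wrt_mono_rel[OF _ sorted_wrt_upto]) (auto simp: kC_def)
 show ?thesis using 1 2 by (auto simp: sorted_wrt_append kC_def)
qed

lemma anti_iff_strict:
 assumes S: "parts m S" and X: "X \<subseteq> S" and p: "invol X p" and Y: "A \<in> X" "B \<in> X" "A \<noteq> B"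
 shows "Max (p B) \<le> Max (p A) \<longleftrightarrow> Max (p B) < Max (p A)"
proof -
 have "p A \<noteq> p B"
 proof
  assume "p A = p B"
  from arg_cong[OF this, of p] have "A = B" unfolding invol_inv[OF p Y(1)] invol_inv[OF p Y(2)] .
  thus False using Y(3) by simp
 qed
 moreover have "p A \<in> X" "p B \<in> X" using invol_in[OF p] Y by auto
 ultimately have "Max (p A) \<noteq> Max (p B)" using part_sub_X(2)[OF S X] unfolding inj_on_def by blast
 thus ?thesis by auto
qed

text \<open>Each maximum of a marked block starts a central edge, and other central edges start
  beyond \<open>int m\<close>. So an edge of \<open>S\<close> below a central edge is the same as an
  edge to the right of a marked block, and the mixed condition of \<open>nonnest_gen\<close> becomes
  nonalignment.\<close>

lemma nonnest_marked:
 assumes k: "keyok m N f" and S: "parts m S" and X: "X \<subseteq> S"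
  and K: "\<And>x y. K x y \<longleftrightarrow> (x, y) \<in> edges S \<or> (- y, - x) \<in> edges S \<or> C x y"
  and C: "\<And>x y. C x y \<Longrightarrow> f x < N - int m \<and> int m < f y \<and> C (- y) (- x) \<and> f (- y) = N - f y"
  and CX: "\<And>A. A \<in> X \<Longrightarrow> \<exists>y. C (Max A) y" and XC: "\<And>x y. C x y \<Longrightarrow> (\<exists>A\<in>X. x = Max A) \<or> int m < f x"
 shows "\<not> (\<exists>x y x' y'. K x y \<and> K x' y' \<and> f x < f x' \<and> f y' < f y) \<longleftrightarrow>
  (S, X) \<in> NNNA m \<and> \<not> (\<exists>x y x' y'. C x y \<and> C x' y' \<and> f x < f x' \<and> f y' < f y)"
proof -
 have fM: "f (Max A) = Max A" if "A \<in> X" for A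
  using keyok(2)[OF k] part_Max(1)[OF S _ subsetD[OF X that]] part_sub[OF S subsetD[OF X that]] by blast
 have al: "(\<forall>x y i j. C x y \<longrightarrow> (i, j) \<in> edges S \<longrightarrow> \<not> f x < i) \<longleftrightarrow> (\<forall>A\<in>X. nonaligned S A)"
 proof
  assume h: "\<forall>x y i j. C x y \<longrightarrow> (i, j) \<in> edges S \<longrightarrow> \<not> f x < i"
  show "\<forall>A\<in>X. nonaligned S A"
  proof
   fix A assume A: "A \<in> X"
   obtain y where "C (Max A) y" using CX[OF A] by blast
   hence "\<not> f (Max A) < i" if "(i, j) \<in> edges S" for i j using h that by blast
   thus "nonaligned S A" unfolding nonaligned_def fM[OF A] by blast
  qed
 next assume h: "\<forall>A\<in>X. nonaligned S A"
  show "\<forall>x y i j. C x y \<longrightarrow> (i, j) \<in> edges S \<longrightarrow> \<not> f x < i"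
  proof (intro allI impI notI)
   fix x y i j assume *: "C x y" "(i, j) \<in> edges S" "f x < i"
   have "\<not> int m < f x" using *(3) edges_range[OF S *(2)] by simp
   then obtain A where A: "A \<in> X" "x = Max A" using XC[OF *(1)] by blast
   have "Max A < i" using *(3) fM[OF A(1)] A(2) by simp
   thus False using h A(1) *(2) unfolding nonaligned_def by blast
  qed
 qed
 have "\<not> (\<exists>x y x' y'. K x y \<and> K x' y' \<and> f x < f x' \<and> f y' < f y) \<longleftrightarrow>
  nns S \<and> (\<forall>x y i j. C x y \<longrightarrow> (i, j) \<in> edges S \<longrightarrow> \<not> f x < i) \<and>
  \<not> (\<exists>x y x' y'. C x y \<and> C x' y' \<and> f x < f x' \<and> f y' < f y)"
  by (rule nonnest_gen[OF k S K C])
 thus ?thesis unfolding al NNNA_iff[OF S X] by (simp only: conj_assoc)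
qed

text \<open>The central edges of \<open>A\<close> and \<open>B\<close> nest exactly if
  \<open>A\<close> and \<open>B\<close> are ordered in the same way as \<open>p A\<close> and
  \<open>p B\<close>.\<close>

lemma NN_C_char:
 assumes S: "parts m S" and X: "X \<subseteq> S" and p: "invol X p"
 shows "build S X p \<in> NN_C m \<longleftrightarrow> (S, X) \<in> NNNA m \<and> anti X p"
proof -
 let ?N = "2 * int m + 1"
 let ?f = "kC ?N"
 have k: "keyok m ?N ?f" by (rule kC_ok) simp
 let ?C = "\<lambda>x y. \<exists>A\<in>X. x = Max A \<and> y = - Max (p A)"
 have sb: "A \<subseteq> {1..int m}" "p A \<subseteq> {1..int m}" "A \<noteq> {}" "p A \<noteq> {}" if "A \<in> X" for A
  using part_sub[OF S] part_ne[OF S] X invol_in[OF p that] that by blast+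
 have Mr: "Max A \<in> {1..int m}" if "A \<in> X" for A using part_Max(1)[OF S _ subsetD[OF X that]] sb(1)[OF that] by blast
 have R: "(\<exists>A\<in>X. ke ?f (A \<union> neg (p A)) x y) \<longleftrightarrow> (\<exists>A\<in>X. (x, y) \<in> edges {A} \<or> (- y, - x) \<in> edges {p A}) \<or> ?C x y" for x y
 proof -
  have "(\<exists>A\<in>X. ke ?f (A \<union> neg (p A)) x y) \<longleftrightarrow>
   (\<exists>A\<in>X. ((x, y) \<in> edges {A} \<or> (- y, - x) \<in> edges {p A}) \<or> (x = Max A \<and> y = - Max (p A)))"
  proof (rule bex_cong[OF refl])
   fix A assume A: "A \<in> X"
   show "ke ?f (A \<union> neg (p A)) x y \<longleftrightarrow> ((x, y) \<in> edges {A} \<or> (- y, - x) \<in> edges {p A}) \<or> (x = Max A \<and> y = - Max (p A))"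
    unfolding ke_cross[OF k sb(1,2)[OF A]] using sb(3,4)[OF A] by simp
  qed
  thus ?thesis by (simp only: bex_disj_distrib)
 qed
 have K: "kedge ?f (build S X p) x y \<longleftrightarrow> (x, y) \<in> edges S \<or> (- y, - x) \<in> edges S \<or> ?C x y" for x y
  unfolding build_alt[OF X p] by (rule kedge_build[OF S X p R k])
 have fM: "?f (Max A) = Max A" "?f (- Max A) = ?N - Max A" if "A \<in> X" for A using keyok(2,3)[OF k Mr[OF that]] by auto
 have C: "?f x < ?N - int m \<and> int m < ?f y \<and> ?C (- y) (- x) \<and> ?f (- y) = ?N - ?f y" if h: "?C x y" for x y
 proof -
  obtain A where A: "A \<in> X" "x = Max A" "y = - Max (p A)" using h by blast
  note q = invol_in[OF p A(1)]
  have "?C (- y) (- x)" using q invol_inv[OF p A(1)] A by (intro bexI[of _ "p A"]) auto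
  thus ?thesis using fM[OF A(1)] fM[OF q] Mr[OF A(1)] Mr[OF q] A(2,3) by auto
 qed
 have CX: "\<exists>y. ?C (Max A) y" if "A \<in> X" for A using that by blast
 have XC: "(\<exists>A\<in>X. x = Max A) \<or> int m < ?f x" if "?C x y" for x y using that by blast
 have P: "build S X p \<in> Pi_B m" by (rule build_Pi[OF S X p])
 have "build S X p \<in> NN_C m \<longleftrightarrow> \<not> (\<exists>x y x' y'. kedge ?f (build S X p) x y \<and> kedge ?f (build S X p) x' y' \<and> ?f x < ?f x' \<and> ?f y' < ?f y)"
  unfolding NN_C_def using P nonnesting_key[OF kC_sorted, of "build S X p" m] part_sub[OF Pi_B_part[OF P]] by simp
 also have "\<dots> \<longleftrightarrow> (S, X) \<in> NNNA m \<and> \<not> (\<exists>x y x' y'. ?C x y \<and> ?C x' y' \<and> ?f x < ?f x' \<and> ?f y' < ?f y)"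
  by (rule nonnest_marked[OF k S X K C CX XC])
 also have "\<not> (\<exists>x y x' y'. ?C x y \<and> ?C x' y' \<and> ?f x < ?f x' \<and> ?f y' < ?f y) \<longleftrightarrow> anti X p"
 proof -
  have "(\<exists>x y x' y'. ?C x y \<and> ?C x' y' \<and> ?f x < ?f x' \<and> ?f y' < ?f y) \<longleftrightarrow>
    (\<exists>A\<in>X. \<exists>B\<in>X. Max A < Max B \<and> Max (p A) < Max (p B))" (is "?l \<longleftrightarrow> ?r")
  proof
   assume ?l
   then obtain A B where AB: "A \<in> X" "B \<in> X" "?f (Max A) < ?f (Max B)" "?f (- Max (p B)) < ?f (- Max (p A))" by blast
   hence "Max A < Max B" "Max (p A) < Max (p B)" using fM[OF AB(1)] fM[OF AB(2)] fM[OF invol_in[OF p AB(1)]] fM[OF invol_in[OF p AB(2)]] by auto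
   thus ?r using AB by blast
  next assume ?r
   then obtain A B where AB: "A \<in> X" "B \<in> X" "Max A < Max B" "Max (p A) < Max (p B)" by blast
   hence "?f (Max A) < ?f (Max B)" "?f (- Max (p B)) < ?f (- Max (p A))" using fM[OF AB(1)] fM[OF AB(2)] fM[OF invol_in[OF p AB(1)]] fM[OF invol_in[OF p AB(2)]] by auto
   thus ?l using AB by blast
  qed
  moreover have "Max (p B) \<le> Max (p A) \<longleftrightarrow> Max (p B) < Max (p A)" if "A \<in> X" "B \<in> X" "Max A < Max B" for A B
   using anti_iff_strict[OF S X p that(1,2)] that(3) by blast
  ultimately show ?thesis unfolding anti_def by (meson not_less)
 qed
 finally show ?thesis .
qed

lemma phi_NN_C_bij: "bij_betw phi (NN_C m) (NNNA m)"
proof (rule phi_bij[where C = anti])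
 show "NN_C m \<subseteq> Pi_B m" unfolding NN_C_def by blast
 show "parts m S \<and> X \<subseteq> S" if "(S, X) \<in> NNNA m" for S X by (rule NNNA_part[OF that])
 show "build S X p \<in> NN_C m \<longleftrightarrow> (S, X) \<in> NNNA m \<and> anti X p" if "parts m S" "X \<subseteq> S" "invol X p" for S X p
  by (rule NN_C_char[OF that])
 show "\<exists>p. invol X p \<and> anti X p" if "finite X" "inj_on Max X" for X
  using anti_ex[OF that] by blast
 show "p A = q A" if "finite X" "inj_on Max X" "invol X p" "invol X q" "anti X p" "anti X q" "A \<in> X" for X p q A
  by (rule anti_unique[OF that])
qed

lemma NN_C_type:
 assumes "P \<in> NN_C m"
 shows "btype P = rest (stat (phi P)) + pairsum (snd (stat (phi P)))"
proof -
 obtain S X where ph: "phi P = (S, X)" by fastforce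
 have Pi: "P \<in> Pi_B m" using assms unfolding NN_C_def by blast
 note B = Pi_build[OF Pi ph]
 obtain p where p: "invol X p" "P = build S X p" using B(3) by blast
 hence "anti X p" using NN_C_char[OF B(1,2) p(1)] assms by simp
 thus ?thesis using btype_build_anti[OF B(1,2) p(1)] p(2) ph by simp
qed

lemma by_max_Cons:
 assumes "finite X" "inj_on Max X" "F \<in> X" "\<And>A. A \<in> X \<Longrightarrow> A \<noteq> F \<Longrightarrow> Max F < Max A"
 shows "by_max X = F # by_max (X - {F})"
proof -
 have Y: "finite (X - {F})" "inj_on Max (X - {F})" using assms(1) inj_on_diff[OF assms(2)] by auto
 note b = by_max[OF Y]
 have "set (F # by_max (X - {F})) = X" using b(1) assms(3) by auto
 moreover have "sorted_wrt (<) (map Max (F # by_max (X - {F})))" using b(1,2) assms(4) by simp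
 ultimately show ?thesis by (rule by_max(5)[OF assms(1,2)])
qed

lemma anti_nth:
 assumes "finite X" "inj_on Max X" "invol X p" "anti X p" "i < card X"
 shows "p (by_max X ! i) = by_max X ! (card X - 1 - i)"
proof -
 have "map p (by_max X) ! i = rev (by_max X) ! i" unfolding anti_rev[OF assms(1,2,4) invol_image[OF assms(3)]] ..
 thus ?thesis using length_by_max[OF assms(1,2)] assms(5) by (simp add: rev_nth)
qed

text \<open>A reversal fixes only the middle position, which exists only for odd length.\<close>

lemma anti_fixed_iff:
 assumes "finite X" "inj_on Max X" "invol X p" "anti X p"
 shows "(\<exists>A\<in>X. p A = A) \<longleftrightarrow> odd (card X)"
proof
 note b = by_max[OF assms(1,2)]
 assume "\<exists>A\<in>X. p A = A"
 then obtain A where A: "A \<in> X" "p A = A" by blast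
 then obtain i where i: "i < card X" "A = by_max X ! i" using b(1,4) by (metis in_set_conv_nth)
 have "by_max X ! (card X - 1 - i) = by_max X ! i" using anti_nth[OF assms i(1)] A(2) i(2) by metis
 hence "card X - 1 - i = i" using nth_eq_iff_index_eq[OF b(3), of "card X - 1 - i" i] i(1) b(4) by simp
 hence "card X = 2 * i + 1" using i(1) by linarith
 thus "odd (card X)" by simp
next
 note b = by_max[OF assms(1,2)]
 assume "odd (card X)"
 then obtain i where i: "card X = 2 * i + 1" by (rule oddE)
 hence "p (by_max X ! i) = by_max X ! i" using anti_nth[OF assms, of i] by simp
 moreover have "by_max X ! i \<in> X" using nth_mem[of i "by_max X"] b(1,4) i by simp
 ultimately show "\<exists>A\<in>X. p A = A" by blast
qed

text \<open>In type B a fixed block \<open>B\<close> has the central edges \<open>(Max B, 0)\<close>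
  and \<open>(0, - Max B)\<close>. The central edge of another marked block starting before
  \<open>Max B\<close> would pass above the first of these, so the fixed block must come
  first.\<close>

definition antiB :: "int set set \<Rightarrow> (int set \<Rightarrow> int set) \<Rightarrow> bool" where
 "antiB X p \<longleftrightarrow> (\<forall>A\<in>X. \<forall>B\<in>X. p A \<noteq> A \<longrightarrow> p B \<noteq> B \<longrightarrow> Max A < Max B \<longrightarrow> Max (p B) < Max (p A)) \<and>
   (\<forall>B\<in>X. \<forall>A\<in>X. p B = B \<longrightarrow> A \<noteq> B \<longrightarrow> Max B < Max A)"

lemma antiB_anti:
 assumes "antiB X p" "Y \<subseteq> X" and nf: "\<And>A. A \<in> Y \<Longrightarrow> p A \<noteq> A"
 shows "anti Y p"
 unfolding anti_def
proof (intro ballI impI)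
 fix A B assume AB: "A \<in> Y" "B \<in> Y" "Max A < Max B"
 have "A \<in> X" "B \<in> X" using AB assms(2) by auto
 thus "Max (p B) < Max (p A)" using conjunct1[OF assms(1)[unfolded antiB_def]] nf[OF AB(1)] nf[OF AB(2)] AB(3) by simp
qed

lemma anti_antiB:
 assumes "anti X p" and nf: "\<And>A. A \<in> X \<Longrightarrow> p A \<noteq> A"
 shows "antiB X p"
 unfolding antiB_def
proof (intro conjI ballI impI)
 fix A B assume "A \<in> X" "B \<in> X" "Max A < Max B"
 thus "Max (p B) < Max (p A)" using assms(1) unfolding anti_def by simp
next fix B A assume "B \<in> X" "p B = B"
 thus "Max B < Max A" using nf by simp
qed

lemma antiB_cases:
 assumes f: "finite X" "inj_on Max X" and p: "invol X p" "antiB X p"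
 obtains (even) "even (card X)" "anti X p" "\<And>A. A \<in> X \<Longrightarrow> p A \<noteq> A"
 | (odd) F where "odd (card X)" "F \<in> X" "p F = F" "by_max X = F # by_max (X - {F})" "invol (X - {F}) p" "anti (X - {F}) p"
  "\<And>A. A \<in> X - {F} \<Longrightarrow> p A \<noteq> A"
proof (cases "\<exists>F\<in>X. p F = F")
 case False
 hence nf: "\<And>A. A \<in> X \<Longrightarrow> p A \<noteq> A" by blast
 have a: "anti X p" by (rule antiB_anti[OF p(2) order_refl nf])
 hence "even (card X)" using anti_fixed_iff[OF f p(1) a] nf by blast
 thus thesis using even a nf by blast
next case True
 then obtain F where F: "F \<in> X" "p F = F" by blast
 let ?Y = "X - {F}"
 have nf: "p A \<noteq> A" if "A \<in> ?Y" for A using invol_fix[OF p(1) _ F(1) _ F(2), of A] that by blast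
 have iY: "invol ?Y p" unfolding invol_def
 proof (intro conjI ballI impI)
  fix A assume A: "A \<in> ?Y"
  show "p (p A) = A" using invol_inv[OF p(1)] A by blast
  have "p A \<noteq> F"
  proof
   assume "p A = F"
   hence "A = F" using invol_inv[OF p(1), of A] A F(2) by simp
   thus False using A by simp
  qed
  thus "p A \<in> ?Y" using invol_in[OF p(1)] A by blast
 next fix A B assume "A \<in> ?Y" "B \<in> ?Y" "p A = A" "p B = B"
  thus "A = B" using nf by blast
 qed
 have fY: "finite ?Y" "inj_on Max ?Y" using f(1) inj_on_diff[OF f(2)] by auto
 have aY: "anti ?Y p" by (rule antiB_anti[OF p(2) Diff_subset nf])
 have "even (card ?Y)" using anti_fixed_iff[OF fY iY aY] nf by blast
 hence "odd (card X)" using f(1) F(1) by (metis card_Suc_Diff1 even_Suc)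
 moreover have "by_max X = F # by_max ?Y" by (rule by_max_Cons[OF f F(1)]) (use p(2) F in \<open>auto simp: antiB_def\<close>)
 ultimately show thesis using odd[OF _ F _ iY aY nf] by blast
qed

lemma antiB_unique:
 assumes f: "finite X" "inj_on Max X" and p: "invol X p" "antiB X p" and q: "invol X q" "antiB X q" and A: "A \<in> X"
 shows "p A = q A"
 using f p
proof (cases rule: antiB_cases)
 case pe: even
 from f q show ?thesis
 proof (cases rule: antiB_cases)
  case even thus ?thesis using anti_unique[OF f p(1) q(1) pe(2) even(2) A] by blast
 qed (use pe in blast)
next case po: (odd F)
 from f q show ?thesis
 proof (cases rule: antiB_cases)
  case (odd G)
  hence FG: "G = F" using po(4) by simp
  have fY: "finite (X - {F})" "inj_on Max (X - {F})" using f(1) inj_on_diff[OF f(2)] by auto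
  show ?thesis
  proof (cases "A = F")
   case True thus ?thesis using po(3) odd(3) FG by simp
  next case False
   hence "A \<in> X - {F}" using A by blast
   thus ?thesis using anti_unique[OF fY po(5) _ po(6), of q A] odd(5,6) FG by blast
  qed
 qed (use po in blast)
qed

lemma antiB_ex:
 assumes f: "finite X" "inj_on Max X"
 shows "\<exists>p. invol X p \<and> antiB X p"
proof (cases "even (card X)")
 case True
 note a = anti_ex[OF f]
 have nf: "rp (by_max X) A \<noteq> A" if "A \<in> X" for A using anti_fixed_iff[OF f a] True that by blast
 have "antiB X (rp (by_max X))" by (rule anti_antiB[OF a(2) nf])
 thus ?thesis using a(1) by (intro exI conjI)
next case False
 note b = by_max[OF f]
 have "X \<noteq> {}" using False by auto
 then obtain F ys where xs: "by_max X = F # ys" using b(1) by (cases "by_max X") auto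
 let ?Y = "X - {F}"
 have F: "F \<in> X" using b(1) xs by auto
 have lt: "Max F < Max A" if "A \<in> X" "A \<noteq> F" for A using b(1,2) that unfolding xs by auto
 have fY: "finite ?Y" "inj_on Max ?Y" using f(1) inj_on_diff[OF f(2)] by auto
 note a = anti_ex[OF fY]
 \<comment> \<open>Reverses all blocks except the first one, \<open>F\<close>, which is fixed
   because \<open>rp\<close> is the identity outside its list.\<close>
 let ?p = "rp (by_max ?Y)"
 have pF: "?p F = F" using rp_other[of F "by_max ?Y"] by_max(1)[OF fY] by simp
 have "card X = Suc (card ?Y)" using f(1) F by (metis card_Suc_Diff1)
 hence "even (card ?Y)" using False by simp
 hence nf: "?p A \<noteq> A" if "A \<in> ?Y" for A using anti_fixed_iff[OF fY a] that by blast
 have "invol X ?p" unfolding invol_def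
 proof (intro conjI ballI impI)
  fix A assume A: "A \<in> X"
  show "?p A \<in> X" using invol_in[OF a(1), of A] A pF by (cases "A = F") auto
  show "?p (?p A) = A" using invol_inv[OF a(1), of A] A pF by (cases "A = F") auto
 next fix A B assume "A \<in> X" "B \<in> X" "?p A = A" "?p B = B"
  thus "A = B" using nf by blast
 qed
 moreover have "antiB X ?p" unfolding antiB_def
 proof (intro conjI ballI impI)
  fix A B assume AB: "A \<in> X" "B \<in> X" "?p A \<noteq> A" "?p B \<noteq> B" "Max A < Max B"
  hence "A \<in> ?Y" "B \<in> ?Y" using pF by auto
  thus "Max (?p B) < Max (?p A)" using a(2) AB(5) unfolding anti_def by blast
 next fix B A assume AB: "B \<in> X" "A \<in> X" "?p B = B" "A \<noteq> B"
  hence "B = F" using nf by blast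
  thus "Max B < Max A" using lt AB by blast
 qed
 ultimately show ?thesis by blast
qed

text \<open>The point 0 sits at rank \<open>m + 1\<close>, the centre of the reflection with
  \<open>N = 2 * int m + 2\<close>.\<close>

definition kZ :: "nat \<Rightarrow> int \<Rightarrow> int" where
 "kZ m x = (if 0 < x then x else if x = 0 then int m + 1 else 2 * int m + 2 + x)"

lemma kZ_ok: "keyok m (2 * int m + 2) (kZ m)"
 unfolding keyok_def kZ_def by auto

lemma kZ_sorted: "sorted_wrt (\<lambda>x y. kZ m x < kZ m y) ([1..int m] @ [0] @ [- int m..-1])"
proof -
 have 1: "sorted_wrt (\<lambda>x y. kZ m x < kZ m y) [1..int m]"
  by (rule sorted_wrt_mono_rel[OF _ sorted_wrt_upto]) (auto simp: kZ_def)
 have 2: "sorted_wrt (\<lambda>x y. kZ m x < kZ m y) [- int m..-1]"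
  by (rule sorted_wrt_mono_rel[OF _ sorted_wrt_upto]) (auto simp: kZ_def)
 show ?thesis using 1 2 by (auto simp: sorted_wrt_append kZ_def)
qed

definition aug :: "(int set \<Rightarrow> int set) \<Rightarrow> int set \<Rightarrow> int set" where
 "aug p A = (if p A = A then insert 0 (A \<union> neg (p A)) else A \<union> neg (p A))"

lemma zero_build_iff:
 assumes "parts m S" "X \<subseteq> S" "invol X p"
 shows "(\<exists>B\<in>build S X p. zero_block B) \<longleftrightarrow> (\<exists>A\<in>X. p A = A)"
proof
 assume "\<exists>B\<in>build S X p. zero_block B"
 then obtain B where B: "B \<in> build S X p" "zero_block B" by blast
 have "\<exists>A\<in>X. p A = A \<and> B = A \<union> neg A" by (rule build_zero[OF assms B(1), THEN iffD1, OF B(2)])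
 thus "\<exists>A\<in>X. p A = A" by blast
next assume "\<exists>A\<in>X. p A = A"
 then obtain A where A: "A \<in> X" "p A = A" by blast
 have "A \<union> neg (p A) \<in> build S X p" unfolding build_alt[OF assms(2,3)] by (rule UnI2, rule image_eqI[OF refl A(1)])
 moreover have "zero_block (A \<union> neg (p A))" unfolding A(2) zero_block_def by (auto simp: neg_Un)
 ultimately show "\<exists>B\<in>build S X p. zero_block B" by blast
qed

lemma add_zero_build:
 assumes S: "parts m S" and X: "X \<subseteq> S" and p: "invol X p"
 shows "add_zero (build S X p) = ((S - X) \<union> neg ` (S - X) \<union> aug p ` X) \<union> (if \<exists>A\<in>X. p A = A then {} else {{0}})"
proof -
 note ctx = S X p
 note z = build_zero[OF ctx]
 let ?P = "build S X p"
 note e = build_alt[OF X p]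
 have inP: "A \<union> neg (p A) \<in> ?P" if "A \<in> X" for A
  unfolding e by (rule UnI2, rule image_eqI[OF refl that])
 have zz: "(\<exists>B\<in>?P. zero_block B) \<longleftrightarrow> (\<exists>A\<in>X. p A = A)" by (rule zero_build_iff[OF ctx])
 show ?thesis
 proof (cases "\<exists>A\<in>X. p A = A")
  case False
  have a: "aug p ` X = (\<lambda>A. A \<union> neg (p A)) ` X"
  proof (rule image_cong[OF refl])
   fix A assume "A \<in> X"
   hence "p A \<noteq> A" using False by blast
   thus "aug p A = A \<union> neg (p A)" unfolding aug_def by simp
  qed
  have nz: "\<not> (\<exists>B\<in>?P. zero_block B)" using zz False by simp
  have "add_zero ?P = insert {0} ?P" unfolding add_zero_def if_not_P[OF nz] ..
  thus ?thesis unfolding if_not_P[OF False] a e by simp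
 next case True
  let ?g = "\<lambda>B. if zero_block B then insert 0 B else B"
  have nz: "\<not> zero_block A" if A: "A \<in> S" for A
  proof
   assume "zero_block A"
   obtain x where x: "x \<in> A" using part_ne[OF S A] by blast
   hence "- x \<in> A" using \<open>zero_block A\<close> unfolding zero_block_def by (metis mem_neg minus_minus)
   thus False using S_pos[OF ctx A x] S_pos[OF ctx A] by fastforce
  qed
  hence nz': "\<not> zero_block (neg A)" if "A \<in> S" for A using that unfolding zero_block_def by (metis neg_neg)
  have 1: "?g ` (S - X) = (\<lambda>B. B) ` (S - X)" by (rule image_cong) (use nz in auto)
  have 2: "?g ` neg ` (S - X) = (\<lambda>B. B) ` neg ` (S - X)" by (rule image_cong) (use nz' in auto)
  have 3: "?g ` (\<lambda>A. A \<union> neg (p A)) ` X = aug p ` X" unfolding image_image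
  proof (rule image_cong[OF refl])
   fix A assume A: "A \<in> X"
   note B = inP[OF A]
   have b: "blk X p A = A \<union> neg (p A)" unfolding blk_def using A by simp
   have "zero_block (A \<union> neg (p A)) \<longleftrightarrow> p A = A"
   proof
    assume "zero_block (A \<union> neg (p A))"
    hence "\<exists>D\<in>X. p D = D \<and> A \<union> neg (p A) = D \<union> neg D" by (rule z[OF B, THEN iffD1])
    then obtain D where D: "D \<in> X" "p D = D" "A \<union> neg (p A) = D \<union> neg D" by blast
    have "blk X p A = blk X p D" using D A unfolding blk_def by simp
    hence "A = D" using build_pos_part[OF ctx, of A] build_pos_part[OF ctx, of D] A D(1) X by (metis subsetD)
    thus "p A = A" using D by simp
   next assume "p A = A"
    thus "zero_block (A \<union> neg (p A))" unfolding zero_block_def by (auto simp: neg_Un)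
   qed
   thus "?g (A \<union> neg (p A)) = aug p A" unfolding aug_def by simp
  qed
  have "add_zero ?P = ?g ` ?P" unfolding add_zero_def using zz True by simp
  also have "\<dots> = (S - X) \<union> neg ` (S - X) \<union> aug p ` X" unfolding e image_Un 1 2 3 by simp
  finally show ?thesis using True by simp
 qed
qed

text \<open>As in type C, except that the central edge of a fixed block is split at 0. If no block
  is fixed, the additional block \<open>{0}\<close> has no edges and changes nothing.\<close>

lemma NN_B_char:
 assumes S: "parts m S" and X: "X \<subseteq> S" and p: "invol X p"
 shows "build S X p \<in> NN_B m \<longleftrightarrow> (S, X) \<in> NNNA m \<and> antiB X p"
proof -
 let ?N = "2 * int m + 2"
 let ?f = "kZ m"
 note k = kZ_ok[of m]
 let ?c = "\<lambda>x y A. (p A \<noteq> A \<and> x = Max A \<and> y = - Max (p A)) \<or> (p A = A \<and> (x = Max A \<and> y = 0 \<or> x = 0 \<and> y = - Max A))"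
 let ?C = "\<lambda>x y. \<exists>A\<in>X. ?c x y A"
 have sb: "A \<subseteq> {1..int m}" "p A \<subseteq> {1..int m}" "A \<noteq> {}" "p A \<noteq> {}" if "A \<in> X" for A
  using part_sub[OF S] part_ne[OF S] X invol_in[OF p] that by blast+
 have Mr: "Max A \<in> {1..int m}" if "A \<in> X" for A using part_Max(1)[OF S _ subsetD[OF X that]] sb(1)[OF that] by blast
 have f0: "?f 0 = int m + 1" unfolding kZ_def by simp
 have R: "(\<exists>A\<in>X. ke ?f (aug p A) x y) \<longleftrightarrow> (\<exists>A\<in>X. (x, y) \<in> edges {A} \<or> (- y, - x) \<in> edges {p A}) \<or> ?C x y" for x y
 proof -
  have "(\<exists>A\<in>X. ke ?f (aug p A) x y) \<longleftrightarrow>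
   (\<exists>A\<in>X. ((x, y) \<in> edges {A} \<or> (- y, - x) \<in> edges {p A}) \<or> ?c x y A)"
  proof (rule bex_cong[OF refl])
   fix A assume A: "A \<in> X"
   have c: "int m < ?f 0" "?f 0 < ?N - int m" unfolding f0 by auto
   show "ke ?f (aug p A) x y \<longleftrightarrow> ((x, y) \<in> edges {A} \<or> (- y, - x) \<in> edges {p A}) \<or> ?c x y A"
   proof (cases "p A = A")
    case True
    show ?thesis unfolding aug_def if_P[OF True] ke_central[OF k sb(1,2)[OF A] c] using sb(3,4)[OF A] True by auto
   next case False
    show ?thesis unfolding aug_def if_not_P[OF False] ke_cross[OF k sb(1,2)[OF A]] using sb(3,4)[OF A] False by auto
   qed
  qed
  thus ?thesis by (simp only: bex_disj_distrib)
 qed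
 have K: "kedge ?f (add_zero (build S X p)) x y \<longleftrightarrow> (x, y) \<in> edges S \<or> (- y, - x) \<in> edges S \<or> ?C x y" for x y
 proof -
  have "kedge ?f (Q \<union> (if b then {} else {{0}})) x y \<longleftrightarrow> kedge ?f Q x y" for Q b
   unfolding kedge_def ke_def by auto
  thus ?thesis unfolding add_zero_build[OF S X p] using kedge_build[OF S X p R k] by simp
 qed
 have fM: "?f (Max A) = Max A" "?f (- Max A) = ?N - Max A" if "A \<in> X" for A using keyok(2,3)[OF k Mr[OF that]] by auto
 have C: "?f x < ?N - int m \<and> int m < ?f y \<and> ?C (- y) (- x) \<and> ?f (- y) = ?N - ?f y" if h: "?C x y" for x y
 proof -
  obtain A where A: "A \<in> X" "?c x y A" using h by blast
  show ?thesis
  proof (cases "p A = A")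
   case False
   hence xy: "x = Max A" "y = - Max (p A)" using A(2) by auto
   note q = invol_in[OF p A(1)]
   have "?C (- y) (- x)" using q invol_inv[OF p A(1)] A(1) False xy by (intro bexI[of _ "p A"]) auto
   thus ?thesis using fM[OF A(1)] fM[OF q] Mr[OF A(1)] Mr[OF q] xy by auto
  next case True
   hence xy: "x = Max A \<and> y = 0 \<or> x = 0 \<and> y = - Max A" using A(2) by auto
   hence "?C (- y) (- x)" using A(1) True by (intro bexI[of _ A]) auto
   moreover have "?f x < ?N - int m \<and> int m < ?f y \<and> ?f (- y) = ?N - ?f y"
    using xy fM[OF A(1)] Mr[OF A(1)] f0 by auto
   ultimately show ?thesis by blast
  qed
 qed
 have CX: "\<exists>y. ?C (Max A) y" if "A \<in> X" for A using that by blast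
 have XC: "(\<exists>A\<in>X. x = Max A) \<or> int m < ?f x" if "?C x y" for x y using that f0 by auto
 have P: "build S X p \<in> Pi_B m" by (rule build_Pi[OF S X p])
 have us: "B \<subseteq> set ([1..int m] @ [0] @ [- int m..-1])" if B: "B \<in> add_zero (build S X p)" for B
 proof -
  have s: "D \<subseteq> {1..int m} \<union> {- int m..-1}" if "D \<in> build S X p" for D by (rule part_sub[OF Pi_B_part[OF P] that])
  have "B = {0} \<or> B \<in> build S X p \<or> (\<exists>D\<in>build S X p. B = insert 0 D)" using B unfolding add_zero_def by (auto split: if_splits)
  thus ?thesis using s by auto
 qed
 have "build S X p \<in> NN_B m \<longleftrightarrow> nonnesting_wrt ([1..int m] @ [0] @ [- int m..-1]) (add_zero (build S X p))"
  unfolding NN_B_def using P by simp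
 also have "\<dots> \<longleftrightarrow> \<not> (\<exists>x y x' y'. kedge ?f (add_zero (build S X p)) x y \<and> kedge ?f (add_zero (build S X p)) x' y' \<and> ?f x < ?f x' \<and> ?f y' < ?f y)"
  by (rule nonnesting_key[OF kZ_sorted us])
 also have "\<dots> \<longleftrightarrow> (S, X) \<in> NNNA m \<and> \<not> (\<exists>x y x' y'. ?C x y \<and> ?C x' y' \<and> ?f x < ?f x' \<and> ?f y' < ?f y)"
  by (rule nonnest_marked[OF k S X K C CX XC])
 also have "\<not> (\<exists>x y x' y'. ?C x y \<and> ?C x' y' \<and> ?f x < ?f x' \<and> ?f y' < ?f y) \<longleftrightarrow> antiB X p"
 proof
  assume n: "\<not> (\<exists>x y x' y'. ?C x y \<and> ?C x' y' \<and> ?f x < ?f x' \<and> ?f y' < ?f y)"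
  have n': False if h: "?C x y" "?C x' y'" "?f x < ?f x'" "?f y' < ?f y" for x y x' y'
   by (rule notE[OF n]) (rule exI[of _ x], rule exI[of _ y], rule exI[of _ x'], rule exI[of _ y'], intro conjI h)
  have c1: "?C (Max A) (- Max (p A))" if "A \<in> X" "p A \<noteq> A" for A by (rule bexI[OF _ that(1)]) (use that in simp)
  have c2: "?C (Max A) 0" if "A \<in> X" "p A = A" for A by (rule bexI[OF _ that(1)]) (use that in simp)
  show "antiB X p" unfolding antiB_def
  proof (intro conjI ballI impI)
   fix A B assume AB: "A \<in> X" "B \<in> X" "p A \<noteq> A" "p B \<noteq> B" "Max A < Max B"
   have l: "?f (Max A) < ?f (Max B)" using fM(1)[OF AB(1)] fM(1)[OF AB(2)] AB(5) by simp
   have "\<not> ?f (- Max (p B)) < ?f (- Max (p A))" by (rule notI, rule n'[OF c1[OF AB(1,3)] c1[OF AB(2,4)] l])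
   hence "Max (p B) \<le> Max (p A)" using fM(2)[OF invol_in[OF p AB(1)]] fM(2)[OF invol_in[OF p AB(2)]] by simp
   thus "Max (p B) < Max (p A)" using anti_iff_strict[OF S X p AB(1,2)] AB(5) by blast
  next fix B A assume AB: "B \<in> X" "A \<in> X" "p B = B" "A \<noteq> B"
   have nA: "p A \<noteq> A" using invol_fix[OF p AB(2,1) _ AB(3)] AB(4) by blast
   show "Max B < Max A"
   proof (rule ccontr)
    assume "\<not> Max B < Max A"
    moreover have "Max A \<noteq> Max B" using part_sub_X(2)[OF S X] AB unfolding inj_on_def by blast
    ultimately have l: "?f (Max A) < ?f (Max B)" using fM(1)[OF AB(1)] fM(1)[OF AB(2)] by simp
    have "?f 0 < ?f (- Max (p A))" using f0 fM(2)[OF invol_in[OF p AB(2)]] Mr[OF invol_in[OF p AB(2)]] by simp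
    thus False by (rule n'[OF c1[OF AB(2) nA] c2[OF AB(1,3)] l])
   qed
  qed
 next assume a: "antiB X p"
  show "\<not> (\<exists>x y x' y'. ?C x y \<and> ?C x' y' \<and> ?f x < ?f x' \<and> ?f y' < ?f y)"
  proof (rule notI, elim exE conjE)
   fix x y x' y' assume *: "?C x y" "?C x' y'" "?f x < ?f x'" "?f y' < ?f y"
   obtain A where A: "A \<in> X" "?c x y A" using *(1) by blast
   obtain B where B: "B \<in> X" "?c x' y' B" using *(2) by blast
   note fA = fM[OF A(1)] fM[OF invol_in[OF p A(1)]] and fB = fM[OF B(1)] fM[OF invol_in[OF p B(1)]]
   show False
   proof (cases "p A = A")
    case True
    hence xA: "x = Max A \<and> y = 0 \<or> x = 0 \<and> y = - Max A" using A(2) by auto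
    show False
    proof (cases "y = 0")
     case True thus False using C[OF *(2)] *(4) f0 by auto
    next case False
     hence "x = 0" using xA by auto
     hence fx: "int m + 1 < ?f x'" using *(3) f0 by simp
     hence "x' \<noteq> 0" using f0 by auto
     hence "x' = Max B" using B(2) by auto
     thus False using fx fB(1) Mr[OF B(1)] by simp
    qed
   next case nA: False
    hence xA: "x = Max A" "y = - Max (p A)" using A(2) by auto
    show False
    proof (cases "p B = B")
     case False
     hence xB: "x' = Max B" "y' = - Max (p B)" using B(2) by auto
     have l: "Max A < Max B" "Max (p A) < Max (p B)" using *(3,4) xA xB fA fB by auto
     have "Max (p B) < Max (p A)" by (rule conjunct1[OF a[unfolded antiB_def], rule_format, OF A(1) B(1) nA False l(1)])
     thus False using l(2) by simp
    next case fixB: True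
     hence xB: "x' = Max B \<and> y' = 0 \<or> x' = 0 \<and> y' = - Max B" using B(2) by auto
     have ne: "A \<noteq> B" using nA fixB by blast
     have ne': "p A \<noteq> B"
     proof
      assume "p A = B"
      hence "p (p A) = p A" using fixB by simp
      thus False using invol_inv[OF p A(1)] nA by simp
     qed
     note a2 = conjunct2[OF a[unfolded antiB_def], rule_format, OF B(1) _ fixB]
     have 1: "Max B < Max A" "Max B < Max (p A)" by (rule a2[OF A(1) ne], rule a2[OF invol_in[OF p A(1)] ne'])
     from xB show False
     proof
      assume "x' = Max B \<and> y' = 0"
      thus False using 1 *(3) xA fA fB by simp
     next assume "x' = 0 \<and> y' = - Max B"
      thus False using 1 *(4) xA fA fB by simp
     qed
    qed
   qed
  qed
 qed
 finally show ?thesis .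
qed

lemma phi_NN_B_bij: "bij_betw phi (NN_B m) (NNNA m)"
proof (rule phi_bij[where C = antiB])
 show "NN_B m \<subseteq> Pi_B m" unfolding NN_B_def by blast
 show "parts m S \<and> X \<subseteq> S" if "(S, X) \<in> NNNA m" for S X by (rule NNNA_part[OF that])
 show "build S X p \<in> NN_B m \<longleftrightarrow> (S, X) \<in> NNNA m \<and> antiB X p" if "parts m S" "X \<subseteq> S" "invol X p" for S X p
  by (rule NN_B_char[OF that])
 show "\<exists>p. invol X p \<and> antiB X p" if "finite X" "inj_on Max X" for X
  by (rule antiB_ex[OF that])
 show "p A = q A" if "finite X" "inj_on Max X" "invol X p" "invol X q" "antiB X p" "antiB X q" "A \<in> X" for X p q A
  by (rule antiB_unique[OF that(1-3,5,4,6,7)])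
qed

text \<open>For odd length the first entry belongs to the fixed block, and the remaining ones are
  matched from the two ends.\<close>

definition pairsumB :: "nat list \<Rightarrow> nat multiset" where
 "pairsumB L = (if even (length L) then pairsum L else pairsum (tl L))"

lemma NN_B_type:
 assumes "P \<in> NN_B m"
 shows "btype P = rest (stat (phi P)) + pairsumB (snd (stat (phi P)))"
proof -
 obtain S X where ph: "phi P = (S, X)" by fastforce
 have Pi: "P \<in> Pi_B m" using assms unfolding NN_B_def by blast
 note B = Pi_build[OF Pi ph]
 obtain p where p: "invol X p" "P = build S X p" using B(3) by blast
 hence a: "antiB X p" using NN_B_char[OF B(1,2) p(1)] assms by simp
 note f = part_sub_X[OF B(1,2)]
 have "image_mset (\<lambda>A. card A + card (p A)) (mset_set {A \<in> X. Max A < Max (p A)}) = pairsumB (map card (by_max X))"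
  using f p(1) a
 proof (cases rule: antiB_cases)
  case even
  thus ?thesis
   using pairsum_rev[OF sorted_by_max[OF f] anti_rev[OF f even(2) invol_image[OF p(1)]]] length_by_max[OF f]
   unfolding set_by_max[OF f] pairsumB_def by simp
 next case (odd F)
  let ?Y = "X - {F}"
  have fY: "finite ?Y" "inj_on Max ?Y" using f(1) inj_on_diff[OF f(2)] by auto
  have "{A \<in> X. Max A < Max (p A)} = {A \<in> ?Y. Max A < Max (p A)}" using odd(3) by auto
  hence "image_mset (\<lambda>A. card A + card (p A)) (mset_set {A \<in> X. Max A < Max (p A)}) = pairsum (map card (by_max ?Y))"
   using pairsum_rev[OF sorted_by_max[OF fY] anti_rev[OF fY odd(6) invol_image[OF odd(5)]]]
   unfolding set_by_max[OF fY] by simp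
  moreover have "length (by_max X) = card X" by (rule length_by_max[OF f])
  ultimately show ?thesis using odd(1,4) unfolding pairsumB_def by simp
 qed
 thus ?thesis unfolding p(2) btype_build[OF B(1,2) p(1)] build_phi[OF B(1,2) p(1)] rest_stat[OF B(1,2)] by (simp add: stat_def)
qed

text \<open>The word moves the middle entry to the front, where \<open>pairsumB\<close> drops it;
  the others keep their order and hence their partners.\<close>

lemma word_B_pairsum: "pairsumB (map (\<lambda>x. L ! (x - 1)) (word_B (length L))) = pairsum L"
proof (cases "even (length L)")
 case True
 have "map (\<lambda>x. L ! (x - 1)) [1..<length L + 1] = L" by (rule nth_equalityI) (simp_all del: upt_Suc)
 thus ?thesis using True unfolding pairsumB_def word_B_def Let_def by simp
next case False
 then obtain t where t: "length L = 2 * t + 1" by (rule oddE)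
 let ?M = "map (\<lambda>x. L ! (x - 1)) ([1..<t + 1] @ [t + 2..<2 * t + 2])"
 have w: "map (\<lambda>x. L ! (x - 1)) (word_B (length L)) = L ! t # ?M" unfolding word_B_def Let_def t by simp
 have lM: "length ?M = 2 * t" by (simp only: length_map length_append length_upt)
 have M: "?M ! i = (if i < t then L ! i else L ! (i + 1))" if "i < 2 * t" for i
  using that by (auto simp: nth_append simp del: upt_Suc)
 have "pairsum ?M = pairsum L" unfolding pairsum_def lM t
 proof (rule arg_cong[where f = mset], rule map_cong)
  show "[0..<2 * t div 2] = [0..<(2 * t + 1) div 2]" by simp
  fix i assume "i \<in> set [0..<(2 * t + 1) div 2]"
  hence i: "i < t" by simp
  hence "?M ! i = L ! i" "?M ! (2 * t - 1 - i) = L ! (2 * t - 1 - i + 1)" using M[of i] M[of "2 * t - 1 - i"] by auto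
  moreover have "2 * t - 1 - i + 1 = 2 * t + 1 - 1 - i" using i by simp
  ultimately show "?M ! i + ?M ! (2 * t - 1 - i) = L ! i + L ! (2 * t + 1 - 1 - i)" by simp
 qed
 thus ?thesis unfolding w pairsumB_def using lM by (simp del: upt_Suc)
qed

section \<open>Partitions of type D\<close>

lemma Pi_B_range: "Q \<in> Pi_B m \<Longrightarrow> B \<in> Q \<Longrightarrow> x \<in> B \<Longrightarrow> x \<noteq> 0 \<and> \<bar>x\<bar> \<le> int m"
 using part_sub[OF Pi_B_part, of Q m B] by fastforce

lemma Pi_B_I:
 assumes "partition_on ({1..int m} \<union> {- int m..-1}) P" "\<And>B. B \<in> P \<Longrightarrow> neg B \<in> P"
  "\<And>A B. A \<in> P \<Longrightarrow> B \<in> P \<Longrightarrow> zero_block A \<Longrightarrow> zero_block B \<Longrightarrow> A = B"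
 shows "P \<in> Pi_B m"
 unfolding Pi_B_def Uniq_def using assms by blast

lemma zero_block_neg [simp]: "zero_block (neg B) \<longleftrightarrow> zero_block B"
 unfolding zero_block_def by (auto simp: neg_inj)

lemma merge_del_eq:
 assumes "partition_on U P" "A \<in> P" "B \<in> P" "int n \<in> A" "- int n \<in> B"
 shows "merge_del n P = (P - {A, B}) \<union> {A \<union> B - {int n, - int n}} - {{}}"
proof -
 have 1: "int n \<in> C \<longleftrightarrow> C = A" if "C \<in> P" for C using part_eq[OF assms(1) that assms(2) _ assms(4)] assms(4) by blast
 have 2: "- int n \<in> C \<longleftrightarrow> C = B" if "C \<in> P" for C using part_eq[OF assms(1) that assms(3) _ assms(5)] assms(5) by blast
 have "{C \<in> P. int n \<notin> C \<and> - int n \<notin> C} = P - {A, B}" using 1 2 by auto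
 moreover have "{C \<in> P. int n \<in> C \<or> - int n \<in> C} = {A, B}" using 1 2 assms(2,3) by auto
 ultimately show ?thesis unfolding merge_del_def by simp
qed

lemma remove_pm_eq:
 assumes "partition_on U P" "A \<in> P" "B \<in> P" "int n \<in> A" "- int n \<in> B"
 shows "remove_pm n P = (P - {A, B}) \<union> {A - {int n, - int n}, B - {int n, - int n}} - {{}}"
proof -
 let ?r = "\<lambda>C. C - {int n, - int n}"
 have "?r ` (P - {A, B}) = (\<lambda>C. C) ` (P - {A, B})"
 proof (rule image_cong[OF refl])
  fix C assume C: "C \<in> P - {A, B}"
  hence "int n \<notin> C" "- int n \<notin> C" using part_eq[OF assms(1) _ assms(2) _ assms(4), of C] part_eq[OF assms(1) _ assms(3) _ assms(5), of C] by blast+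
  thus "?r C = C" by blast
 qed
 moreover have "P = (P - {A, B}) \<union> {A, B}" using assms(2,3) by blast
 hence "?r ` P = ?r ` (P - {A, B}) \<union> {?r A, ?r B}" by (metis image_Un image_empty image_insert)
 ultimately show ?thesis unfolding remove_pm_def by simp
qed

section \<open>Centred partitions of type D\<close>

text \<open>Inverse of passing to the merged partition on the centred ones: the zero block regains
  \<open>n\<close> and \<open>- n\<close>, or two singletons are added.\<close>

definition cext :: "nat \<Rightarrow> int set set \<Rightarrow> int set set" where
 "cext n Q = (if \<exists>B\<in>Q. zero_block B then (\<lambda>B. if zero_block B then B \<union> {int n, - int n} else B) ` Q
   else Q \<union> {{int n}, {- int n}})"

lemma ground_Suc: "{1..int (Suc m)} \<union> {- int (Suc m)..-1} = ({1..int m} \<union> {- int m..-1}) \<union> {int (Suc m), - int (Suc m)}"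
 by auto

lemma Pi_B_zero_cases:
 assumes "Q \<in> Pi_B m"
 obtains (none) "\<not> (\<exists>B\<in>Q. zero_block B)" | (zero) Z where "Z \<in> Q" "zero_block Z" "\<And>B. B \<in> Q \<Longrightarrow> zero_block B \<Longrightarrow> B = Z"
 using Pi_B_zero[OF assms] by metis

lemma cext_zero:
 assumes Q: "Q \<in> Pi_B m" and Z: "Z \<in> Q" "zero_block Z"
 shows "cext n Q = insert (Z \<union> {int n, - int n}) (Q - {Z})"
proof -
 let ?g = "\<lambda>B. if zero_block B then B \<union> {int n, - int n} else B"
 have "?g ` (Q - {Z}) = (\<lambda>B. B) ` (Q - {Z})"
 proof (rule image_cong[OF refl])
  fix B assume "B \<in> Q - {Z}"
  hence "\<not> zero_block B" using Pi_B_zero[OF Q _ Z(1) _ Z(2), of B] by blast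
  thus "?g B = B" by simp
 qed
 moreover have "Q = insert Z (Q - {Z})" using Z(1) by blast
 hence "?g ` Q = ?g ` insert Z (Q - {Z})" by (rule arg_cong)
 hence "?g ` Q = insert (?g Z) (?g ` (Q - {Z}))" unfolding image_insert .
 moreover have "\<exists>B\<in>Q. zero_block B" using Z by blast
 ultimately show ?thesis unfolding cext_def using Z(2) by simp
qed

lemma neg_insert: "neg (insert x B) = insert (- x) (neg B)"
 by (rule image_insert)

text \<open>The additional part 1 of the type comes from the pair of singletons, present exactly
  when there is no zero block.\<close>

lemma cext_props:
 assumes Q: "Q \<in> Pi_B m"
 shows "cext (Suc m) Q \<in> Pi_B (Suc m)" "zero_blocks_D (Suc m) (cext (Suc m) Q)" "centred (Suc m) (cext (Suc m) Q)"
  "merge_del (Suc m) (cext (Suc m) Q) = Q" "remove_pm (Suc m) (cext (Suc m) Q) = Q"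
  "btype (cext (Suc m) Q) = btype Q + (if \<exists>B\<in>Q. zero_block B then {#} else {#1#})"
proof -
 let ?n = "Suc m" let ?N = "int ?n"
 let ?P = "cext ?n Q"
 note pQ = Pi_B_part[OF Q]
 have NQ: "?N \<notin> B" "- ?N \<notin> B" if "B \<in> Q" for B using Pi_B_range[OF Q that, of ?N] Pi_B_range[OF Q that, of "- ?N"] by auto
 have neQ: "B \<noteq> {}" if "B \<in> Q" for B using part_ne[OF pQ that] .
 have fQ: "finite Q" using part_finite[OF pQ] by simp
 have "?P \<in> Pi_B ?n \<and> zero_blocks_D ?n ?P \<and> centred ?n ?P \<and> merge_del ?n ?P = Q \<and> remove_pm ?n ?P = Q \<and>
   btype ?P = btype Q + (if \<exists>B\<in>Q. zero_block B then {#} else {#1#})"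
  using Q
 proof (cases rule: Pi_B_zero_cases)
  case none
  have e: "?P = insert {- ?N} (insert {?N} Q)" unfolding cext_def using none by auto
  have z: "\<not> zero_block B" if "B \<in> ?P" for B
   using that none unfolding e zero_block_def by auto
  have p1: "partition_on (({1..int m} \<union> {- int m..-1}) \<union> {?N}) (insert {?N} Q)" by (rule part_insert[OF pQ]) auto
  have "partition_on (({1..int m} \<union> {- int m..-1}) \<union> {?N} \<union> {- ?N}) ?P" unfolding e by (rule part_insert[OF p1]) auto
  hence p: "partition_on ({1..?N} \<union> {- ?N..-1}) ?P" unfolding ground_Suc by (simp only: Un_insert_right Un_insert_left Un_empty_right insert_commute)
  have Pi: "?P \<in> Pi_B ?n"
  proof (rule Pi_B_I[OF p])
   show "neg B \<in> ?P" if "B \<in> ?P" for B using that Pi_B_neg[OF Q] unfolding e by auto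
  qed (use z in blast)
  have zD: "zero_blocks_D ?n ?P" unfolding zero_blocks_D_def using z by blast
  have c: "centred ?n ?P" unfolding centred_def e by simp
  have AB: "{?N} \<in> ?P" "{- ?N} \<in> ?P" unfolding e by auto
  have d: "?P - {{?N}, {- ?N}} = Q" unfolding e using NQ by auto
  have "{} \<notin> Q" using neQ by blast
  hence md: "merge_del ?n ?P = Q" "remove_pm ?n ?P = Q"
   using merge_del_eq[OF p AB] remove_pm_eq[OF p AB] unfolding d by auto
  have "btype ?P = btype Q + {#1#}"
  proof -
   let ?W = "{{B, neg B} |B. B \<in> Q \<and> \<not> zero_block B}"
   have 1: "{{B, neg B} |B. B \<in> ?P \<and> \<not> zero_block B} = insert {{?N}, {- ?N}} ?W"
   proof (intro equalityI subsetI)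
    fix q assume "q \<in> {{B, neg B} |B. B \<in> ?P \<and> \<not> zero_block B}"
    then obtain B where B: "q = {B, neg B}" "B \<in> ?P" "\<not> zero_block B" by blast
    then consider "B = {?N}" | "B = {- ?N}" | "B \<in> Q" unfolding e by blast
    thus "q \<in> insert {{?N}, {- ?N}} ?W"
    proof cases
     case 1 thus ?thesis using B by simp
    next case 2 thus ?thesis using B by (simp add: insert_commute add.commute)
    next case 3 thus ?thesis using B by blast
    qed
   next fix q assume "q \<in> insert {{?N}, {- ?N}} ?W"
    then consider "q = {{?N}, neg {?N}}" | "q \<in> ?W" by auto
    thus "q \<in> {{B, neg B} |B. B \<in> ?P \<and> \<not> zero_block B}"
    proof cases
     case 1 thus ?thesis using AB z[OF AB(1)] by blast
    next case 2 thus ?thesis unfolding e by blast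
    qed
   qed
   have 2: "{{?N}, {- ?N}} \<notin> ?W"
   proof
    assume "{{?N}, {- ?N}} \<in> ?W"
    then obtain B where B: "{{?N}, {- ?N}} = {B, neg B}" "B \<in> Q" by blast
    hence "B = {?N} \<or> B = {- ?N}" by blast
    thus False using NQ[OF B(2)] by blast
   qed
   have "finite ?W" using fQ by simp
   hence "mset_set (insert {{?N}, {- ?N}} ?W) = add_mset {{?N}, {- ?N}} (mset_set ?W)" using 2 by (rule mset_set.insert)
   moreover have "the_elem (card ` {{?N}, {- ?N}}) = 1" by simp
   ultimately show ?thesis unfolding btype_def 1 by simp
  qed
  thus ?thesis using none Pi zD c md by simp
 next case (zero Z)
  let ?Z = "Z \<union> {?N, - ?N}"
  have e: "?P = insert ?Z (Q - {Z})" by (rule cext_zero[OF Q zero(1,2)])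
  have zZ: "zero_block ?Z" using zero(2) unfolding zero_block_def by (simp add: neg_Un insert_commute add.commute)
  have nz: "\<not> zero_block B" if "B \<in> Q - {Z}" for B using that zero(3) by blast
  have "partition_on ((({1..int m} \<union> {- int m..-1}) - Z) \<union> ?Z) ?P" unfolding e
   by (rule part_insert[OF part_diff[OF pQ zero(1)]]) auto
  moreover have "(({1..int m} \<union> {- int m..-1}) - Z) \<union> ?Z = {1..?N} \<union> {- ?N..-1}"
   unfolding ground_Suc using part_sub[OF pQ zero(1)] by blast
  ultimately have p: "partition_on ({1..?N} \<union> {- ?N..-1}) ?P" by simp
  have Pi: "?P \<in> Pi_B ?n"
  proof (rule Pi_B_I[OF p])
   fix B assume "B \<in> ?P"
   then consider "B = ?Z" | "B \<in> Q - {Z}" unfolding e by blast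
   thus "neg B \<in> ?P"
   proof cases
    case 1 thus ?thesis using zZ unfolding zero_block_def e by simp
   next case 2
    hence "neg B \<in> Q" using Pi_B_neg[OF Q] by blast
    moreover have "neg B \<noteq> Z" using nz[OF 2] zero(2) by (metis zero_block_neg)
    ultimately show ?thesis unfolding e by blast
   qed
  next fix A B assume "A \<in> ?P" "B \<in> ?P" "zero_block A" "zero_block B"
   thus "A = B" using nz unfolding e by blast
  qed
  obtain z where z: "z \<in> Z" using neQ[OF zero(1)] by blast
  have "z \<noteq> ?N" "z \<noteq> - ?N" using z NQ[OF zero(1)] by (metis, metis)
  hence sub: "{?N, - ?N} \<subset> ?Z" using z by (intro psubsetI) auto
  have zD: "zero_blocks_D ?n ?P" unfolding zero_blocks_D_def
  proof (intro ballI impI)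
   fix B assume B: "B \<in> ?P" "zero_block B"
   hence "B = ?Z" using nz[of B] unfolding e by blast
   thus "{?N, - ?N} \<subset> B" using sub by simp
  qed
  have c: "centred ?n ?P" unfolding centred_def e using zZ by blast
  have AB: "?Z \<in> ?P" "?N \<in> ?Z" "- ?N \<in> ?Z" unfolding e by auto
  have "?Z \<notin> Q" using NQ by blast
  hence d: "?P - {?Z, ?Z} = Q - {Z}" unfolding e by blast
  have d2: "?Z \<union> ?Z - {?N, - ?N} = Z" "?Z - {?N, - ?N} = Z" using NQ[OF zero(1)] by auto
  have "{} \<notin> Q" using neQ by blast
  hence md: "merge_del ?n ?P = Q" "remove_pm ?n ?P = Q"
   using merge_del_eq[OF p AB(1,1,2,3)] remove_pm_eq[OF p AB(1,1,2,3)] zero(1) unfolding d d2 by auto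
  have "{{B, neg B} |B. B \<in> ?P \<and> \<not> zero_block B} = {{B, neg B} |B. B \<in> Q \<and> \<not> zero_block B}"
   unfolding e using zZ zero(2) by blast
  hence "btype ?P = btype Q" unfolding btype_def by simp
  moreover have "\<exists>B\<in>Q. zero_block B" using zero by blast
  ultimately show ?thesis using Pi zD c md by simp
 qed
 thus "cext (Suc m) Q \<in> Pi_B (Suc m)" "zero_blocks_D (Suc m) (cext (Suc m) Q)" "centred (Suc m) (cext (Suc m) Q)"
  "merge_del (Suc m) (cext (Suc m) Q) = Q" "remove_pm (Suc m) (cext (Suc m) Q) = Q"
  "btype (cext (Suc m) Q) = btype Q + (if \<exists>B\<in>Q. zero_block B then {#} else {#1#})" by blast+
qed

text \<open>By \<open>zero_blocks_D\<close> a zero block strictly contains \<open>n\<close> and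
  \<open>- n\<close>, so it stays nonempty after their removal.\<close>

lemma centred_cext:
 assumes P: "P \<in> Pi_B (Suc m)" and z: "zero_blocks_D (Suc m) P" and c: "centred (Suc m) P"
 shows "\<exists>Q\<in>Pi_B m. P = cext (Suc m) Q"
proof -
 let ?N = "int (Suc m)"
 note pP = Pi_B_part[OF P]
 show ?thesis
 proof (cases "\<exists>B\<in>P. zero_block B")
  case False
  hence AB: "{?N} \<in> P" "{- ?N} \<in> P" using c unfolding centred_def by auto
  let ?Q = "P - {{?N}} - {{- ?N}}"
  have "partition_on (({1..?N} \<union> {- ?N..-1}) - {?N} - {- ?N}) ?Q"
   by (rule part_diff[OF part_diff[OF pP AB(1)]]) (use AB in auto)
  moreover have "({1..?N} \<union> {- ?N..-1}) - {?N} - {- ?N} = {1..int m} \<union> {- int m..-1}" by auto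
  ultimately have p: "partition_on ({1..int m} \<union> {- int m..-1}) ?Q" by simp
  have "?Q \<in> Pi_B m"
  proof (rule Pi_B_I[OF p])
   fix B assume B: "B \<in> ?Q"
   have "neg B \<noteq> {?N}" "neg B \<noteq> {- ?N}"
   proof -
    have "B \<noteq> neg {?N}" "B \<noteq> neg {- ?N}" using B by auto
    thus "neg B \<noteq> {?N}" "neg B \<noteq> {- ?N}" using neg_neg[of B] by metis+
   qed
   thus "neg B \<in> ?Q" using Pi_B_neg[OF P, of B] B by blast
  qed (use False in blast)
  moreover have "P = cext (Suc m) ?Q" unfolding cext_def using False AB by auto
  ultimately show ?thesis by blast
 next case True
  then obtain Z where Z: "Z \<in> P" "zero_block Z" by blast
  have NZ: "{?N, - ?N} \<subset> Z" using z Z unfolding zero_blocks_D_def by blast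
  let ?Z = "Z - {?N, - ?N}"
  let ?Q = "insert ?Z (P - {Z})"
  have "partition_on ((({1..?N} \<union> {- ?N..-1}) - Z) \<union> ?Z) ?Q"
   by (rule part_insert[OF part_diff[OF pP Z(1)]]) (use NZ in auto)
  moreover have "(({1..?N} \<union> {- ?N..-1}) - Z) \<union> ?Z = {1..int m} \<union> {- int m..-1}"
  proof -
   have "Z \<subseteq> {1..?N} \<union> {- ?N..-1}" by (rule part_sub[OF pP Z(1)])
   hence "(({1..?N} \<union> {- ?N..-1}) - Z) \<union> ?Z = ({1..?N} \<union> {- ?N..-1}) - {?N, - ?N}" using NZ by blast
   also have "\<dots> = {1..int m} \<union> {- int m..-1}" by auto
   finally show ?thesis .
  qed
  ultimately have p: "partition_on ({1..int m} \<union> {- int m..-1}) ?Q" by simp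
  have nz: "\<not> zero_block B" if "B \<in> P - {Z}" for B using Pi_B_zero[OF P _ Z(1) _ Z(2), of B] that by blast
  have zZ: "zero_block ?Z" unfolding zero_block_def
  proof -
   have nZ: "neg Z = Z" using Z(2) unfolding zero_block_def .
   show "neg ?Z = ?Z"
   proof (rule set_eqI)
    fix x
    have "- x \<in> Z \<longleftrightarrow> x \<in> Z" using mem_neg[of x Z] nZ by simp
    thus "x \<in> neg ?Z \<longleftrightarrow> x \<in> ?Z" by (auto simp: mem_neg)
   qed
  qed
  have Q: "?Q \<in> Pi_B m"
  proof (rule Pi_B_I[OF p])
   fix B assume "B \<in> ?Q"
   then consider "B = ?Z" | "B \<in> P - {Z}" by blast
   thus "neg B \<in> ?Q"
   proof cases
    case 1 thus ?thesis using zZ unfolding zero_block_def by simp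
   next case 2
    hence "neg B \<in> P" using Pi_B_neg[OF P] by blast
    moreover have "neg B \<noteq> Z" using nz[OF 2] Z(2) by (metis zero_block_neg)
    ultimately show ?thesis by blast
   qed
  next fix A B assume "A \<in> ?Q" "B \<in> ?Q" "zero_block A" "zero_block B"
   thus "A = B" using nz by blast
  qed
  have "?Z \<notin> P - {Z}" using nz zZ by blast
  hence "?Q - {?Z} = P - {Z}" by blast
  moreover have "?Z \<union> {?N, - ?N} = Z" using NZ by blast
  moreover have "cext (Suc m) ?Q = insert (?Z \<union> {?N, - ?N}) (?Q - {?Z})" by (rule cext_zero[OF Q _ zZ]) blast
  ultimately have "cext (Suc m) ?Q = P" using Z(1) by auto
  thus ?thesis using Q by blast
 qed
qed

section \<open>Noncentred partitions of type D\<close>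

text \<open>By \<open>ext_props\<close> and \<open>noncentred_ext\<close>, the noncentred partitions
  are those obtained in this way from a partition \<open>Q\<close> without zero block.\<close>

definition ext :: "nat \<Rightarrow> int set set \<Rightarrow> int set \<Rightarrow> int set set" where
 "ext n Q D = (Q - {D, neg D}) \<union> {insert (int n) D, insert (- int n) (neg D)}"

lemma ext_props:
 assumes Q: "Q \<in> Pi_B m" and nz0: "\<forall>B\<in>Q. \<not> zero_block B" and D: "D \<in> Q"
 shows "ext (Suc m) Q D \<in> Pi_B (Suc m)" "\<forall>B\<in>ext (Suc m) Q D. \<not> zero_block B"
  "\<not> centred (Suc m) (ext (Suc m) Q D)" "remove_pm (Suc m) (ext (Suc m) Q D) = Q"
  "merge_del (Suc m) (ext (Suc m) Q D) = (Q - {D, neg D}) \<union> {D \<union> neg D}"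
  "block_of (ext (Suc m) Q D) (int (Suc m)) = insert (int (Suc m)) D"
proof -
 let ?n = "Suc m" let ?N = "int ?n"
 let ?P = "ext ?n Q D"
 let ?A = "insert ?N D" and ?B = "insert (- ?N) (neg D)"
 note pQ = Pi_B_part[OF Q]
 have NQ: "?N \<notin> B" "- ?N \<notin> B" if "B \<in> Q" for B using Pi_B_range[OF Q that, of ?N] Pi_B_range[OF Q that, of "- ?N"] by auto
 have nz: "\<not> zero_block B" if "B \<in> Q" for B using nz0 that by blast
 have nD: "neg D \<in> Q" by (rule Pi_B_neg[OF Q D])
 have Dn: "neg D \<noteq> D" using nz[OF D] unfolding zero_block_def .
 have e: "?P = insert ?B (insert ?A (Q - {D} - {neg D}))" unfolding ext_def by auto
 have r1: "partition_on (({1..int m} \<union> {- int m..-1}) - D - neg D) (Q - {D} - {neg D})"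
  by (rule part_diff[OF part_diff[OF pQ D]]) (use nD Dn in auto)
 have r2: "partition_on ((({1..int m} \<union> {- int m..-1}) - D - neg D) \<union> ?A) (insert ?A (Q - {D} - {neg D}))"
  by (rule part_insert[OF r1]) auto
 have dis: "D \<inter> neg D = {}" using part_eq[OF pQ D nD] Dn by blast
 have r3: "partition_on ((({1..int m} \<union> {- int m..-1}) - D - neg D) \<union> ?A \<union> ?B) ?P"
  unfolding e by (rule part_insert[OF r2]) (use dis NQ[OF D] NQ[OF nD] in auto)
 have "(({1..int m} \<union> {- int m..-1}) - D - neg D) \<union> ?A \<union> ?B = {1..?N} \<union> {- ?N..-1}"
  unfolding ground_Suc using part_sub[OF pQ D] part_sub[OF pQ nD] by blast
 hence p: "partition_on ({1..?N} \<union> {- ?N..-1}) ?P" using r3 by simp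
 have nA: "neg ?A = ?B" "neg ?B = ?A" by (simp_all add: neg_insert del: of_nat_Suc)
 have zA: "\<not> zero_block ?A"
 proof
  assume "zero_block ?A"
  hence "?B = ?A" using nA(1) unfolding zero_block_def by simp
  hence "- ?N \<in> ?A" by blast
  thus False using NQ(2)[OF D] by simp
 qed
 have zB: "\<not> zero_block ?B" using zA nA(1) zero_block_neg[of ?A] by simp
 have z: "\<not> zero_block B" if "B \<in> ?P" for B using that nz zA zB unfolding e by blast
 thus "\<forall>B\<in>?P. \<not> zero_block B" by blast
 show "?P \<in> Pi_B ?n"
 proof (rule Pi_B_I[OF p])
  fix B assume "B \<in> ?P"
  then consider "B = ?A" | "B = ?B" | "B \<in> Q" "B \<noteq> D" "B \<noteq> neg D" unfolding e by blast
  thus "neg B \<in> ?P"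
  proof cases
   case 1 thus ?thesis using nA e by simp
  next case 2 thus ?thesis using nA e by simp
  next case 3
   have "neg B \<in> Q" by (rule Pi_B_neg[OF Q 3(1)])
   moreover have "neg B \<noteq> neg D" using 3(2) neg_inj[of B D] by simp
   moreover have "neg B \<noteq> D" using 3(3) neg_neg[of B] by metis
   ultimately show ?thesis unfolding e by blast
  qed
 qed (use z in blast)
 have AB: "?A \<in> ?P" "?B \<in> ?P" "?N \<in> ?A" "- ?N \<in> ?B" unfolding e by auto
 have D0: "D \<noteq> {}" using part_ne[OF pQ D] .
 have "{?N} \<notin> ?P"
 proof
  assume "{?N} \<in> ?P"
  hence "{?N} = ?A" using part_eq[OF p _ AB(1) _ AB(3), of "{?N}"] by simp
  thus False using D0 NQ(1)[OF D] by auto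
 qed
 thus "\<not> centred ?n ?P" unfolding centred_def using z by blast
 have d: "?P - {?A, ?B} = Q - {D, neg D}"
 proof -
  have "?A \<notin> Q" "?B \<notin> Q" using NQ by blast+
  thus ?thesis unfolding e by blast
 qed
 have d2: "?A - {?N, - ?N} = D" "?B - {?N, - ?N} = neg D" "?A \<union> ?B - {?N, - ?N} = D \<union> neg D" using NQ[OF D] NQ[OF nD] by auto
 have ne: "{} \<notin> Q" using part_ne[OF pQ] by blast
 show "remove_pm ?n ?P = Q" unfolding remove_pm_eq[OF p AB] d d2 using ne D nD by auto
 show "merge_del ?n ?P = (Q - {D, neg D}) \<union> {D \<union> neg D}" unfolding merge_del_eq[OF p AB] d d2 using ne D0 by auto
 show "block_of ?P ?N = ?A" by (rule part_block_of[OF p AB(1,3)])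
qed

lemma noncentred_ext:
 assumes P: "P \<in> Pi_B (Suc m)" and c: "\<not> centred (Suc m) P"
 shows "\<exists>Q D. Q \<in> Pi_B m \<and> (\<forall>B\<in>Q. \<not> zero_block B) \<and> D \<in> Q \<and> P = ext (Suc m) Q D"
proof -
 let ?N = "int (Suc m)"
 note pP = Pi_B_part[OF P]
 have nz: "\<not> zero_block B" if "B \<in> P" for B using c that unfolding centred_def by blast
 obtain A where A: "A \<in> P" "?N \<in> A" using part_ex[OF pP, of ?N] by auto
 have nA: "neg A \<in> P" "- ?N \<in> neg A" using Pi_B_neg[OF P A(1)] A(2) by (auto simp: mem_neg simp del: of_nat_Suc)
 have ne: "neg A \<noteq> A" using nz[OF A(1)] unfolding zero_block_def .
 have dis: "A \<inter> neg A = {}" using part_eq[OF pP A(1) nA(1)] ne by blast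
 let ?D = "A - {?N}"
 have nD: "neg ?D = neg A - {- ?N}" by (auto simp: mem_neg)
 have D0: "?D \<noteq> {}"
 proof
  assume "?D = {}"
  hence "A = {?N}" using A(2) by blast
  hence "{?N} \<in> P" "{- ?N} \<in> P" using A nA by auto
  thus False using c unfolding centred_def by blast
 qed
 hence nD0: "neg ?D \<noteq> {}" by simp
 define Q where "Q = insert (neg ?D) (insert ?D (P - {A} - {neg A}))"
 have r1: "partition_on (({1..?N} \<union> {- ?N..-1}) - A - neg A) (P - {A} - {neg A})"
  by (rule part_diff[OF part_diff[OF pP A(1)]]) (use nA ne in auto)
 have r2: "partition_on ((({1..?N} \<union> {- ?N..-1}) - A - neg A) \<union> ?D) (insert ?D (P - {A} - {neg A}))"
  by (rule part_insert[OF r1 D0]) auto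
 have r3: "partition_on ((({1..?N} \<union> {- ?N..-1}) - A - neg A) \<union> ?D \<union> neg ?D) Q"
  unfolding Q_def by (rule part_insert[OF r2 nD0]) (use dis in \<open>auto simp: nD\<close>)
 have "(({1..?N} \<union> {- ?N..-1}) - A - neg A) \<union> ?D \<union> neg ?D = ({1..?N} \<union> {- ?N..-1}) - {?N, - ?N}"
  unfolding nD using part_sub[OF pP A(1)] part_sub[OF pP nA(1)] A(2) nA(2) dis by blast
 also have "\<dots> = {1..int m} \<union> {- int m..-1}" by auto
 finally have p: "partition_on ({1..int m} \<union> {- int m..-1}) Q" using r3 by simp
 have zD: "\<not> zero_block ?D"
 proof
  assume "zero_block ?D"
  hence "neg A - {- ?N} = ?D" unfolding zero_block_def nD .
  thus False using D0 dis by blast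
 qed
 have zQ: "\<not> zero_block B" if "B \<in> Q" for B
  using that nz zD zero_block_neg[of ?D] unfolding Q_def by blast
 have Pi: "Q \<in> Pi_B m"
 proof (rule Pi_B_I[OF p])
  fix B assume "B \<in> Q"
  then consider "B = ?D" | "B = neg ?D" | "B \<in> P" "B \<noteq> A" "B \<noteq> neg A" unfolding Q_def by blast
  thus "neg B \<in> Q"
  proof cases
   case 1 thus ?thesis unfolding Q_def by simp
  next case 2
   hence "neg B = ?D" by (simp only: neg_neg)
   thus ?thesis unfolding Q_def by simp
  next case 3
   have "neg B \<in> P" by (rule Pi_B_neg[OF P 3(1)])
   moreover have "neg B \<noteq> neg A" using 3(3) neg_inj[of B A] 3(2) by simp
   moreover have "neg B \<noteq> A" using 3(3) neg_neg[of B] by metis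
   ultimately show ?thesis unfolding Q_def by blast
  qed
 qed (use zQ in blast)
 have "P = ext (Suc m) Q ?D"
 proof -
  have 1: "?D \<notin> P" "neg ?D \<notin> P"
  proof -
   show "?D \<notin> P" using part_eq[OF pP _ A(1), of ?D] D0 A(2) by blast
   show "neg ?D \<notin> P" using part_eq[OF pP _ nA(1), of "neg ?D"] nD0 nA(2) unfolding nD by blast
  qed
  hence "Q - {?D, neg ?D} = P - {A} - {neg A}" unfolding Q_def by blast
  moreover have "insert ?N ?D = A" "insert (- ?N) (neg ?D) = neg A" unfolding nD using A nA by auto
  ultimately show ?thesis unfolding ext_def using A nA by auto
 qed
 moreover have "?D \<in> Q" unfolding Q_def by blast
 ultimately show ?thesis using Pi zQ by blast
qed

text \<open>\<open>lo\<close> and \<open>p lo\<close> are the positive parts, apart from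
  \<open>n\<close>, of the blocks of \<open>n\<close> and \<open>- n\<close>. The case
  \<open>p lo = lo\<close> encodes that these blocks have, apart from \<open>n\<close> and
  \<open>- n\<close>, elements of one sign only.\<close>

definition dok :: "int set set \<Rightarrow> (int set \<Rightarrow> int set) \<Rightarrow> int set \<Rightarrow> bool" where
 "dok X p lo \<longleftrightarrow> invol X p \<and> lo \<in> X \<and> Max lo \<le> Max (p lo) \<and> (\<forall>A\<in>X. p A = A \<longrightarrow> A = lo)"

text \<open>If \<open>p lo = lo\<close>, the block \<open>lo\<close> is marked only because
  \<open>n\<close> or \<open>- n\<close> was attached to it; without these points it is an ordinary
  unmarked block.\<close>

definition dcore :: "int set set \<Rightarrow> (int set \<Rightarrow> int set) \<Rightarrow> int set \<Rightarrow> int set set" where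
 "dcore X p lo = (if p lo = lo then X - {lo} else X)"

definition B0 :: "(int set \<Rightarrow> int set) \<Rightarrow> int set \<Rightarrow> int set" where
 "B0 p lo = (if p lo = lo then lo else lo \<union> neg (p lo))"

text \<open>\<open>e\<close> decides which of the two opposite blocks receives \<open>n\<close>, the
  choice that \<open>phi_D\<close> records as its sign.\<close>

definition dbuild :: "nat \<Rightarrow> int set set \<Rightarrow> int set set \<Rightarrow> (int set \<Rightarrow> int set) \<Rightarrow> int set \<Rightarrow> int \<Rightarrow> int set set" where
 "dbuild m S X p lo e = ext (Suc m) (build S (dcore X p lo) p) (if e = 1 then B0 p lo else neg (B0 p lo))"

lemma dokD: "dok X p lo \<Longrightarrow> invol X p" "dok X p lo \<Longrightarrow> lo \<in> X" "dok X p lo \<Longrightarrow> Max lo \<le> Max (p lo)"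
 "dok X p lo \<Longrightarrow> A \<in> X \<Longrightarrow> p A = A \<Longrightarrow> A = lo"
 unfolding dok_def by blast+

lemma dok_rest:
 assumes d: "dok X p lo"
 shows "invol (X - {lo, p lo}) p" "A \<in> X - {lo, p lo} \<Longrightarrow> p A \<noteq> A"
proof -
 note p = dokD(1)[OF d] and lo = dokD(2)[OF d]
 have nf: "p A \<noteq> A" if A: "A \<in> X - {lo, p lo}" for A
 proof
  assume e: "p A = A"
  have "A = lo" by (rule dokD(4)[OF d _ e]) (use A in simp)
  thus False using A by simp
 qed
 thus "A \<in> X - {lo, p lo} \<Longrightarrow> p A \<noteq> A" .
 show "invol (X - {lo, p lo}) p" unfolding invol_def
 proof (intro conjI ballI impI)
  fix A assume A: "A \<in> X - {lo, p lo}"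
  hence AX: "A \<in> X" by simp
  show "p (p A) = A" by (rule invol_inv[OF p AX])
  have "p A \<noteq> lo"
  proof
   assume "p A = lo"
   from arg_cong[OF this, of p] have "A = p lo" unfolding invol_inv[OF p AX] .
   thus False using A by simp
  qed
  moreover have "p A \<noteq> p lo"
  proof
   assume "p A = p lo"
   from arg_cong[OF this, of p] have "A = lo" unfolding invol_inv[OF p AX] invol_inv[OF p lo] .
   thus False using A by simp
  qed
  ultimately show "p A \<in> X - {lo, p lo}" using invol_in[OF p AX] by simp
 next fix A B assume "A \<in> X - {lo, p lo}" "p A = A"
  thus "A = B" using nf by blast
 qed
qed

lemma dcore_props:
 assumes d: "dok X p lo"
 shows "invol (dcore X p lo) p" "dcore X p lo \<subseteq> X" "\<And>A. A \<in> dcore X p lo \<Longrightarrow> p A \<noteq> A"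
proof -
 note p = dokD(1)[OF d] and lo = dokD(2)[OF d]
 show s: "dcore X p lo \<subseteq> X" unfolding dcore_def by auto
 show nf: "p A \<noteq> A" if "A \<in> dcore X p lo" for A
 proof
  assume e: "p A = A"
  have "A \<in> X" using that s by blast
  hence "A = lo" by (rule dokD(4)[OF d _ e])
  thus False using that e unfolding dcore_def by simp
 qed
 show "invol (dcore X p lo) p"
 proof (cases "p lo = lo")
  case True
  hence "dcore X p lo = X - {lo, p lo}" unfolding dcore_def by simp
  thus ?thesis using dok_rest(1)[OF d] by (simp only:)
 next case False
  hence "dcore X p lo = X" unfolding dcore_def by simp
  thus ?thesis using p by (simp only:)
 qed
qed

lemma dbuild_props:
 assumes S: "parts m S" and X: "X \<subseteq> S" and d: "dok X p lo"
 defines "Q \<equiv> build S (dcore X p lo) p"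
 shows "Q \<in> Pi_B m" "\<forall>B\<in>Q. \<not> zero_block B" "B0 p lo \<in> Q" "neg (B0 p lo) \<in> Q" "phi Q = (S, dcore X p lo)"
  "(if e = (1::int) then B0 p lo else neg (B0 p lo)) \<in> Q"
proof -
 note c = dcore_props[OF d]
 have XS: "dcore X p lo \<subseteq> S" using c(2) X by blast
 note ctx = S XS c(1)
 show Pi: "Q \<in> Pi_B m" unfolding Q_def by (rule build_Pi[OF ctx])
 show "\<forall>B\<in>Q. \<not> zero_block B"
 proof (intro ballI notI)
  fix B assume that: "B \<in> Q" and "zero_block B"
  hence "\<exists>A\<in>dcore X p lo. p A = A \<and> B = A \<union> neg A" using build_zero[OF ctx] that unfolding Q_def by simp
  then obtain A where "A \<in> dcore X p lo" "p A = A" by blast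
  thus False using c(3) by simp
 qed
 have lo: "lo \<in> X" "lo \<in> S" using dokD(2)[OF d] X by auto
 have "blk (dcore X p lo) p lo = B0 p lo" unfolding blk_def B0_def dcore_def using lo by simp
 moreover have "blk (dcore X p lo) p lo \<in> Q" unfolding Q_def build_def using lo(2) by simp
 ultimately show B: "B0 p lo \<in> Q" by simp
 thus nB: "neg (B0 p lo) \<in> Q" by (rule Pi_B_neg[OF Pi])
 show "phi Q = (S, dcore X p lo)" unfolding Q_def by (rule build_phi[OF ctx])
 show "(if e = (1::int) then B0 p lo else neg (B0 p lo)) \<in> Q" using B nB by simp
qed

definition eps :: "int set \<Rightarrow> int" where
 "eps D = (if pos (neg D) = {} \<or> (pos D \<noteq> {} \<and> pos (neg D) \<noteq> {} \<and> Max (pos D) < Max (pos (neg D))) then 1 else - 1)"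

text \<open>Attaching \<open>n\<close> or \<open>- n\<close> makes a block consisting of positive
  elements only properly contained in the new block, so \<open>D\<close> or \<open>neg D\<close>
  becomes marked when it lies in \<open>S\<close>.\<close>

lemma phi_D_ext:
 assumes Q: "Q \<in> Pi_B m" and nz: "\<forall>B\<in>Q. \<not> zero_block B" and D: "D \<in> Q" and ph: "phi Q = (S, X)"
 shows "phi_D (Suc m) (ext (Suc m) Q D) = (S, X \<union> {A \<in> S. A = D \<or> A = neg D}, eps D)"
proof -
 let ?n = "Suc m" let ?N = "int ?n"
 let ?P = "ext ?n Q D"
 note x = ext_props[OF Q nz D]
 have S: "parts m S" by (rule Pi_build(1)[OF Q ph])
 have Se: "S = pos ` Q - {{}}" and Xe: "X = contained_blocks S Q" using ph unfolding phi_eq by auto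
 have rD: "\<bar>x\<bar> \<le> int m" if "x \<in> D" for x using Pi_B_range[OF Q D that] by simp
 have as: "{a \<in> insert ?N D. 0 < a \<and> a < ?N} = pos D"
  using rD unfolding pos_def by fastforce
 have bs: "{b. 0 < b \<and> b < ?N \<and> - b \<in> insert ?N D} = pos (neg D)"
  using rD unfolding pos_def by (fastforce simp: mem_neg)
 have pr: "{x \<in> B. 0 < x} - {?N} = pos (B - {?N, - ?N})" for B unfolding pos_def by auto
 define R where "R = (\<lambda>B. B - {?N, - ?N}) ` ?P"
 have 1: "(\<lambda>B. {x \<in> B. 0 < x} - {?N}) ` ?P = pos ` R" unfolding R_def pr image_image ..
 have 2: "R - {{}} = Q" using x(4) unfolding remove_pm_def R_def .
 have "pos {} = {}" unfolding pos_def by simp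
 hence "pos ` R - {{}} = pos ` (R - {{}}) - {{}}" by auto
 hence S': "(\<lambda>B. {x \<in> B. 0 < x} - {?N}) ` ?P - {{}} = S" unfolding 1 2 Se .
 have NA: "?N \<notin> A" "- ?N \<notin> A" if "A \<in> S" for A using part_sub[OF S that] by auto
 have "contained_blocks S ?P = X \<union> {A \<in> S. A = D \<or> A = neg D}"
 proof (intro equalityI subsetI)
  fix A assume "A \<in> contained_blocks S ?P"
  then obtain B where B: "A \<in> S" "B \<in> ?P" "A \<subset> B" unfolding contained_blocks_def by blast
  from B(2) consider "B = insert ?N D" | "B = insert (- ?N) (neg D)" | "B \<in> Q" unfolding ext_def by blast
  thus "A \<in> X \<union> {A \<in> S. A = D \<or> A = neg D}"
  proof cases
   case 1
   hence "A \<subseteq> D" using B(3) NA[OF B(1)] by blast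
   thus ?thesis using B(1) D unfolding Xe contained_blocks_def by blast
  next case 2
   hence "A \<subseteq> neg D" using B(3) NA[OF B(1)] by blast
   thus ?thesis using B(1) Pi_B_neg[OF Q D] unfolding Xe contained_blocks_def by blast
  next case 3 thus ?thesis using B unfolding Xe contained_blocks_def by blast
  qed
 next fix A assume "A \<in> X \<union> {A \<in> S. A = D \<or> A = neg D}"
  hence AS: "A \<in> S" and "(\<exists>B\<in>Q. A \<subset> B) \<or> A = D \<or> A = neg D" unfolding Xe contained_blocks_def by auto
  then consider B where "B \<in> Q - {D, neg D}" "A \<subset> B" | "A \<subseteq> D" | "A \<subseteq> neg D" by blast
  hence "\<exists>B\<in>?P. A \<subset> B"
  proof cases
   case (1 B)
   have "B \<in> ?P" unfolding ext_def using 1(1) by simp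
   thus ?thesis using 1(2) by blast
  next case 2
   have "A \<subset> insert ?N D" using 2 NA(1)[OF AS] by blast
   moreover have "insert ?N D \<in> ?P" unfolding ext_def by simp
   ultimately show ?thesis by blast
  next case 3
   have "A \<subset> insert (- ?N) (neg D)" using 3 NA(2)[OF AS] by blast
   moreover have "insert (- ?N) (neg D) \<in> ?P" unfolding ext_def by simp
   ultimately show ?thesis by blast
  qed
  thus "A \<in> contained_blocks S ?P" using AS unfolding contained_blocks_def by blast
 qed
 thus ?thesis unfolding phi_D_def Let_def x(6) as bs S' eps_def using x(3) by simp
qed

lemma pos_id: "parts m S \<Longrightarrow> A \<in> S \<Longrightarrow> pos A = A"
 unfolding pos_def using part_sub[of "{1..int m}" S A] by fastforce

lemma pos_neg_id: "parts m S \<Longrightarrow> A \<in> S \<Longrightarrow> pos (neg A) = {}"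
 unfolding pos_def using part_sub[of "{1..int m}" S A] by fastforce

lemma pos_Un: "pos (A \<union> B) = pos A \<union> pos B"
 unfolding pos_def by auto

text \<open>The convention \<open>Max lo \<le> Max (p lo)\<close> makes the sign come out as
  \<open>e\<close>: if both signs occur in the block of \<open>n\<close>, the sign of
  \<open>phi_D\<close> compares the two maxima.\<close>

lemma phi_D_dbuild:
 assumes S: "parts m S" and X: "X \<subseteq> S" and d: "dok X p lo" and e: "e = 1 \<or> e = - 1"
 shows "phi_D (Suc m) (dbuild m S X p lo e) = (S, X, e)"
proof -
 note q = dbuild_props[OF S X d]
 let ?D = "if e = 1 then B0 p lo else neg (B0 p lo)"
 note p = dokD(1)[OF d] and lo = dokD(2)[OF d]
 have loS: "lo \<in> S" "p lo \<in> S" using lo X invol_in[OF p lo] by auto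
 have pl: "pos lo = lo" "pos (neg lo) = {}" "pos (p lo) = p lo" "pos (neg (p lo)) = {}"
  using pos_id[OF S] pos_neg_id[OF S] loS by auto
 have ne: "lo \<noteq> {}" "p lo \<noteq> {}" using part_ne[OF S] loS by auto
 have ph: "phi_D (Suc m) (dbuild m S X p lo e) = (S, dcore X p lo \<union> {A \<in> S. A = ?D \<or> A = neg ?D}, eps ?D)"
  unfolding dbuild_def by (rule phi_D_ext[OF q(1,2,6,5)])
 have nn: "A = ?D \<or> A = neg ?D \<longleftrightarrow> A = B0 p lo \<or> A = neg (B0 p lo)" for A by auto
 show ?thesis
 proof (cases "p lo = lo")
  case True
  have b: "B0 p lo = lo" unfolding B0_def using True by simp
  have "neg lo \<notin> S"
  proof
   assume "neg lo \<in> S"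
   hence "pos (neg lo) = neg lo" by (rule pos_id[OF S])
   thus False using pl(2) ne(1) by simp
  qed
  hence "{A \<in> S. A = B0 p lo \<or> A = neg (B0 p lo)} = {lo}" unfolding b using loS by blast
  hence s1: "{A \<in> S. A = ?D \<or> A = neg ?D} = {lo}" unfolding nn .
  have s2: "dcore X p lo \<union> {lo} = X" unfolding dcore_def using True lo by auto
  have s3: "eps ?D = e" unfolding b eps_def using e pl ne by auto
  show ?thesis unfolding ph s1 s3 s2 by simp
 next case False
  have b: "B0 p lo = lo \<union> neg (p lo)" "neg (B0 p lo) = p lo \<union> neg lo" unfolding B0_def using False by (simp_all add: neg_Un Un_commute)
  have Ml: "Max lo < Max (p lo)" using dokD(3)[OF d] part_Max_inj[OF S] loS False unfolding inj_on_def by (metis finite_atLeastAtMost_int order_le_less)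
  have "A \<noteq> B0 p lo" "A \<noteq> neg (B0 p lo)" if "A \<in> S" for A
  proof -
   have x: "x \<in> A \<Longrightarrow> 0 < x" for x using part_sub[OF S that] by force
   obtain y z where y: "y \<in> lo" "z \<in> p lo" using ne by blast
   have "0 < y" "0 < z" using part_sub[OF S loS(1)] part_sub[OF S loS(2)] y by force+
   moreover have "- z \<in> B0 p lo" "- y \<in> neg (B0 p lo)" unfolding b using y by (auto simp: mem_neg)
   ultimately show "A \<noteq> B0 p lo" "A \<noteq> neg (B0 p lo)" using x by force+
  qed
  hence "{A \<in> S. A = B0 p lo \<or> A = neg (B0 p lo)} = {}" by blast
  hence s1: "{A \<in> S. A = ?D \<or> A = neg ?D} = {}" unfolding nn .
  have s2: "dcore X p lo = X" unfolding dcore_def using False by simp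
  have s3: "eps ?D = e"
  proof (cases "e = 1")
   case True
   thus ?thesis unfolding eps_def using b Ml ne pl by (simp add: pos_Un)
  next case False
   have "neg (p lo \<union> neg lo) = lo \<union> neg (p lo)" by (simp add: neg_Un Un_commute)
   thus ?thesis unfolding eps_def using False b Ml ne pl e by (simp add: pos_Un)
  qed
  show ?thesis unfolding ph s1 s3 s2 by simp
 qed
qed

text \<open>If the block \<open>D\<close> receiving \<open>n\<close> has elements of one sign only,
  its positive version becomes the fixed point \<open>lo\<close>. Otherwise \<open>lo\<close> is the
  one of its two parts with the smaller maximum, and the sign says whether this is the positive part
  of \<open>D\<close>.\<close>

lemma noncentred_dbuild:
 assumes P: "P \<in> Pi_B (Suc m)" and c: "\<not> centred (Suc m) P"
 shows "\<exists>S X p lo e. parts m S \<and> X \<subseteq> S \<and> dok X p lo \<and> (e = 1 \<or> e = - 1) \<and> P = dbuild m S X p lo e"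
proof -
 obtain Q D where Q: "Q \<in> Pi_B m" "\<forall>B\<in>Q. \<not> zero_block B" "D \<in> Q" "P = ext (Suc m) Q D"
  using noncentred_ext[OF P c] by blast
 obtain S X' where ph: "phi Q = (S, X')" by fastforce
 note B = Pi_build[OF Q(1) ph]
 obtain p' where p': "invol X' p'" "Q = build S X' p'" using B(3) by blast
 note ctx = B(1,2) p'(1)
 have nf: "p' A \<noteq> A" if "A \<in> X'" for A
 proof
  assume e: "p' A = A"
  have "A \<union> neg (p' A) \<in> Q" unfolding p'(2) build_alt[OF B(2) p'(1)] by (rule UnI2, rule image_eqI[OF refl that])
  moreover have "zero_block (A \<union> neg (p' A))" unfolding e zero_block_def by (auto simp: neg_Un)
  ultimately show False using Q(2) by blast
 qed
 obtain A where A: "A \<in> S" "D = blk X' p' A \<or> D = neg (blk X' p' A)" using Q(3) unfolding p'(2) build_def by blast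
 show ?thesis
 proof (cases "A \<in> X'")
  case False
  let ?p = "p'(A := A)" and ?X = "insert A X'"
  have pe: "?p C = p' C" if "C \<in> X'" for C using that False by auto
  have fx: "C = A" if "C \<in> ?X" "?p C = C" for C
  proof (rule ccontr)
   assume n: "C \<noteq> A"
   hence "C \<in> X'" using that(1) by simp
   thus False using nf that(2) n by simp
  qed
  have "invol ?X ?p" unfolding invol_def
  proof (intro conjI ballI impI)
   fix C assume C: "C \<in> ?X"
   show "?p C \<in> ?X" "?p (?p C) = C"
   proof -
    consider "C = A" | "C \<in> X'" using C by blast
    hence "?p C \<in> ?X \<and> ?p (?p C) = C"
    proof cases
     case 1 thus ?thesis by simp
    next case 2
     thus ?thesis using pe[OF 2] pe[OF invol_in[OF p'(1) 2]] invol_in[OF p'(1) 2] invol_inv[OF p'(1) 2] by (simp del: fun_upd_apply)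
    qed
    thus "?p C \<in> ?X" "?p (?p C) = C" by blast+
   qed
  next fix C E assume "C \<in> ?X" "E \<in> ?X" "?p C = C" "?p E = E"
   hence "C = A" "E = A" using fx by (simp_all del: fun_upd_apply)
   thus "C = E" by simp
  qed
  moreover have "?p A = A" by simp
  ultimately have dk: "dok ?X ?p A" unfolding dok_def using fx by (simp del: fun_upd_apply)
  have co: "dcore ?X ?p A = X'" unfolding dcore_def using False by simp
  have bb: "build S X' ?p = Q" unfolding p'(2) by (rule build_cong) (rule pe)
  have b0: "B0 ?p A = A" unfolding B0_def by simp
  have bA: "blk X' p' A = A" unfolding blk_def using False by simp
  have XS: "?X \<subseteq> S" using A B(2) by blast
  from A(2)[unfolded bA] have "P = dbuild m S ?X ?p A 1 \<or> P = dbuild m S ?X ?p A (- 1)"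
   unfolding dbuild_def co bb b0 Q(4) by auto
  thus ?thesis using B(1) XS dk by blast
 next case True
  have "\<exists>A\<in>X'. D = A \<union> neg (p' A)"
  proof -
   from A(2) show ?thesis
   proof
    assume "D = blk X' p' A"
    thus ?thesis using True unfolding blk_def by auto
   next assume "D = neg (blk X' p' A)"
    hence "D = blk X' p' (p' A)" unfolding neg_blk[OF p'(1) True] .
    thus ?thesis using invol_in[OF p'(1) True] unfolding blk_def by auto
   qed
  qed
  then obtain C where C: "C \<in> X'" "D = C \<union> neg (p' C)" by blast
  note pC = invol_in[OF p'(1) C(1)] and ppC = invol_inv[OF p'(1) C(1)]
  have "Max C \<noteq> Max (p' C)" using part_sub_X(2)[OF B(1,2)] C(1) pC nf[OF C(1)] unfolding inj_on_def by metis
  then consider "Max C < Max (p' C)" | "Max (p' C) < Max C" by linarith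
  thus ?thesis
  proof cases
   case 1
   have dk: "dok X' p' C" unfolding dok_def using p'(1) C(1) 1 nf by auto
   have "P = dbuild m S X' p' C 1" unfolding dbuild_def dcore_def B0_def using nf[OF C(1)] Q(4) p'(2) C(2) by simp
   thus ?thesis using B(1,2) dk by blast
  next case 2
   have dk: "dok X' p' (p' C)" unfolding dok_def using p'(1) pC ppC 2 nf by auto
   have n2: "C \<noteq> p' C" using nf[OF C(1)] by (rule not_sym)
   have "neg (B0 p' (p' C)) = D" unfolding B0_def ppC if_not_P[OF n2] C(2) by (simp add: neg_Un Un_commute)
   hence "P = dbuild m S X' p' (p' C) (- 1)" unfolding dbuild_def dcore_def ppC if_not_P[OF n2] Q(4) p'(2) by simp
   thus ?thesis using B(1,2) dk by blast
  qed
 qed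
qed

lemma dbuild_cong:
 assumes "\<And>A. A \<in> X \<Longrightarrow> p A = q A" "lo \<in> X"
 shows "dbuild m S X p lo e = dbuild m S X q lo e"
proof -
 have l: "p lo = q lo" by (rule assms(1)[OF assms(2)])
 have c: "dcore X p lo = dcore X q lo" unfolding dcore_def l ..
 have "build S (dcore X q lo) p = build S (dcore X q lo) q"
 proof (rule build_cong)
  fix A assume "A \<in> dcore X q lo"
  hence "A \<in> X" unfolding dcore_def by (auto split: if_splits)
  thus "p A = q A" by (rule assms(1))
 qed
 thus ?thesis unfolding dbuild_def c B0_def l by simp
qed

lemma dbuild_Pi:
 assumes S: "parts m S" and X: "X \<subseteq> S" and d: "dok X p lo"
 shows "dbuild m S X p lo e \<in> Pi_B (Suc m)" "zero_blocks_D (Suc m) (dbuild m S X p lo e)" "\<not> centred (Suc m) (dbuild m S X p lo e)"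
proof -
 note q = dbuild_props[OF S X d]
 note x = ext_props[OF q(1,2) q(6)[of e]]
 show "dbuild m S X p lo e \<in> Pi_B (Suc m)" unfolding dbuild_def by (rule x(1))
 show "zero_blocks_D (Suc m) (dbuild m S X p lo e)" unfolding dbuild_def zero_blocks_D_def using x(2) by blast
 show "\<not> centred (Suc m) (dbuild m S X p lo e)" unfolding dbuild_def by (rule x(3))
qed

lemma phi_D_cases:
 assumes "P \<in> Pi_B (Suc m)" "zero_blocks_D (Suc m) P"
 obtains (centred) Q where "Q \<in> Pi_B m" "P = cext (Suc m) Q" "phi_D (Suc m) P = (fst (phi Q), snd (phi Q), 0)"
 | (noncentred) S X p lo e where "parts m S" "X \<subseteq> S" "dok X p lo" "e = 1 \<or> e = - 1"
  "P = dbuild m S X p lo e" "phi_D (Suc m) P = (S, X, e)"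
proof (cases "centred (Suc m) P")
 case True
 obtain Q where Q: "Q \<in> Pi_B m" "P = cext (Suc m) Q" using centred_cext[OF assms(1) assms(2) True] by blast
 moreover have "phi_D (Suc m) P = (fst (phi Q), snd (phi Q), 0)"
  unfolding phi_D_def if_P[OF True] using cext_props(4)[OF Q(1)] Q(2) by (simp add: case_prod_beta)
 ultimately show thesis by (rule centred)
next case False
 obtain S X p lo e where s: "parts m S" "X \<subseteq> S" "dok X p lo" "e = 1 \<or> e = - 1" "P = dbuild m S X p lo e"
  using noncentred_dbuild[OF assms(1) False] by blast
 moreover have "phi_D (Suc m) P = (S, X, e)" unfolding s(5) by (rule phi_D_dbuild[OF s(1-4)])
 ultimately show thesis by (rule noncentred)
qed

text \<open>Centred partitions carry sign 0 and reduce to the bijection in type B. For each nonzero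
  sign the data \<open>(S, X)\<close> with \<open>X\<close> nonempty must admit exactly one central
  block \<open>lo\<close> and matching.\<close>

lemma phi_D_bij:
 assumes sub: "\<And>P. P \<in> \<P> \<Longrightarrow> P \<in> Pi_B (Suc m) \<and> zero_blocks_D (Suc m) P"
  and cen: "\<And>Q. Q \<in> Pi_B m \<Longrightarrow> cext (Suc m) Q \<in> \<P> \<longleftrightarrow> Q \<in> \<Q>"
  and sQ: "\<Q> \<subseteq> Pi_B m" and bij: "bij_betw phi \<Q> M"
  and M: "\<And>S X. (S, X) \<in> M \<Longrightarrow> parts m S \<and> X \<subseteq> S"
  and char: "\<And>S X p lo e. parts m S \<Longrightarrow> X \<subseteq> S \<Longrightarrow> dok X p lo \<Longrightarrow> e = 1 \<or> e = - 1 \<Longrightarrow>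
   dbuild m S X p lo e \<in> \<P> \<longleftrightarrow> (S, X) \<in> M \<and> C X p lo"
  and ex: "\<And>S X. (S, X) \<in> M \<Longrightarrow> X \<noteq> {} \<Longrightarrow> \<exists>p lo. dok X p lo \<and> C X p lo"
  and uniq: "\<And>S X p q lo lo'. (S, X) \<in> M \<Longrightarrow> dok X p lo \<Longrightarrow> dok X q lo' \<Longrightarrow> C X p lo \<Longrightarrow> C X q lo' \<Longrightarrow> lo = lo' \<and> (\<forall>A\<in>X. p A = q A)"
 shows "bij_betw (phi_D (Suc m)) \<P> (triples M)"
proof -
 have cases: "(\<exists>Q\<in>\<Q>. P = cext (Suc m) Q \<and> phi_D (Suc m) P = (fst (phi Q), snd (phi Q), 0)) \<or>
   (\<exists>S X p lo e. (S, X) \<in> M \<and> dok X p lo \<and> C X p lo \<and> (e = 1 \<or> e = - 1) \<and> P = dbuild m S X p lo e \<and> phi_D (Suc m) P = (S, X, e))"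
  if h: "P \<in> \<P>" for P
 proof -
  have h': "P \<in> Pi_B (Suc m)" "zero_blocks_D (Suc m) P" using sub[OF h] by auto
  from h' show ?thesis
  proof (cases rule: phi_D_cases)
   case (centred Q)
   have "Q \<in> \<Q>" using cen[OF centred(1)] h unfolding centred(2) by simp
   thus ?thesis using centred(2,3) by blast
  next case (noncentred S X p lo e)
   have "(S, X) \<in> M \<and> C X p lo" using char[OF noncentred(1-4)] h unfolding noncentred(5) by simp
   thus ?thesis using noncentred(3-6) by blast
  qed
 qed
 show ?thesis
 proof (rule bij_betw_imageI)
  show "inj_on (phi_D (Suc m)) \<P>"
  proof (rule inj_onI)
   fix P P' assume h: "P \<in> \<P>" "P' \<in> \<P>" "phi_D (Suc m) P = phi_D (Suc m) P'"
   from cases[OF h(1)] show "P = P'"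
   proof (elim disjE exE bexE conjE)
    fix Q assume Q: "Q \<in> \<Q>" "P = cext (Suc m) Q" "phi_D (Suc m) P = (fst (phi Q), snd (phi Q), 0)"
    from cases[OF h(2)] show "P = P'"
    proof (elim disjE exE bexE conjE)
     fix Q' assume Q': "Q' \<in> \<Q>" "P' = cext (Suc m) Q'" "phi_D (Suc m) P' = (fst (phi Q'), snd (phi Q'), 0)"
     have "phi Q = phi Q'" using Q(3) Q'(3) h(3) by (simp add: prod_eq_iff)
     hence "Q = Q'" using bij_betw_imp_inj_on[OF bij] Q(1) Q'(1) unfolding inj_on_def by blast
     thus "P = P'" using Q(2) Q'(2) by simp
    next fix S X e assume "phi_D (Suc m) P' = (S, X, e)" "e = 1"
     thus "P = P'" using Q(3) h(3) by simp
    next fix S X e assume "phi_D (Suc m) P' = (S, X, e)" "e = - 1"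
     thus "P = P'" using Q(3) h(3) by simp
    qed
   next
    have nc: "P = P'" if s: "(S, X) \<in> M" "dok X p lo" "C X p lo" "P = dbuild m S X p lo e" "phi_D (Suc m) P = (S, X, e)" "e = 1 \<or> e = - 1" for S X p lo e
     using cases[OF h(2)]
    proof
     assume "\<exists>Q\<in>\<Q>. P' = cext (Suc m) Q \<and> phi_D (Suc m) P' = (fst (phi Q), snd (phi Q), 0)"
     thus ?thesis using s(5,6) h(3) by auto
    next assume "\<exists>S X p lo e. (S, X) \<in> M \<and> dok X p lo \<and> C X p lo \<and> (e = 1 \<or> e = - 1) \<and> P' = dbuild m S X p lo e \<and> phi_D (Suc m) P' = (S, X, e)"
     then obtain T Y q lo' e' where t: "dok Y q lo'" "C Y q lo'" "P' = dbuild m T Y q lo' e'" "phi_D (Suc m) P' = (T, Y, e')" by blast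
     have eq: "T = S" "Y = X" "e' = e" using s(5) t(4) h(3) by auto
     have u: "lo = lo' \<and> (\<forall>A\<in>X. p A = q A)" by (rule uniq[OF s(1,2) t(1)[unfolded eq] s(3) t(2)[unfolded eq]])
     have "dbuild m S X p lo e = dbuild m S X q lo e" by (rule dbuild_cong) (use u dokD(2)[OF s(2)] in auto)
     thus ?thesis unfolding s(4) t(3) eq using u by simp
    qed
    {
     fix S X p lo e assume "(S, X) \<in> M" "dok X p lo" "C X p lo" "P = dbuild m S X p lo e" "phi_D (Suc m) P = (S, X, e)" "e = 1"
     thus "P = P'" using nc by blast
    }
    {
     fix S X p lo e assume "(S, X) \<in> M" "dok X p lo" "C X p lo" "P = dbuild m S X p lo e" "phi_D (Suc m) P = (S, X, e)" "e = - 1"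
     thus "P = P'" using nc by blast
    }
   qed
  qed
  show "phi_D (Suc m) ` \<P> = triples M"
  proof (intro equalityI subsetI)
   fix z assume "z \<in> phi_D (Suc m) ` \<P>"
   then obtain P where P: "P \<in> \<P>" "z = phi_D (Suc m) P" by blast
   from cases[OF P(1)] show "z \<in> triples M"
   proof
    assume "\<exists>Q\<in>\<Q>. P = cext (Suc m) Q \<and> phi_D (Suc m) P = (fst (phi Q), snd (phi Q), 0)"
    then obtain Q where "Q \<in> \<Q>" "z = (fst (phi Q), snd (phi Q), 0)" using P(2) by blast
    thus ?thesis using bij_betwE[OF bij] unfolding triples_def by auto
   next assume "\<exists>S X p lo e. (S, X) \<in> M \<and> dok X p lo \<and> C X p lo \<and> (e = 1 \<or> e = - 1) \<and> P = dbuild m S X p lo e \<and> phi_D (Suc m) P = (S, X, e)"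
    then obtain S X p lo e where "(S, X) \<in> M" "dok X p lo" "e = 1 \<or> e = - 1" "z = (S, X, e)" using P(2) by blast
    thus ?thesis using dokD(2) unfolding triples_def by auto
   qed
  next fix z assume z: "z \<in> triples M"
   obtain S X e where ze: "z = (S, X, e)" by (cases z)
   have SX: "(S, X) \<in> M" "e = 0 \<or> e = 1 \<or> e = - 1" "X = {} \<longrightarrow> e = 0" using z unfolding ze triples_def by auto
   show "z \<in> phi_D (Suc m) ` \<P>"
   proof (cases "e = 0")
    case True
    obtain Q where Q: "Q \<in> \<Q>" "phi Q = (S, X)" using bij_betw_imp_surj_on[OF bij] SX(1) by (metis imageE)
    hence QP: "Q \<in> Pi_B m" using sQ by blast
    hence cP: "cext (Suc m) Q \<in> \<P>" using cen Q(1) by simp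
    have "phi_D (Suc m) (cext (Suc m) Q) = z"
     unfolding phi_D_def if_P[OF cext_props(3)[OF QP]] cext_props(4)[OF QP] Q(2) ze True by simp
    thus ?thesis using cP by blast
   next case False
    hence "X \<noteq> {}" "e = 1 \<or> e = - 1" using SX by auto
    obtain p lo where p: "dok X p lo" "C X p lo" using ex[OF SX(1) \<open>X \<noteq> {}\<close>] by blast
    have s: "parts m S" "X \<subseteq> S" using M[OF SX(1)] by auto
    have "dbuild m S X p lo e \<in> \<P>" using char[OF s p(1) \<open>e = 1 \<or> e = - 1\<close>] SX(1) p(2) by simp
    moreover have "phi_D (Suc m) (dbuild m S X p lo e) = z" unfolding ze by (rule phi_D_dbuild[OF s p(1) \<open>e = 1 \<or> e = - 1\<close>])
    ultimately show ?thesis by blast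
   qed
  qed
 qed
qed

section \<open>Noncrossing partitions of type D\<close>

text \<open>For an order-reversing matching the second condition makes \<open>lo\<close> and
  \<open>p lo\<close> the innermost pair, or the middle block if \<open>lo\<close> is fixed.\<close>

definition anti_mid :: "int set set \<Rightarrow> (int set \<Rightarrow> int set) \<Rightarrow> int set \<Rightarrow> bool" where
 "anti_mid X p lo \<longleftrightarrow> anti X p \<and> (\<forall>Z\<in>X. \<not> (Max lo < Max Z \<and> Max Z < Max (p lo)))"

definition others :: "int set set \<Rightarrow> int set set \<Rightarrow> (int set \<Rightarrow> int set) \<Rightarrow> int set \<Rightarrow> int set set" where
 "others S X p lo = blk X p ` (S - {lo, p lo}) \<union> neg ` blk X p ` (S - {lo, p lo})"

lemma dbuild_decomp:
 assumes S: "parts m S" and X: "X \<subseteq> S" and d: "dok X p lo"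
 shows "build S (dcore X p lo) p = others S X p lo \<union> {B0 p lo, neg (B0 p lo)}"
  "B0 p lo \<notin> others S X p lo" "neg (B0 p lo) \<notin> others S X p lo" "B0 p lo \<noteq> neg (B0 p lo)"
proof -
 let ?Y = "dcore X p lo"
 define S0 where "S0 = S - {lo, p lo}"
 note c = dcore_props[OF d]
 have YS: "?Y \<subseteq> S" using c(2) X by blast
 note p = dokD(1)[OF d] and lo = dokD(2)[OF d]
 have loS: "lo \<in> S" "p lo \<in> S" using lo X invol_in[OF p lo] by auto
 have F: "others S X p lo = blk X p ` S0 \<union> neg ` blk X p ` S0" unfolding others_def S0_def ..
 have bS0: "blk ?Y p ` S0 = blk X p ` S0" by (rule image_cong) (auto simp: blk_def dcore_def S0_def)
 have bl: "blk ?Y p lo = B0 p lo" unfolding blk_def B0_def dcore_def using lo by simp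
 have b2: "blk ?Y p (p lo) = B0 p lo \<and> p lo = lo \<or> blk ?Y p (p lo) = neg (B0 p lo) \<and> p lo \<noteq> lo"
 proof (cases "p lo = lo")
  case True thus ?thesis using bl by simp
 next case False
  hence "lo \<in> ?Y" unfolding dcore_def using lo by simp
  from neg_blk[OF c(1) this] show ?thesis unfolding bl using False by simp
 qed
 have Seq: "S = insert lo (insert (p lo) S0)" unfolding S0_def using loS by auto
 have im: "blk ?Y p ` S = insert (blk ?Y p lo) (insert (blk ?Y p (p lo)) (blk X p ` S0))"
  by (simp only: Seq image_insert bS0)
 from b2 show "build S ?Y p = others S X p lo \<union> {B0 p lo, neg (B0 p lo)}"
 proof (elim disjE conjE)
  assume e: "blk ?Y p (p lo) = B0 p lo"
  show ?thesis unfolding build_def im bl e F by auto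
 next assume e: "blk ?Y p (p lo) = neg (B0 p lo)"
  show ?thesis unfolding build_def im bl e F by auto
 qed
 have pB: "pos (B0 p lo) = lo" using build_pos_part[OF S YS c(1) loS(1)] unfolding bl .
 have pnB: "pos (neg (B0 p lo)) = {} \<or> pos (neg (B0 p lo)) = p lo"
 proof (cases "p lo = lo")
  case True
  thus ?thesis unfolding B0_def using pos_neg_id[OF S loS(1)] by simp
 next case False
  hence "blk ?Y p (p lo) = neg (B0 p lo)" using b2 by blast
  thus ?thesis using build_pos_part[OF S YS c(1) loS(2)] by simp
 qed
 have h: "blk X p A \<noteq> B0 p lo" "blk X p A \<noteq> neg (B0 p lo)" if A: "A \<in> S0" for A
 proof -
  have A': "A \<in> S" "A \<noteq> lo" "A \<noteq> p lo" using A unfolding S0_def by auto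
  have pA: "pos (blk X p A) = A" by (rule build_pos_part[OF S X p A'(1)])
  show "blk X p A \<noteq> B0 p lo" using pA pB A'(2) by (intro notI) simp
  have "A \<noteq> {}" by (rule part_ne[OF S A'(1)])
  thus "blk X p A \<noteq> neg (B0 p lo)" using pA pnB A'(3) by (intro notI) auto
 qed
 show "B0 p lo \<notin> others S X p lo"
 proof
  assume "B0 p lo \<in> others S X p lo"
  then obtain A where A: "A \<in> S0" "B0 p lo = blk X p A \<or> B0 p lo = neg (blk X p A)" unfolding F by blast
  from A(2) show False
  proof
   assume "B0 p lo = blk X p A" thus False using h(1)[OF A(1)] by simp
  next assume "B0 p lo = neg (blk X p A)" thus False using h(2)[OF A(1)] by simp
  qed
 qed
 show "neg (B0 p lo) \<notin> others S X p lo"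
 proof
  assume "neg (B0 p lo) \<in> others S X p lo"
  then obtain A where A: "A \<in> S0" "neg (B0 p lo) = blk X p A \<or> neg (B0 p lo) = neg (blk X p A)" unfolding F by blast
  thus False using h[OF A(1)] unfolding neg_inj by metis
 qed
 have "\<not> zero_block (B0 p lo)" using dbuild_props(2,3)[OF S X d] by blast
 thus "B0 p lo \<noteq> neg (B0 p lo)" unfolding zero_block_def by metis
qed

text \<open>The merged block is \<open>lo \<union> neg lo\<close>, so merging turns
  \<open>lo\<close> into an ordinary fixed point of a matching in type B.\<close>

lemma merge_fixed:
 assumes X: "X \<subseteq> S" and d: "dok X p lo" and e: "p lo = lo"
 shows "insert (B0 p lo \<union> neg (B0 p lo)) (others S X p lo) = build S X p"
proof -
 define S0 where "S0 = S - {lo, p lo}"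
 have lo: "lo \<in> X" using dokD(2)[OF d] .
 have Seq: "S = insert lo S0" unfolding S0_def using lo X e by auto
 have im: "blk X p ` S = insert (blk X p lo) (blk X p ` S0)" by (simp only: Seq image_insert)
 have b: "blk X p lo = B0 p lo \<union> neg (B0 p lo)" unfolding blk_def B0_def using lo e by simp
 have n: "neg (B0 p lo \<union> neg (B0 p lo)) = B0 p lo \<union> neg (B0 p lo)" by (simp add: neg_Un Un_commute)
 show ?thesis unfolding build_def im b image_insert n others_def S0_def[symmetric] by auto
qed

lemma NCNN_subset: "(S, X) \<in> NCNN m \<Longrightarrow> Y \<subseteq> X \<Longrightarrow> (S, Y) \<in> NCNN m"
 unfolding NCNN_def by blast

lemma anti_subset: "anti X p \<Longrightarrow> Y \<subseteq> X \<Longrightarrow> anti Y p"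
 unfolding anti_def by blast

text \<open>For a nonfixed central pair, merging its two blocks replaces the marked blocks \<open>lo\<close> and \<open>p lo\<close>
 by their union, which becomes the fixed point of the matching.\<close>

lemma merge_nonfixed:
 assumes S: "parts m S" and X: "X \<subseteq> S" and d: "dok X p lo" and ne: "p lo \<noteq> lo"
  and SN: "S \<in> NC m" and nn: "\<And>A. A \<in> X \<Longrightarrow> nonnested S A" and an: "anti X p"
 shows "insert (B0 p lo \<union> neg (B0 p lo)) (others S X p lo) \<in> NC_B m \<longleftrightarrow> anti_mid X p lo"
proof -
 define S0 where "S0 = S - {lo, p lo}"
 define U where "U = lo \<union> p lo"
 define X0 where "X0 = X - {lo, p lo}"
 define p' where "p' = p(U := U)"
 let ?S = "insert U S0" and ?X = "insert U X0"
 note p = dokD(1)[OF d] and lo = dokD(2)[OF d]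
 note plo = invol_in[OF p lo] and pplo = invol_inv[OF p lo]
 have loS: "lo \<in> S" "p lo \<in> S" using lo X plo by auto
 note Mx = part_Max[OF S, simplified]
 have inj: "A = B" if "A \<in> S" "B \<in> S" "Max A = Max B" for A B
  using part_Max_inj[OF S] that unfolding inj_on_def by simp
 have Ml: "Max lo < Max (p lo)" using dokD(3)[OF d] inj[OF loS] ne by fastforce
 have Lne: "lo \<noteq> {}" "p lo \<noteq> {}" using part_ne[OF S] loS by auto
 have fin: "finite lo" "finite (p lo)" using part_finite_block[OF S] loS by auto
 have MU: "Max U = Max (p lo)" unfolding U_def using Max_Un[OF fin(1) Lne(1) fin(2) Lne(2)] Ml by simp
 have S0: "A \<in> S" "A \<noteq> lo" "A \<noteq> p lo" if "A \<in> S0" for A using that unfolding S0_def by auto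
 have X0: "A \<in> X" "A \<noteq> lo" "A \<noteq> p lo" "A \<in> S0" if "A \<in> X0" for A using that X unfolding X0_def S0_def by auto
 have UL: "\<exists>L. (L = lo \<or> L = p lo) \<and> x \<in> L" if "x \<in> U" for x using that unfolding U_def by blast
 have LX: "L \<in> X" "L \<in> S" if "L = lo \<or> L = p lo" for L using that lo plo loS by auto
 have US0: "U \<notin> S0"
 proof
  assume u: "U \<in> S0"
  obtain x where "x \<in> lo" using Lne by blast
  hence "U = lo" using part_eq[OF S S0(1)[OF u] loS(1), of x] unfolding U_def by blast
  thus False using S0(2)[OF u] by simp
 qed
 have dis: "p lo \<inter> lo = {}" using part_eq[OF S loS(2,1)] ne by blast
 have r1: "partition_on ({1..int m} - lo - p lo) (S - {lo} - {p lo})"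
  by (rule part_diff[OF part_diff[OF S loS(1)]]) (use loS ne in simp)
 have r2: "partition_on (({1..int m} - lo - p lo) \<union> U) (insert U (S - {lo} - {p lo}))"
  by (rule part_insert[OF r1]) (use Lne in \<open>auto simp: U_def\<close>)
 have "({1..int m} - lo - p lo) \<union> U = {1..int m}" unfolding U_def using part_sub[OF S loS(1)] part_sub[OF S loS(2)] by blast
 moreover have "S - {lo} - {p lo} = S0" unfolding S0_def by blast
 ultimately have S': "parts m ?S" using r2 by simp
 have X': "?X \<subseteq> ?S" using X0(4) by blast
 have pe: "p' A = p A" if "A \<in> X0" for A
 proof -
  have "A \<noteq> U" using X0(4)[OF that] US0 by blast
  thus ?thesis unfolding p'_def by simp
 qed
 have pU: "p' U = U" unfolding p'_def by simp
 have pX0: "p A \<in> X0" if "A \<in> X0" for A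
  unfolding X0_def by (rule invol_in[OF dok_rest(1)[OF d] that[unfolded X0_def]])
 have fx: "A = U" if "A \<in> ?X" "p' A = A" for A
 proof (rule ccontr)
  assume "A \<noteq> U"
  hence A: "A \<in> X0" using that(1) by simp
  hence "A = lo" using dokD(4)[OF d X0(1)[OF A]] pe[OF A] that(2) by simp
  thus False using X0(2)[OF A] by simp
 qed
 have p': "invol ?X p'" unfolding invol_def
 proof (intro conjI ballI impI)
  fix A assume "A \<in> ?X"
  then consider "A = U" | "A \<in> X0" by blast
  hence "p' A \<in> ?X \<and> p' (p' A) = A"
  proof cases
   case 1 thus ?thesis using pU by simp
  next case 2 thus ?thesis using pe[OF 2] pe[OF pX0[OF 2]] pX0[OF 2] invol_inv[OF p X0(1)[OF 2]] by simp
  qed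
  thus "p' A \<in> ?X" "p' (p' A) = A" by blast+
 next fix A B assume "A \<in> ?X" "B \<in> ?X" "p' A = A" "p' B = B"
  hence "A = U" "B = U" using fx by blast+
  thus "A = B" by simp
 qed
 have bb: "blk ?X p' ` S0 = blk X p ` S0"
 proof (rule image_cong[OF refl])
  fix A assume A: "A \<in> S0"
  hence "A \<noteq> U" using US0 by blast
  hence "A \<in> ?X \<longleftrightarrow> A \<in> X" "p' A = p A" unfolding X0_def p'_def using S0[OF A] by auto
  thus "blk ?X p' A = blk X p A" unfolding blk_def by simp
 qed
 have bU: "blk ?X p' U = B0 p lo \<union> neg (B0 p lo)" unfolding blk_def B0_def using pU ne by (auto simp: U_def neg_Un)
 have n: "neg (B0 p lo \<union> neg (B0 p lo)) = B0 p lo \<union> neg (B0 p lo)" by (simp add: neg_Un Un_commute)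
 have e: "insert (B0 p lo \<union> neg (B0 p lo)) (others S X p lo) = build ?S ?X p'"
  unfolding build_def image_insert bU bb n others_def S0_def[symmetric] by auto
 have ncS: "ncr S" using SN unfolding NC_def by simp
 have bet: "D = A" if "A \<in> X" "D \<in> S" "x1 \<in> D" "x3 \<in> D" "x2 \<in> A" "x1 < x2" "x2 < x3" for A D x1 x2 x3
  using nonnested_between[OF SN _ nn[OF that(1)] that(2-7)] that(1) X by blast
 have ord: "x < y" if "A \<in> X" "B \<in> X" "Max A < Max B" "x \<in> A" "y \<in> B" for A B x y
  using nonnested_order[OF SN _ nn[OF that(1)] _ nn[OF that(2)] that(3-5)] that(1,2) X by blast
 \<comment> \<open>The union \<open>U\<close> inherits the property \<open>nonnested_between\<close>
   from its two halves.\<close>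
 have betU: False if h: "D \<in> S0" "x1 \<in> D" "x3 \<in> D" "x2 \<in> U" "x1 < x2" "x2 < x3" for D x1 x2 x3
 proof -
  obtain L where L: "L = lo \<or> L = p lo" "x2 \<in> L" using UL[OF h(4)] by blast
  have "D = L" by (rule bet[OF LX(1)[OF L(1)] S0(1)[OF h(1)] h(2,3) L(2) h(5,6)])
  thus False using L(1) S0(2,3)[OF h(1)] by blast
 qed
 show ?thesis unfolding e NC_B_char[OF S' X' p']
 proof
  assume h: "(?S, ?X) \<in> NCNN m \<and> anti ?X p'"
  have SN': "?S \<in> NC m" and nn': "\<And>A. A \<in> ?X \<Longrightarrow> nonnested ?S A" using h unfolding NCNN_def by auto
  \<comment> \<open>A marked block strictly between \<open>lo\<close> and \<open>p lo\<close> would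
    be spanned by their union.\<close>
  have "\<not> (Max lo < Max Z \<and> Max Z < Max (p lo))" if Z: "Z \<in> X" for Z
  proof
   assume a: "Max lo < Max Z \<and> Max Z < Max (p lo)"
   hence Z0: "Z \<in> X0" unfolding X0_def using Z by auto
   have ZS: "Z \<in> S" using Z X by blast
   have "Max lo < Min Z" using ord[OF lo Z _ Mx(1)[OF loS(1)] Mx(2)[OF ZS]] a by simp
   moreover have "nonnested ?S Z" using nn' Z0 by blast
   moreover have "Max lo \<in> U" "Max (p lo) \<in> U" unfolding U_def using Mx(1) loS by auto
   moreover have "Z \<in> ?S" using X0(4)[OF Z0] by blast
   ultimately show False using a nonnested_NC[OF SN', of Z] by blast
  qed
  thus "anti_mid X p lo" unfolding anti_mid_def using an by blast
 next assume "anti_mid X p lo"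
  hence mid: "\<not> (Max lo < Max Z \<and> Max Z < Max (p lo))" if "Z \<in> X" for Z using that unfolding anti_mid_def by blast
  have "ncr ?S" unfolding ncr_def
  proof (intro ballI impI)
   fix A B a b c d assume *: "A \<in> ?S" "B \<in> ?S" "a \<in> A" "b \<in> B" "c \<in> A" "d \<in> B" "a < b" "b < c" "c < d"
   consider "A = U" "B = U" | "A = U" "B \<in> S0" | "A \<in> S0" "B = U" | "A \<in> S0" "B \<in> S0" using *(1,2) by blast
   thus "A = B"
   proof cases
    case 1 thus ?thesis by simp
   next case 2 thus ?thesis using betU[OF 2(2) *(4,6), of c] *(5,8,9) by blast
   next case 3 thus ?thesis using betU[OF 3(1) *(3,5), of b] *(4,7,8) by blast
   next case 4 thus ?thesis using ncrD[OF ncS S0(1)[OF 4(1)] S0(1)[OF 4(2)] *(3-9)] by blast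
   qed
  qed
  hence SN': "?S \<in> NC m" using S' unfolding NC_def by simp
  note Mx' = part_Max[OF S' finite_atLeastAtMost_int]
  have "nonnested ?S Z" if Z: "Z \<in> ?X" for Z
  proof -
   have ZS: "Z \<in> ?S" using Z X' by blast
   show ?thesis unfolding nonnested_NC[OF SN' ZS]
   proof (intro ballI notI)
    fix D x y assume D: "D \<in> ?S" "x \<in> D" "y \<in> D" "x < Min Z \<and> Max Z < y"
    have z: "Min Z \<in> Z" "x < Min Z" "Min Z < y" using Mx'(2)[OF ZS] Mx'(4)[OF ZS Mx'(1)[OF ZS]] D(4) by auto
    consider "D = Z" | "D \<noteq> Z" "D \<in> S0" "Z = U" | "D \<noteq> Z" "D \<in> S0" "Z \<in> X0" | "D \<noteq> Z" "D = U" "Z \<in> X0" using D(1) Z by blast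
    thus False
    proof cases
     case 1 thus False using Mx'(4)[OF ZS] D(2) z(2) by force
    next case 2 thus False using betU[OF 2(2) D(2,3) _ z(2,3)] z(1) by blast
    next case 3 thus False using bet[OF X0(1)[OF 3(3)] S0(1)[OF 3(2)] D(2,3) z] by blast
    next case 4
     obtain L1 where L1: "L1 = lo \<or> L1 = p lo" "x \<in> L1" using UL D(2) 4(2) by blast
     obtain L2 where L2: "L2 = lo \<or> L2 = p lo" "y \<in> L2" using UL D(3) 4(2) by blast
     note Z0 = X0[OF 4(3)]
     have xy: "x < y" using z by simp
     \<comment> \<open>The only new way of spanning \<open>Z\<close> is from a point of
       \<open>lo\<close> to a point of \<open>p lo\<close>, and this is what \<open>mid\<close>
       excludes.\<close>
     from L1(1) L2(1) consider "L1 = L2" | "L1 = lo" "L2 = p lo" | "L1 = p lo" "L2 = lo" by blast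
     thus False
     proof cases
      case 1
      have "L1 = Z" by (rule bet[OF Z0(1) LX(2)[OF L1(1)] L1(2) _ z]) (use L2(2) 1 in simp)
      thus False using L1(1) Z0(2,3) by blast
     next case 2
      have "Max Z \<noteq> Max lo" "Max Z \<noteq> Max (p lo)" using inj[OF S0(1)[OF Z0(4)] loS(1)] inj[OF S0(1)[OF Z0(4)] loS(2)] Z0(2,3) by blast+
      moreover have "\<not> Max Z < Max lo" using ord[OF Z0(1) lo _ z(1), of x] L1(2) 2(1) z(2) by auto
      moreover have "\<not> Max (p lo) < Max Z" using ord[OF plo Z0(1) _ _ z(1), of y] L2(2) 2(2) z(3) by auto
      ultimately show False using mid[OF Z0(1)] by linarith
     next case 3
      thus False using ord[OF lo plo Ml, of y x] L1(2) L2(2) xy by auto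
     qed
    qed
   qed
  qed
  hence "(?S, ?X) \<in> NCNN m" unfolding NCNN_def using SN' X' by auto
  moreover have "anti ?X p'" unfolding anti_def
  proof (intro ballI impI)
   fix A B assume AB: "A \<in> ?X" "B \<in> ?X" "Max A < Max B"
   have an': "Max (p B) < Max (p A)" if "A \<in> X" "B \<in> X" "Max A < Max B" for A B using an that unfolding anti_def by blast
   consider "A = U" "B = U" | "A = U" "B \<in> X0" | "A \<in> X0" "B = U" | "A \<in> X0" "B \<in> X0" using AB(1,2) by blast
   thus "Max (p' B) < Max (p' A)"
   proof cases
    case 1 thus ?thesis using AB(3) by simp
   next case 2
    have "Max (p B) < Max (p (p lo))" using an'[OF plo X0(1)[OF 2(2)]] AB(3) 2(1) MU by simp
    thus ?thesis using pe[OF 2(2)] 2(1) pU MU pplo Ml by simp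
   next case 3
    have "Max A \<noteq> Max lo" using inj[OF S0(1)[OF X0(4)[OF 3(1)]] loS(1)] X0(2)[OF 3(1)] by blast
    hence "Max A < Max lo" using mid[OF X0(1)[OF 3(1)]] AB(3) 3(2) MU by auto
    hence "Max (p lo) < Max (p A)" by (rule an'[OF X0(1)[OF 3(1)] lo])
    thus ?thesis using pe[OF 3(1)] 3(2) pU MU by simp
   next case 4
    thus ?thesis using an'[OF X0(1)[OF 4(1)] X0(1)[OF 4(2)] AB(3)] pe by simp
   qed
  qed
  ultimately show "(?S, ?X) \<in> NCNN m \<and> anti ?X p'" by blast
 qed
qed

text \<open>If \<open>lo\<close> is not fixed, deleting \<open>n\<close> and \<open>- n\<close>
  without merging already forces nonnested marks and an order-reversing matching, and merging adds
  the condition that the pair is innermost. If \<open>lo\<close> is fixed, the merged partition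
  yields everything, and the condition without merging follows by restricting to fewer
  marks.\<close>

lemma NC_D_char:
 assumes S: "parts m S" and X: "X \<subseteq> S" and d: "dok X p lo"
 shows "dbuild m S X p lo e \<in> NC_D (Suc m) \<longleftrightarrow> (S, X) \<in> NCNN m \<and> anti_mid X p lo"
proof -
 let ?Y = "dcore X p lo"
 let ?Q = "build S ?Y p"
 let ?M = "insert (B0 p lo \<union> neg (B0 p lo)) (others S X p lo)"
 note q = dbuild_props[OF S X d]
 note x = ext_props[OF q(1,2) q(6)[of e]]
 note dc = dbuild_decomp[OF S X d]
 note c = dcore_props[OF d]
 have YS: "?Y \<subseteq> S" using c(2) X by blast
 have "?Q - {B0 p lo, neg (B0 p lo)} = others S X p lo" unfolding dc(1) using dc(2,3) by blast
 hence M: "merge_del (Suc m) (dbuild m S X p lo e) = ?M"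
  unfolding dbuild_def x(5) by (cases "e = 1") (simp_all add: insert_commute Un_commute)
 have R: "remove_pm (Suc m) (dbuild m S X p lo e) = ?Q" unfolding dbuild_def x(4) ..
 have 1: "dbuild m S X p lo e \<in> NC_D (Suc m) \<longleftrightarrow> ?M \<in> NC_B m \<and> ?Q \<in> NC_B m"
  unfolding NC_D_def using dbuild_Pi(1,2)[OF S X d, of e] M R by simp
 note Qc = NC_B_char[OF S YS c(1)]
 show ?thesis
 proof (cases "p lo = lo")
  case True
  have 2: "?M \<in> NC_B m \<longleftrightarrow> (S, X) \<in> NCNN m \<and> anti X p"
   unfolding merge_fixed[OF X d True] by (rule NC_B_char[OF S X dokD(1)[OF d]])
  have "anti_mid X p lo \<longleftrightarrow> anti X p" unfolding anti_mid_def True by auto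
  thus ?thesis unfolding 1 2 Qc using NCNN_subset[OF _ c(2)] anti_subset[OF _ c(2)] by blast
 next case False
  hence Y: "?Y = X" unfolding dcore_def by simp
  show ?thesis
  proof (cases "(S, X) \<in> NCNN m \<and> anti X p")
   case True
   have "S \<in> NC m" "\<And>A. A \<in> X \<Longrightarrow> nonnested S A" using True unfolding NCNN_def by auto
   thus ?thesis unfolding 1 Y using merge_nonfixed[OF S X d False] True NC_B_char[OF S X dokD(1)[OF d]] by simp
  next case f: False
   thus ?thesis unfolding 1 Y NC_B_char[OF S X dokD(1)[OF d]] anti_mid_def by blast
  qed
 qed
qed

text \<open>Take the reversal, and for \<open>lo\<close> the block with the largest maximum among
  those not above their partner. For a marked block strictly between \<open>lo\<close> and
  \<open>p lo\<close>, itself or its partner would be a larger candidate.\<close>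

lemma anti_mid_ex:
 assumes f: "finite X" "inj_on Max X" and ne: "X \<noteq> {}"
 shows "\<exists>p lo. dok X p lo \<and> anti_mid X p lo"
proof -
 let ?p = "rp (by_max X)"
 note a = anti_ex[OF f]
 have an: "Max (?p B) < Max (?p A)" if "A \<in> X" "B \<in> X" "Max A < Max B" for A B using a(2) that unfolding anti_def by blast
 let ?T = "{A \<in> X. Max A \<le> Max (?p A)}"
 have "?T \<noteq> {}"
 proof -
  obtain A where A: "A \<in> X" using ne by blast
  show ?thesis
  proof (cases "Max A \<le> Max (?p A)")
   case True thus ?thesis using A by blast
  next case False
   hence "?p A \<in> ?T" using invol_in[OF a(1) A] invol_inv[OF a(1) A] by simp
   thus ?thesis by blast
  qed
 qed
 hence "Max (Max ` ?T) \<in> Max ` ?T" using f(1) by (intro Max_in) auto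
 then obtain lo where l: "lo \<in> ?T" "Max (Max ` ?T) = Max lo" by auto
 have ml: "Max A \<le> Max lo" if "A \<in> ?T" for A unfolding l(2)[symmetric] using f(1) that by (intro Max_ge) auto
 have lo: "lo \<in> X" "Max lo \<le> Max (?p lo)" using l(1) by auto
 have "A = lo" if A: "A \<in> X" "?p A = A" for A
 proof -
  have "Max A \<le> Max lo" using ml A by simp
  moreover have "\<not> Max A < Max lo" using an[OF A(1) lo(1)] A(2) lo(2) by auto
  ultimately show ?thesis using f(2) A(1) lo(1) unfolding inj_on_def by simp
 qed
 hence "dok X ?p lo" unfolding dok_def using a(1) lo by blast
 moreover have "\<not> (Max lo < Max Z \<and> Max Z < Max (?p lo))" if Z: "Z \<in> X" for Z
 proof
  assume h: "Max lo < Max Z \<and> Max Z < Max (?p lo)"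
  hence "Z \<notin> ?T" using ml[of Z] by auto
  hence "?p Z \<in> ?T" using Z invol_in[OF a(1) Z] invol_inv[OF a(1) Z] by simp
  moreover have "Max lo < Max (?p Z)" using an[OF Z invol_in[OF a(1) lo(1)]] invol_inv[OF a(1) lo(1)] h by simp
  ultimately show False using ml[of "?p Z"] by simp
 qed
 ultimately show ?thesis unfolding anti_mid_def using a(2) by blast
qed

lemma anti_mid_le:
 assumes "anti_mid X p lo" "lo \<in> X" "A \<in> X" "Max A \<le> Max (p A)"
 shows "Max A \<le> Max lo"
proof (rule ccontr)
 assume "\<not> Max A \<le> Max lo"
 hence l: "Max lo < Max A" by simp
 hence "Max (p A) < Max (p lo)" using assms(1-3) unfolding anti_mid_def anti_def by blast
 hence "Max lo < Max A \<and> Max A < Max (p lo)" using assms(4) l by simp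
 thus False using assms(1,3) unfolding anti_mid_def by blast
qed

lemma phi_D_NC_bij: "bij_betw (phi_D (Suc m)) (NC_D (Suc m)) (triples (NCNN m))"
proof (rule phi_D_bij[where C = anti_mid and \<Q> = "NC_B m"])
 show "P \<in> Pi_B (Suc m) \<and> zero_blocks_D (Suc m) P" if "P \<in> NC_D (Suc m)" for P using that unfolding NC_D_def by blast
 show "cext (Suc m) Q \<in> NC_D (Suc m) \<longleftrightarrow> Q \<in> NC_B m" if "Q \<in> Pi_B m" for Q
  unfolding NC_D_def using cext_props(1,2,4,5)[OF that] by simp
 show "NC_B m \<subseteq> Pi_B m" unfolding NC_B_def by blast
 show "bij_betw phi (NC_B m) (NCNN m)" by (rule phi_NC_B_bij)
 show "parts m S \<and> X \<subseteq> S" if "(S, X) \<in> NCNN m" for S X by (rule NCNN_part[OF that])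
 show "dbuild m S X p lo e \<in> NC_D (Suc m) \<longleftrightarrow> (S, X) \<in> NCNN m \<and> anti_mid X p lo"
  if "parts m S" "X \<subseteq> S" "dok X p lo" for S X p lo e by (rule NC_D_char[OF that])
 show "\<exists>p lo. dok X p lo \<and> anti_mid X p lo" if "(S, X) \<in> NCNN m" "X \<noteq> {}" for S X
  using anti_mid_ex[OF part_sub_X[OF conjunct1[OF NCNN_part[OF that(1)]] conjunct2[OF NCNN_part[OF that(1)]]] that(2)] .
 show "lo = lo' \<and> (\<forall>A\<in>X. p A = q A)"
  if h: "(S, X) \<in> NCNN m" "dok X p lo" "dok X q lo'" "anti_mid X p lo" "anti_mid X q lo'" for S X p q lo lo'
 proof -
  note f = part_sub_X[OF conjunct1[OF NCNN_part[OF h(1)]] conjunct2[OF NCNN_part[OF h(1)]]]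
  have e: "p A = q A" if "A \<in> X" for A
   using anti_unique[OF f dokD(1)[OF h(2)] dokD(1)[OF h(3)] _ _ that] h(4,5) unfolding anti_mid_def by blast
  note lo = dokD(2)[OF h(2)] dokD(2)[OF h(3)]
  have "Max lo' \<le> Max lo" using anti_mid_le[OF h(4) lo] dokD(3)[OF h(3)] e[OF lo(2)] by simp
  moreover have "Max lo \<le> Max lo'" using anti_mid_le[OF h(5) lo(2,1)] dokD(3)[OF h(2)] e[OF lo(1)] by simp
  ultimately have "lo = lo'" using f(2) lo unfolding inj_on_def by simp
  thus ?thesis using e by blast
 qed
qed

section \<open>Nonnesting partitions of type D\<close>

text \<open>The central edges of a noncentred partition, where \<open>c\<close> is the one of
  \<open>n\<close>, \<open>- n\<close> in the block that contains \<open>lo\<close>. They are the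
  central edges of the remaining mixed blocks and the edges at the points \<open>c\<close> and
  \<open>- c\<close>.\<close>

definition cedge :: "int set set \<Rightarrow> (int set \<Rightarrow> int set) \<Rightarrow> int set \<Rightarrow> int \<Rightarrow> int \<Rightarrow> int \<Rightarrow> bool" where
 "cedge X p lo c x y \<longleftrightarrow> (\<exists>A\<in>X - {lo, p lo}. x = Max A \<and> y = - Max (p A)) \<or> (x = Max lo \<and> y = c) \<or> (x = - c \<and> y = - Max lo) \<or>
   (p lo \<noteq> lo \<and> (x = c \<and> y = - Max (p lo) \<or> x = Max (p lo) \<and> y = - c))"

text \<open>The edges from \<open>lo\<close> and \<open>p lo\<close> to the centre lie below any
  central edge that starts before them. So these blocks must come first, while the others are
  reversed among themselves.\<close>

definition anti_low :: "int set set \<Rightarrow> (int set \<Rightarrow> int set) \<Rightarrow> int set \<Rightarrow> bool" where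
 "anti_low X p lo \<longleftrightarrow> anti (X - {lo, p lo}) p \<and> (\<forall>A\<in>X - {lo, p lo}. Max (p lo) < Max A)"

lemma dbuild_blocks:
 assumes S: "parts m S" and X: "X \<subseteq> S" and d: "dok X p lo" and e: "e = 1 \<or> e = - 1"
 shows "dbuild m S X p lo e = others S X p lo \<union> {insert (e * int (Suc m)) (B0 p lo), insert (- (e * int (Suc m))) (neg (B0 p lo))}"
proof -
 note dc = dbuild_decomp[OF S X d]
 have 1: "build S (dcore X p lo) p - {B0 p lo, neg (B0 p lo)} = others S X p lo"
  unfolding dc(1) using dc(2,3) by blast
 have 2: "build S (dcore X p lo) p - {neg (B0 p lo), B0 p lo} = others S X p lo"
  using 1 by (simp add: insert_commute)
 from e show ?thesis
 proof
  assume e: "e = 1"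
  show ?thesis unfolding dbuild_def ext_def e using 1 by (simp del: of_nat_Suc)
 next assume e: "e = - 1"
  show ?thesis unfolding dbuild_def ext_def e using 2 by (simp add: insert_commute del: of_nat_Suc)
 qed
qed

lemma others_alt:
 assumes X: "X \<subseteq> S" and d: "dok X p lo"
 shows "others S X p lo = (S - X) \<union> neg ` (S - X) \<union> (\<lambda>A. A \<union> neg (p A)) ` (X - {lo, p lo})"
proof -
 let ?S = "S - {lo, p lo}" and ?X = "X - {lo, p lo}"
 have "blk X p ` ?S = blk ?X p ` ?S" by (rule image_cong) (auto simp: blk_def)
 hence "others S X p lo = build ?S ?X p" unfolding others_def build_def by simp
 also have "\<dots> = (?S - ?X) \<union> neg ` (?S - ?X) \<union> (\<lambda>A. A \<union> neg (p A)) ` ?X"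
  by (rule build_alt) (use X dok_rest(1)[OF d] in auto)
 also have "?S - ?X = S - X" using dokD(2)[OF d] invol_in[OF dokD(1)[OF d] dokD(2)[OF d]] by blast
 finally show ?thesis .
qed

lemma dbuild_nonnest:
 assumes S: "parts m S" and X: "X \<subseteq> S" and d: "dok X p lo"
  and k: "keyok m (2 * int m + 3) f" and c: "int m < f c" "f c < int m + 3" "f (- c) = 2 * int m + 3 - f c"
 defines "P \<equiv> others S X p lo \<union> {insert c (B0 p lo), insert (- c) (neg (B0 p lo))}"
 shows "\<not> (\<exists>x y x' y'. kedge f P x y \<and> kedge f P x' y' \<and> f x < f x' \<and> f y' < f y) \<longleftrightarrow>
  (S, X) \<in> NNNA m \<and> \<not> (\<exists>x y x' y'. cedge X p lo c x y \<and> cedge X p lo c x' y' \<and> f x < f x' \<and> f y' < f y)"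
proof -
 let ?N = "2 * int m + 3"
 let ?C = "cedge X p lo c"
 define X0 where "X0 = X - {lo, p lo}"
 \<comment> \<open>The empty set stands for the missing second part when \<open>lo\<close> is fixed,
   so that \<open>ke_central\<close> covers both cases.\<close>
 define HI where "HI = (if p lo = lo then {} else p lo)"
 note p = dokD(1)[OF d] and lo = dokD(2)[OF d]
 note plo = invol_in[OF p lo]
 note r = dok_rest[OF d, folded X0_def]
 have X0: "A \<in> X" if "A \<in> X0" for A using that unfolding X0_def by blast
 have sb: "A \<subseteq> {1..int m}" "A \<noteq> {}" if "A \<in> X" for A using part_sub[OF S] part_ne[OF S] X that by blast+
 have Mr: "1 \<le> Max A \<and> Max A \<le> int m" if "A \<in> X" for A using part_Max(1)[OF S _ subsetD[OF X that]] sb(1)[OF that] by auto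
 have fM: "f (Max A) = Max A" "f (- Max A) = ?N - Max A" if "A \<in> X" for A using keyok(2,3)[OF k, of "Max A"] Mr[OF that] by auto
 have HIs: "HI \<subseteq> {1..int m}" unfolding HI_def using sb(1)[OF plo] by simp
 have B0: "B0 p lo = lo \<union> neg HI" "neg (B0 p lo) = HI \<union> neg lo" unfolding B0_def HI_def by (auto simp: neg_Un)
 have HIM: "HI \<noteq> {} \<longleftrightarrow> p lo \<noteq> lo" "p lo \<noteq> lo \<Longrightarrow> HI = p lo" unfolding HI_def using sb(2)[OF plo] by auto
 have cc: "int m < f c" "f c < ?N - int m" "int m < f (- c)" "f (- c) < ?N - int m" using c by auto
 have kp: "ke f A x y \<longleftrightarrow> (x, y) \<in> edges {A}" "ke f (neg A) x y \<longleftrightarrow> (- y, - x) \<in> edges {A}" if "A \<in> S" for A x y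
  using ke_pos[OF k part_sub[OF S that]] ke_neg[OF k part_sub[OF S that]] by auto
 have K: "kedge f P x y \<longleftrightarrow> (x, y) \<in> edges S \<or> (- y, - x) \<in> edges S \<or> ?C x y" for x y
 proof -
  define e where "e = (\<lambda>A. (x, y) \<in> edges {A})"
  define e' where "e' = (\<lambda>A. (- y, - x) \<in> edges {A})"
  have sp: "(\<exists>A\<in>S. h A) \<longleftrightarrow> (\<exists>A\<in>S - X. h A) \<or> (\<exists>A\<in>X0. h A) \<or> h lo \<or> h (p lo)" for h
   unfolding X0_def using X lo plo by blast
  have HIe: "h lo \<or> h (p lo) \<longleftrightarrow> h lo \<or> h HI" if "\<not> h {}" for h
   unfolding HI_def using that by auto
  have gen: "(\<exists>B\<in>A1 \<union> neg ` A1 \<union> g ` A2 \<union> {b1, b2}. h B) \<longleftrightarrow> (\<exists>A\<in>A1. h A) \<or> (\<exists>A\<in>A1. h (neg A)) \<or> (\<exists>A\<in>A2. h (g A)) \<or> h b1 \<or> h b2"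
   for A1 A2 :: "int set set" and g b1 b2 h by blast
  have e0: "\<not> e {}" "\<not> e' {}" unfolding e_def e'_def edges_def by auto
  have a1: "(\<exists>A\<in>S - X. ke f A x y) \<longleftrightarrow> (\<exists>A\<in>S - X. e A)" unfolding e_def using kp(1) by simp
  have a2: "(\<exists>A\<in>S - X. ke f (neg A) x y) \<longleftrightarrow> (\<exists>A\<in>S - X. e' A)" unfolding e'_def using kp(2) by simp
  have a3: "(\<exists>A\<in>X0. ke f (A \<union> neg (p A)) x y) \<longleftrightarrow> (\<exists>A\<in>X0. e A) \<or> (\<exists>A\<in>X0. e' (p A)) \<or> (\<exists>A\<in>X0. x = Max A \<and> y = - Max (p A))"
  proof -
   have "ke f (A \<union> neg (p A)) x y \<longleftrightarrow> e A \<or> e' (p A) \<or> (x = Max A \<and> y = - Max (p A))" if "A \<in> X0" for A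
    unfolding ke_cross[OF k sb(1)[OF X0[OF that]] sb(1)[OF invol_in[OF p X0[OF that]]]] e_def e'_def
    using sb(2)[OF X0[OF that]] sb(2)[OF invol_in[OF p X0[OF that]]] by simp
   thus ?thesis by blast
  qed
  have a4: "(\<exists>A\<in>X0. e' (p A)) \<longleftrightarrow> (\<exists>A\<in>X0. e' A)"
  proof
   assume "\<exists>A\<in>X0. e' (p A)"
   thus "\<exists>A\<in>X0. e' A" using invol_in[OF r(1)] by blast
  next assume "\<exists>A\<in>X0. e' A"
   then obtain A where A: "A \<in> X0" "e' A" by blast
   hence "e' (p (p A))" using invol_inv[OF r(1)] by simp
   thus "\<exists>A\<in>X0. e' (p A)" using invol_in[OF r(1) A(1)] by blast
  qed
  have a5: "ke f (insert c (B0 p lo)) x y \<longleftrightarrow> e lo \<or> e' HI \<or> (x = Max lo \<and> y = c) \<or> (p lo \<noteq> lo \<and> x = c \<and> y = - Max (p lo))"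
   unfolding B0(1) ke_central[OF k sb(1)[OF lo] HIs cc(1,2)] e_def e'_def using sb(2)[OF lo] HIM by auto
  have a6: "ke f (insert (- c) (neg (B0 p lo))) x y \<longleftrightarrow> e HI \<or> e' lo \<or> (p lo \<noteq> lo \<and> x = Max (p lo) \<and> y = - c) \<or> (x = - c \<and> y = - Max lo)"
   unfolding B0(2) ke_central[OF k HIs sb(1)[OF lo] cc(3,4)] e_def e'_def using sb(2)[OF lo] HIM by auto
  have "kedge f P x y \<longleftrightarrow> (\<exists>A\<in>S - X. ke f A x y) \<or> (\<exists>A\<in>S - X. ke f (neg A) x y) \<or> (\<exists>A\<in>X0. ke f (A \<union> neg (p A)) x y) \<or>
   ke f (insert c (B0 p lo)) x y \<or> ke f (insert (- c) (neg (B0 p lo))) x y"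
   unfolding kedge_def P_def others_alt[OF X d] X0_def[symmetric] by (rule gen)
  also have "\<dots> \<longleftrightarrow> (\<exists>A\<in>S. e A) \<or> (\<exists>A\<in>S. e' A) \<or> ?C x y"
   unfolding a1 a2 a3 a4 a5 a6 sp[of e] sp[of e'] HIe[of e, OF e0(1)] HIe[of e', OF e0(2)] cedge_def X0_def[symmetric] by argo
  finally show ?thesis unfolding e_def e'_def edges_blocks[of x y S] edges_blocks[of "- y" "- x" S] .
 qed
 have C: "f x < ?N - int m \<and> int m < f y \<and> ?C (- y) (- x) \<and> f (- y) = ?N - f y" if h: "?C x y" for x y
 proof -
  from h consider A where "A \<in> X0" "x = Max A" "y = - Max (p A)" | "x = Max lo" "y = c" | "x = - c" "y = - Max lo" |
   "p lo \<noteq> lo" "x = c" "y = - Max (p lo)" | "p lo \<noteq> lo" "x = Max (p lo)" "y = - c" unfolding cedge_def X0_def[symmetric] by blast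
  thus ?thesis
  proof cases
   case (1 A)
   note q = invol_in[OF r(1) 1(1)]
   have "?C (- y) (- x)" unfolding cedge_def X0_def[symmetric] using q invol_inv[OF r(1) 1(1)] 1 by (intro disjI1 bexI[of _ "p A"]) auto
   thus ?thesis using fM[OF X0[OF 1(1)]] fM[OF X0[OF q]] Mr[OF X0[OF 1(1)]] Mr[OF X0[OF q]] 1(2,3) by auto
  next case 2
   have "?C (- y) (- x)" unfolding cedge_def 2 by simp
   thus ?thesis using fM[OF lo] Mr[OF lo] c 2 by simp
  next case 3
   have "?C (- y) (- x)" unfolding cedge_def 3 by simp
   thus ?thesis using fM[OF lo] Mr[OF lo] c 3 by simp
  next case 4
   have "?C (- y) (- x)" unfolding cedge_def 4(2,3) using 4(1) by simp
   thus ?thesis using fM[OF plo] Mr[OF plo] c 4 by simp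
  next case 5
   have "?C (- y) (- x)" unfolding cedge_def 5(2,3) using 5(1) by simp
   thus ?thesis using fM[OF plo] Mr[OF plo] c 5 by simp
  qed
 qed
 have CX: "\<exists>y. ?C (Max A) y" if A: "A \<in> X" for A
 proof -
  consider "A \<in> X0" | "A = lo" | "A = p lo" "p lo \<noteq> lo" using A unfolding X0_def by blast
  thus ?thesis unfolding cedge_def X0_def[symmetric] by cases blast+
 qed
 have XC: "(\<exists>A\<in>X. x = Max A) \<or> int m < f x" if h: "?C x y" for x y
 proof -
  from h consider A where "A \<in> X" "x = Max A" | "x = c" | "x = - c" unfolding cedge_def using lo plo by blast
  thus ?thesis using cc(1,3) by cases blast+
 qed
 show ?thesis by (rule nonnest_marked[OF k S X K C CX XC])
qed

text \<open>Necessity holds for either order of \<open>n\<close> and \<open>- n\<close>. For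
  sufficiency \<open>c\<close> comes first: then the edge from the smaller maximum
  \<open>Max lo\<close> also ends first, and reflection treats the edges leaving the centre.\<close>

lemma cedge_nest:
 assumes S: "parts m S" and X: "X \<subseteq> S" and d: "dok X p lo"
  and k: "keyok m (2 * int m + 3) f" and c: "int m < f c" "f c < int m + 3" "f (- c) = 2 * int m + 3 - f c"
 defines "T \<equiv> \<not> (\<exists>x y x' y'. cedge X p lo c x y \<and> cedge X p lo c x' y' \<and> f x < f x' \<and> f y' < f y)"
 shows "T \<Longrightarrow> anti_low X p lo" "anti_low X p lo \<Longrightarrow> f c = int m + 1 \<Longrightarrow> T"
proof -
 let ?N = "2 * int m + 3"
 let ?C = "cedge X p lo c"
 define X0 where "X0 = X - {lo, p lo}"
 note p = dokD(1)[OF d] and lo = dokD(2)[OF d]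
 note plo = invol_in[OF p lo]
 note r = dok_rest[OF d, folded X0_def]
 have X0: "A \<in> X" "A \<noteq> p lo" if "A \<in> X0" for A using that unfolding X0_def by blast+
 have inj: "A = B" if "A \<in> X" "B \<in> X" "Max A = Max B" for A B using part_sub_X(2)[OF S X] that unfolding inj_on_def by blast
 have Mr: "1 \<le> Max A \<and> Max A \<le> int m" if "A \<in> X" for A
  using part_Max(1)[OF S _ subsetD[OF X that]] part_sub[OF S subsetD[OF X that]] by auto
 have fM: "f (Max A) = Max A" "f (- Max A) = ?N - Max A" if "A \<in> X" for A using keyok(2,3)[OF k, of "Max A"] Mr[OF that] by auto
 have c1: "?C (Max A) (- Max (p A))" if "A \<in> X0" for A unfolding cedge_def X0_def[symmetric] using that by blast
 {
  assume T: T
  have n: False if h: "?C x y" "?C x' y'" "f x < f x'" "f y' < f y" for x y x' y'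
   using T that unfolding T_def by blast
  have "anti X0 p" unfolding anti_def
  proof (intro ballI impI)
   fix A B assume AB: "A \<in> X0" "B \<in> X0" "Max A < Max B"
   have l: "f (Max A) < f (Max B)" using fM(1)[OF X0(1)[OF AB(1)]] fM(1)[OF X0(1)[OF AB(2)]] AB(3) by simp
   have "\<not> f (- Max (p B)) < f (- Max (p A))" by (rule notI, rule n[OF c1[OF AB(1)] c1[OF AB(2)] l])
   hence "Max (p B) \<le> Max (p A)" using fM(2)[OF X0(1)[OF invol_in[OF r(1) AB(1)]]] fM(2)[OF X0(1)[OF invol_in[OF r(1) AB(2)]]] by simp
   thus "Max (p B) < Max (p A)" using anti_iff_strict[OF S X p X0(1)[OF AB(1)] X0(1)[OF AB(2)]] AB(3) by blast
  qed
  moreover have "Max (p lo) < Max A" if A: "A \<in> X0" for A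
  proof (rule ccontr)
   assume "\<not> Max (p lo) < Max A"
   moreover have "Max A \<noteq> Max (p lo)" using inj[OF X0(1)[OF A] plo] X0(2)[OF A] by blast
   ultimately have l: "f (Max A) < f (Max (p lo))" using fM(1)[OF X0(1)[OF A]] fM(1)[OF plo] by simp
   have y: "f c < f (- Max (p A))" "f (- c) < f (- Max (p A))"
    using c fM(2)[OF X0(1)[OF invol_in[OF r(1) A]]] Mr[OF X0(1)[OF invol_in[OF r(1) A]]] by auto
   show False
   proof (cases "p lo = lo")
    case True
    have "?C (Max (p lo)) c" unfolding True cedge_def by simp
    thus False using n[OF c1[OF A] _ l y(1)] by blast
   next case False
    hence "?C (Max (p lo)) (- c)" unfolding cedge_def by simp
    thus False using n[OF c1[OF A] _ l y(2)] by blast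
   qed
  qed
  ultimately show "anti_low X p lo" unfolding anti_low_def X0_def[symmetric] by blast
 }
 {
  assume a: "anti_low X p lo" and fc: "f c = int m + 1"
  have an: "Max (p B) < Max (p A)" if "A \<in> X0" "B \<in> X0" "Max A < Max B" for A B
   using a that unfolding anti_low_def X0_def[symmetric] anti_def by blast
  have low: "Max (p lo) < Max A" if "A \<in> X0" for A using a that unfolding anti_low_def X0_def[symmetric] by blast
  have fcm: "f (- c) = int m + 2" using c(3) fc by simp
  have ll: "Max lo \<le> Max (p lo)" "Max (p lo) \<le> int m" using dokD(3)[OF d] Mr[OF plo] by auto
  have cv: "(\<exists>A\<in>X0. f x = Max A \<and> f y = ?N - Max (p A)) \<or> f x = Max lo \<and> f y = int m + 1 \<or> f x = int m + 2 \<and> f y = ?N - Max lo \<or>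
    f x = int m + 1 \<and> f y = ?N - Max (p lo) \<or> f x = Max (p lo) \<and> f y = int m + 2" if h: "?C x y" for x y
  proof -
   from h consider A where "A \<in> X0" "x = Max A" "y = - Max (p A)" | "x = Max lo" "y = c" | "x = - c" "y = - Max lo" |
    "x = c" "y = - Max (p lo)" | "x = Max (p lo)" "y = - c" unfolding cedge_def X0_def[symmetric] by blast
   thus ?thesis
   proof cases
    case (1 A)
    have "f x = Max A \<and> f y = ?N - Max (p A)" using fM(1)[OF X0(1)[OF 1(1)]] fM(2)[OF X0(1)[OF invol_in[OF r(1) 1(1)]]] 1(2,3) by simp
    thus ?thesis using 1(1) by blast
   qed (simp_all add: fM[OF lo] fM[OF plo] fc fcm)
  qed
  have bd: "Max (p lo) < Max A \<and> Max A \<le> int m \<and> Max (p lo) < Max (p A) \<and> Max (p A) \<le> int m" if "A \<in> X0" for A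
   using low[OF that] low[OF invol_in[OF r(1) that]] Mr[OF X0(1)[OF that]] Mr[OF X0(1)[OF invol_in[OF r(1) that]]] by blast
  show T unfolding T_def
  proof (rule notI, elim exE conjE)
   fix x y x' y' assume *: "?C x y" "?C x' y'" "f x < f x'" "f y' < f y"
   show False
   proof (cases "\<exists>A\<in>X0. f x = Max A \<and> f y = ?N - Max (p A)")
    case True
    then obtain A where A: "A \<in> X0" "f x = Max A" "f y = ?N - Max (p A)" by blast
    show False
    proof (cases "\<exists>B\<in>X0. f x' = Max B \<and> f y' = ?N - Max (p B)")
     case True
     then obtain B where B: "B \<in> X0" "f x' = Max B" "f y' = ?N - Max (p B)" by blast
     show False using an[OF A(1) B(1)] A B *(3,4) by simp
    next case False
     thus False using cv[OF *(2)] bd[OF A(1)] A(2,3) *(3,4) ll by (elim disjE) (blast, linarith+)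
    qed
   next case nA: False
    show False
    proof (cases "\<exists>B\<in>X0. f x' = Max B \<and> f y' = ?N - Max (p B)")
     case True
     then obtain B where B: "B \<in> X0" "f x' = Max B" "f y' = ?N - Max (p B)" by blast
     from cv[OF *(1)] show False using nA bd[OF B(1)] B(2,3) *(3,4) ll by (elim disjE) (blast, linarith+)
    next case False
     have "f x = Max lo \<and> f y = int m + 1 \<or> f x = int m + 2 \<and> f y = ?N - Max lo \<or>
      f x = int m + 1 \<and> f y = ?N - Max (p lo) \<or> f x = Max (p lo) \<and> f y = int m + 2"
      by (rule mp[OF disj_imp[THEN iffD1, OF cv[OF *(1)]] nA])
     moreover have "f x' = Max lo \<and> f y' = int m + 1 \<or> f x' = int m + 2 \<and> f y' = ?N - Max lo \<or>
      f x' = int m + 1 \<and> f y' = ?N - Max (p lo) \<or> f x' = Max (p lo) \<and> f y' = int m + 2"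
      by (rule mp[OF disj_imp[THEN iffD1, OF cv[OF *(2)]] False])
     ultimately show False using *(3,4) ll by (elim disjE conjE) linarith+
    qed
   qed
  qed
 }
qed

text \<open>Two central ranks \<open>m + 1\<close> and \<open>m + 2\<close>, exchanged by the
  reflection with \<open>N = 2 * int m + 3\<close>; \<open>s\<close> says whether \<open>n\<close>
  precedes \<open>- n\<close>.\<close>

definition kD :: "nat \<Rightarrow> bool \<Rightarrow> int \<Rightarrow> int" where
 "kD m s x = (if x = int m + 1 then (if s then int m + 1 else int m + 2)
   else if x = - (int m + 1) then (if s then int m + 2 else int m + 1)
   else if 0 < x then x else 2 * int m + 3 + x)"

lemma kD_ok: "keyok m (2 * int m + 3) (kD m s)"
 unfolding keyok_def kD_def by auto

lemma kD_sorted: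
 "sorted_wrt (\<lambda>x y. kD m s x < kD m s y) ([1..int m] @ (if s then [int m + 1, - (int m + 1)] else [- (int m + 1), int m + 1]) @ [- int m..-1])"
proof -
 have 1: "sorted_wrt (\<lambda>x y. kD m s x < kD m s y) [1..int m]"
  by (rule sorted_wrt_mono_rel[OF _ sorted_wrt_upto]) (auto simp: kD_def)
 have 2: "sorted_wrt (\<lambda>x y. kD m s x < kD m s y) [- int m..-1]"
  by (rule sorted_wrt_mono_rel[OF _ sorted_wrt_upto]) (auto simp: kD_def)
 show ?thesis using 1 2 by (cases s) (auto simp: sorted_wrt_append kD_def)
qed

text \<open>Either of the two orders forces \<open>anti_low\<close>, and conversely the order in
  which the element attached to the block of \<open>lo\<close> comes first,
  \<open>s = (e = 1)\<close>, is then nonnesting. This is how the disjunction in \<open>NN_D\<close>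
  is resolved.\<close>

lemma NN_D_char:
 assumes S: "parts m S" and X: "X \<subseteq> S" and d: "dok X p lo" and e: "e = 1 \<or> e = - 1"
 shows "dbuild m S X p lo e \<in> NN_D (Suc m) \<longleftrightarrow> (S, X) \<in> NNNA m \<and> anti_low X p lo"
proof -
 let ?P = "dbuild m S X p lo e"
 let ?c = "e * int (Suc m)"
 let ?us = "\<lambda>s. [1..int m] @ (if s then [int m + 1, - (int m + 1)] else [- (int m + 1), int m + 1]) @ [- int m..-1]"
 let ?T = "\<lambda>s. \<not> (\<exists>x y x' y'. cedge X p lo ?c x y \<and> cedge X p lo ?c x' y' \<and> kD m s x < kD m s x' \<and> kD m s y' < kD m s y)"
 note Pi = dbuild_Pi[OF S X d, of e]
 note b = dbuild_blocks[OF S X d e]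
 have fc: "kD m s ?c = (if s = (e = 1) then int m + 1 else int m + 2)" "kD m s (- ?c) = (if s = (e = 1) then int m + 2 else int m + 1)" for s
  using e by (auto simp: kD_def)
 have c: "int m < kD m s ?c" "kD m s ?c < int m + 3" "kD m s (- ?c) = 2 * int m + 3 - kD m s ?c" for s
  unfolding fc by auto
 have nw: "nonnesting_wrt (?us s) ?P \<longleftrightarrow> (S, X) \<in> NNNA m \<and> ?T s" for s
 proof -
  have us: "B \<subseteq> set (?us s)" if "B \<in> ?P" for B using part_sub[OF Pi_B_part[OF Pi(1)] that] by (force simp: ground_Suc)
  have "nonnesting_wrt (?us s) ?P \<longleftrightarrow>
   \<not> (\<exists>x y x' y'. kedge (kD m s) ?P x y \<and> kedge (kD m s) ?P x' y' \<and> kD m s x < kD m s x' \<and> kD m s y' < kD m s y)"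
   by (rule nonnesting_key[OF kD_sorted us])
  also have "\<dots> \<longleftrightarrow> (S, X) \<in> NNNA m \<and> ?T s" unfolding b by (rule dbuild_nonnest[OF S X d kD_ok c])
  finally show ?thesis .
 qed
 have i: "int (Suc m) - 1 = int m" "int (Suc m) = int m + 1" by auto
 have "?P \<in> NN_D (Suc m) \<longleftrightarrow> nonnesting_wrt (?us True) ?P \<or> nonnesting_wrt (?us False) ?P"
  unfolding NN_D_def i using Pi by simp
 also have "\<dots> \<longleftrightarrow> (S, X) \<in> NNNA m \<and> (?T True \<or> ?T False)" unfolding nw by blast
 also have "?T True \<or> ?T False \<longleftrightarrow> anti_low X p lo"
 proof
  assume "?T True \<or> ?T False"
  thus "anti_low X p lo" using cedge_nest(1)[OF S X d kD_ok c] by blast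
 next assume a: "anti_low X p lo"
  have T: "?T (e = 1)" by (rule cedge_nest(2)[OF S X d kD_ok c a]) (simp add: fc del: of_nat_Suc)
  show "?T True \<or> ?T False"
  proof (cases "e = 1")
   case True
   hence b: "(e = 1) = True" by simp
   show ?thesis by (rule disjI1) (rule T[unfolded b])
  next case False
   hence b: "(e = 1) = False" by simp
   show ?thesis by (rule disjI2) (rule T[unfolded b])
  qed
 qed
 finally show ?thesis .
qed

lemma anti_low_by_max:
 assumes f: "finite X" "inj_on Max X" and d: "dok X p lo" and a: "anti_low X p lo"
 shows "by_max X = (if p lo = lo then [lo] else [lo, p lo]) @ by_max (X - {lo, p lo})" "odd (card X) \<longleftrightarrow> p lo = lo"
  "invol (X - {lo, p lo}) p" "anti (X - {lo, p lo}) p"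
proof -
 let ?Y = "X - {lo, p lo}"
 note p = dokD(1)[OF d] and lo = dokD(2)[OF d]
 note plo = invol_in[OF p lo]
 note r = dok_rest[OF d]
 show an: "anti ?Y p" using a unfolding anti_low_def by blast
 show "invol ?Y p" by (rule r(1))
 have low: "Max (p lo) < Max A" if "A \<in> ?Y" for A using a that unfolding anti_low_def by blast
 have fY: "finite ?Y" "inj_on Max ?Y" using f(1) inj_on_diff[OF f(2)] by auto
 have ev: "even (card ?Y)" using anti_fixed_iff[OF fY r(1) an] r(2) by blast
 show "by_max X = (if p lo = lo then [lo] else [lo, p lo]) @ by_max ?Y"
 proof (cases "p lo = lo")
  case True
  hence e: "?Y = X - {lo}" by simp
  have "by_max X = lo # by_max (X - {lo})" by (rule by_max_Cons[OF f lo]) (use low True e in simp)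
  thus ?thesis using True by simp
 next case False
  have "Max lo \<noteq> Max (p lo)" using f(2) lo plo False unfolding inj_on_def by metis
  hence l: "Max lo < Max (p lo)" using dokD(3)[OF d] by simp
  have fZ: "finite (X - {lo})" "inj_on Max (X - {lo})" using f(1) inj_on_diff[OF f(2)] by auto
  have "Max lo < Max A" if A: "A \<in> X" "A \<noteq> lo" for A
  proof (cases "A = p lo")
   case True thus ?thesis using l by simp
  next case False
   thus ?thesis using low[of A] l A by simp
  qed
  hence 1: "by_max X = lo # by_max (X - {lo})" by (rule by_max_Cons[OF f lo])
  have "by_max (X - {lo}) = p lo # by_max (X - {lo} - {p lo})"
   by (rule by_max_Cons[OF fZ]) (use plo False low in auto)
  moreover have "X - {lo} - {p lo} = ?Y" by blast
  ultimately show ?thesis using 1 False by simp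
 qed
 hence "length (by_max X) = (if p lo = lo then 1 else 2) + length (by_max ?Y)" by (auto split: if_splits)
 hence "card X = (if p lo = lo then 1 else 2) + card ?Y" unfolding length_by_max[OF f] length_by_max[OF fY] .
 thus "odd (card X) \<longleftrightarrow> p lo = lo" using ev by (auto split: if_splits)
qed

text \<open>For an odd number of marks the matching of type B works, with its fixed first block as
  \<open>lo\<close>. For a positive even number the first two blocks are matched with each other and
  the rest is reversed.\<close>

lemma anti_low_ex:
 assumes f: "finite X" "inj_on Max X" and ne: "X \<noteq> {}"
 shows "\<exists>p lo. dok X p lo \<and> anti_low X p lo"
proof (cases "even (card X)")
 case False
 obtain p where p: "invol X p" "antiB X p" using antiB_ex[OF f] by blast
 from f p show ?thesis
 proof (cases rule: antiB_cases)
  case even thus ?thesis using False by blast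
 next case (odd F)
  have fx: "A = F" if "A \<in> X" "p A = A" for A by (rule invol_fix[OF p(1) that(1) odd(2) that(2) odd(3)])
  have "dok X p F" unfolding dok_def odd(3) by (intro conjI ballI impI p(1) odd(2) order_refl; rule fx)
  moreover have "Max F < Max A" if "A \<in> X - {F}" for A
   by (rule conjunct2[OF p(2)[unfolded antiB_def], rule_format, OF odd(2) _ odd(3)]) (use that in auto)
  hence "anti_low X p F" unfolding anti_low_def odd(3) insert_absorb2 using odd(6) by blast
  ultimately show ?thesis by blast
 qed
next case True
 note b = by_max[OF f]
 have "card X \<noteq> 0" using f(1) ne by simp
 hence "2 \<le> length (by_max X)" using True b(4) by (metis One_nat_def Suc_leI even_Suc even_zero le_neq_implies_less less_2_cases_iff not_less neq0_conv)
 then obtain lo hi ys where xs: "by_max X = lo # hi # ys" by (cases "by_max X" rule: remdups_adj.cases) auto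
 have in_X: "lo \<in> X" "hi \<in> X" using b(1) xs by auto
 have l: "Max lo < Max hi" using b(2) xs by simp
 hence lh: "lo \<noteq> hi" by auto
 define Y where "Y = X - {lo, hi}"
 have low: "Max hi < Max A" if "A \<in> Y" for A
 proof -
  have "A \<in> set ys" using that b(1) unfolding Y_def xs by auto
  thus ?thesis using b(2) unfolding xs by simp
 qed
 have fY: "finite Y" "inj_on Max Y" unfolding Y_def using f(1) inj_on_diff[OF f(2)] by auto
 have "card Y = card X - 2" unfolding Y_def using f(1) in_X lh by (simp add: card_Diff_subset)
 hence ev: "even (card Y)" using True by simp
 define q where "q = rp (by_max Y)"
 note a = anti_ex[OF fY, folded q_def]
 define p where "p = q(lo := hi, hi := lo)"
 have plh: "p lo = hi" "p hi = lo" unfolding p_def using lh by simp_all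
 have pY: "p A = q A" if "A \<in> Y" for A using that unfolding p_def Y_def by simp
 have nf: "p A \<noteq> A" if A: "A \<in> X" for A
 proof -
  consider "A = lo" | "A = hi" | "A \<in> Y" using A unfolding Y_def by blast
  thus ?thesis
  proof cases
   case 3
   show ?thesis unfolding pY[OF 3] using anti_fixed_iff[OF fY a] ev 3 by blast
  qed (use plh lh in auto)
 qed
 have "invol X p" unfolding invol_def
 proof (intro conjI ballI impI)
  fix A assume A: "A \<in> X"
  consider "A = lo" | "A = hi" | "A \<in> Y" using A unfolding Y_def by blast
  hence "p A \<in> X \<and> p (p A) = A"
  proof cases
   case 3
   have "q A \<in> Y" by (rule invol_in[OF a(1) 3])
   thus ?thesis unfolding pY[OF 3] using pY[of "q A"] invol_inv[OF a(1) 3] unfolding Y_def by simp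
  qed (use plh in_X in auto)
  thus "p A \<in> X" "p (p A) = A" by blast+
 next fix A B assume "A \<in> X" "p A = A"
  thus "A = B" using nf by blast
 qed
 hence "dok X p lo" unfolding dok_def plh using in_X(1) l nf by simp
 moreover have "anti_low X p lo" unfolding anti_low_def plh Y_def[symmetric]
 proof (intro conjI ballI)
  show "anti Y p" using a(2) pY unfolding anti_def by simp
 qed (use low in blast)
 ultimately show ?thesis by blast
qed

lemma phi_D_NN_bij: "bij_betw (phi_D (Suc m)) (NN_D (Suc m)) (triples (NNNA m))"
proof (rule phi_D_bij[where C = anti_low and \<Q> = "NN_B m"])
 show "P \<in> Pi_B (Suc m) \<and> zero_blocks_D (Suc m) P" if "P \<in> NN_D (Suc m)" for P using that unfolding NN_D_def by blast
 show "cext (Suc m) Q \<in> NN_D (Suc m) \<longleftrightarrow> Q \<in> NN_B m" if "Q \<in> Pi_B m" for Q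
  unfolding NN_D_def using cext_props(1-4)[OF that] by simp
 show "NN_B m \<subseteq> Pi_B m" unfolding NN_B_def by blast
 show "bij_betw phi (NN_B m) (NNNA m)" by (rule phi_NN_B_bij)
 show "parts m S \<and> X \<subseteq> S" if "(S, X) \<in> NNNA m" for S X by (rule NNNA_part[OF that])
 show "dbuild m S X p lo e \<in> NN_D (Suc m) \<longleftrightarrow> (S, X) \<in> NNNA m \<and> anti_low X p lo"
  if "parts m S" "X \<subseteq> S" "dok X p lo" "e = 1 \<or> e = - 1" for S X p lo e by (rule NN_D_char[OF that])
 show "\<exists>p lo. dok X p lo \<and> anti_low X p lo" if "(S, X) \<in> NNNA m" "X \<noteq> {}" for S X
  using anti_low_ex[OF part_sub_X[OF conjunct1[OF NNNA_part[OF that(1)]] conjunct2[OF NNNA_part[OF that(1)]]] that(2)] .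
 show "lo = lo' \<and> (\<forall>A\<in>X. p A = q A)"
  if h: "(S, X) \<in> NNNA m" "dok X p lo" "dok X q lo'" "anti_low X p lo" "anti_low X q lo'" for S X p q lo lo'
 proof -
  note f = part_sub_X[OF conjunct1[OF NNNA_part[OF h(1)]] conjunct2[OF NNNA_part[OF h(1)]]]
  note ap = anti_low_by_max[OF f h(2,4)] and aq = anti_low_by_max[OF f h(3,5)]
  have fy: "finite (X - {lo, p lo})" "inj_on Max (X - {lo, p lo})" using f(1) inj_on_diff[OF f(2)] by auto
  have par: "p lo = lo \<longleftrightarrow> q lo' = lo'" using ap(2) aq(2) by blast
  \<comment> \<open>The parity of \<open>card X\<close> decides whether \<open>lo\<close> is fixed;
    then the first one or two entries of the sorted list are \<open>lo\<close> and its partner for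
    both matchings.\<close>
  have eq: "lo = lo' \<and> p lo = q lo'"
  proof (cases "p lo = lo")
   case True
   thus ?thesis using ap(1) aq(1) par by simp
  next case False
   hence "q lo' \<noteq> lo'" using par by blast
   hence "[lo, p lo] @ by_max (X - {lo, p lo}) = [lo', q lo'] @ by_max (X - {lo', q lo'})"
    using trans[OF sym[OF ap(1)] aq(1)] False by (simp only: if_False)
   thus ?thesis unfolding append_Cons list.inject by blast
  qed
  have Y: "X - {lo', q lo'} = X - {lo, p lo}"
   unfolding conjunct2[OF eq, symmetric] unfolding conjunct1[OF eq, symmetric] ..
  note iq = aq(3,4)[unfolded Y]
  have plo: "p (p lo) = lo" "q (q lo') = lo'" using invol_inv[OF dokD(1,2)[OF h(2)]] invol_inv[OF dokD(1,2)[OF h(3)]] by auto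
  have "p A = q A" if A: "A \<in> X" for A
  proof -
   consider "A = lo" | "A = p lo" | "A \<in> X - {lo, p lo}" using A by blast
   thus ?thesis
   proof cases
    case 1
    show ?thesis unfolding 1 using conjunct2[OF eq] unfolding conjunct1[OF eq, symmetric] .
   next case 2
    have "q (p lo) = lo" unfolding conjunct2[OF eq] plo(2) by (rule conjunct1[OF eq, symmetric])
    thus ?thesis unfolding 2 plo(1) by (rule sym)
   next case 3 show ?thesis by (rule anti_unique[OF fy ap(3) iq(1) ap(4) iq(2) 3])
   qed
  qed
  thus ?thesis using eq by blast
 qed
qed

section \<open>Types\<close>

lemma btype_insert_pair:
 assumes F: "finite F" "D \<notin> F" "neg D \<notin> F" "\<not> zero_block D"
 shows "btype (F \<union> {D, neg D}) = add_mset (card D) (btype F)"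
proof -
 let ?R = "{{B, neg B} |B. B \<in> F \<and> \<not> zero_block B}"
 have e: "{{B, neg B} |B. B \<in> F \<union> {D, neg D} \<and> \<not> zero_block B} = insert {D, neg D} ?R"
 proof (intro equalityI subsetI)
  fix q assume "q \<in> {{B, neg B} |B. B \<in> F \<union> {D, neg D} \<and> \<not> zero_block B}"
  then obtain B where B: "q = {B, neg B}" "B \<in> F \<or> B = D \<or> B = neg D" "\<not> zero_block B" by blast
  from B(2) show "q \<in> insert {D, neg D} ?R"
  proof (elim disjE)
   assume "B \<in> F" thus ?thesis using B(1,3) by blast
  next assume e: "B = D" show ?thesis unfolding B(1) e by simp
  next assume e: "B = neg D" show ?thesis unfolding B(1) e neg_neg by (simp add: insert_commute)
  qed
 next fix q assume "q \<in> insert {D, neg D} ?R"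
  then consider "q = {D, neg D}" | B where "q = {B, neg B}" "B \<in> F" "\<not> zero_block B" by blast
  thus "q \<in> {{B, neg B} |B. B \<in> F \<union> {D, neg D} \<and> \<not> zero_block B}"
  proof cases
   case 1 thus ?thesis using F(4) by blast
  next case 2 thus ?thesis by blast
  qed
 qed
 have n: "{D, neg D} \<notin> ?R"
 proof
  assume "{D, neg D} \<in> ?R"
  then obtain B where B: "{D, neg D} = {B, neg B}" "B \<in> F" by blast
  have "B \<in> {D, neg D}" unfolding B(1) by simp
  thus False using F(2,3) B(2) by auto
 qed
 have fin: "finite ?R" using F(1) by simp
 have c: "the_elem (card ` {D, neg D}) = card D" by (simp add: card_image)
 show ?thesis unfolding btype_def e mset_set.insert[OF fin n] image_mset_add_mset c ..
qed

lemma lower_half: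
 assumes p: "invol X p" and lo: "lo \<in> X" and l: "Max lo < Max (p lo)"
 shows "{A \<in> X. Max A < Max (p A)} = insert lo {A \<in> X - {lo, p lo}. Max A < Max (p A)}"
proof (intro equalityI subsetI)
 fix A assume A: "A \<in> {A \<in> X. Max A < Max (p A)}"
 have "A \<noteq> p lo"
 proof
  assume "A = p lo"
  hence "Max (p lo) < Max (p (p lo))" using A by simp
  thus False using l unfolding invol_inv[OF p lo] by simp
 qed
 thus "A \<in> insert lo {A \<in> X - {lo, p lo}. Max A < Max (p A)}" using A by simp
next fix A assume "A \<in> insert lo {A \<in> X - {lo, p lo}. Max A < Max (p A)}"
 thus "A \<in> {A \<in> X. Max A < Max (p A)}" using lo l by auto
qed

text \<open>The partition differs from \<open>build S (dcore X p lo) p\<close> only in one opposite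
  pair of blocks, enlarged by one point. The type of the remaining blocks is obtained by cancelling
  that pair from the type already known.\<close>

lemma btype_dbuild:
 assumes S: "parts m S" and X: "X \<subseteq> S" and d: "dok X p lo" and e: "e = 1 \<or> e = - 1"
 shows "btype (dbuild m S X p lo e) = add_mset (Suc (card lo + (if p lo = lo then 0 else card (p lo))))
  (image_mset card (mset_set (S - X)) +
   image_mset (\<lambda>A. card A + card (p A)) (mset_set {A \<in> X - {lo, p lo}. Max A < Max (p A)}))"
proof -
 let ?F = "others S X p lo" and ?Y = "dcore X p lo" and ?c = "e * int (Suc m)" and ?B = "B0 p lo"
 let ?Q = "build S ?Y p"
 let ?h = "\<lambda>A. card A + card (p A)"
 let ?Z = "{A \<in> X - {lo, p lo}. Max A < Max (p A)}"
 note q = dbuild_props[OF S X d] and dc = dbuild_decomp[OF S X d] and co = dcore_props[OF d]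
 have YS: "?Y \<subseteq> S" using co(2) X by blast
 note p = dokD(1)[OF d] and lo = dokD(2)[OF d]
 note plo = invol_in[OF p lo]
 have loS: "lo \<in> S" "p lo \<in> S" using lo plo X by auto
 have fS: "finite S" using part_finite[OF S] by simp
 have fX: "finite X" using part_sub_X(1)[OF S X] .
 have fQ: "finite ?Q" using part_finite[OF Pi_B_part[OF q(1)]] by simp
 hence fF: "finite ?F" unfolding dc(1) by simp
 have nz: "\<not> zero_block ?B" using q(2,3) by blast
 have bQ: "btype ?Q = add_mset (card ?B) (btype ?F)" unfolding dc(1) by (rule btype_insert_pair[OF fF dc(2,3) nz])
 have c: "\<bar>?c\<bar> = int (Suc m)" using e by auto
 have r: "?c \<notin> B" "- ?c \<notin> B" if "B \<in> ?Q" for B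
  using Pi_B_range[OF q(1) that, of ?c] Pi_B_range[OF q(1) that, of "- ?c"] c by auto
 have FQ: "?F \<subseteq> ?Q" unfolding dc(1) by blast
 have nI: "neg (insert ?c ?B) = insert (- ?c) (neg ?B)" by (rule neg_insert)
 have 1: "insert ?c ?B \<notin> ?F"
 proof
  assume "insert ?c ?B \<in> ?F"
  hence "?c \<notin> insert ?c ?B" using r(1) FQ by blast
  thus False by simp
 qed
 have 2: "neg (insert ?c ?B) \<notin> ?F"
 proof
  assume "neg (insert ?c ?B) \<in> ?F"
  hence "- ?c \<notin> neg (insert ?c ?B)" using r(2) FQ by blast
  thus False unfolding nI by simp
 qed
 have 3: "\<not> zero_block (insert ?c ?B)"
 proof
  assume "zero_block (insert ?c ?B)"
  hence "insert (- ?c) (neg ?B) = insert ?c ?B" unfolding zero_block_def nI .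
  hence "- ?c \<in> insert ?c ?B" by blast
  hence "- ?c = ?c" using r(2)[OF q(3)] by blast
  hence "\<bar>?c\<bar> = 0" by linarith
  thus False unfolding c by simp
 qed
 have fB: "finite ?B" using part_finite_block[OF Pi_B_part[OF q(1)] _ q(3)] by simp
 have cI: "card (insert ?c ?B) = Suc (card ?B)" using fB r(1)[OF q(3)] by simp
 have bP: "btype (dbuild m S X p lo e) = add_mset (Suc (card ?B)) (btype ?F)"
  unfolding dbuild_blocks[OF S X d e] nI[symmetric] btype_insert_pair[OF fF 1 2 3] cI ..
 have cB: "card ?B = card lo + (if p lo = lo then 0 else card (p lo))"
 proof (cases "p lo = lo")
  case True thus ?thesis unfolding B0_def by simp
 next case False
  have "x \<notin> neg (p lo)" if "x \<in> lo" for x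
   using that part_sub[OF S loS(1)] part_sub[OF S loS(2)] by (fastforce simp: mem_neg)
  hence "card (lo \<union> neg (p lo)) = card lo + card (neg (p lo))"
   using part_finite_block[OF S _ loS(1)] part_finite_block[OF S _ loS(2)] by (intro card_Un_disjoint) auto
  moreover have "card (neg (p lo)) = card (p lo)" by (simp add: card_image)
  ultimately show ?thesis unfolding B0_def using False by simp
 qed
 have "btype ?Q = add_mset (card ?B) (image_mset card (mset_set (S - X)) + image_mset ?h (mset_set ?Z))"
 proof (cases "p lo = lo")
  case True
  hence Y: "?Y = X - {lo, p lo}" unfolding dcore_def by simp
  have "S - ?Y = insert lo (S - X)" unfolding Y True using loS by blast
  hence "mset_set (S - ?Y) = add_mset lo (mset_set (S - X))" using fS lo by simp
  thus ?thesis unfolding btype_build[OF S YS co(1)] cB using True by (simp add: Y)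
 next case False
  hence Y: "?Y = X" unfolding dcore_def by simp
  have "Max lo \<noteq> Max (p lo)" using part_Max_inj[OF S] loS False unfolding inj_on_def by (metis finite_atLeastAtMost_int)
  hence l: "Max lo < Max (p lo)" using dokD(3)[OF d] by simp
  have "{A \<in> X. Max A < Max (p A)} = insert lo ?Z" by (rule lower_half[OF p lo l])
  hence "mset_set {A \<in> X. Max A < Max (p A)} = add_mset lo (mset_set ?Z)" using fX by simp
  thus ?thesis unfolding Y btype_build[OF S X p] cB using False by simp
 qed
 hence "btype ?F = image_mset card (mset_set (S - X)) + image_mset ?h (mset_set ?Z)" unfolding bQ by simp
 thus ?thesis unfolding bP cB by simp
qed

text \<open>Here \<open>a\<close> is the size of the block of \<open>n\<close> without
  \<open>n\<close>, and \<open>M\<close> collects the sizes of the other pairs of mixed blocks, when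
  \<open>lo\<close> and \<open>p lo\<close> are in the middle of the list of marked blocks.\<close>

definition middle :: "nat list \<Rightarrow> nat \<Rightarrow> nat multiset \<Rightarrow> bool" where
 "middle L a M \<longleftrightarrow> (if odd (length L) then a = L ! (length L div 2) \<and> M = pairsum L
   else a = L ! (length L div 2 - 1) + L ! (length L div 2) \<and> pairsum L = add_mset a M)"

text \<open>The same data when \<open>lo\<close> and \<open>p lo\<close> come first in the
  list.\<close>

definition front :: "nat list \<Rightarrow> nat \<Rightarrow> nat multiset \<Rightarrow> bool" where
 "front L a M \<longleftrightarrow> (if odd (length L) then a = L ! 0 \<and> M = pairsum (tl L)
   else a = L ! 0 + L ! 1 \<and> M = pairsum (tl (tl L)))"

lemma anti_mid_middle:
 assumes S: "parts m S" and X: "X \<subseteq> S" and d: "dok X p lo" and a: "anti_mid X p lo"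
 shows "middle (map card (by_max X)) (card lo + (if p lo = lo then 0 else card (p lo)))
  (image_mset (\<lambda>A. card A + card (p A)) (mset_set {A \<in> X - {lo, p lo}. Max A < Max (p A)}))"
proof -
 let ?xs = "by_max X" and ?k = "card X"
 let ?h = "\<lambda>A. card A + card (p A)"
 let ?Z = "{A \<in> X - {lo, p lo}. Max A < Max (p A)}"
 note f = part_sub_X[OF S X]
 note b = by_max[OF f]
 note p = dokD(1)[OF d] and lo = dokD(2)[OF d]
 note plo = invol_in[OF p lo]
 have an: "anti X p" using a unfolding anti_mid_def by blast
 have tot: "image_mset ?h (mset_set {A \<in> X. Max A < Max (p A)}) = pairsum (map card ?xs)"
  using pairsum_rev[OF sorted_by_max[OF f] anti_rev[OF f an invol_image[OF p]]] unfolding set_by_max[OF f] .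
 have len: "length (map card ?xs) = ?k" using b(4) by simp
 obtain i where i: "i < ?k" "lo = ?xs ! i" using lo b(1,4) by (metis in_set_conv_nth)
 have pi: "p lo = ?xs ! (?k - 1 - i)" using anti_nth[OF f p an i(1)] unfolding i(2) .
 have ki: "?k - 1 - i < ?k" using i(1) by simp
 show ?thesis
 proof (cases "p lo = lo")
  case True
  have od: "odd ?k" using anti_fixed_iff[OF f p an] lo True by blast
  have "?xs ! (?k - 1 - i) = ?xs ! i" using pi True i(2) by simp
  hence "?k - 1 - i = i" using nth_eq_iff_index_eq[OF b(3), of "?k - 1 - i" i] i(1) ki b(4) by simp
  hence im: "i = ?k div 2" using i(1) by linarith
  have "{A \<in> X. Max A < Max (p A)} = ?Z" using True by auto
  thus ?thesis unfolding middle_def len using od tot True i im b(4) by simp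
 next case False
  have nf: "\<not> (\<exists>A\<in>X. p A = A)"
  proof
   assume "\<exists>A\<in>X. p A = A"
   then obtain A where A: "A \<in> X" "p A = A" by blast
   have "A = lo" by (rule dokD(4)[OF d A])
   thus False using A(2) False by simp
  qed
  hence ev: "even ?k" using anti_fixed_iff[OF f p an] by blast
  have "Max lo \<noteq> Max (p lo)" using f(2) lo plo False unfolding inj_on_def by metis
  hence l: "Max lo < Max (p lo)" using dokD(3)[OF d] by simp
  have lt: "Max (?xs ! u) < Max (?xs ! v) \<longleftrightarrow> u < v" if "u < ?k" "v < ?k" for u v
   using sorted_nth_less[OF b(2), of u v] that b(4) by simp
  have 1: "i < ?k - 1 - i" using l lt[OF i(1) ki] unfolding pi[symmetric] i(2)[symmetric] by simp
  \<comment> \<open>A position strictly between those of \<open>lo\<close> and \<open>p lo\<close>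
    would hold a marked block excluded by \<open>anti_mid\<close>, so the two positions are adjacent
    and hence the two middle ones.\<close>
  have "\<not> i + 1 < ?k - 1 - i"
  proof
   assume s: "i + 1 < ?k - 1 - i"
   hence s': "i + 1 < ?k" by simp
   have "?xs ! (i + 1) \<in> X" using nth_mem[of "i + 1" ?xs] b(1,4) s' by simp
   moreover have "Max lo < Max (?xs ! (i + 1))" using lt[OF i(1) s'] unfolding i(2)[symmetric] by simp
   moreover have "Max (?xs ! (i + 1)) < Max (p lo)" using lt[OF s' ki] s unfolding pi[symmetric] by simp
   ultimately show False using a unfolding anti_mid_def by blast
  qed
  hence k: "i = ?k div 2 - 1" "?k - 1 - i = ?k div 2" using 1 ev i(1) by (auto elim!: evenE)
  have "{A \<in> X. Max A < Max (p A)} = insert lo ?Z" by (rule lower_half[OF p lo l])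
  hence "mset_set {A \<in> X. Max A < Max (p A)} = add_mset lo (mset_set ?Z)" using f(1) by simp
  hence P: "pairsum (map card ?xs) = add_mset (card lo + card (p lo)) (image_mset ?h (mset_set ?Z))" unfolding tot[symmetric] by simp
  have L: "map card ?xs ! (?k div 2 - 1) = card lo" "map card ?xs ! (?k div 2) = card (p lo)"
   using i ki pi k b(4) by (metis nth_map)+
  show ?thesis unfolding middle_def len L using ev P False by simp
 qed
qed

lemma anti_low_front:
 assumes S: "parts m S" and X: "X \<subseteq> S" and d: "dok X p lo" and a: "anti_low X p lo"
 shows "front (map card (by_max X)) (card lo + (if p lo = lo then 0 else card (p lo)))
  (image_mset (\<lambda>A. card A + card (p A)) (mset_set {A \<in> X - {lo, p lo}. Max A < Max (p A)}))"
proof -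
 let ?Y = "X - {lo, p lo}"
 note f = part_sub_X[OF S X]
 note l = anti_low_by_max[OF f d a]
 have fY: "finite ?Y" "inj_on Max ?Y" using f(1) inj_on_diff[OF f(2)] by auto
 have "image_mset (\<lambda>A. card A + card (p A)) (mset_set {A \<in> ?Y. Max A < Max (p A)}) = pairsum (map card (by_max ?Y))"
  using pairsum_rev[OF sorted_by_max[OF fY] anti_rev[OF fY l(4) invol_image[OF l(3)]]] unfolding set_by_max[OF fY] .
 moreover have "length (map card (by_max X)) = card X" using length_by_max[OF f] by simp
 ultimately show ?thesis unfolding front_def using l(2) unfolding l(1) by (cases "p lo = lo") simp_all
qed

text \<open>The word carries the one or two middle entries to the front and keeps the order of the
  others, so the opposite pairs among those survive. For odd length it coincides with the word of
  type B.\<close>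

lemma word_D_front:
 assumes L: "L \<noteq> []" and e: "e \<noteq> 0" and m: "middle L a M"
  and fr: "front (map (\<lambda>x. L ! (x - 1)) (word_D (length L) e)) b N"
 shows "b = a \<and> N = M"
proof (cases "odd (length L)")
 case True
 hence w: "word_D (length L) e = word_B (length L)" unfolding word_D_def word_B_def Let_def by simp
 let ?L = "map (\<lambda>x. L ! (x - 1)) (word_B (length L))"
 have len: "length ?L = length L" using word_B(2) by simp
 have "pairsum (tl ?L) = pairsum L" using word_B_pairsum[of L] True unfolding pairsumB_def len by simp
 moreover have "?L ! 0 = L ! (length L div 2)" unfolding word_B_def Let_def using True by simp
 ultimately show ?thesis using m fr True unfolding w middle_def front_def len by simp
next case False
 then obtain t where t: "length L = 2 * t" by (auto elim: evenE)
 then obtain s where s: "t = Suc s" using L by (cases t) auto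
 let ?M = "map (\<lambda>x. L ! (x - 1)) ([1..<t] @ [t + 2..<2 * t + 1])"
 have w: "map (\<lambda>x. L ! (x - 1)) (word_D (length L) e) = L ! s # L ! t # ?M"
  unfolding word_D_def Let_def t using e s by simp
 have lM: "length ?M = 2 * s" unfolding s by (simp only: length_map length_append length_upt) simp
 have M: "?M ! i = (if i < s then L ! i else L ! (i + 2))" if "i < 2 * s" for i
  using that unfolding s by (auto simp: nth_append simp del: upt_Suc)
 have "pairsum ?M = mset (map (\<lambda>i. L ! i + L ! (2 * t - 1 - i)) [0..<s])" unfolding pairsum_def lM
 proof (rule arg_cong[where f = mset], rule map_cong)
  show "[0..<2 * s div 2] = [0..<s]" by simp
  fix i assume "i \<in> set [0..<s]"
  hence i: "i < s" by simp
  hence "?M ! i = L ! i" "?M ! (2 * s - 1 - i) = L ! (2 * s - 1 - i + 2)" using M[of i] M[of "2 * s - 1 - i"] by auto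
  moreover have "2 * s - 1 - i + 2 = 2 * t - 1 - i" using i s by simp
  ultimately show "?M ! i + ?M ! (2 * s - 1 - i) = L ! i + L ! (2 * t - 1 - i)" by simp
 qed
 moreover have "pairsum L = mset (map (\<lambda>i. L ! i + L ! (2 * t - 1 - i)) [0..<Suc s])" unfolding pairsum_def t s by simp
 ultimately have "pairsum L = add_mset (L ! s + L ! t) (pairsum ?M)" using s by simp
 moreover have "length (L ! s # L ! t # ?M) = 2 * t" using lM s by simp
 ultimately show ?thesis using m fr False t s unfolding w middle_def front_def by simp
qed

lemma stat_length: "parts m S \<Longrightarrow> X \<subseteq> S \<Longrightarrow> length (snd (stat (S, X))) = card X"
 unfolding stat_def using length_by_max[OF part_sub_X] by simp

lemma NC_B_zero: "Q \<in> NC_B m \<Longrightarrow> (\<exists>B\<in>Q. zero_block B) \<longleftrightarrow> odd (length (snd (stat (phi Q))))"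
proof -
 assume Q: "Q \<in> NC_B m"
 obtain S X where ph: "phi Q = (S, X)" by fastforce
 have Pi: "Q \<in> Pi_B m" using Q unfolding NC_B_def by blast
 note B = Pi_build[OF Pi ph]
 obtain p where p: "invol X p" "Q = build S X p" using B(3) by blast
 have an: "anti X p" using NC_B_char[OF B(1,2) p(1)] Q p(2) by simp
 show ?thesis unfolding ph stat_length[OF B(1,2)] unfolding p(2) zero_build_iff[OF B(1,2) p(1)]
  by (rule anti_fixed_iff[OF part_sub_X[OF B(1,2)] p(1) an])
qed

lemma NN_B_zero: "Q \<in> NN_B m \<Longrightarrow> (\<exists>B\<in>Q. zero_block B) \<longleftrightarrow> odd (length (snd (stat (phi Q))))"
proof -
 assume Q: "Q \<in> NN_B m"
 obtain S X where ph: "phi Q = (S, X)" by fastforce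
 have Pi: "Q \<in> Pi_B m" using Q unfolding NN_B_def by blast
 note B = Pi_build[OF Pi ph]
 obtain p where p: "invol X p" "Q = build S X p" using B(3) by blast
 have an: "antiB X p" using NN_B_char[OF B(1,2) p(1)] Q p(2) by simp
 from part_sub_X[OF B(1,2)] p(1) an have "(\<exists>A\<in>X. p A = A) \<longleftrightarrow> odd (card X)"
 proof (cases rule: antiB_cases)
  case even thus ?thesis by blast
 next case (odd F) thus ?thesis by blast
 qed
 thus ?thesis unfolding ph stat_length[OF B(1,2)] unfolding p(2) zero_build_iff[OF B(1,2) p(1)] .
qed

text \<open>Sign 0 is the centred case, where the additional part 1 appears exactly if there is no
  zero block, that is, if the number of marks is even. Otherwise the block of \<open>n\<close>
  contributes \<open>Suc a\<close>, the 1 being \<open>n\<close> itself.\<close>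

lemma NC_D_type:
 assumes P: "P \<in> NC_D (Suc m)" and s: "stat3 (phi_D (Suc m) P) = (U, L, e)"
 shows "e = 0 \<and> btype P = rest (U, L) + pairsum L + (if odd (length L) then {#} else {#1#}) \<or>
  e \<noteq> 0 \<and> L \<noteq> [] \<and> (\<exists>a M. middle L a M \<and> btype P = add_mset (Suc a) (rest (U, L) + M))"
proof -
 have P': "P \<in> Pi_B (Suc m)" "zero_blocks_D (Suc m) P" using P unfolding NC_D_def by auto
 from P' show ?thesis
 proof (cases rule: phi_D_cases)
  case (centred Q)
  have Q: "Q \<in> NC_B m" using P unfolding centred(2) NC_D_def using cext_props(4)[OF centred(1)] by simp
  have st: "stat (phi Q) = (U, L)" "e = 0" using s unfolding centred(3) stat3_def by auto
  have "btype P = btype Q + (if odd (length L) then {#} else {#1#})"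
   unfolding centred(2) cext_props(6)[OF centred(1)] NC_B_zero[OF Q] st by simp
  thus ?thesis unfolding NC_B_type[OF Q] st by simp
 next case (noncentred S X p lo e')
  have st: "stat (S, X) = (U, L)" "e = e'" using s unfolding noncentred(6) stat3_def by auto
  have L: "L = map card (by_max X)" using st(1) unfolding stat_def by simp
  have "card X \<noteq> 0" using dokD(2)[OF noncentred(3)] part_sub_X(1)[OF noncentred(1,2)] by auto
  hence "length L \<noteq> 0" using stat_length[OF noncentred(1,2)] unfolding st(1) by simp
  hence ne: "L \<noteq> []" by simp
  have a: "anti_mid X p lo" using P NC_D_char[OF noncentred(1-3)] unfolding noncentred(5) by blast
  show ?thesis
  proof (rule disjI2, intro conjI exI)
   show "e \<noteq> 0" using noncentred(4) st(2) by auto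
   show "L \<noteq> []" by (rule ne)
   show "middle L (card lo + (if p lo = lo then 0 else card (p lo)))
    (image_mset (\<lambda>A. card A + card (p A)) (mset_set {A \<in> X - {lo, p lo}. Max A < Max (p A)}))"
    unfolding L by (rule anti_mid_middle[OF noncentred(1-3) a])
  qed (simp only: noncentred(5) btype_dbuild[OF noncentred(1-4)] rest_stat[OF noncentred(1,2), symmetric] st(1))
 qed
qed

lemma NN_D_type:
 assumes P: "P \<in> NN_D (Suc m)" and s: "stat3 (phi_D (Suc m) P) = (U, L, e)"
 shows "e = 0 \<and> btype P = rest (U, L) + pairsumB L + (if odd (length L) then {#} else {#1#}) \<or>
  e \<noteq> 0 \<and> (\<exists>a M. front L a M \<and> btype P = add_mset (Suc a) (rest (U, L) + M))"
proof -
 have P': "P \<in> Pi_B (Suc m)" "zero_blocks_D (Suc m) P" using P unfolding NN_D_def by auto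
 from P' show ?thesis
 proof (cases rule: phi_D_cases)
  case (centred Q)
  have Q: "Q \<in> NN_B m" using P unfolding centred(2) NN_D_def using cext_props(3,4)[OF centred(1)] by simp
  have st: "stat (phi Q) = (U, L)" "e = 0" using s unfolding centred(3) stat3_def by auto
  have "btype P = btype Q + (if odd (length L) then {#} else {#1#})"
   unfolding centred(2) cext_props(6)[OF centred(1)] NN_B_zero[OF Q] st by simp
  thus ?thesis unfolding NN_B_type[OF Q] st by simp
 next case (noncentred S X p lo e')
  have st: "stat (S, X) = (U, L)" "e = e'" using s unfolding noncentred(6) stat3_def by auto
  have L: "L = map card (by_max X)" using st(1) unfolding stat_def by simp
  have a: "anti_low X p lo" using P NN_D_char[OF noncentred(1-4)] unfolding noncentred(5) by blast
  show ?thesis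
  proof (rule disjI2, intro conjI exI)
   show "e \<noteq> 0" using noncentred(4) st(2) by auto
   show "front L (card lo + (if p lo = lo then 0 else card (p lo)))
    (image_mset (\<lambda>A. card A + card (p A)) (mset_set {A \<in> X - {lo, p lo}. Max A < Max (p A)}))"
    unfolding L by (rule anti_low_front[OF noncentred(1-3) a])
  qed (simp only: noncentred(5) btype_dbuild[OF noncentred(1-4)] rest_stat[OF noncentred(1,2), symmetric] st(1))
 qed
qed

lemma rest_perm:
 assumes "perm_word w" "length w = length L"
 shows "rest (U, map (\<lambda>x. L ! (x - 1)) w) = rest (U, L)"
proof -
 have d: "distinct w" "set w = {1..length L}" using assms unfolding perm_word_def by auto
 let ?f = "\<lambda>x. L ! (x - 1)"
 have "set w = set [1..<Suc (length L)]" unfolding d(2) by auto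
 hence w: "mset w = mset [1..<Suc (length L)]"
  using set_eq_iff_mset_eq_distinct[OF d(1) distinct_upt] by blast
 have "mset (map ?f w) = image_mset ?f (mset w)" by (rule mset_map)
 also have "\<dots> = mset (map ?f [1..<Suc (length L)])" unfolding w by (rule mset_map[symmetric])
 also have "map ?f [1..<Suc (length L)] = L" by (rule nth_equalityI) (simp_all del: upt_Suc)
 finally have "mset (map ?f w) = mset L" .
 thus ?thesis unfolding rest_def by simp
qed

section \<open>The composed bijections\<close>

text \<open>The inverse of \<open>h\<close> is known only through \<open>h Q = g (f P)\<close>, so
  preservation of types is required for all \<open>P\<close> and \<open>Q\<close> related in this
  way.\<close>

lemma transport_bij:
 assumes f: "bij_betw f A M" and g: "bij_betw g M N" and h: "bij_betw h B N"
  and t: "\<And>P Q. P \<in> A \<Longrightarrow> Q \<in> B \<Longrightarrow> h Q = g (f P) \<Longrightarrow> btype Q = btype P"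
 shows "type_preserving_bij (inv_into B h \<circ> g \<circ> f) A B"
 unfolding type_preserving_bij_def
proof (intro conjI ballI)
 have b: "bij_betw (inv_into B h) N B" by (rule bij_betw_inv_into[OF h])
 show "bij_betw (inv_into B h \<circ> g \<circ> f) A B"
  using bij_betw_trans[OF f bij_betw_trans[OF g b]] by (simp add: o_assoc)
 fix P assume P: "P \<in> A"
 hence n: "g (f P) \<in> N" using bij_betwE[OF f] bij_betwE[OF g] by blast
 show "btype ((inv_into B h \<circ> g \<circ> f) P) = btype P" unfolding o_apply
  by (rule t[OF P _ bij_betw_inv_into_right[OF h n]]) (use bij_betwE[OF b] n in blast)
qed

lemma marked_stat_empty:
 assumes "parts m S" "X \<subseteq> S" "parts m T" "Y \<subseteq> T" "stat (T, Y) = stat (S, X)"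
 shows "Y = {} \<longleftrightarrow> X = {}"
proof -
 have "card Y = card X" using stat_length[OF assms(1,2)] stat_length[OF assms(3,4)] assms(5) by simp
 thus ?thesis using part_sub_X(1)[OF assms(1,2)] part_sub_X(1)[OF assms(3,4)] by (metis card_0_eq)
qed

lemma NCNA_part: "(S, X) \<in> NCNA m \<Longrightarrow> parts m S \<and> X \<subseteq> S"
 unfolding NCNA_def using NC_part by auto

theorem theorem5p8:
  fixes n :: nat
  assumes "n \<ge> 2"
  shows "type_preserving_bij
           (inv_into (NN_B n) phi \<circ> rho_bar \<circ> xi_bar \<circ> iota_B \<circ> phi) (NC_B n) (NN_B n) \<and>
         type_preserving_bij
           (inv_into (NN_C n) phi \<circ> rho_bar \<circ> xi_bar \<circ> phi) (NC_B n) (NN_C n) \<and>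
         type_preserving_bij
           (inv_into (NN_D n) (phi_D n) \<circ> on_triples rho_bar \<circ> on_triples xi_bar \<circ> iota_D \<circ> phi_D n)
           (NC_D n) (NN_D n)"
proof (intro conjI)
 have xb: "bij_betw (rho_bar \<circ> xi_bar) (NCNN k) (NNNA k)" for k by (rule bij_betw_trans[OF xi_bar_bij rho_bar_bij])
 have xs: "stat (rho_bar (xi_bar A)) = stat A" if "A \<in> NCNN k" for A k
  using rho_bar_stat[of "xi_bar A" k] xi_bar_stat[OF that] bij_betwE[OF xi_bar_bij] that by auto
 have "type_preserving_bij (inv_into (NN_B n) phi \<circ> (rho_bar \<circ> xi_bar \<circ> iota_B) \<circ> phi) (NC_B n) (NN_B n)"
 proof (rule transport_bij[OF phi_NC_B_bij bij_betw_trans[OF iota_B_bij xb] phi_NN_B_bij])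
  fix P Q assume h: "P \<in> NC_B n" "Q \<in> NN_B n" "phi Q = (rho_bar \<circ> xi_bar \<circ> iota_B) (phi P)"
  have A: "phi P \<in> NCNN n" "iota_B (phi P) \<in> NCNN n" using bij_betwE[OF phi_NC_B_bij] bij_betwE[OF iota_B_bij] h(1) by blast+
  obtain U L where UL: "stat (phi P) = (U, L)" by fastforce
  have "stat (phi Q) = (U, map (\<lambda>x. L ! (x - 1)) (word_B (length L)))"
   unfolding h(3) o_apply xs[OF A(2)] iota_B_stat[OF A(1)] UL by simp
  thus "btype Q = btype P" unfolding NN_B_type[OF h(2)] NC_B_type[OF h(1)] UL
   by (simp only: snd_conv rest_perm[OF word_B] word_B_pairsum)
 qed
 thus "type_preserving_bij (inv_into (NN_B n) phi \<circ> rho_bar \<circ> xi_bar \<circ> iota_B \<circ> phi) (NC_B n) (NN_B n)"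
  by (simp only: o_assoc)
 have "type_preserving_bij (inv_into (NN_C n) phi \<circ> (rho_bar \<circ> xi_bar) \<circ> phi) (NC_B n) (NN_C n)"
 proof (rule transport_bij[OF phi_NC_B_bij xb phi_NN_C_bij])
  fix P Q assume h: "P \<in> NC_B n" "Q \<in> NN_C n" "phi Q = (rho_bar \<circ> xi_bar) (phi P)"
  have A: "phi P \<in> NCNN n" using bij_betwE[OF phi_NC_B_bij] h(1) by blast
  have "stat (phi Q) = stat (phi P)" unfolding h(3) o_apply by (rule xs[OF A])
  thus "btype Q = btype P" unfolding NN_C_type[OF h(2)] NC_B_type[OF h(1)] by simp
 qed
 thus "type_preserving_bij (inv_into (NN_C n) phi \<circ> rho_bar \<circ> xi_bar \<circ> phi) (NC_B n) (NN_C n)"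
  by (simp only: o_assoc)
 obtain m where n: "n = Suc m" using assms by (cases n) auto
 have e1: "snd (xi_bar (S, X)) = {} \<longleftrightarrow> X = {}" if "(S, X) \<in> NCNN m" for S X
 proof -
  obtain T Y where TY: "xi_bar (S, X) = (T, Y)" by fastforce
  have "(T, Y) \<in> NCNA m" using bij_betwE[OF xi_bar_bij] that TY by metis
  thus ?thesis unfolding TY using marked_stat_empty[of m S X T Y] NCNN_part[OF that] NCNA_part[of T Y m] xi_bar_stat[OF that] TY by simp
 qed
 have e2: "snd (rho_bar (S, X)) = {} \<longleftrightarrow> X = {}" if "(S, X) \<in> NCNA m" for S X
 proof -
  obtain T Y where TY: "rho_bar (S, X) = (T, Y)" by fastforce
  have "(T, Y) \<in> NNNA m" using bij_betwE[OF rho_bar_bij] that TY by metis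
  thus ?thesis unfolding TY using marked_stat_empty[of m S X T Y] NCNA_part[OF that] NNNA_part[of T Y m] rho_bar_stat[OF that] TY by simp
 qed
 have tb: "bij_betw (on_triples rho_bar \<circ> on_triples xi_bar) (triples (NCNN m)) (triples (NNNA m))"
  by (rule bij_betw_trans[OF on_triples_bij[OF xi_bar_bij e1] on_triples_bij[OF rho_bar_bij e2]])
 have ts: "stat3 (on_triples rho_bar (on_triples xi_bar (S, X, e))) = stat3 (S, X, e)" if "(S, X) \<in> NCNN m" for S X e
  using xs[OF that] unfolding on_triples_def stat3_def by (simp add: case_prod_beta)
 have "type_preserving_bij (inv_into (NN_D n) (phi_D n) \<circ> (on_triples rho_bar \<circ> on_triples xi_bar \<circ> iota_D) \<circ> phi_D n) (NC_D n) (NN_D n)"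
  unfolding n
 proof (rule transport_bij[OF phi_D_NC_bij bij_betw_trans[OF iota_D_bij tb] phi_D_NN_bij])
  fix P Q assume h: "P \<in> NC_D (Suc m)" "Q \<in> NN_D (Suc m)"
   "phi_D (Suc m) Q = (on_triples rho_bar \<circ> on_triples xi_bar \<circ> iota_D) (phi_D (Suc m) P)"
  obtain S X e where Z: "phi_D (Suc m) P = (S, X, e)" by (cases "phi_D (Suc m) P")
  have Zt: "(S, X, e) \<in> triples (NCNN m)" using bij_betwE[OF phi_D_NC_bij] h(1) unfolding Z[symmetric] by blast
  obtain U L where UL: "stat3 (S, X, e) = (U, L, e)" unfolding stat3_def by auto
  obtain S' X' e' where Z': "iota_D (S, X, e) = (S', X', e')" by (cases "iota_D (S, X, e)")
  have "(S', X', e') \<in> triples (NCNN m)" using bij_betwE[OF iota_D_bij] Zt unfolding Z'[symmetric] by blast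
  hence "(S', X') \<in> NCNN m" unfolding triples_def by simp
  hence st: "stat3 (phi_D (Suc m) Q) = (U, map (\<lambda>x. L ! (x - 1)) (word_D (length L) e), e)"
   unfolding h(3) o_apply Z Z' using ts iota_D_stat[OF Zt UL] unfolding Z' by simp
  let ?L = "map (\<lambda>x. L ! (x - 1)) (word_D (length L) e)"
  note tP = NC_D_type[OF h(1) UL[folded Z]] and tQ = NN_D_type[OF h(2) st]
  \<comment> \<open>A nonzero sign comes with a nonempty list of marks by \<open>NC_D_type\<close>,
    as \<open>word_D\<close> demands.\<close>
  have w: "length L = 0 \<longrightarrow> e = 0" using tP by auto
  note wd = word_D[OF w]
  have r: "rest (U, ?L) = rest (U, L)" by (rule rest_perm[OF wd])
  have len: "length ?L = length L" using wd(2) by simp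
  show "btype Q = btype P"
  proof (cases "e = 0")
   case True
   \<comment> \<open>With sign 0 the computation in type B applies; the additional part 1 depends
     only on the parity of the number of marks, which is preserved.\<close>
   have "word_D (length L) e = word_B (length L)" unfolding word_D_def word_B_def Let_def True by simp
   hence "pairsumB ?L = pairsum L" using word_B_pairsum[of L] by simp
   thus ?thesis using tP tQ True r len by simp
  next case False
   obtain a M where a: "L \<noteq> []" "middle L a M" "btype P = add_mset (Suc a) (rest (U, L) + M)" using tP False by blast
   obtain b N where b: "front ?L b N" "btype Q = add_mset (Suc b) (rest (U, ?L) + N)" using tQ False by blast
   have "b = a \<and> N = M" by (rule word_D_front[OF a(1) False a(2) b(1)])
   thus ?thesis using a(3) b(2) r by simp
  qed
 qed
 thus "type_preserving_bij
   (inv_into (NN_D n) (phi_D n) \<circ> on_triples rho_bar \<circ> on_triples xi_bar \<circ> iota_D \<circ> phi_D n) (NC_D n) (NN_D n)"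
  by (simp only: o_assoc)
qed

end
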